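(* Let $V:\mathbb{R}^k\to\mathbb{R}$ and let $\sigma^-\neq\sigma^+$ be two elements of $\Sigma=\{\sigma_1,\dots,\sigma_l\}$, $l\ge 2$. Assume the following. (a) $V\in C^2_{\mathrm{loc}}(\mathbb{R}^k)$, $V\ge 0$ in $\mathbb{R}^k$, and $V(\mathbf{u})=0$ if and only if $\mathbf{u}\in\Sigma$. (b) There exist $\alpha_0,\beta_0,R_0>0$ such that for all $\mathbf{u}\in\mathbb{R}^k$ with $|\mathbf{u}|\ge R_0$ one has $\langle\nabla V(\mathbf{u}),\mathbf{u}\rangle\ge\alpha_0|\mathbf{u}|^2$ and $V(\mathbf{u})\ge\beta_0$. (c) For all $\sigma\in\Sigma$ the matrix $D^2V(\sigma)$ is positive definite. (d) $\mathcal{F}=\mathcal{F}_0\cup\mathcal{F}_1$ with $\mathcal{F}_0,\mathcal{F}_1$ nonempty and $d(\mathcal{F}_0,\mathcal{F}_1)>0$. (e) $\sigma^-=(-1,0,\dots,0)$, $\sigma^+=(+1,0,\dots,0)$, and $V(\mathfrak{s}(\mathbf{u}))=V(\mathbf{u})$ for all $\mathbf{u}\in\mathbb{R}^k$, where $\mathfrak{s}(u_1,u_2,\dots,u_k)=(-u_1,u_2,\dots,u_k)$. (f) $\mathfrak{c}_{\mathrm{sym}}<\mathfrak{m}^\star$. Then one of the two following scenarios holds: 1. There exist two non constant functions $\mathfrak{u}_+,\mathfrak{u}_-\in H^1_{\mathrm{loc}}(\mathbb{R},\mathbb{R}^k)\cap C^2(\mathbb{R},\mathbb{R}^k)$, both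 solutions of $q''=\nabla V(q)$ in $\mathbb{R}$, such that $E(\mathfrak{u}_+)\le\mathfrak{c}_{\mathrm{sym}}$, $\lim_{t\to\pm\infty}\mathfrak{u}_+(t)=\sigma^+$, and $\mathfrak{u}_-(t)=\mathfrak{s}(\mathfrak{u}_+(t))$ for all $t\in\mathbb{R}$. In particular, $\lim_{t\to\pm\infty}\mathfrak{u}_-(t)=\sigma^-$. 2. There exists a solution $\mathfrak{u}\in X_{\mathrm{sym},+}$ of $q''=\nabla V(q)$ in $\mathbb{R}$ such that $E(\mathfrak{u})=\mathfrak{c}_{\mathrm{sym}}$. In particular, $\mathfrak{u}\notin\mathcal{F}_{\mathrm{sym}}$.
   Context: $k\ge 2$; $\langle\cdot,\cdot\rangle$ and $|\cdot|$ are the Euclidean inner product and norm on $\mathbb{R}^k$. Curves in $H^1_{\mathrm{loc}}(\mathbb{R},\mathbb{R}^k)$ are identified with their continuous representatives. $\mathscr{H}:=H^1(\mathbb{R},\mathbb{R}^k)$. Energy: $E(q):=\int_{\mathbb{R}}\left[\tfrac12|q'(t)|^2+V(q(t))\right]dt$ for $q\in H^1_{\mathrm{loc}}(\mathbb{R},\mathbb{R}^k)$. For $\sigma_i,\sigma_j\in\Sigma$: $X(\sigma_i,\sigma_j):=\{q\in H^1_{\mathrm{loc}}(\mathbb{R},\mathbb{R}^k): E(q)<+\infty,\ \lim_{t\to-\infty}q(t)=\sigma_i,\ \lim_{t\to+\infty}q(t)=\sigma_j\}$ and $\mathfrak{m}_{\sigma_i\sigma_j}:=\inf\{E(q):q\in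 X(\sigma_i,\sigma_j)\}$. Set $\mathfrak{m}:=\mathfrak{m}_{\sigma^-\sigma^+}$ and $\mathfrak{m}^\star:=\min\{\mathfrak{m}_{\sigma^-\sigma}+\mathfrak{m}_{\sigma\sigma^+}:\sigma\in\Sigma\setminus\{\sigma^-,\sigma^+\}\}$ ($=+\infty$ if $\Sigma=\{\sigma^-,\sigma^+\}$). $\mathcal{F}:=\{\mathfrak{q}\in X(\sigma^-,\sigma^+):E(\mathfrak{q})=\mathfrak{m}\}$. For $q,\tilde q\in X(\sigma^-,\sigma^+)$ one has $q-\tilde q\in\mathscr{H}$, and $d(q,\tilde q):=\|q-\tilde q\|_{\mathscr{H}}$; for sets $A,B$, $d(A,B):=\inf_{a\in A,b\in B}d(a,b)$. $\psi(t):=\sigma^-$ for $t\le-1$, $\psi(t):=\frac{t+1}{2}\sigma^++\frac{1-t}{2}\sigma^-$ for $-1\le t\le1$, $\psi(t):=\sigma^+$ for $t\ge1$. For $v\in\mathscr{H}$ one has $v+\psi\in X(\sigma^-,\sigma^+)$, and $J(v):=E(v+\psi)$. Symmetric setting: $X_{\mathrm{sym},+}:=\{q\in X(\sigma^-,\sigma^+):\forall t\ge0,\ q_1(t)\ge0\text{ and }\mathfrak{s}(q(t))=q(-t)\}$, where $q_1$ is the first component of $q$. $\mathscr{H}_{\mathrm{sym}}:=\{v\in\mathscr{H}:\forall t\ge0,\ \mathfrak{s}(v(t))=v(-t)\}$, a closed subspace of $\mathscr{H}$. $\mathcal{F}_{\mathrm{sym}}:=\mathcal{F}\cap X_{\mathrm{sym},+}$,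 and for $i\in\{0,1\}$, $\mathcal{F}_{\mathrm{sym},i}:=\mathcal{F}_i\cap X_{\mathrm{sym},+}$ (nonempty) and $\mathcal{V}_{\mathrm{sym},i}:=\mathcal{F}_{\mathrm{sym},i}-\{\psi\}$. $\Gamma_{\mathrm{sym}}:=\{\gamma\in C([0,1],\mathscr{H}_{\mathrm{sym}}):\gamma(0)\in\mathcal{V}_{\mathrm{sym},0},\ \gamma(1)\in\mathcal{V}_{\mathrm{sym},1}\}$ and $\mathfrak{c}_{\mathrm{sym}}:=\inf_{\gamma\in\Gamma_{\mathrm{sym}}}\max_{s\in[0,1]}J(\gamma(s))<+\infty$. *)

theory Defs
  imports "HOL-Analysis.Analysis"
begin

definition test_functions :: "(real \<Rightarrow> real) set" where
  "test_functions = {\<phi>. \<phi> C1_differentiable_on UNIV \<and> compact (closure {t. \<phi> t \<noteq> 0})}"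

definition L2 :: "(real \<Rightarrow> 'a::euclidean_space) set" where
  "L2 = {g \<in> borel_measurable lborel. integrable lborel (\<lambda>t. (norm (g t))\<^sup>2)}"

definition L2_loc :: "(real \<Rightarrow> 'a::euclidean_space) set" where
  "L2_loc = {g \<in> borel_measurable lborel. \<forall>a b. set_integrable lborel {a..b} (\<lambda>t. (norm (g t))\<^sup>2)}"

text \<open>Only used for locally square integrable functions, where both integrals exist.\<close>

definition is_weak_deriv :: "(real \<Rightarrow> 'a::euclidean_space) \<Rightarrow> (real \<Rightarrow> 'a) \<Rightarrow> bool" where
  "is_weak_deriv q g \<longleftrightarrow>
     (\<forall>\<phi>\<in>test_functions. (LINT t|lborel. deriv \<phi> t *\<^sub>R q t) = - (LINT t|lborel. \<phi> t *\<^sub>R g t))"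

text \<open>Elements of the Sobolev spaces are represented by their continuous representatives, so
  that equality of elements is equality of functions.\<close>

definition H1_loc :: "(real \<Rightarrow> 'a::euclidean_space) set" where
  "H1_loc = {q. continuous_on UNIV q \<and> (\<exists>g\<in>L2_loc. is_weak_deriv q g)}"

definition H1 :: "(real \<Rightarrow> 'a::euclidean_space) set" where
  "H1 = {v. continuous_on UNIV v \<and> v \<in> L2 \<and> (\<exists>g\<in>L2. is_weak_deriv v g)}"

text \<open>The weak derivative is unique up to null sets; it is only used under integrals, so the
  choice of a representative is immaterial.\<close>

definition weak_deriv :: "(real \<Rightarrow> 'a::euclidean_space) \<Rightarrow> real \<Rightarrow> 'a" where
  "weak_deriv q = (SOME g. g \<in> L2_loc \<and> is_weak_deriv q g)"

definition H1_norm :: "(real \<Rightarrow> 'a::euclidean_space) \<Rightarrow> real" where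
  "H1_norm v = sqrt ((LINT t|lborel. (norm (v t))\<^sup>2) + (LINT t|lborel. (norm (weak_deriv v t))\<^sup>2))"

text \<open>To be used for nonempty sets of curves all of whose differences lie in \<open>H1\<close>.\<close>

definition H1_setdist :: "(real \<Rightarrow> 'a::euclidean_space) set \<Rightarrow> (real \<Rightarrow> 'a) set \<Rightarrow> real" where
  "H1_setdist A B = (INF p\<in>A \<times> B. H1_norm (\<lambda>t. fst p t - snd p t))"

definition grad :: "(real ^ 'n \<Rightarrow> real) \<Rightarrow> real ^ 'n \<Rightarrow> real ^ 'n" where
  "grad V u = (\<chi> i. frechet_derivative V (at u) (axis i 1))"

definition hess :: "(real ^ 'n \<Rightarrow> real) \<Rightarrow> real ^ 'n \<Rightarrow> real ^ 'n ^ 'n" where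
  "hess V u = matrix (frechet_derivative (grad V) (at u))"

definition C2_potential :: "(real ^ 'n \<Rightarrow> real) \<Rightarrow> bool" where
  "C2_potential V \<longleftrightarrow> (\<forall>u. V differentiable (at u)) \<and> (\<forall>u. grad V differentiable (at u)) \<and>
     continuous_on UNIV (hess V)"

definition pos_definite :: "real ^ 'n ^ 'n \<Rightarrow> bool" where
  "pos_definite A \<longleftrightarrow> transpose A = A \<and> (\<forall>h. h \<noteq> 0 \<longrightarrow> h \<bullet> (A *v h) > 0)"

definition C2_curve :: "(real \<Rightarrow> 'a::euclidean_space) \<Rightarrow> bool" where
  "C2_curve q \<longleftrightarrow> (\<exists>p. (\<forall>t. (q has_vector_derivative p t) (at t)) \<and> p C1_differentiable_on UNIV)"

definition solves_ode :: "(real ^ 'n \<Rightarrow> real) \<Rightarrow> (real \<Rightarrow> real ^ 'n) \<Rightarrow> bool" where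
  "solves_ode V q \<longleftrightarrow> (\<exists>p. (\<forall>t. (q has_vector_derivative p t) (at t)) \<and>
     (\<forall>t. (p has_vector_derivative grad V (q t)) (at t)))"

text \<open>The energy takes values in \<open>[0, \<infinity>]\<close>; the coercion to \<^typ>\<open>ennreal\<close> would
  truncate negative values, but is harmless for the potentials \<open>V \<ge> 0\<close> considered.\<close>

definition energy :: "(real ^ 'n \<Rightarrow> real) \<Rightarrow> (real \<Rightarrow> real ^ 'n) \<Rightarrow> ennreal" where
  "energy V q = (\<integral>\<^sup>+ t. ennreal ((norm (weak_deriv q t))\<^sup>2 / 2 + V (q t)) \<partial>lborel)"

definition conn :: "(real ^ 'n \<Rightarrow> real) \<Rightarrow> real ^ 'n \<Rightarrow> real ^ 'n \<Rightarrow> (real \<Rightarrow> real ^ 'n) set" where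
  "conn V a b = {q \<in> H1_loc. energy V q < \<infinity> \<and> (q \<longlongrightarrow> a) at_bot \<and> (q \<longlongrightarrow> b) at_top}"

definition min_energy :: "(real ^ 'n \<Rightarrow> real) \<Rightarrow> real ^ 'n \<Rightarrow> real ^ 'n \<Rightarrow> ennreal" where
  "min_energy V a b = (INF q\<in>conn V a b. energy V q)"

text \<open>The infimum over a finite set; it is \<open>\<infinity>\<close> when there are no further wells.\<close>

definition m_star :: "(real ^ 'n \<Rightarrow> real) \<Rightarrow> (real ^ 'n) set \<Rightarrow> real ^ 'n \<Rightarrow> real ^ 'n \<Rightarrow> ennreal" where
  "m_star V S sm sp = (INF s\<in>S - {sm, sp}. min_energy V sm s + min_energy V s sp)"

definition minimizers :: "(real ^ 'n \<Rightarrow> real) \<Rightarrow> real ^ 'n \<Rightarrow> real ^ 'n \<Rightarrow> (real \<Rightarrow> real ^ 'n) set" where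
  "minimizers V sm sp = {q \<in> conn V sm sp. energy V q = min_energy V sm sp}"

definition psi :: "real ^ 'n \<Rightarrow> real ^ 'n \<Rightarrow> real \<Rightarrow> real ^ 'n" where
  "psi sm sp t = (if t \<le> -1 then sm else if t \<ge> 1 then sp
     else ((t + 1) / 2) *\<^sub>R sp + ((1 - t) / 2) *\<^sub>R sm)"

definition J :: "(real ^ 'n \<Rightarrow> real) \<Rightarrow> real ^ 'n \<Rightarrow> real ^ 'n \<Rightarrow> (real \<Rightarrow> real ^ 'n) \<Rightarrow> ennreal" where
  "J V sm sp v = energy V (\<lambda>t. v t + psi sm sp t)"

text \<open>The index \<open>i\<close> below designates the first coordinate; no order on the index type is needed.\<close>

definition refl1 :: "'n \<Rightarrow> real ^ 'n \<Rightarrow> real ^ 'n" where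
  "refl1 i u = (\<chi> j. if j = i then - u $ j else u $ j)"

definition X_sym :: "(real ^ 'n \<Rightarrow> real) \<Rightarrow> 'n \<Rightarrow> real ^ 'n \<Rightarrow> real ^ 'n \<Rightarrow> (real \<Rightarrow> real ^ 'n) set" where
  "X_sym V i sm sp = {q \<in> conn V sm sp. \<forall>t\<ge>0. q t $ i \<ge> 0 \<and> refl1 i (q t) = q (- t)}"

definition H1_sym :: "'n \<Rightarrow> (real \<Rightarrow> real ^ 'n) set" where
  "H1_sym i = {v \<in> H1. \<forall>t\<ge>0. refl1 i (v t) = v (- t)}"

text \<open>For \<open>F = minimizers V sm sp\<close> this is the set of all symmetric minimizers, and for one of
  the two components \<open>F\<close> of the minimizers it is its symmetric part.\<close>

definition F_sym ::
  "(real ^ 'n \<Rightarrow> real) \<Rightarrow> 'n \<Rightarrow> real ^ 'n \<Rightarrow> real ^ 'n \<Rightarrow> (real \<Rightarrow> real ^ 'n) set \<Rightarrow> (real \<Rightarrow> real ^ 'n) set" where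
  "F_sym V i sm sp F = F \<inter> X_sym V i sm sp"

definition V_sym ::
  "(real ^ 'n \<Rightarrow> real) \<Rightarrow> 'n \<Rightarrow> real ^ 'n \<Rightarrow> real ^ 'n \<Rightarrow> (real \<Rightarrow> real ^ 'n) set \<Rightarrow> (real \<Rightarrow> real ^ 'n) set" where
  "V_sym V i sm sp F = (\<lambda>q t. q t - psi sm sp t) ` F_sym V i sm sp F"

text \<open>Continuity of a path is with respect to the \<open>H1\<close> norm; the values of a path outside
  the unit interval are irrelevant.\<close>

definition Gamma_sym ::
  "(real ^ 'n \<Rightarrow> real) \<Rightarrow> 'n \<Rightarrow> real ^ 'n \<Rightarrow> real ^ 'n \<Rightarrow> (real \<Rightarrow> real ^ 'n) set \<Rightarrow> (real \<Rightarrow> real ^ 'n) set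
    \<Rightarrow> (real \<Rightarrow> real \<Rightarrow> real ^ 'n) set" where
  "Gamma_sym V i sm sp F0 F1 = {\<gamma>.
     (\<forall>s\<in>{0..1}. \<gamma> s \<in> H1_sym i) \<and>
     (\<forall>s\<in>{0..1}. ((\<lambda>r. H1_norm (\<lambda>t. \<gamma> r t - \<gamma> s t)) \<longlongrightarrow> 0) (at s within {0..1})) \<and>
     \<gamma> 0 \<in> V_sym V i sm sp F0 \<and> \<gamma> 1 \<in> V_sym V i sm sp F1}"

text \<open>The supremum is attained, \<open>J\<close> being continuous on \<open>H1\<close> for the potentials considered.\<close>

definition c_sym ::
  "(real ^ 'n \<Rightarrow> real) \<Rightarrow> 'n \<Rightarrow> real ^ 'n \<Rightarrow> real ^ 'n \<Rightarrow> (real \<Rightarrow> real ^ 'n) set \<Rightarrow> (real \<Rightarrow> real ^ 'n) set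
    \<Rightarrow> ennreal" where
  "c_sym V i sm sp F0 F1 = (INF \<gamma>\<in>Gamma_sym V i sm sp F0 F1. SUP s\<in>{0..1}. J V sm sp (\<gamma> s))"

end

theory Submission
  imports Defs "HOL-Complex_Analysis.Great_Picard"
begin

text \<open>The level \<open>c_sym\<close> is a mountain pass level between the two separated sets of minimizers, so one expects
  a critical point of the energy there. What may fail is compactness: a sequence of almost critical curves can
  lose mass to infinity in time. The symmetry, together with \<open>c_sym < m_star\<close>, leaves a single way for this to
  happen, in which the lost piece is a homoclinic solution at \<open>sp\<close> (with its mirror image at \<open>sm\<close>). This is
  the alternative of the theorem.

  \<^bold>\<open>An almost critical sequence.\<close> Each competing path is first folded: the reflection is used to make the
  distinguished coordinate nonnegative for \<open>t \<ge> 0\<close>. This does not increase the energy and is continuous in the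
  Sobolev norm (\<open>fold_X_sym\<close>, \<open>fold_curve_conv\<close>). The role of a deformation flow is played by one step of steepest
  descent \<open>q - \<tau> w\<close>, applied to all curves of an almost optimal path simultaneously. Here \<open>w\<close> is the gradient of
  the energy in the Sobolev space, the solution of \<open>w - w'' = grad V q - q''\<close>, which the factorization
  \<open>1 - D\<^sup>2 = (1 + D) (1 - D)\<close> gives in terms of two explicit first order resolvents. The step lowers the energy
  by at least \<open>\<tau> / 2\<close> times the square of the norm of the gradient, uniformly on energy sublevels
  (\<open>energy_descent\<close>), depends Lipschitz continuously on the curve (\<open>descent_Lipschitz\<close>) and leaves minimizers
  fixed. So the new path competes in the definition of \<open>c_sym\<close>, and some curve on the old path must have energy close
  to \<open>c_sym\<close> and a small gradient (\<open>almost_optimal_paths\<close>). If \<open>c_sym\<close> happens to equal the minimal energy,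
  every curve on the path has a small gradient, and by connectedness one of them can be chosen at a fixed
  distance from all minimizers (\<open>path_between_separated_sets\<close>); a strong limit is then not a minimizer.

  \<^bold>\<open>Passing to the limit.\<close> The resolvent turns an almost critical curve \<open>q\<close> into an exact solution of a first
  order system with an \<open>L2\<close> error: \<open>q' = y - R\<close> and \<open>y' = grad V q - R\<close>, where \<open>R\<close> is the residual, of the same norm
  as the gradient. Such curves converge pointwise along subsequences to solutions, also after translations in
  time, and the energy is lower semicontinuous (\<open>almost_solutions_converge\<close>, \<open>energy_lower_semicontinuous\<close>). A
  curve of energy below \<open>m_star\<close> cannot come close to a third well, because it could be cut there into two
  connecting curves at negligible cost (\<open>cut\<close>, \<open>away_from_other_wells\<close>), and a folded curve stays away from \<open>sm\<close>
  for \<open>t \<ge> 0\<close>. Hence every limit that lives in the closed positive half space near an end tends to \<open>sp\<close> there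
  (\<open>tends_to_sp\<close>).

  \<^bold>\<open>The alternative.\<close> Consider the last time at which the \<open>n\<close>-th curve is at distance at least \<open>\<rho>\<close> from
  \<open>sp\<close>. If these times tend to infinity, the curves recentred there converge to a solution in the positive
  half space with both limits equal to \<open>sp\<close>, which is not constant (\<open>escaping_gives_homoclinic\<close>). Otherwise they are
  bounded along a subsequence, and the nondegeneracy of the well controls the tails uniformly
  (\<open>tail_estimate\<close>). Then the convergence is strong, and the limit is a symmetric solution whose energy is exactly
  \<open>c_sym\<close> (\<open>bounded_gives_critical_point\<close>).\<close>

section \<open>Square integrable functions\<close>

lemma L2_measurable: "f \<in> L2 \<Longrightarrow> f \<in> borel_measurable borel"
  by (simp add: L2_def)

lemma L2_loc_measurable: "f \<in> L2_loc \<Longrightarrow> f \<in> borel_measurable borel"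
  by (simp add: L2_loc_def)

lemma L2_integrable: "f \<in> L2 \<Longrightarrow> integrable lborel (\<lambda>t. (norm (f t))\<^sup>2)"
  by (simp add: L2_def)

lemma L2I: "f \<in> borel_measurable borel \<Longrightarrow> integrable lborel (\<lambda>t. (norm (f t))\<^sup>2) \<Longrightarrow> f \<in> L2"
  by (simp add: L2_def)

lemma norm_add_sq_le: "(norm (a + b :: 'a::real_normed_vector))\<^sup>2 \<le> 2 * (norm a)\<^sup>2 + 2 * (norm b)\<^sup>2"
proof -
  have "(norm (a + b))\<^sup>2 \<le> (norm a + norm b)\<^sup>2"
    by (intro power_mono norm_triangle_ineq) simp
  also have "\<dots> \<le> 2 * (norm a)\<^sup>2 + 2 * (norm b)\<^sup>2"
    using zero_le_power2[of "norm a - norm b"] by (simp add: power2_eq_square algebra_simps)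
  finally show ?thesis .
qed

lemma L2_bound:
  assumes "f \<in> L2" "g \<in> borel_measurable borel" "AE t in lborel. (norm (g t))\<^sup>2 \<le> C * (norm (f t))\<^sup>2"
  shows "g \<in> L2"
proof (rule L2I[OF assms(2)])
  show "integrable lborel (\<lambda>t. (norm (g t))\<^sup>2)"
    by (rule Bochner_Integration.integrable_bound[of _ "\<lambda>t. C * (norm (f t))\<^sup>2"])
      (use assms L2_integrable[OF assms(1)] in \<open>auto elim!: eventually_mono simp: abs_le_iff intro: order_trans\<close>)
qed

lemma L2_add:
  fixes f g :: "real \<Rightarrow> 'a::euclidean_space"
  assumes "f \<in> L2" "g \<in> L2"
  shows "(\<lambda>t. f t + g t) \<in> L2"
proof (rule L2I)
  note [measurable] = assms[THEN L2_measurable]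
  show "(\<lambda>t. f t + g t) \<in> borel_measurable borel" by measurable
  show "integrable lborel (\<lambda>t. (norm (f t + g t))\<^sup>2)"
    by (rule Bochner_Integration.integrable_bound[of _ "\<lambda>t. 2 * (norm (f t))\<^sup>2 + 2 * (norm (g t))\<^sup>2"])
      (use assms[THEN L2_integrable] norm_add_sq_le in auto)
qed

lemma L2_bounded_linear:
  fixes f :: "real \<Rightarrow> 'a::euclidean_space" and h :: "'a \<Rightarrow> 'b::euclidean_space"
  assumes "bounded_linear h" "f \<in> L2"
  shows "(\<lambda>t. h (f t)) \<in> L2"
proof -
  note [measurable] = L2_measurable[OF assms(2)]
  obtain K where K: "\<And>x. norm (h x) \<le> norm x * K" "K > 0"
    using bounded_linear.pos_bounded[OF assms(1)] by blast
  have "h \<in> borel_measurable borel"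
    by (intro borel_measurable_continuous_onI linear_continuous_on assms)
  then have "(\<lambda>t. h (f t)) \<in> borel_measurable borel" by measurable
  moreover have "(norm (h (f t)))\<^sup>2 \<le> K\<^sup>2 * (norm (f t))\<^sup>2" for t
    using power_mono[OF K(1)[of "f t"], of 2] by (simp add: power_mult_distrib mult.commute)
  ultimately show ?thesis by (intro L2_bound[OF assms(2)]) auto
qed

lemma L2_scaleR: "f \<in> L2 \<Longrightarrow> (\<lambda>t. r *\<^sub>R f t :: 'a::euclidean_space) \<in> L2"
  by (rule L2_bounded_linear[OF bounded_linear_scaleR_right])

lemma L2_minus: "f \<in> L2 \<Longrightarrow> (\<lambda>t. - f t :: 'a::euclidean_space) \<in> L2"
  by (rule L2_bounded_linear[OF bounded_linear_minus[OF bounded_linear_ident]])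

lemma L2_diff: "f \<in> L2 \<Longrightarrow> g \<in> L2 \<Longrightarrow> (\<lambda>t. f t - g t :: 'a::euclidean_space) \<in> L2"
  using L2_add[OF _ L2_minus] by fastforce

lemma L2_loc_zero: "(\<lambda>t. 0 :: 'a::euclidean_space) \<in> L2_loc"
  by (simp add: L2_loc_def set_integrable_def)

lemma integrable_lborel_affine:
  fixes f :: "real \<Rightarrow> 'a::euclidean_space"
  assumes "integrable lborel f" "c \<noteq> 0"
  shows "integrable lborel (\<lambda>t. f (a + c * t))"
  by (rule lborel_integrable_real_affine[OF assms])

lemma L2_affine:
  assumes "f \<in> L2" "c \<noteq> 0" shows "(\<lambda>t. f (a + c * t)) \<in> L2"
proof (rule L2I)
  note [measurable] = L2_measurable[OF assms(1)]
  show "(\<lambda>t. f (a + c * t)) \<in> borel_measurable borel" by measurable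
  show "integrable lborel (\<lambda>t. (norm (f (a + c * t)))\<^sup>2)"
    using integrable_lborel_affine[OF L2_integrable[OF assms(1)] assms(2)] .
qed

lemma L2_reflect: "f \<in> L2 \<Longrightarrow> (\<lambda>t. f (- t)) \<in> L2"
  using L2_affine[of f "-1" 0] by simp

lemma L2_shift: "f \<in> L2 \<Longrightarrow> (\<lambda>t. f (t + a)) \<in> L2"
  using L2_affine[of f 1 a] by (simp add: add.commute)

lemma integral_reflect: "(LINT t|lborel. f (- t :: real)) = (LINT t|lborel. f t :: 'a::euclidean_space)"
  using lborel_integral_real_affine[of "-1" f 0] by simp

lemma integral_shift: "(LINT t|lborel. f (t + a :: real)) = (LINT t|lborel. f t :: 'a::euclidean_space)"
  using lborel_integral_real_affine[of "1" f a] by (simp add: add.commute)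

lemma inner_le_sq: "\<bar>a \<bullet> b\<bar> \<le> ((norm a)\<^sup>2 + (norm (b::'a::real_inner))\<^sup>2) / 2"
proof -
  have "\<bar>a \<bullet> b\<bar> \<le> norm a * norm b" by (rule Cauchy_Schwarz_ineq2)
  also have "\<dots> \<le> ((norm a)\<^sup>2 + (norm b)\<^sup>2) / 2"
    using zero_le_power2[of "norm a - norm b"] by (simp add: power2_eq_square algebra_simps)
  finally show ?thesis .
qed

lemma L2_inner_integrable:
  assumes "f \<in> L2" "g \<in> L2" shows "integrable lborel (\<lambda>t. f t \<bullet> g t)"
proof (rule Bochner_Integration.integrable_bound[of _ "\<lambda>t. ((norm (f t))\<^sup>2 + (norm (g t))\<^sup>2) / 2"])
  note [measurable] = assms[THEN L2_measurable]
  show "(\<lambda>t. f t \<bullet> g t) \<in> borel_measurable lborel" by measurable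
qed (use assms[THEN L2_integrable] inner_le_sq in auto)

lemma integrable_set_integrable:
  fixes f :: "real \<Rightarrow> 'a::euclidean_space"
  shows "integrable lborel f \<Longrightarrow> A \<in> sets borel \<Longrightarrow> set_integrable lborel A f"
  unfolding set_integrable_def by (rule integrable_mult_indicator) auto

lemma L2_imp_L2_loc: "f \<in> L2 \<Longrightarrow> f \<in> L2_loc"
  by (simp add: L2_def L2_loc_def integrable_set_integrable)

lemma L2_loc_sq_set_integrable: "f \<in> L2_loc \<Longrightarrow> set_integrable lborel {a..b} (\<lambda>t. (norm (f t))\<^sup>2)"
  by (simp add: L2_loc_def)

lemma set_integrable_boundedI:
  fixes f :: "real \<Rightarrow> 'a::euclidean_space" and g :: "real \<Rightarrow> real"
  assumes "f \<in> borel_measurable borel" "set_integrable lborel {a..b} g"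
    "\<And>t. t \<in> {a..b} \<Longrightarrow> norm (f t) \<le> g t"
  shows "set_integrable lborel {a..b} f"
proof (rule set_integrable_bound[OF assms(2)])
  show "set_borel_measurable lborel {a..b} f"
    unfolding set_borel_measurable_def using assms(1) by measurable
  show "AE x in lborel. x \<in> {a..b} \<longrightarrow> norm (f x) \<le> norm (g x)"
    using assms(3) by (force intro!: AE_I2)
qed

lemma set_integrable_const: "set_integrable lborel {a..b::real} (\<lambda>t. c :: 'a::euclidean_space)"
  by (rule borel_integrable_atLeastAtMost') (rule continuous_on_const)

lemma le_sq_half: "x \<le> (1 + x\<^sup>2) / (2::real)"
  using zero_le_power2[of "x - 1"] by (simp add: power2_eq_square algebra_simps)

lemma L2_loc_norm_set_integrable:
  assumes "f \<in> L2_loc" shows "set_integrable lborel {a..b} (\<lambda>t. norm (f t))"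
proof (rule set_integrable_boundedI)
  note [measurable] = L2_loc_measurable[OF assms]
  show "(\<lambda>t. norm (f t)) \<in> borel_measurable borel" by measurable
  show "set_integrable lborel {a..b} (\<lambda>t. (1 + (norm (f t))\<^sup>2) / 2)"
    by (intro set_integrable_divide set_integral_add set_integrable_const L2_loc_sq_set_integrable assms)
qed (simp only: real_norm_def abs_norm_cancel le_sq_half)

lemma L2_loc_set_integrable:
  fixes f :: "real \<Rightarrow> 'a::euclidean_space"
  assumes "f \<in> L2_loc" shows "set_integrable lborel {a..b} f"
  by (rule set_integrable_boundedI[OF L2_loc_measurable[OF assms] L2_loc_norm_set_integrable[OF assms]]) simp

lemma L2_locI:
  assumes "f \<in> borel_measurable borel" "\<And>a b. set_integrable lborel {a..b} (\<lambda>t. (norm (f t))\<^sup>2)"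
  shows "f \<in> L2_loc"
  using assms by (simp add: L2_loc_def)

lemma L2_loc_add:
  fixes f g :: "real \<Rightarrow> 'a::euclidean_space"
  assumes "f \<in> L2_loc" "g \<in> L2_loc"
  shows "(\<lambda>t. f t + g t) \<in> L2_loc"
proof (rule L2_locI)
  note [measurable] = assms[THEN L2_loc_measurable]
  show "(\<lambda>t. f t + g t) \<in> borel_measurable borel" by measurable
  show "set_integrable lborel {a..b} (\<lambda>t. (norm (f t + g t))\<^sup>2)" for a b
    by (rule set_integrable_boundedI[of _ _ _ "\<lambda>t. 2 * (norm (f t))\<^sup>2 + 2 * (norm (g t))\<^sup>2"])
      (use assms norm_add_sq_le in \<open>auto intro!: set_integral_add L2_loc_sq_set_integrable\<close>)
qed

text \<open>A product with a locally bounded factor stays locally square integrable.\<close>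

lemma L2_loc_prod:
  fixes f :: "real \<Rightarrow> 'a::euclidean_space" and g :: "real \<Rightarrow> 'b::euclidean_space" 
    and h :: "real \<Rightarrow> 'c::euclidean_space"
  assumes "h \<in> borel_measurable borel" "f \<in> L2_loc" "continuous_on UNIV g"
    "\<And>t. norm (h t) \<le> K * norm (f t) * norm (g t)"
  shows "h \<in> L2_loc"
proof (rule L2_locI[OF assms(1)])
  fix a b :: real
  note [measurable] = L2_loc_measurable[OF assms(2)] assms(1)
  have "compact (g ` {a..b})"
    by (intro compact_continuous_image continuous_on_subset[OF assms(3)]) auto
  then obtain B where B: "\<And>t. t \<in> {a..b} \<Longrightarrow> norm (g t) \<le> B"
    by (metis bounded_iff compact_imp_bounded image_eqI)
  show "set_integrable lborel {a..b} (\<lambda>t. (norm (h t))\<^sup>2)"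
  proof (rule set_integrable_boundedI[of _ _ _ "\<lambda>t. (K*B)\<^sup>2 * (norm (f t))\<^sup>2"])
    show "norm ((norm (h t))\<^sup>2) \<le> (K*B)\<^sup>2 * (norm (f t))\<^sup>2" if "t \<in> {a..b}" for t
    proof -
      have "norm (h t) \<le> \<bar>K\<bar> * norm (f t) * norm (g t)"
        by (rule order_trans[OF assms(4)]) (simp add: mult_right_mono)
      also have "\<dots> \<le> \<bar>K\<bar> * norm (f t) * B"
        using B[OF that] by (intro mult_left_mono) auto
      finally have "(norm (h t))\<^sup>2 \<le> (\<bar>K\<bar> * norm (f t) * B)\<^sup>2"
        by (intro power_mono) auto
      then show ?thesis by (simp add: power_mult_distrib algebra_simps)
    qed
  qed (use L2_loc_sq_set_integrable[OF assms(2)] in auto)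
qed

lemma L2_loc_continuous:
  fixes f :: "real \<Rightarrow> 'a::euclidean_space"
  assumes "continuous_on UNIV f" shows "f \<in> L2_loc"
  by (intro L2_locI borel_integrable_atLeastAtMost' continuous_intros borel_measurable_continuous_onI
      continuous_on_subset[OF assms]) (use assms in auto)

lemma L2_loc_bounded_linear:
  fixes f :: "real \<Rightarrow> 'a::euclidean_space" and h :: "'a \<Rightarrow> 'b::euclidean_space"
  assumes "bounded_linear h" "f \<in> L2_loc"
  shows "(\<lambda>t. h (f t)) \<in> L2_loc"
proof -
  note [measurable] = L2_loc_measurable[OF assms(2)]
  obtain K where K: "\<And>x. norm (h x) \<le> norm x * K" "K > 0"
    using bounded_linear.pos_bounded[OF assms(1)] by blast
  have "h \<in> borel_measurable borel"
    by (intro borel_measurable_continuous_onI linear_continuous_on assms)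
  then have "(\<lambda>t. h (f t)) \<in> borel_measurable borel" by measurable
  then show ?thesis
    by (rule L2_loc_prod[OF _ assms(2), of _ "\<lambda>_. 1 :: real" K]) (use K in \<open>auto simp: mult.commute\<close>)
qed

lemma L2_loc_minus: "f \<in> L2_loc \<Longrightarrow> (\<lambda>t. - f t :: 'a::euclidean_space) \<in> L2_loc"
  by (rule L2_loc_bounded_linear[OF bounded_linear_minus[OF bounded_linear_ident]])

lemma set_integral_combine:
  fixes f :: "real \<Rightarrow> 'a::euclidean_space"
  assumes "a \<le> b" "b \<le> c" "set_integrable lborel {a..c} f"
  shows "(LINT t:{a..c}|lborel. f t) = (LINT t:{a..b}|lborel. f t) + (LINT t:{b..c}|lborel. f t)"
proof -
  have 1: "set_integrable lborel {a..b} f" "set_integrable lborel {b..c} f"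
    by (rule set_integrable_subset[OF assms(3)]; use assms in auto)+
  show ?thesis
    using Henstock_Kurzweil_Integration.integral_combine[of a b c f] set_borel_integral_eq_integral[OF assms(3)] 
      set_borel_integral_eq_integral[OF 1(1)] set_borel_integral_eq_integral[OF 1(2)] assms
    by simp
qed

lemma set_integral_point: "(LINT t:{a..a::real}|lborel. f t :: 'a::euclidean_space) = 0"
proof -
  have "AE t in lborel. indicator {a..a} t *\<^sub>R f t = 0"
    using AE_lborel_singleton[of a] by eventually_elim (auto simp: indicator_def)
  then show ?thesis unfolding set_lebesgue_integral_def
    by (simp add: integral_eq_zero_AE)
qed

lemma set_integral_norm_le:
  fixes f :: "real \<Rightarrow> 'a::euclidean_space"
  assumes "set_integrable lborel A f"
  shows "norm (LINT t:A|lborel. f t) \<le> (LINT t:A|lborel. norm (f t))"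
  using integral_norm_bound[of lborel "\<lambda>t. indicator A t *\<^sub>R f t"]
  by (simp add: set_lebesgue_integral_def)

lemma set_integral_bounded_le:
  fixes f :: "real \<Rightarrow> 'a::euclidean_space"
  assumes "set_integrable lborel A f" "set_integrable lborel A g" 
    "\<And>t. t \<in> A \<Longrightarrow> norm (f t) \<le> g t"
  shows "norm (LINT t:A|lborel. f t) \<le> (LINT t:A|lborel. g t)"
proof -
  have "set_integrable lborel A (\<lambda>t. norm (f t))"
    using integrable_norm[OF assms(1)[unfolded set_integrable_def]] by (simp add: set_integrable_def)
  then show ?thesis
    by (intro order_trans[OF set_integral_norm_le[OF assms(1)]] set_integral_mono assms)
qed

lemma set_integral_nonneg': 
  assumes "\<And>t. t \<in> A \<Longrightarrow> (0::real) \<le> f t"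
  shows "0 \<le> (LINT t:A|lborel. f t)"
  unfolding set_lebesgue_integral_def using assms
  by (intro Bochner_Integration.integral_nonneg) (auto simp: indicator_def)

lemma set_integral_le_integral:
  fixes f :: "real \<Rightarrow> real"
  assumes "integrable lborel f" "A \<in> sets borel" "\<And>t. (0::real) \<le> f t"
  shows "(LINT t:A|lborel. f t) \<le> (LINT t|lborel. f t)"
  unfolding set_lebesgue_integral_def
proof (rule integral_mono[OF _ assms(1)])
  show "integrable lborel (\<lambda>t. indicat_real A t *\<^sub>R f t)"
    using integrable_set_integrable[OF assms(1,2)] by (simp add: set_integrable_def)
  show "indicat_real A t *\<^sub>R f t \<le> f t" for t
    using assms(3)[of t] by (simp add: indicator_def)
qed

lemma set_integral_constant: "a \<le> b \<Longrightarrow> (LINT t:{a..b::real}|lborel. (c::real)) = (b - a) * c"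
  by (simp add: set_lebesgue_integral_def)

lemma set_integral_bounded_linear:
  fixes f :: "real \<Rightarrow> 'a::euclidean_space" and h :: "'a \<Rightarrow> 'b::euclidean_space"
  assumes "bounded_linear h" "set_integrable lborel A f"
  shows "h (LINT t:A|lborel. f t) = (LINT t:A|lborel. h (f t))"
  using integral_bounded_linear[OF assms(1) assms(2)[unfolded set_integrable_def], symmetric]
    linear_simps(5)[OF assms(1)]
  by (simp add: set_lebesgue_integral_def)

lemma set_integral_affine_pos:
  fixes f :: "real \<Rightarrow> 'a::euclidean_space"
  shows "(LINT t:{a..b}|lborel. f (t + c)) = (LINT t:{a+c..b+c}|lborel. f t)"
proof -
  have "(LINT t:{a+c..b+c}|lborel. f t) = (LINT t|lborel. indicator {a+c..b+c} (t+c) *\<^sub>R f (t + c))"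
    using integral_shift[of "\<lambda>t. indicator {a+c..b+c} t *\<^sub>R f t" c]
    by (simp add: set_lebesgue_integral_def)
  also have "\<dots> = (LINT t:{a..b}|lborel. f (t + c))"
    unfolding set_lebesgue_integral_def by (rule Bochner_Integration.integral_cong) (auto simp: indicator_def)
  finally show ?thesis by simp
qed

lemma set_integral_reflect_Icc:
  fixes f :: "real \<Rightarrow> 'a::euclidean_space"
  shows "(LINT t:{a..b}|lborel. f (- t)) = (LINT t:{-b..-a}|lborel. f t)"
proof -
  have "(LINT t:{-b..-a}|lborel. f t) = (LINT t|lborel. indicator {-b..-a} (-t) *\<^sub>R f (- t))"
    using integral_reflect[of "\<lambda>t. indicator {-b..-a} t *\<^sub>R f t"]
    by (simp add: set_lebesgue_integral_def)
  also have "\<dots> = (LINT t:{a..b}|lborel. f (- t))"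
    unfolding set_lebesgue_integral_def by (rule Bochner_Integration.integral_cong) (auto simp: indicator_def)
  finally show ?thesis by simp
qed

lemma L2_loc_shift: assumes "f \<in> L2_loc" shows "(\<lambda>t. f (t + c)) \<in> L2_loc"
proof (rule L2_locI)
  note [measurable] = L2_loc_measurable[OF assms]
  show "(\<lambda>t. f (t + c)) \<in> borel_measurable borel" by measurable
  show "set_integrable lborel {a..b} (\<lambda>t. (norm (f (t + c)))\<^sup>2)" for a b
  proof -
    have "integrable lborel (\<lambda>t. (\<lambda>t. indicator {a+c..b+c} t *\<^sub>R (norm (f t))\<^sup>2) (c + 1 * t))"
      using L2_loc_sq_set_integrable[OF assms, of "a+c" "b+c"] unfolding set_integrable_def
      by (intro integrable_lborel_affine) auto
    moreover have "(\<lambda>t. (\<lambda>t. indicator {a+c..b+c} t *\<^sub>R (norm (f t))\<^sup>2) (c + 1 * t)) 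
        = (\<lambda>t. indicator {a..b} t *\<^sub>R (norm (f (t + c)))\<^sup>2)"
      by (auto simp: fun_eq_iff indicator_def add.commute)
    ultimately show ?thesis unfolding set_integrable_def by simp
  qed
qed

lemma L2_loc_reflect: assumes "f \<in> L2_loc" shows "(\<lambda>t. f (- t)) \<in> L2_loc"
proof (rule L2_locI)
  note [measurable] = L2_loc_measurable[OF assms]
  show "(\<lambda>t. f (- t)) \<in> borel_measurable borel" by measurable
  show "set_integrable lborel {a..b} (\<lambda>t. (norm (f (- t)))\<^sup>2)" for a b
  proof -
    have "integrable lborel (\<lambda>t. (\<lambda>t. indicator {-b..-a} t *\<^sub>R (norm (f t))\<^sup>2) (0 + (-1) * t))"
      using L2_loc_sq_set_integrable[OF assms, of "-b" "-a"] unfolding set_integrable_def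
      by (intro integrable_lborel_affine) auto
    moreover have "(\<lambda>t. (\<lambda>t. indicator {-b..-a} t *\<^sub>R (norm (f t))\<^sup>2) (0 + (-1) * t)) 
        = (\<lambda>t. indicator {a..b} t *\<^sub>R (norm (f (- t)))\<^sup>2)"
      by (auto simp: fun_eq_iff indicator_def)
    ultimately show ?thesis unfolding set_integrable_def by simp
  qed
qed

section \<open>Primitives of locally square integrable functions\<close>

text \<open>On the line, the weak derivative is most easily handled through the fundamental theorem of calculus;
  \<open>H1_loc_iff\<close> and \<open>H1_iff\<close> below show that this describes the same spaces as testing against smooth functions.\<close>

definition primitive :: "(real \<Rightarrow> 'a::euclidean_space) \<Rightarrow> (real \<Rightarrow> 'a) \<Rightarrow> bool" where
  "primitive q g \<longleftrightarrow> g \<in> L2_loc \<and> (\<forall>a b. a \<le> b \<longrightarrow> q b - q a = (LINT t:{a..b}|lborel. g t))"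

lemma primitiveD: "primitive q g \<Longrightarrow> a \<le> b \<Longrightarrow> q b - q a = (LINT t:{a..b}|lborel. g t)"
  by (simp add: primitive_def)

lemma primitive_L2_loc: "primitive q g \<Longrightarrow> g \<in> L2_loc"
  by (simp add: primitive_def)

lemma primitive_set_integrable: "primitive q g \<Longrightarrow> set_integrable lborel {a..b} g"
  by (rule L2_loc_set_integrable[OF primitive_L2_loc])

lemma primitive_bounded_linear:
  fixes q :: "real \<Rightarrow> 'a::euclidean_space" and h :: "'a \<Rightarrow> 'b::euclidean_space"
  assumes "bounded_linear h" "primitive q g"
  shows "primitive (\<lambda>t. h (q t)) (\<lambda>t. h (g t))"
  unfolding primitive_def
proof (intro conjI allI impI)
  show "(\<lambda>t. h (g t)) \<in> L2_loc"
    by (rule L2_loc_bounded_linear[OF assms(1) primitive_L2_loc[OF assms(2)]])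
  fix a b :: real assume "a \<le> b"
  show "h (q b) - h (q a) = (LINT t:{a..b}|lborel. h (g t))"
    using set_integral_bounded_linear[OF assms(1) primitive_set_integrable[OF assms(2)]] 
      primitiveD[OF assms(2) \<open>a \<le> b\<close>] linear_simps(2)[OF assms(1)] by metis
qed

lemma primitive_scaleR: "primitive q g \<Longrightarrow> primitive (\<lambda>t. r *\<^sub>R q t) (\<lambda>t. r *\<^sub>R g t)"
  by (rule primitive_bounded_linear[OF bounded_linear_scaleR_right])

lemma primitive_minus: "primitive q g \<Longrightarrow> primitive (\<lambda>t. - q t) (\<lambda>t. - g t)"
  by (rule primitive_bounded_linear[OF bounded_linear_minus[OF bounded_linear_ident]])

lemma primitive_add:
  assumes "primitive q g" "primitive p h"
  shows "primitive (\<lambda>t. q t + p t) (\<lambda>t. g t + h t)"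
  unfolding primitive_def
proof (intro conjI allI impI)
  show "(\<lambda>t. g t + h t) \<in> L2_loc"
    by (rule L2_loc_add[OF assms[THEN primitive_L2_loc]])
  fix a b :: real assume "a \<le> b"
  show "q b + p b - (q a + p a) = (LINT t:{a..b}|lborel. g t + h t)"
    using primitiveD[OF assms(1) \<open>a \<le> b\<close>] primitiveD[OF assms(2) \<open>a \<le> b\<close>]
    by (subst set_integral_add(2)) (auto simp: assms[THEN primitive_set_integrable] algebra_simps)
qed

lemma primitive_diff:
  assumes "primitive q g" "primitive p h"
  shows "primitive (\<lambda>t. q t - p t) (\<lambda>t. g t - h t)"
  using primitive_add[OF assms(1) primitive_minus[OF assms(2)]] by simp

lemma primitive_const: "primitive (\<lambda>t. c) (\<lambda>t. 0)"
  by (simp add: primitive_def L2_loc_zero)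

lemma primitive_add_const: "primitive q g \<Longrightarrow> primitive (\<lambda>t. q t + c) g"
  using primitive_add[OF _ primitive_const] by fastforce

lemma primitive_shift:
  assumes "primitive q g" shows "primitive (\<lambda>t. q (t + c)) (\<lambda>t. g (t + c))"
  unfolding primitive_def
  using L2_loc_shift[OF primitive_L2_loc[OF assms]] primitiveD[OF assms]
  by (auto simp: set_integral_affine_pos)

lemma primitive_reflect:
  assumes "primitive q g" shows "primitive (\<lambda>t. q (- t)) (\<lambda>t. - g (- t))"
proof -
  have 1: "(\<lambda>t. g (- t)) \<in> L2_loc"
    by (rule L2_loc_reflect[OF primitive_L2_loc[OF assms]])
  have "q (- b) - q (- a) = (LINT t:{a..b}|lborel. - g (- t))" if "a \<le> b" for a b
    using primitiveD[OF assms, of "-b" "-a"] that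
    by (subst set_integral_uminus[OF L2_loc_set_integrable[OF 1]]) 
      (simp add: set_integral_reflect_Icc, metis minus_diff_eq)
  then show ?thesis
    unfolding primitive_def using L2_loc_minus[OF 1] by auto
qed

lemma primitive_C1:
  fixes q :: "real \<Rightarrow> 'a::euclidean_space"
  assumes "\<And>t. (q has_vector_derivative g t) (at t)" "continuous_on UNIV g"
  shows "primitive q g"
  unfolding primitive_def
proof (intro conjI allI impI)
  show "g \<in> L2_loc" by (rule L2_loc_continuous[OF assms(2)])
  fix a b :: real assume "a \<le> b"
  show "q b - q a = (LINT t:{a..b}|lborel. g t)"
    unfolding set_lebesgue_integral_def
    by (rule integral_FTC_atLeastAtMost[OF \<open>a \<le> b\<close>, symmetric])
      (use assms has_vector_derivative_at_within continuous_on_subset in blast)+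
qed

text \<open>Hoelder continuity with exponent one half, in a form without a square root of the
  integral: the weight in \<open>2 x \<le> x\<^sup>2 / r + r\<close> is taken to be \<open>1 / sqrt (b - a)\<close>.\<close>

lemma L2_loc_integral_norm_le:
  assumes "g \<in> L2_loc" "a \<le> b"
  shows "(LINT t:{a..b}|lborel. norm (g t)) \<le> sqrt (b - a) * (1 + (LINT t:{a..b}|lborel. (norm (g t))\<^sup>2)) / 2"
proof (cases "a = b")
  case True then show ?thesis using set_integral_point[of a "\<lambda>t. norm (g t)"] by simp
next
  case False
  define r where "r = sqrt (b - a)"
  have r: "r > 0" "r * r = b - a" using False assms(2) by (auto simp: r_def)
  have "(LINT t:{a..b}|lborel. norm (g t)) \<le> (LINT t:{a..b}|lborel. (1 / r + r * (norm (g t))\<^sup>2) / 2)"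
  proof (rule set_integral_mono)
    show "norm (g t) \<le> (1 / r + r * (norm (g t))\<^sup>2) / 2" for t
      using le_sq_half[of "r * norm (g t)"] r by (simp add: field_simps power2_eq_square)
  qed (intro set_integrable_divide set_integral_add set_integrable_const set_integrable_mult_right impI
      L2_loc_sq_set_integrable L2_loc_norm_set_integrable assms)+
  also have "\<dots> = (LINT t:{a..b}|lborel. 1 / r + r * (norm (g t))\<^sup>2) / 2"
    by (rule set_integral_divide_zero)
  also have "(LINT t:{a..b}|lborel. 1 / r + r * (norm (g t))\<^sup>2) = 
     (LINT t:{a..b}|lborel. 1 / r) + (LINT t:{a..b}|lborel. r * (norm (g t))\<^sup>2)"
    by (intro set_integral_add set_integrable_const set_integrable_mult_right impI
      L2_loc_sq_set_integrable assms)
  also have "\<dots> = r + r * (LINT t:{a..b}|lborel. (norm (g t))\<^sup>2)"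
    using r assms(2) by (simp add: set_integral_constant field_simps)
  finally show ?thesis by (simp add: r_def algebra_simps)
qed

lemma primitive_dist_le:
  assumes "primitive q g" "a \<le> b"
  shows "norm (q b - q a) \<le> (LINT t:{a..b}|lborel. norm (g t))"
  unfolding primitiveD[OF assms] by (rule set_integral_norm_le[OF primitive_set_integrable[OF assms(1)]])

lemma primitive_holder:
  assumes "primitive q g" "a \<le> b"
  shows "norm (q b - q a) \<le> sqrt (b - a) * (1 + (LINT t:{a..b}|lborel. (norm (g t))\<^sup>2)) / 2"
  using primitive_dist_le[OF assms] L2_loc_integral_norm_le[OF primitive_L2_loc[OF assms(1)] assms(2)] by simp

lemma primitive_continuous:
  assumes "primitive q g" shows "continuous_on UNIV q"
proof -
  have "isCont q x" for x
  proof -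
    define C where "C = (1 + (LINT t:{x-1..x+1}|lborel. (norm (g t))\<^sup>2)) / 2"
    have mono: "(LINT t:{a..b}|lborel. (norm (g t))\<^sup>2) \<le> (LINT t:{x-1..x+1}|lborel. (norm (g t))\<^sup>2)" 
      if "{a..b} \<subseteq> {x-1..x+1}" for a b
      unfolding set_lebesgue_integral_def
      by (rule integral_mono)
        (use L2_loc_sq_set_integrable[OF primitive_L2_loc[OF assms]] that in 
          \<open>auto simp: set_integrable_def indicator_def\<close>)
    have bd: "norm (q y - q x) \<le> sqrt \<bar>y - x\<bar> * C" if "\<bar>y - x\<bar> \<le> 1" for y
    proof (cases "x \<le> y")
      case True
      have "norm (q y - q x) \<le> sqrt (y - x) * (1 + (LINT t:{x..y}|lborel. (norm (g t))\<^sup>2)) / 2"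
        by (rule primitive_holder[OF assms True])
      also have "\<dots> \<le> sqrt (y - x) * C" unfolding C_def times_divide_eq_right
        by (intro divide_right_mono mult_left_mono add_left_mono mono) (use True that in auto)
      finally show ?thesis using True by simp
    next
      case False
      have "norm (q x - q y) \<le> sqrt (x - y) * (1 + (LINT t:{y..x}|lborel. (norm (g t))\<^sup>2)) / 2"
        by (rule primitive_holder[OF assms]) (use False in simp)
      also have "\<dots> \<le> sqrt (x - y) * C" unfolding C_def times_divide_eq_right
        by (intro divide_right_mono mult_left_mono add_left_mono mono) (use False that in auto)
      finally show ?thesis using False by (simp add: norm_minus_commute abs_if)
    qed
    have "((\<lambda>y. sqrt \<bar>y - x\<bar> * C) \<longlongrightarrow> sqrt \<bar>x - x\<bar> * C) (at x)"
      by (intro tendsto_intros)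
    then have 0: "((\<lambda>y. sqrt \<bar>y - x\<bar> * C) \<longlongrightarrow> 0) (at x)" by simp
    have "\<forall>\<^sub>F y in at x. \<bar>y - x\<bar> \<le> 1"
      unfolding eventually_at by (intro exI[of _ 1]) (auto simp: dist_real_def)
    then have "\<forall>\<^sub>F y in at x. norm (q y - q x) \<le> sqrt \<bar>y - x\<bar> * C"
      by eventually_elim (rule bd)
    then have "((\<lambda>y. q y - q x) \<longlongrightarrow> 0) (at x)"
      by (rule Lim_null_comparison[OF _ 0])
    then show ?thesis by (simp add: isCont_def LIM_zero_iff)
  qed
  then show ?thesis by (simp add: continuous_at_imp_continuous_on)
qed

lemma primitive_measurable:
  "primitive q g \<Longrightarrow> q \<in> borel_measurable borel" "primitive q g \<Longrightarrow> g \<in> borel_measurable borel"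
  by (auto intro: borel_measurable_continuous_onI primitive_continuous L2_loc_measurable primitive_L2_loc)

lemma primitive_glue:
  assumes q: "primitive q g" and p: "primitive p h" and eq: "q c = p c"
  shows "primitive (\<lambda>t. if t \<le> c then q t else p t) (\<lambda>t. if t \<le> c then g t else h t)"
proof -
  note [measurable] = primitive_measurable[OF q] primitive_measurable[OF p]
  define G where "G t = (if t \<le> c then g t else h t)" for t
  define Q where "Q t = (if t \<le> c then q t else p t)" for t
  have Gm: "G \<in> borel_measurable borel" unfolding G_def by measurable
  have Gl: "G \<in> L2_loc"
  proof (rule L2_locI[OF Gm])
    note [measurable] = Gm
    show "set_integrable lborel {a..b} (\<lambda>t. (norm (G t))\<^sup>2)" for a b
      by (rule set_integrable_boundedI[of _ _ _ "\<lambda>t. (norm (g t))\<^sup>2 + (norm (h t))\<^sup>2"])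
        (auto simp: G_def intro!: set_integral_add L2_loc_sq_set_integrable primitive_L2_loc[OF q] primitive_L2_loc[OF p])
  qed
  have left: "Q b - Q a = (LINT t:{a..b}|lborel. G t)" if "a \<le> b" "b \<le> c" for a b
  proof -
    have "Q b - Q a = (LINT t:{a..b}|lborel. g t)" using primitiveD[OF q that(1)] that by (simp add: Q_def)
    also have "\<dots> = (LINT t:{a..b}|lborel. G t)"
      by (rule set_lebesgue_integral_cong) (use that in \<open>auto simp: G_def\<close>)
    finally show ?thesis .
  qed
  have right: "Q b - Q a = (LINT t:{a..b}|lborel. G t)" if "a \<le> b" "c \<le> a" for a b
  proof -
    have "Q b - Q a = (LINT t:{a..b}|lborel. h t)" using primitiveD[OF p that(1)] that eq 
      by (cases "a = c"; cases "b = c") (auto simp: Q_def)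
    also have "\<dots> = (LINT t:{a..b}|lborel. G t)"
    proof (rule set_lebesgue_integral_cong_AE)
      show "AE x\<in>{a..b} in lborel. h x = G x"
        using AE_lborel_singleton[of c] by eventually_elim (use that in \<open>auto simp: G_def\<close>)
    qed (use Gm in measurable)
    finally show ?thesis .
  qed
  have "Q b - Q a = (LINT t:{a..b}|lborel. G t)" if "a \<le> b" for a b
  proof -
    consider "b \<le> c" | "c \<le> a" | "a \<le> c" "c \<le> b" by linarith
    then show ?thesis
    proof cases
      case 3
      have "Q b - Q a = (Q c - Q a) + (Q b - Q c)" by simp
      then show ?thesis using left[OF 3(1)] right[OF 3(2)] set_integral_combine[OF 3 L2_loc_set_integrable[OF Gl]] by simp
    qed (use left right that in auto)
  qed
  then have "primitive Q G" using Gl by (simp add: primitive_def)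
  then show ?thesis by (simp add: Q_def[abs_def] G_def[abs_def])
qed

text \<open>The positive and the negative part of a component are the densities of two measures that agree on all
  intervals, a generator of the Borel sets that is closed under intersections.\<close>

lemma AE_eq_of_set_integrals_eq:
  fixes f :: "real \<Rightarrow> 'a::euclidean_space"
  assumes "\<And>a b. set_integrable lborel {a..b} f" "\<And>a b. a \<le> b \<Longrightarrow> (LINT t:{a..b}|lborel. f t) = 0"
   and [measurable]: "f \<in> borel_measurable borel"
  shows "AE t in lborel. f t = 0"
proof -
  have comp: "AE t in lborel. t \<in> {-real n..real n} \<longrightarrow> f t \<bullet> b = 0" if "b \<in> Basis" for b n
  proof -
    let ?I = "{-real n..real n}"
    define h where "h t = indicator ?I t * (f t \<bullet> b)" for t
    have bl: "bounded_linear (\<lambda>x. x \<bullet> b)" by (rule bounded_linear_inner_left)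
    have si: "set_integrable lborel {a..c} (\<lambda>t. f t \<bullet> b)" for a c
    proof -
      have "integrable lborel (\<lambda>t. (indicator {a..c} t *\<^sub>R f t) \<bullet> b)"
        using assms(1)[of a c] unfolding set_integrable_def by (rule integrable_inner_left[where c=b, rotated])  
      then show ?thesis by (simp add: set_integrable_def)
    qed
    have int: "integrable lborel h"
      using si[of "-real n" "real n"] by (simp add: set_integrable_def h_def[abs_def])
    have z: "(LINT t:{a..c}|lborel. f t \<bullet> b) = 0" for a c
    proof (cases "a \<le> c")
      case True then show ?thesis
        using set_integral_bounded_linear[OF bl assms(1)[of a c]] assms(2)[of a c] by simp
    qed (simp add: set_lebesgue_integral_def)
    have zh: "(LINT t:{a..c}|lborel. h t) = 0" for a c
    proof -
      have "(LINT t:{a..c}|lborel. h t) = (LINT t:{max a (-real n)..min c (real n)}|lborel. f t \<bullet> b)"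
        unfolding set_lebesgue_integral_def h_def
        by (rule Bochner_Integration.integral_cong) (auto simp: indicator_def)
      then show ?thesis using z by simp
    qed
    have "AE t in lborel. h t = 0"
    proof -
      have pos: "(\<integral>\<^sup>+ t. ennreal (h t) * indicator {a..c} t \<partial>lborel) = (\<integral>\<^sup>+ t. ennreal (- h t) * indicator {a..c} t \<partial>lborel)" for a c
      proof -
        have i: "integrable lborel (\<lambda>t. h t * indicator {a..c} t)"
          using integrable_set_integrable[OF int, of "{a..c}"] unfolding set_integrable_def real_scaleR_def by (subst mult.commute) simp
        have "integral\<^sup>L lborel (\<lambda>t. h t * indicator {a..c} t) = 0"
          using zh[of a c] unfolding set_lebesgue_integral_def real_scaleR_def by (subst mult.commute) simp
        then have e: "enn2real (\<integral>\<^sup>+ t. ennreal (h t * indicator {a..c} t) \<partial>lborel) = 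
            enn2real (\<integral>\<^sup>+ t. ennreal (- (h t * indicator {a..c} t)) \<partial>lborel)"
          using real_lebesgue_integral_def[OF i] by simp
        have f1: "(\<integral>\<^sup>+ t. ennreal (h t * indicator {a..c} t) \<partial>lborel) < \<infinity>"
          "(\<integral>\<^sup>+ t. ennreal (- (h t * indicator {a..c} t)) \<partial>lborel) < \<infinity>"
          using real_integrable_def[of lborel "\<lambda>t. h t * indicator {a..c} t"] i by (auto simp: top.not_eq_extremum)
        have "(\<integral>\<^sup>+ t. ennreal (h t * indicator {a..c} t) \<partial>lborel) = (\<integral>\<^sup>+ t. ennreal (- (h t * indicator {a..c} t)) \<partial>lborel)"
          using e f1 by (metis ennreal_enn2real infinity_ennreal_def)
        moreover have "ennreal (h t * indicator {a..c} t) = ennreal (h t) * indicator {a..c} t"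
          "ennreal (- (h t * indicator {a..c} t)) = ennreal (- h t) * indicator {a..c} t" for t
          by (auto simp: indicator_def)
        ultimately show ?thesis by simp
      qed
      have hm[measurable]: "h \<in> borel_measurable borel" unfolding h_def by measurable
      have gen: "(\<lambda>t. ennreal (h t)) \<in> borel_measurable borel" "(\<lambda>t. ennreal (- h t)) \<in> borel_measurable borel"
        by measurable
      have "density lborel (\<lambda>t. ennreal (h t)) = density lborel (\<lambda>t. ennreal (- h t))"
      proof (rule measure_eqI_generator_eq[where E="range (\<lambda>(a,b). {a..b::real})" and \<Omega>=UNIV and A="\<lambda>n. {-real n..real n}"])
        show "Int_stable (range (\<lambda>(a, b). {a..b::real}))"
          by (auto simp: Int_stable_def)
        show "sets (density lborel (\<lambda>t. ennreal (h t))) = sigma_sets UNIV (range (\<lambda>(a, b). {a..b}))"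
          "sets (density lborel (\<lambda>t. ennreal (- h t))) = sigma_sets UNIV (range (\<lambda>(a, b). {a..b}))"
          using arg_cong[OF borel_eq_atLeastAtMost, of sets] by (simp_all add: )
        show "emeasure (density lborel (\<lambda>t. ennreal (h t))) X = emeasure (density lborel (\<lambda>t. ennreal (- h t))) X"
          if "X \<in> range (\<lambda>(a, b). {a..b::real})" for X
          using that pos by (auto simp: emeasure_density)
        show "(\<Union>i. {- real i..real i}) = UNIV"
        proof -
          have "\<exists>i. x \<in> {-real i..real i}" for x :: real
          proof -
            obtain n where "\<bar>x\<bar> \<le> real n" using real_arch_simple by blast
            then show ?thesis by (intro exI[of _ n]) (auto simp: abs_le_iff)
          qed
          then show ?thesis by blast
        qed
        show "emeasure (density lborel (\<lambda>t. ennreal (h t))) {-real i..real i} \<noteq> \<infinity>" for i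
        proof -
          have "(\<integral>\<^sup>+ t. ennreal (h t) * indicator {-real i..real i} t \<partial>lborel) \<le> (\<integral>\<^sup>+ t. ennreal (h t) \<partial>lborel)"
            by (intro nn_integral_mono) (auto simp: indicator_def)
          also have "\<dots> < \<infinity>"
            using int by (simp add: real_integrable_def top.not_eq_extremum)
          finally show ?thesis by (simp add: emeasure_density)
        qed
      qed auto
      then have "AE t in lborel. ennreal (h t) = ennreal (- h t)"
        using gen by (subst (asm) sigma_finite_measure.density_unique_iff[OF sigma_finite_lborel]) auto
      then show ?thesis
      proof eventually_elim
        fix t assume e: "ennreal (h t) = ennreal (- h t)"
        show "h t = 0"
        proof (cases "h t \<ge> 0")
          case True then show ?thesis using e ennreal_neg[of "- h t"] by simp
        next
          case False then show ?thesis using e ennreal_neg[of "h t"] by (simp add: ennreal_eq_0_iff[of "- h t", symmetric])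
        qed
      qed
    qed
    then show ?thesis by eventually_elim (auto simp: h_def indicator_def)
  qed
  have "AE t in lborel. \<forall>n. \<forall>b\<in>Basis. t \<in> {-real n..real n} \<longrightarrow> f t \<bullet> b = 0"
    unfolding AE_all_countable
  proof
    fix n
    show "AE t in lborel. \<forall>b\<in>Basis. t \<in> {-real n..real n} \<longrightarrow> f t \<bullet> b = 0"
      by (rule AE_finite_allI[OF finite_Basis]) (rule comp)
  qed
  then show ?thesis
  proof eventually_elim
    fix t assume t: "\<forall>n. \<forall>b\<in>Basis. t \<in> {-real n..real n} \<longrightarrow> f t \<bullet> b = 0"
    obtain n where "\<bar>t\<bar> \<le> real n" using real_arch_simple by blast
    then have tn: "t \<in> {-real n..real n}" unfolding atLeastAtMost_iff by linarith
    show "f t = 0"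
    proof (rule euclidean_eqI)
      fix b :: 'a assume "b \<in> Basis"
      then show "f t \<bullet> b = 0 \<bullet> b" unfolding inner_zero_left by (rule t[rule_format, OF _ tn])
    qed
  qed
qed

lemma primitive_unique_AE:
  assumes "primitive q g" "primitive q h"
  shows "AE t in lborel. g t = h t"
proof -
  have d: "primitive (\<lambda>t. 0) (\<lambda>t. g t - h t)" using primitive_diff[OF assms] by simp
  have "AE t in lborel. g t - h t = 0"
    by (rule AE_eq_of_set_integrals_eq)
      (use primitiveD[OF d] in \<open>auto intro: primitive_set_integrable[OF d] primitive_measurable(2)[OF d]\<close>)
  then show ?thesis by simp
qed

section \<open>Product rule and chain rule\<close>

text \<open>A function whose increments over short intervals are of smaller order than those of another
  function takes equal values at the end points; one sums over an equidistant partition. This replaces differentiation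
  almost everywhere in the proofs of the product rule and of the chain rule.\<close>

lemma eq_of_small_increments:
  fixes D :: "real \<Rightarrow> 'a::real_normed_vector" and H :: "real \<Rightarrow> real"
  assumes "a \<le> b" 
    and small: "\<And>e. e > 0 \<Longrightarrow> \<exists>d>0. \<forall>s t. a \<le> s \<and> s \<le> t \<and> t \<le> b \<and> t - s < d \<longrightarrow>
       norm (D t - D s) \<le> e * (H t - H s)"
  shows "D b = D a"
proof -
  have le: "norm (D b - D a) \<le> e * (H b - H a)" if e: "e > 0" for e
  proof -
    obtain d where d: "d > 0" "\<And>s t. a \<le> s \<Longrightarrow> s \<le> t \<Longrightarrow> t \<le> b \<Longrightarrow> t - s < d \<Longrightarrow>
       norm (D t - D s) \<le> e * (H t - H s)" using small[OF e] by blast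
    obtain n where n: "(b - a) / d < real n" using reals_Archimedean2 by blast
    have n0: "real n > 0" using n d(1) assms(1)
      by (metis diff_ge_0_iff_ge divide_nonneg_pos le_less_trans)
    define h where "h = (b - a) / real n"
    have h: "h \<ge> 0" "h < d" "real n * h = b - a" using n n0 d(1) assms(1) by (auto simp: h_def field_simps)
    have "norm (D (a + real k * h) - D a) \<le> e * (H (a + real k * h) - H a)" if "k \<le> n" for k
      using that
    proof (induction k)
      case (Suc k)
      have "real (Suc k) * h \<le> real n * h" using Suc.prems h(1) by (intro mult_right_mono) auto
      then have "norm (D (a + real (Suc k) * h) - D (a + real k * h)) 
          \<le> e * (H (a + real (Suc k) * h) - H (a + real k * h))"
        using h by (intro d(2)) (auto simp: algebra_simps)
      moreover have "norm (D (a + real (Suc k) * h) - D a) \<le> 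
        norm (D (a + real (Suc k) * h) - D (a + real k * h)) + norm (D (a + real k * h) - D a)"
        by (metis add_diff_cancel_left' diff_add_cancel add_diff_eq norm_triangle_ineq)
      ultimately show ?case using Suc by (simp add: algebra_simps)
    qed simp
    from this[of n] show ?thesis using h by simp
  qed
  have "norm (D b - D a) \<le> 0"
  proof (cases "H b - H a \<le> 0")
    case True
    have "norm (D b - D a) \<le> 1 * (H b - H a)" by (rule le) simp
    also have "\<dots> \<le> 0" using True by simp
    finally show ?thesis .
  next
    case False
    show ?thesis
    proof (rule ccontr)
      define x h where "x = norm (D b - D a)" and "h = H b - H a"
      assume "\<not> norm (D b - D a) \<le> 0"
      then have x: "x > 0" and h: "h > 0" using False by (auto simp: x_def h_def)
      have "x \<le> x / (2 * h) * h" using le[of "x / (2 * h)"] x h by (simp add: x_def h_def)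
      then show False using x h by simp
    qed
  qed
  then show ?thesis by simp
qed

lemma continuous_uniformly_on_Icc:
  fixes f :: "real \<Rightarrow> 'a::euclidean_space"
  assumes "continuous_on UNIV f" "e > 0"
  shows "\<exists>d>0. \<forall>s\<in>{a..b}. \<forall>t\<in>{a..b}. \<bar>s - t\<bar> < d \<longrightarrow> norm (f s - f t) < e"
proof -
  have "uniformly_continuous_on {a..b} f"
    by (intro compact_uniformly_continuous continuous_on_subset[OF assms(1)]) auto
  then show ?thesis using assms(2) unfolding uniformly_continuous_on_def dist_norm
    by (metis real_norm_def norm_minus_commute)
qed

text \<open>Over a short interval the increment of the product is the integral of
  \<open>prod (F r) (h t) + prod (f s) (K r)\<close> with \<open>h\<close> and \<open>f\<close> frozen at the end points. Freezing costs a small multiple of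
  the integral of \<open>norm F + norm K\<close>, since \<open>f\<close> and \<open>h\<close> are uniformly continuous.\<close>

lemma primitive_product:
  fixes f :: "real \<Rightarrow> 'a::euclidean_space" and h :: "real \<Rightarrow> 'b::euclidean_space"
    and prod :: "'a \<Rightarrow> 'b \<Rightarrow> 'c::euclidean_space"
  assumes "bounded_bilinear prod" "primitive f F" "primitive h K"
  shows "primitive (\<lambda>t. prod (f t) (h t)) (\<lambda>t. prod (F t) (h t) + prod (f t) (K t))"
proof -
  interpret bounded_bilinear prod by fact
  obtain C where C: "C > 0" "\<And>x y. norm (prod x y) \<le> norm x * norm y * C" using pos_bounded by blast
  note cf = primitive_continuous[OF assms(2)] and ch = primitive_continuous[OF assms(3)]
  note [measurable] = primitive_measurable[OF assms(2)] primitive_measurable[OF assms(3)]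
  have cp: "continuous_on UNIV (\<lambda>x. prod (fst x) (snd x))" by (intro continuous_on continuous_intros)
  have m[measurable]: "(\<lambda>t. prod (u t) (v t)) \<in> borel_measurable borel" 
    if "u \<in> borel_measurable borel" "v \<in> borel_measurable borel" for u v
    by (rule borel_measurable_continuous_Pair[OF that cp])
  have l1: "(\<lambda>t. prod (F t) (h t)) \<in> L2_loc"
    by (rule L2_loc_prod[OF _ primitive_L2_loc[OF assms(2)] ch, of _ C])
      (use C in \<open>auto simp: mult_ac intro!: m primitive_measurable[OF assms(2)] primitive_measurable[OF assms(3)]\<close>)
  have l2: "(\<lambda>t. prod (f t) (K t)) \<in> L2_loc"
    by (rule L2_loc_prod[OF _ primitive_L2_loc[OF assms(3)] cf, of _ C])
      (use C in \<open>auto simp: mult_ac intro!: m primitive_measurable[OF assms(2)] primitive_measurable[OF assms(3)]\<close>)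
  define G where "G t = prod (F t) (h t) + prod (f t) (K t)" for t
  have G: "G \<in> L2_loc" unfolding G_def[abs_def] by (rule L2_loc_add[OF l1 l2])
  note Gi = L2_loc_set_integrable[OF G]
  have nF: "set_integrable lborel {s..t} (\<lambda>r. norm (F r) + norm (K r))" for s t
    by (intro set_integral_add L2_loc_norm_set_integrable primitive_L2_loc[OF assms(2)] primitive_L2_loc[OF assms(3)])
  have "prod (f b) (h b) - prod (f a) (h a) = (LINT t:{a..b}|lborel. G t)" if ab: "a \<le> b" for a b
  proof -
    define D where "D t = prod (f t) (h t) - (LINT r:{a..t}|lborel. G r)" for t
    define H where "H t = (LINT r:{a..t}|lborel. norm (F r) + norm (K r))" for t
    have "D b = D a"
    proof (rule eq_of_small_increments[OF ab, of _ H])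
      fix e :: real assume e: "e > 0"
      define e' where "e' = e / C"
      have e': "e' > 0" using e C by (simp add: e'_def)
      obtain d1 where d1: "d1 > 0" "\<And>s t. s \<in> {a..b} \<Longrightarrow> t \<in> {a..b} \<Longrightarrow> \<bar>s - t\<bar> < d1 \<Longrightarrow> norm (f s - f t) < e'"
        using continuous_uniformly_on_Icc[OF cf e', of a b] by blast
      obtain d2 where d2: "d2 > 0" "\<And>s t. s \<in> {a..b} \<Longrightarrow> t \<in> {a..b} \<Longrightarrow> \<bar>s - t\<bar> < d2 \<Longrightarrow> norm (h s - h t) < e'"
        using continuous_uniformly_on_Icc[OF ch e', of a b] by blast
      have "norm (D t - D s) \<le> e * (H t - H s)" if st: "a \<le> s" "s \<le> t" "t \<le> b" "t - s < min d1 d2" for s t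
      proof -
        have i1: "set_integrable lborel {s..t} (\<lambda>r. prod (F r) (h t))" 
          by (rule L2_loc_set_integrable[OF L2_loc_bounded_linear[OF bounded_linear_left primitive_L2_loc[OF assms(2)]]])
        have i2: "set_integrable lborel {s..t} (\<lambda>r. prod (f s) (K r))" 
          by (rule L2_loc_set_integrable[OF L2_loc_bounded_linear[OF bounded_linear_right primitive_L2_loc[OF assms(3)]]])
        have i12: "set_integrable lborel {s..t} (\<lambda>r. prod (F r) (h t) + prod (f s) (K r))"
          by (rule set_integral_add(1)[OF i1 i2])
        have "prod (f t) (h t) - prod (f s) (h s) = prod (f t - f s) (h t) + prod (f s) (h t - h s)"
          by (simp add: diff_left diff_right)
        also have "\<dots> = (LINT r:{s..t}|lborel. prod (F r) (h t)) + (LINT r:{s..t}|lborel. prod (f s) (K r))"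
          using set_integral_bounded_linear[OF bounded_linear_left[of "h t"] primitive_set_integrable[OF assms(2)], of s t]
            set_integral_bounded_linear[OF bounded_linear_right[of "f s"] primitive_set_integrable[OF assms(3)], of s t]
            primitiveD[OF assms(2) st(2)] primitiveD[OF assms(3) st(2)] by simp
        also have "\<dots> = (LINT r:{s..t}|lborel. prod (F r) (h t) + prod (f s) (K r))"
          by (rule set_integral_add(2)[OF i1 i2, symmetric])
        finally have 1: "prod (f t) (h t) - prod (f s) (h s) = (LINT r:{s..t}|lborel. prod (F r) (h t) + prod (f s) (K r))" .
        have 2: "(LINT r:{a..t}|lborel. G r) - (LINT r:{a..s}|lborel. G r) = (LINT r:{s..t}|lborel. G r)"
          using set_integral_combine[OF st(1,2) Gi] by simp
        have 3: "H t - H s = (LINT r:{s..t}|lborel. norm (F r) + norm (K r))"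
          unfolding H_def using set_integral_combine[OF st(1,2) nF] by simp
        have "D t - D s = (LINT r:{s..t}|lborel. (prod (F r) (h t) + prod (f s) (K r)) - G r)"
          unfolding D_def using 1 2 set_integral_diff(2)[OF i12 Gi] by (simp add: algebra_simps)
        also have "norm \<dots> \<le> (LINT r:{s..t}|lborel. e * (norm (F r) + norm (K r)))"
        proof (rule set_integral_bounded_le)
          show "set_integrable lborel {s..t} (\<lambda>r. prod (F r) (h t) + prod (f s) (K r) - G r)"
            by (rule set_integral_diff(1)[OF i12 Gi])
          show "set_integrable lborel {s..t} (\<lambda>r. e * (norm (F r) + norm (K r)))"
            using nF by (intro set_integrable_mult_right) auto
          fix r assume r: "r \<in> {s..t}"
          have "prod (F r) (h t) + prod (f s) (K r) - G r = prod (F r) (h t - h r) + prod (f s - f r) (K r)"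
            by (simp add: G_def diff_left diff_right)
          also have "norm \<dots> \<le> norm (prod (F r) (h t - h r)) + norm (prod (f s - f r) (K r))"
            by (rule norm_triangle_ineq)
          also have "\<dots> \<le> norm (F r) * norm (h t - h r) * C + norm (f s - f r) * norm (K r) * C"
            by (intro add_mono C)
          also have "\<dots> \<le> norm (F r) * e' * C + e' * norm (K r) * C"
          proof -
            have "norm (h t - h r) \<le> e'" using d2(2)[of t r] r st by auto
            moreover have "norm (f s - f r) \<le> e'" using d1(2)[of s r] r st by auto
            ultimately show ?thesis using C(1) by (intro add_mono mult_right_mono mult_left_mono) auto
          qed
          also have "\<dots> = e * (norm (F r) + norm (K r))" using C(1) by (simp add: e'_def field_simps)
          finally show "norm (prod (F r) (h t) + prod (f s) (K r) - G r) \<le> e * (norm (F r) + norm (K r))" .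
        qed
        also have "\<dots> = e * (H t - H s)" using 3 by simp
        finally show ?thesis .
      qed
      then show "\<exists>d>0. \<forall>s t. a \<le> s \<and> s \<le> t \<and> t \<le> b \<and> t - s < d \<longrightarrow> norm (D t - D s) \<le> e * (H t - H s)"
        using d1(1) d2(1) by (intro exI[of _ "min d1 d2"]) auto
    qed
    then show ?thesis unfolding D_def set_integral_point by (simp add: algebra_simps)
  qed
  then show ?thesis using G unfolding primitive_def G_def[abs_def] by auto
qed

text \<open>By the mean value theorem, the increment over a short interval is that of \<open>f\<close> times \<open>\<phi>'\<close> at some value that \<open>f\<close>
  attains in the interval; replacing it by the values of \<open>\<phi>' \<circ> f\<close> under the integral costs little.\<close>

lemma primitive_chain:
  fixes f :: "real \<Rightarrow> real" and \<phi> \<phi>' :: "real \<Rightarrow> real"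
  assumes "primitive f F" "\<And>x. (\<phi> has_real_derivative \<phi>' x) (at x)" "continuous_on UNIV \<phi>'"
  shows "primitive (\<lambda>t. \<phi> (f t)) (\<lambda>t. \<phi>' (f t) * F t)"
proof -
  note cf = primitive_continuous[OF assms(1)]
  have cpf: "continuous_on UNIV (\<lambda>t. \<phi>' (f t))"
    by (rule continuous_on_compose2[OF assms(3) cf]) auto
  note [measurable] = primitive_measurable[OF assms(1)] borel_measurable_continuous_onI[OF cpf]
  define G where "G t = \<phi>' (f t) * F t" for t
  have "(\<lambda>t. \<phi>' (f t) * F t) \<in> borel_measurable borel" by measurable
  then have G: "G \<in> L2_loc" unfolding G_def[abs_def]
    by (rule L2_loc_prod[OF _ primitive_L2_loc[OF assms(1)] cpf, of _ 1]) (simp add: abs_mult mult.commute)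
  note Gi = L2_loc_set_integrable[OF G]
  have nF: "set_integrable lborel {s..t} (\<lambda>r. norm (F r))" for s t
    by (intro L2_loc_norm_set_integrable primitive_L2_loc[OF assms(1)])
  have "\<phi> (f b) - \<phi> (f a) = (LINT t:{a..b}|lborel. G t)" if ab: "a \<le> b" for a b
  proof -
    define D where "D t = \<phi> (f t) - (LINT r:{a..t}|lborel. G r)" for t
    define H where "H t = (LINT r:{a..t}|lborel. norm (F r))" for t
    have "D b = D a"
    proof (rule eq_of_small_increments[OF ab, of _ H])
      fix e :: real assume e: "e > 0"
      obtain d where d: "d > 0" "\<And>s t. s \<in> {a..b} \<Longrightarrow> t \<in> {a..b} \<Longrightarrow> \<bar>s - t\<bar> < d \<Longrightarrow> norm (\<phi>' (f s) - \<phi>' (f t)) < e"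
        using continuous_uniformly_on_Icc[OF cpf e, of a b] by blast
      have "norm (D t - D s) \<le> e * (H t - H s)" if st: "a \<le> s" "s \<le> t" "t \<le> b" "t - s < d" for s t
      proof -
        have "\<exists>x. x \<in> closed_segment (f s) (f t) \<and> \<phi> (f t) - \<phi> (f s) = \<phi>' x * (f t - f s)"
        proof (cases "f s" "f t" rule: linorder_cases)
          case less
          from MVT2[OF this] assms(2) obtain z where "f s < z" "z < f t" "\<phi> (f t) - \<phi> (f s) = (f t - f s) * \<phi>' z" by metis
          then show ?thesis by (intro exI[of _ z]) (auto simp: closed_segment_eq_real_ivl)
        next
          case greater
          from MVT2[OF this] assms(2) obtain z where "f t < z" "z < f s" "\<phi> (f s) - \<phi> (f t) = (f s - f t) * \<phi>' z" by metis
          then show ?thesis by (intro exI[of _ z]) (auto simp: closed_segment_eq_real_ivl algebra_simps)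
        qed (auto intro!: exI[of _ "f s"])
        then obtain x where x: "x \<in> closed_segment (f s) (f t)" "\<phi> (f t) - \<phi> (f s) = \<phi>' x * (f t - f s)" by blast
        \<comment> \<open>the intermediate point of the mean value theorem is a value of f between s and t\<close>
        have "closed_segment (f s) (f t) \<subseteq> f ` {s..t}"
        proof (rule closed_segment_subset)
          have "connected (f ` {s..t})" 
            by (intro connected_continuous_image continuous_on_subset[OF cf]) auto
          then show "convex (f ` {s..t})" by (simp add: is_interval_connected_1[symmetric] is_interval_convex_1[symmetric])
        qed (use st in auto)
        then obtain r0 where r0: "r0 \<in> {s..t}" "x = f r0" using x(1) by auto
        have i1: "set_integrable lborel {s..t} (\<lambda>r. \<phi>' x * F r)"
          using primitive_set_integrable[OF assms(1)] by (intro set_integrable_mult_right) auto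
        have 1: "\<phi> (f t) - \<phi> (f s) = (LINT r:{s..t}|lborel. \<phi>' x * F r)"
          using x(2) primitiveD[OF assms(1) st(2)] by simp
        have 2: "(LINT r:{a..t}|lborel. G r) - (LINT r:{a..s}|lborel. G r) = (LINT r:{s..t}|lborel. G r)"
          using set_integral_combine[OF st(1,2) Gi] by simp
        have 3: "H t - H s = (LINT r:{s..t}|lborel. norm (F r))"
          unfolding H_def using set_integral_combine[OF st(1,2) nF] by simp
        have "D t - D s = (LINT r:{s..t}|lborel. \<phi>' x * F r - G r)"
          unfolding D_def using 1 2 set_integral_diff(2)[OF i1 Gi] by (simp add: algebra_simps)
        also have "norm \<dots> \<le> (LINT r:{s..t}|lborel. e * norm (F r))"
        proof (rule set_integral_bounded_le)
          show "set_integrable lborel {s..t} (\<lambda>r. \<phi>' x * F r - G r)"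
            by (rule set_integral_diff(1)[OF i1 Gi])
          show "set_integrable lborel {s..t} (\<lambda>r. e * norm (F r))"
            using nF by (intro set_integrable_mult_right) auto
          fix r assume r: "r \<in> {s..t}"
          have "norm (\<phi>' (f r0) - \<phi>' (f r)) \<le> e" 
          proof -
            have "r0 \<in> {a..b}" "r \<in> {a..b}" "\<bar>r0 - r\<bar> < d" using r r0(1) st by (auto simp: abs_if)
            then show ?thesis using d(2) less_imp_le by blast
          qed
          moreover have "\<phi>' x * F r - G r = (\<phi>' (f r0) - \<phi>' (f r)) * F r"
            by (simp add: G_def r0 algebra_simps)
          ultimately show "norm (\<phi>' x * F r - G r) \<le> e * norm (F r)"
            by (simp add: abs_mult mult_right_mono)
        qed
        also have "\<dots> = e * (H t - H s)" using 3 by simp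
        finally show ?thesis .
      qed
      then show "\<exists>d>0. \<forall>s t. a \<le> s \<and> s \<le> t \<and> t \<le> b \<and> t - s < d \<longrightarrow> norm (D t - D s) \<le> e * (H t - H s)"
        using d(1) by blast
    qed
    then show ?thesis unfolding D_def set_integral_point by (simp add: algebra_simps)
  qed
  then show ?thesis using G unfolding primitive_def G_def[abs_def] by auto
qed

section \<open>Weak derivatives are derivatives of primitives\<close>

lemma C1_real_deriv:
  fixes \<phi> :: "real \<Rightarrow> real"
  assumes "\<phi> C1_differentiable_on UNIV"
  shows "(\<phi> has_real_derivative deriv \<phi> t) (at t)" "continuous_on UNIV (deriv \<phi>)"
proof -
  obtain D where D: "\<And>x. (\<phi> has_vector_derivative D x) (at x)" "continuous_on UNIV D"
    using assms unfolding C1_differentiable_on_def by auto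
  have "deriv \<phi> = D"
    using D(1) by (auto simp: fun_eq_iff has_real_derivative_iff_has_vector_derivative[symmetric] intro: DERIV_imp_deriv)
  then show "(\<phi> has_real_derivative deriv \<phi> t) (at t)" "continuous_on UNIV (deriv \<phi>)"
    using D by (auto simp: has_real_derivative_iff_has_vector_derivative)
qed

lemma primitive_imp_weak_deriv:
  assumes "primitive q g" shows "is_weak_deriv q g"
  unfolding is_weak_deriv_def
proof
  fix \<phi> :: "real \<Rightarrow> real" assume "\<phi> \<in> test_functions"
  then have phi: "\<phi> C1_differentiable_on UNIV" "compact (closure {t. \<phi> t \<noteq> 0})"
    by (auto simp: test_functions_def)
  obtain M where M0: "\<And>t. \<phi> t \<noteq> 0 \<Longrightarrow> \<bar>t\<bar> \<le> M"
    using compact_imp_bounded[OF phi(2)] closure_subset[of "{t. \<phi> t \<noteq> 0}"]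
    unfolding bounded_iff by (metis (mono_tags, lifting) mem_Collect_eq real_norm_def subset_iff)
  define N where "N = \<bar>M\<bar> + 1"
  have z: "\<phi> t = 0" if "\<bar>t\<bar> \<ge> N" for t
  proof (rule ccontr)
    assume "\<phi> t \<noteq> 0"
    from M0[OF this] that show False by (simp add: N_def)
  qed
  have dz: "deriv \<phi> t = 0" if "t \<notin> {-N..N}" for t
  proof (rule DERIV_imp_deriv)
    have "\<forall>\<^sub>F x in nhds t. \<bar>x\<bar> > N"
      by (rule eventually_nhds_in_open[of "{x. \<bar>x\<bar> > N}", simplified])
        (use that in \<open>auto intro!: open_Collect_less continuous_intros\<close>)
    then have "\<forall>\<^sub>F x in nhds t. \<phi> x = 0" by eventually_elim (auto intro: z)
    then show "(\<phi> has_field_derivative 0) (at t)"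
      by (subst DERIV_cong_ev[OF refl _ refl, of _ "\<lambda>_. 0"]) auto
  qed
  have pphi: "primitive \<phi> (deriv \<phi>)"
    by (rule primitive_C1) (use C1_real_deriv[OF phi(1)] has_real_derivative_iff_has_vector_derivative in auto)
  note [measurable] = primitive_measurable[OF pphi] primitive_measurable[OF assms]
  have pp: "primitive (\<lambda>t. \<phi> t *\<^sub>R q t) (\<lambda>t. deriv \<phi> t *\<^sub>R q t + \<phi> t *\<^sub>R g t)"
    by (rule primitive_product[OF bounded_bilinear_scaleR pphi assms])
  have l1: "set_integrable lborel {-N..N} (\<lambda>t. deriv \<phi> t *\<^sub>R q t)"
    by (rule borel_integrable_atLeastAtMost') 
      (intro continuous_intros continuous_on_subset[OF C1_real_deriv(2)[OF phi(1)]] continuous_on_subset[OF primitive_continuous[OF assms]]; simp)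
  have "(\<lambda>t. \<phi> t *\<^sub>R g t) \<in> L2_loc"
    by (rule L2_loc_prod[OF _ primitive_L2_loc[OF assms] primitive_continuous[OF pphi], of _ 1]) auto
  then have l2: "set_integrable lborel {-N..N} (\<lambda>t. \<phi> t *\<^sub>R g t)" by (rule L2_loc_set_integrable)
  have "(LINT t:{-N..N}|lborel. deriv \<phi> t *\<^sub>R q t + \<phi> t *\<^sub>R g t) = 0"
    using primitiveD[OF pp, of "-N" N] z[of N] z[of "-N"] by (simp add: N_def)
  then have "(LINT t:{-N..N}|lborel. deriv \<phi> t *\<^sub>R q t) + (LINT t:{-N..N}|lborel. \<phi> t *\<^sub>R g t) = 0"
    by (simp add: set_integral_add(2)[OF l1 l2])
  moreover have "(LINT t:{-N..N}|lborel. deriv \<phi> t *\<^sub>R q t) = (LINT t|lborel. deriv \<phi> t *\<^sub>R q t)"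
    unfolding set_lebesgue_integral_def
  proof (rule Bochner_Integration.integral_cong[OF refl])
    show "indicat_real {-N..N} t *\<^sub>R deriv \<phi> t *\<^sub>R q t = deriv \<phi> t *\<^sub>R q t" for t
      using dz[of t] by (cases "t \<in> {-N..N}") auto
  qed
  moreover have "(LINT t:{-N..N}|lborel. \<phi> t *\<^sub>R g t) = (LINT t|lborel. \<phi> t *\<^sub>R g t)"
    unfolding set_lebesgue_integral_def
  proof (rule Bochner_Integration.integral_cong[OF refl])
    show "indicat_real {-N..N} t *\<^sub>R \<phi> t *\<^sub>R g t = \<phi> t *\<^sub>R g t" for t
      using z[of t] by (cases "t \<in> {-N..N}") auto
  qed
  ultimately show "(LINT t|lborel. deriv \<phi> t *\<^sub>R q t) = - (LINT t|lborel. \<phi> t *\<^sub>R g t)"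
    by (simp add: eq_neg_iff_add_eq_0)
qed

text \<open>A continuously differentiable step from 0 to 1 across the unit interval. It is a combination of
  squared positive parts, and its derivative \<open>hat\<close> is the piecewise linear hat function with integral one.\<close>

definition ramp :: "real \<Rightarrow> real" where
  "ramp x = 2 * (max 0 x)\<^sup>2 - 4 * (max 0 (x - 1/2))\<^sup>2 + 2 * (max 0 (x - 1))\<^sup>2"

definition hat :: "real \<Rightarrow> real" where
  "hat x = 4 * max 0 x - 8 * max 0 (x - 1/2) + 4 * max 0 (x - 1)"

lemma DERIV_pos_part_sq: "((\<lambda>x. (max 0 x)\<^sup>2) has_real_derivative 2 * max 0 x) (at (x::real))"
proof (cases x "0::real" rule: linorder_cases)
  case less
  have "\<forall>\<^sub>F y in nhds x. y < 0" using less by (rule eventually_nhds_in_open[of "{..<0}", simplified, OF open_lessThan])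
  then have "\<forall>\<^sub>F y in nhds x. (max 0 y)\<^sup>2 = 0" by eventually_elim auto
  moreover have "((\<lambda>y. 0) has_real_derivative 2 * max 0 x) (at x)" using less by simp
  ultimately show ?thesis using DERIV_cong_ev[OF refl _ refl, of "\<lambda>y. (max 0 y)\<^sup>2" _ x] by fast
next
  case greater
  have "\<forall>\<^sub>F y in nhds x. y > 0" using greater by (rule eventually_nhds_in_open[of "{0<..}", simplified, OF open_greaterThan])
  then have "\<forall>\<^sub>F y in nhds x. (max 0 y)\<^sup>2 = y\<^sup>2" by eventually_elim auto
  moreover have "((\<lambda>y. y\<^sup>2) has_real_derivative 2 * max 0 x) (at x)" using greater
    by (auto intro!: derivative_eq_intros)
  ultimately show ?thesis using DERIV_cong_ev[OF refl _ refl, of "\<lambda>y. (max 0 y)\<^sup>2" _ x] by fast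
next
  case equal
  have "(\<lambda>h. ((max 0 (x + h))\<^sup>2 - (max 0 x)\<^sup>2) / h) \<midarrow>0\<rightarrow> 0"
  proof (rule Lim_null_comparison[of _ "\<lambda>h. \<bar>h\<bar>"])
    show "\<forall>\<^sub>F h in at 0. norm (((max 0 (x + h))\<^sup>2 - (max 0 x)\<^sup>2) / h) \<le> \<bar>h\<bar>"
      using equal by (intro always_eventually) (auto simp: max_def power2_eq_square)
    show "(\<lambda>h::real. \<bar>h\<bar>) \<midarrow>0\<rightarrow> 0" using tendsto_rabs[OF tendsto_ident_at, of 0 UNIV] by simp
  qed
  then show ?thesis using equal by (simp add: DERIV_def)
qed

lemma DERIV_ramp: "(ramp has_real_derivative hat x) (at x)"
proof -
  have s: "((\<lambda>x. (max 0 (x - c))\<^sup>2) has_real_derivative 2 * max 0 (x - c)) (at x)" for c :: real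
  proof -
    have "((\<lambda>x. x - c) has_real_derivative 1) (at x)" by (auto intro!: derivative_eq_intros)
    from DERIV_chain2[OF DERIV_pos_part_sq this] show ?thesis by simp
  qed
  show ?thesis unfolding ramp_def[abs_def] hat_def
    using DERIV_add[OF DERIV_diff[OF DERIV_cmult[OF s[of 0], of 2] DERIV_cmult[OF s[of "1/2"], of 4]] DERIV_cmult[OF s[of 1], of 2]]
    by (simp add: algebra_simps)
qed

lemma continuous_hat: "continuous_on A hat"
  unfolding hat_def[abs_def] by (intro continuous_intros)

lemma hat_nonneg: "0 \<le> hat x" and hat_le: "hat x \<le> 2" and hat_outside: "x \<notin> {0..1} \<Longrightarrow> hat x = 0"
  unfolding hat_def by (auto simp: max_def)

lemma ramp_low: "x \<le> 0 \<Longrightarrow> ramp x = 0"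
  by (simp add: ramp_def max_def)

lemma ramp_high: "x \<ge> 1 \<Longrightarrow> ramp x = 1"
  by (simp add: ramp_def max_def power2_eq_square algebra_simps)

lemma ramp_mono: "x \<le> y \<Longrightarrow> ramp x \<le> ramp y"
  by (rule DERIV_nonneg_imp_nondecreasing) (use DERIV_ramp hat_nonneg in blast)+

lemma ramp_range: "0 \<le> ramp x" "ramp x \<le> 1"
  using ramp_mono[of "min x 0" x] ramp_mono[of x "max x 1"] ramp_low[of "min x 0"] ramp_high[of "max x 1"] by auto

lemma integral_hat: "(LINT x:{0..1}|lborel. hat x) = 1"
proof -
  have "(LINT x:{0..1}|lborel. hat x) = ramp 1 - ramp 0"
    unfolding set_lebesgue_integral_def
    by (rule integral_FTC_atLeastAtMost) (use DERIV_ramp continuous_hat in 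
      \<open>auto simp: has_real_derivative_iff_has_vector_derivative[symmetric] intro: DERIV_subset\<close>)
  then show ?thesis by (simp add: ramp_low ramp_high)
qed

text \<open>The rescaled hat functions form an approximate identity at \<open>a\<close>, supported to the right of \<open>a\<close>.\<close>

lemma hat_average_tendsto:
  fixes q :: "real \<Rightarrow> 'a::euclidean_space"
  assumes q: "continuous_on UNIV q"
  shows "(\<lambda>n. LINT t|lborel. (real (Suc n) * hat (real (Suc n) * (t - a))) *\<^sub>R q t) \<longlonglongrightarrow> q a"
proof -
  have eq: "(LINT t|lborel. (real (Suc n) * hat (real (Suc n) * (t - a))) *\<^sub>R q t) = 
     (LINT x:{0..1}|lborel. hat x *\<^sub>R q (a + x / real (Suc n)))" for n
  proof -
    have "(LINT t|lborel. (real (Suc n) * hat (real (Suc n) * (t - a))) *\<^sub>R q t) = 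
      \<bar>1 / real (Suc n)\<bar> *\<^sub>R (LINT x|lborel. (real (Suc n) * hat (real (Suc n) * ((a + 1 / real (Suc n) * x) - a))) *\<^sub>R q (a + 1 / real (Suc n) * x))"
      by (rule lborel_integral_real_affine) simp
    also have "\<dots> = (LINT x|lborel. hat x *\<^sub>R q (a + x / real (Suc n)))"
      by (simp only: integral_scaleR_right[symmetric]) simp
    also have "\<dots> = (LINT x:{0..1}|lborel. hat x *\<^sub>R q (a + x / real (Suc n)))"
      unfolding set_lebesgue_integral_def
    proof (rule Bochner_Integration.integral_cong[OF refl])
      show "hat x *\<^sub>R q (a + x / real (Suc n)) = indicat_real {0..1} x *\<^sub>R hat x *\<^sub>R q (a + x / real (Suc n))" for x
        using hat_outside[of x] by (cases "x \<in> {0..1}") auto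
    qed
    finally show ?thesis .
  qed
  have "compact (q ` {a..a+1})"
    by (intro compact_continuous_image continuous_on_subset[OF q]) auto
  then obtain B where B: "\<And>t. t \<in> {a..a+1} \<Longrightarrow> norm (q t) \<le> B"
    by (metis bounded_iff compact_imp_bounded image_eqI)
  have B0: "B \<ge> 0" using order_trans[OF norm_ge_zero B[of a]] by simp
  note [measurable] = borel_measurable_continuous_onI[OF q] borel_measurable_continuous_onI[OF continuous_hat]
  have "(\<lambda>n. LINT x:{0..1}|lborel. hat x *\<^sub>R q (a + x / real (Suc n))) \<longlonglongrightarrow> (LINT x:{0..1}|lborel. hat x *\<^sub>R q a)"
    unfolding set_lebesgue_integral_def
  proof (rule integral_dominated_convergence[of _ _ _ "\<lambda>x. indicator {0..1} x *\<^sub>R (2 * B)"])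
    show "integrable lborel (\<lambda>x::real. indicat_real {0..1} x *\<^sub>R (2 * B))"
      using set_integrable_const[of 0 1 "2 * B"] unfolding set_integrable_def .
    show "AE x in lborel. (\<lambda>i. indicat_real {0..1} x *\<^sub>R hat x *\<^sub>R q (a + x / real (Suc i))) \<longlonglongrightarrow> indicat_real {0..1} x *\<^sub>R hat x *\<^sub>R q a"
    proof (intro AE_I2 tendsto_intros)
      fix x :: real
      have "(\<lambda>i. a + x * inverse (real (Suc i))) \<longlonglongrightarrow> a + x * 0"
        by (intro tendsto_intros LIMSEQ_inverse_real_of_nat)
      then have "(\<lambda>i. a + x / real (Suc i)) \<longlonglongrightarrow> a" by (simp add: divide_inverse)
      then show "(\<lambda>i. q (a + x / real (Suc i))) \<longlonglongrightarrow> q a"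
        by (rule continuous_on_tendsto_compose[OF q]) auto
    qed
    show "AE x in lborel. norm (indicat_real {0..1} x *\<^sub>R hat x *\<^sub>R q (a + x / real (Suc i))) \<le> indicat_real {0..1} x *\<^sub>R (2 * B)" for i
    proof (intro AE_I2)
      fix x :: real
      show "norm (indicat_real {0..1} x *\<^sub>R hat x *\<^sub>R q (a + x / real (Suc i))) \<le> indicat_real {0..1} x *\<^sub>R (2 * B)"
      proof (cases "x \<in> {0..1}")
        case True
        have "x / real (Suc i) \<le> 1" "0 \<le> x / real (Suc i)" using True by (auto simp: field_simps)
        then have "norm (q (a + x / real (Suc i))) \<le> B" by (intro B) auto
        then show ?thesis using True hat_nonneg[of x] hat_le[of x] B0 by (auto intro!: mult_mono)
      qed auto
    qed
  qed measurable
  also have "(LINT x:{0..1}|lborel. hat x *\<^sub>R q a) = q a"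
    using set_integral_bounded_linear[OF bounded_linear_scaleR_left[of "q a"] borel_integrable_atLeastAtMost'[OF continuous_hat], of 0 1]
      integral_hat by simp
  finally show ?thesis unfolding eq .
qed

text \<open>Differences of two steep ramps are test functions that approximate the indicator function of \<open>{a..b}\<close>, while
  their derivatives approximate the difference of the point masses at \<open>a\<close> and \<open>b\<close>.\<close>

lemma weak_deriv_imp_primitive:
  assumes q: "continuous_on UNIV q" and g: "g \<in> L2_loc" and w: "is_weak_deriv q g"
  shows "primitive q g"
  unfolding primitive_def
proof (intro conjI allI impI g)
  fix a b :: real assume ab: "a \<le> b"
  define N where "N n = real (Suc n)" for n
  have N: "N n \<ge> 1" "N n > 0" for n by (auto simp: N_def)
  define \<phi> where "\<phi> n t = ramp (N n * (t - a)) - ramp (N n * (t - b))" for n t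
  define \<phi>' where "\<phi>' n t = N n * hat (N n * (t - a)) - N n * hat (N n * (t - b))" for n t
  have d: "(\<phi> n has_real_derivative \<phi>' n t) (at t)" for n t
    unfolding \<phi>_def[abs_def] \<phi>'_def
    by (rule DERIV_diff; rule DERIV_chain2[OF DERIV_ramp, THEN DERIV_cong]) (auto intro!: derivative_eq_intros)
  have dphi: "deriv (\<phi> n) = \<phi>' n" for n using DERIV_imp_deriv[OF d] by auto
  have cphi': "continuous_on UNIV (\<phi>' n)" for n
    unfolding \<phi>'_def[abs_def] 
    by (intro continuous_intros continuous_on_compose2[OF continuous_hat[of UNIV]]) auto
  \<comment> \<open>the ramps have length at most 1, so both have reached the value 1 beyond b + 1\<close>
  have supp: "\<phi> n t = 0" if "t \<notin> {a..b+1}" for n t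
  proof -
    have "t < a \<or> t > b + 1" using that unfolding atLeastAtMost_iff by linarith
    then consider "t < a" | "t > b + 1" by blast
    then show ?thesis
    proof cases
      case 1
      have "N n * (t - a) \<le> 0" "N n * (t - b) \<le> 0" using 1 N[of n] ab by (auto simp: mult_le_0_iff)
      then show ?thesis unfolding \<phi>_def by (simp add: ramp_low)
    next
      case 2
      have "1 * 1 \<le> N n * (t - a)" "1 * 1 \<le> N n * (t - b)" by (rule mult_mono; use 2 N[of n] ab in auto)+
      then show ?thesis unfolding \<phi>_def by (simp add: ramp_high)
    qed
  qed
  have tf: "\<phi> n \<in> test_functions" for n
  proof -
    have "closure {t. \<phi> n t \<noteq> 0} \<subseteq> {a..b+1}"
    proof (rule closure_minimal)
      show "{t. \<phi> n t \<noteq> 0} \<subseteq> {a..b+1}" using supp by blast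
    qed simp
    then have "compact (closure {t. \<phi> n t \<noteq> 0})" 
      by (metis closed_closure compact_Icc compact_Int_closed inf.absorb_iff2)
    moreover have "\<phi> n C1_differentiable_on UNIV"
      unfolding C1_differentiable_on_def using d cphi' has_real_derivative_iff_has_vector_derivative by blast
    ultimately show ?thesis by (simp add: test_functions_def)
  qed
  have eq: "(LINT t|lborel. \<phi>' n t *\<^sub>R q t) = - (LINT t|lborel. \<phi> n t *\<^sub>R g t)" for n
    using w[unfolded is_weak_deriv_def, rule_format, OF tf] by (simp add: dphi)
  have int: "integrable lborel (\<lambda>t. (N n * hat (N n * (t - c))) *\<^sub>R q t)" for n c
  proof -
    have "set_integrable lborel {c..c+1} (\<lambda>t. (N n * hat (N n * (t - c))) *\<^sub>R q t)"
      by (rule borel_integrable_atLeastAtMost')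
       (intro continuous_intros continuous_on_compose2[OF continuous_hat[of UNIV]] continuous_on_subset[OF q]; auto)
    moreover have "(\<lambda>t. (N n * hat (N n * (t - c))) *\<^sub>R q t) = (\<lambda>t. indicator {c..c+1} t *\<^sub>R ((N n * hat (N n * (t - c))) *\<^sub>R q t))"
    proof
      fix t
      show "(N n * hat (N n * (t - c))) *\<^sub>R q t = indicator {c..c+1} t *\<^sub>R ((N n * hat (N n * (t - c))) *\<^sub>R q t)"
      proof (cases "t \<in> {c..c+1}")
        case False
        then have "t < c \<or> t > c + 1" unfolding atLeastAtMost_iff by linarith
        then consider "t < c" | "t > c + 1" by blast
        then have "N n * (t - c) \<notin> {0..1}"
        proof cases
          case 1 then show ?thesis using N[of n] by (auto simp: zero_le_mult_iff)
        next
          case 2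
          have "1 * 1 < N n * (t - c)" by (rule mult_le_less_imp_less; use 2 N[of n] in auto)
          then show ?thesis by auto
        qed
        then show ?thesis by (simp add: hat_outside)
      qed simp
    qed
    ultimately show ?thesis unfolding set_integrable_def by metis
  qed
  have "(\<lambda>n. LINT t|lborel. \<phi>' n t *\<^sub>R q t) = (\<lambda>n. (LINT t|lborel. (N n * hat (N n * (t - a))) *\<^sub>R q t) - (LINT t|lborel. (N n * hat (N n * (t - b))) *\<^sub>R q t))"
    unfolding \<phi>'_def by (simp add: scaleR_diff_left Bochner_Integration.integral_diff[OF int int])
  then have lim1: "(\<lambda>n. LINT t|lborel. \<phi>' n t *\<^sub>R q t) \<longlonglongrightarrow> q a - q b"
    using tendsto_diff[OF hat_average_tendsto[OF q, of a] hat_average_tendsto[OF q, of b]]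
    by (simp add: N_def)
  have [measurable]: "ramp \<in> borel_measurable borel"
    by (rule borel_measurable_continuous_onI) (metis DERIV_ramp DERIV_continuous_on has_field_derivative_at_within)
  note [measurable] = L2_loc_measurable[OF g]
  have lim2: "(\<lambda>n. LINT t|lborel. \<phi> n t *\<^sub>R g t) \<longlonglongrightarrow> (LINT t|lborel. indicator {a..b} t *\<^sub>R g t)"
  proof (rule integral_dominated_convergence[of _ _ _ "\<lambda>t. indicator {a..b+1} t *\<^sub>R norm (g t)"])
    show "integrable lborel (\<lambda>t. indicat_real {a..b+1} t *\<^sub>R norm (g t))"
      using L2_loc_norm_set_integrable[OF g] by (simp add: set_integrable_def)
    show "AE t in lborel. norm (\<phi> i t *\<^sub>R g t) \<le> indicat_real {a..b+1} t *\<^sub>R norm (g t)" for i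
    proof (intro AE_I2)
      fix t
      have "\<bar>\<phi> i t\<bar> \<le> 1" unfolding \<phi>_def 
        using ramp_range[of "N i * (t - a)"] ramp_range[of "N i * (t - b)"] by auto
      then show "norm (\<phi> i t *\<^sub>R g t) \<le> indicat_real {a..b+1} t *\<^sub>R norm (g t)"
        by (cases "t \<in> {a..b+1}") (auto simp: supp mult_left_le_one_le)
    qed
    show "AE t in lborel. (\<lambda>i. \<phi> i t *\<^sub>R g t) \<longlonglongrightarrow> indicat_real {a..b} t *\<^sub>R g t"
    proof -
      have ra: "(\<lambda>n. ramp (N n * (t - c))) \<longlonglongrightarrow> (if t > c then 1 else 0)" for t c
      proof (cases "t > c")
        case True
        obtain m where m: "1 / (t - c) < real m" using reals_Archimedean2 by blast
        have "\<forall>\<^sub>F n in sequentially. ramp (N n * (t - c)) = 1"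
        proof (rule eventually_sequentiallyI[of m])
          fix n assume "m \<le> n"
          then have "1 / (t - c) \<le> N n" using m by (simp add: N_def)
          then have "1 \<le> N n * (t - c)" using True by (simp add: field_simps)
          then show "ramp (N n * (t - c)) = 1" by (rule ramp_high)
        qed
        then show ?thesis using True by (simp add: tendsto_eventually)
      next
        case False
        have "ramp (N n * (t - c)) = 0" for n
          by (rule ramp_low) (use False N[of n] in \<open>auto simp: mult_le_0_iff\<close>)
        then show ?thesis using False by simp
      qed
      have "(\<lambda>i. \<phi> i t *\<^sub>R g t) \<longlonglongrightarrow> indicat_real {a..b} t *\<^sub>R g t" if "t \<noteq> a" for t
      proof (intro tendsto_scaleR tendsto_const)
        have "(\<lambda>i. \<phi> i t) \<longlonglongrightarrow> (if t > a then 1 else 0) - (if t > b then 1 else 0)"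
          unfolding \<phi>_def by (intro tendsto_diff ra)
        moreover have "(if t > a then 1 else 0) - (if t > b then 1 else 0) = indicat_real {a..b} t"
          using that ab by (auto simp: indicator_def)
        ultimately show "(\<lambda>i. \<phi> i t) \<longlonglongrightarrow> indicat_real {a..b} t" by simp
      qed
      then show ?thesis using AE_lborel_singleton[of a] by (auto elim!: eventually_mono)
    qed
  qed (unfold \<phi>_def, measurable)
  have "(\<lambda>n. - (LINT t|lborel. \<phi> n t *\<^sub>R g t)) \<longlonglongrightarrow> q a - q b" using lim1 unfolding eq .
  then have "- (LINT t|lborel. indicator {a..b} t *\<^sub>R g t) = q a - q b"
    using tendsto_minus[OF lim2] LIMSEQ_unique by blast
  then show "q b - q a = (LINT t:{a..b}|lborel. g t)"
    unfolding set_lebesgue_integral_def by (metis minus_diff_eq minus_minus)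
qed

lemma H1_loc_iff: "q \<in> H1_loc \<longleftrightarrow> (\<exists>g. primitive q g)"
  unfolding H1_loc_def
  using weak_deriv_imp_primitive primitive_imp_weak_deriv primitive_continuous primitive_L2_loc by blast

lemma H1_iff: "v \<in> H1 \<longleftrightarrow> v \<in> L2 \<and> (\<exists>g\<in>L2. primitive v g)"
  unfolding H1_def
  using weak_deriv_imp_primitive primitive_imp_weak_deriv primitive_continuous L2_imp_L2_loc by blast

lemma primitive_weak_deriv: assumes "primitive q g" shows "primitive q (weak_deriv q)"
proof -
  have "weak_deriv q \<in> L2_loc \<and> is_weak_deriv q (weak_deriv q)"
    unfolding weak_deriv_def 
    by (rule someI[of "\<lambda>g. g \<in> L2_loc \<and> is_weak_deriv q g" g]) 
      (use primitive_imp_weak_deriv primitive_L2_loc assms in blast)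
  then show ?thesis using weak_deriv_imp_primitive primitive_continuous[OF assms] by blast
qed

lemma energy_primitive:
  assumes "primitive q g"
  shows "energy V q = (\<integral>\<^sup>+ t. ennreal ((norm (g t))\<^sup>2 / 2 + V (q t)) \<partial>lborel)"
  unfolding energy_def
  by (rule nn_integral_cong_AE) 
    (use primitive_unique_AE[OF primitive_weak_deriv[OF assms] assms] in eventually_elim, simp)

lemma H1_norm_primitive:
  assumes "primitive v g"
  shows "H1_norm v = sqrt ((LINT t|lborel. (norm (v t))\<^sup>2) + (LINT t|lborel. (norm (g t))\<^sup>2))"
proof -
  note [measurable] = primitive_measurable(2)[OF assms] primitive_measurable(2)[OF primitive_weak_deriv[OF assms]]
  have "(LINT t|lborel. (norm (weak_deriv v t))\<^sup>2) = (LINT t|lborel. (norm (g t))\<^sup>2)"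
  proof (rule integral_cong_AE)
    show "AE t in lborel. (norm (weak_deriv v t))\<^sup>2 = (norm (g t))\<^sup>2"
      using primitive_unique_AE[OF primitive_weak_deriv[OF assms] assms] by eventually_elim simp
  qed measurable
  then show ?thesis by (simp add: H1_norm_def)
qed

section \<open>Curves in the Sobolev space on the line\<close>

lemma eventually_in_Icc: "\<forall>\<^sub>F n in sequentially. t \<in> {-real n..real n}"
proof -
  obtain m where m: "\<bar>t\<bar> \<le> real m" using real_arch_simple by blast
  show ?thesis
  proof (rule eventually_sequentiallyI[of m])
    fix n assume "m \<le> n"
    then show "t \<in> {-real n..real n}" using m unfolding atLeastAtMost_iff by linarith
  qed
qed

lemma indicator_Icc_tendsto: "(\<lambda>n. indicat_real {- real n..real n} t *\<^sub>R f t) \<longlonglongrightarrow> (f t :: 'a::euclidean_space)"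
  by (rule tendsto_eventually) (use eventually_in_Icc[of t] in eventually_elim, simp)

lemma integral_Icc_tendsto:
  fixes f :: "real \<Rightarrow> 'a::euclidean_space"
  assumes "integrable lborel f"
  shows "(\<lambda>n. LINT t:{-real n..real n}|lborel. f t) \<longlonglongrightarrow> (LINT t|lborel. f t)"
  unfolding set_lebesgue_integral_def
proof (rule integral_dominated_convergence[of _ _ _ "\<lambda>t. norm (f t)"])
  show "AE t in lborel. (\<lambda>i. indicat_real {- real i..real i} t *\<^sub>R f t) \<longlonglongrightarrow> f t"
    by (intro AE_I2 indicator_Icc_tendsto)
qed (use assms in \<open>auto simp: indicator_def\<close>)

lemma integrable_of_bounded_Icc:
  fixes f :: "real \<Rightarrow> real"
  assumes [measurable]: "f \<in> borel_measurable borel" and nn: "\<And>t. 0 \<le> f t"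
    and i: "\<And>n. set_integrable lborel {-real n..real n} f"
    and C: "\<And>n. (LINT t:{-real n..real n}|lborel. f t) \<le> C"
  shows "integrable lborel f" "(LINT t|lborel. f t) \<le> C"
proof -
  define F where "F n t = indicat_real {-real n..real n} t *\<^sub>R f t" for n t
  have Fi: "integrable lborel (F n)" for n using i[of n] by (simp add: F_def[abs_def] set_integrable_def)
  have Fm: "F m t \<le> F n t" if "m \<le> n" for m n t
  proof -
    have "real m \<le> real n" using that by simp
    then show ?thesis using nn[of t] by (auto simp: F_def indicator_def)
  qed
  have Fl: "(\<lambda>n. F n t) \<longlonglongrightarrow> f t" for t unfolding F_def by (rule indicator_Icc_tendsto)
  have inc: "incseq (\<lambda>n. integral\<^sup>L lborel (F n))"
    by (intro incseq_SucI integral_mono Fi Fm) simp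
  have bd: "integral\<^sup>L lborel (F n) \<le> C" for n
    using C[of n] by (simp add: F_def[abs_def] set_lebesgue_integral_def)
  obtain L where L: "(\<lambda>n. integral\<^sup>L lborel (F n)) \<longlonglongrightarrow> L" "\<forall>i. integral\<^sup>L lborel (F i) \<le> L"
    using incseq_convergent[OF inc] bd by blast
  have 1: "AE t in lborel. mono (\<lambda>n. F n t)" by (intro AE_I2 monoI Fm)
  have 2: "AE t in lborel. (\<lambda>n. F n t) \<longlonglongrightarrow> f t" by (intro AE_I2 Fl)
  have 3: "f \<in> borel_measurable lborel" by simp
  show "integrable lborel f" by (rule integrable_monotone_convergence[OF Fi 1 2 L(1) 3])
  have "integral\<^sup>L lborel f = L" by (rule integral_monotone_convergence[OF Fi 1 2 L(1) 3])
  moreover have "L \<le> C" by (rule LIMSEQ_le_const2[OF L(1)]) (use bd in auto)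
  ultimately show "(LINT t|lborel. f t) \<le> C" by simp
qed

text \<open>The norm at \<open>T\<close> exceeds the mean of the norm over \<open>{T..T+1}\<close> at most by the integral of the norm of the derivative; both
  integrals tend to zero.\<close>

lemma primitive_vanishes_at_top:
  fixes f :: "real \<Rightarrow> 'a::euclidean_space"
  assumes p: "primitive f h" and "integrable lborel f" "integrable lborel h"
  shows "(f \<longlongrightarrow> 0) at_top"
proof (rule Lim_null_comparison)
  have i: "integrable lborel (\<lambda>t. norm (f t) + norm (h t))" using assms by simp
  note si = integrable_set_integrable[OF i]
  have nh: "set_integrable lborel {a..b} (\<lambda>t. norm (h t))" and nf: "set_integrable lborel {a..b} (\<lambda>t. norm (f t))" for a b
    using integrable_set_integrable[of "\<lambda>t. norm (h t)"] integrable_set_integrable[of "\<lambda>t. norm (f t)"] assms by auto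
  show "\<forall>\<^sub>F T in at_top. norm (f T) \<le> (LINT t:{T..T+1}|lborel. norm (f t) + norm (h t))"
  proof (intro always_eventually allI)
    fix T
    define c where "c = (LINT t:{T..T+1}|lborel. norm (h t))"
    have bd: "norm (f T) \<le> norm (f r) + c" if r: "r \<in> {T..T+1}" for r
    proof -
      have "norm (f r - f T) \<le> (LINT t:{T..r}|lborel. norm (h t))"
        using primitive_dist_le[OF p, of T r] r by simp
      also have "\<dots> \<le> c"
      proof -
        have "c = (LINT t:{T..r}|lborel. norm (h t)) + (LINT t:{r..T+1}|lborel. norm (h t))"
          unfolding c_def by (rule set_integral_combine) (use r nh in auto)
        moreover have "0 \<le> (LINT t:{r..T+1}|lborel. norm (h t))" by (rule set_integral_nonneg') simp
        ultimately show ?thesis by simp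
      qed
      finally show ?thesis using norm_triangle_ineq4[of "f r" "f r - f T"] by simp
    qed
    have "norm (f T) = (LINT t:{T..T+1}|lborel. norm (f T))" using set_integral_constant[of T "T+1" "norm (f T)"] by simp
    also have "\<dots> \<le> (LINT t:{T..T+1}|lborel. norm (f t) + c)"
      by (rule set_integral_mono) (use bd in \<open>auto intro!: set_integral_add nf set_integrable_const\<close>)
    also have "\<dots> = (LINT t:{T..T+1}|lborel. norm (f t)) + (LINT t:{T..T+1}|lborel. c)"
      by (rule set_integral_add(2)[OF nf set_integrable_const])
    also have "\<dots> = (LINT t:{T..T+1}|lborel. norm (f t)) + c" using set_integral_constant[of T "T+1" c] by simp
    also have "\<dots> = (LINT t:{T..T+1}|lborel. norm (f t) + norm (h t))"
      unfolding c_def by (rule set_integral_add(2)[OF nf nh, symmetric])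
    finally show "norm (f T) \<le> (LINT t:{T..T+1}|lborel. norm (f t) + norm (h t))" .
  qed
  have "((\<lambda>T. LINT t|lborel. indicator {T..T+1} t *\<^sub>R (norm (f t) + norm (h t))) \<longlongrightarrow> (LINT t|(lborel :: real measure). (0::real))) at_top"
  proof (rule integral_dominated_convergence_at_top[where w="\<lambda>t. norm (f t) + norm (h t)" and f="\<lambda>_. 0" and M=lborel])
    show "AE t in lborel. ((\<lambda>T. indicat_real {T..T+1} t *\<^sub>R (norm (f t) + norm (h t))) \<longlongrightarrow> 0) at_top"
    proof (intro AE_I2 tendsto_eventually)
      fix t :: real
      show "\<forall>\<^sub>F T in at_top. indicat_real {T..T+1} t *\<^sub>R (norm (f t) + norm (h t)) = 0"
        using eventually_gt_at_top[of t] by eventually_elim simp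
    qed
    show "\<forall>\<^sub>F T in at_top. AE t in lborel. norm (indicat_real {T..T+1} t *\<^sub>R (norm (f t) + norm (h t))) \<le> norm (f t) + norm (h t)"
      by (intro always_eventually allI AE_I2) (simp add: indicator_def)
  qed (use i primitive_measurable[OF p] in auto)
  then show "((\<lambda>T. LINT t:{T..T+1}|lborel. norm (f t) + norm (h t)) \<longlongrightarrow> 0) at_top"
    by (simp add: set_lebesgue_integral_def)
qed

lemma primitive_vanishes_at_bot:
  fixes f :: "real \<Rightarrow> 'a::euclidean_space"
  assumes p: "primitive f h" and "integrable lborel f" "integrable lborel h"
  shows "(f \<longlongrightarrow> 0) at_bot"
proof -
  have "((\<lambda>t. f (- t)) \<longlongrightarrow> 0) at_top"
  proof (rule primitive_vanishes_at_top[OF primitive_reflect[OF p]])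
    show "integrable lborel (\<lambda>t. f (- t))" "integrable lborel (\<lambda>t. - h (- t))"
      using integrable_lborel_affine[OF assms(2), of "-1" 0] integrable_lborel_affine[OF assms(3), of "-1" 0] by auto
  qed
  then show ?thesis by (simp add: filterlim_at_bot_mirror)
qed

lemma primitive_inner:
  assumes "primitive v g" "primitive w h"
  shows "primitive (\<lambda>t. v t \<bullet> w t) (\<lambda>t. g t \<bullet> w t + v t \<bullet> h t)"
  by (rule primitive_product[OF bounded_bilinear_inner assms])

lemma primitive_norm_sq:
  assumes "primitive v g" shows "primitive (\<lambda>t. (norm (v t))\<^sup>2) (\<lambda>t. 2 * (v t \<bullet> g t))"
  using primitive_inner[OF assms assms] by (simp add: power2_norm_eq_inner inner_commute)

text \<open>The square of the norm and its derivative \<open>2 (v \<bullet> v')\<close> are integrable.\<close>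

lemma primitive_L2_vanishes:
  assumes "primitive v g" "v \<in> L2" "g \<in> L2"
  shows "(v \<longlongrightarrow> 0) at_top" "(v \<longlongrightarrow> 0) at_bot"
proof -
  note i = L2_integrable[OF assms(2)] 
  have i2: "integrable lborel (\<lambda>t. 2 * (v t \<bullet> g t))" using L2_inner_integrable[OF assms(2,3)] by simp
  have "((\<lambda>t. (norm (v t))\<^sup>2) \<longlongrightarrow> 0) at_top" "((\<lambda>t. (norm (v t))\<^sup>2) \<longlongrightarrow> 0) at_bot"
    using primitive_vanishes_at_top[OF primitive_norm_sq[OF assms(1)] i i2]
      primitive_vanishes_at_bot[OF primitive_norm_sq[OF assms(1)] i i2] by auto
  from this[THEN tendsto_real_sqrt] show "(v \<longlongrightarrow> 0) at_top" "(v \<longlongrightarrow> 0) at_bot"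
    by (auto simp: tendsto_norm_zero_iff)
qed

lemma tendsto_real_at_top: "(f \<longlongrightarrow> l) at_top \<Longrightarrow> (\<lambda>n. f (real n)) \<longlonglongrightarrow> l"
  by (rule filterlim_compose[OF _ filterlim_real_sequentially])

lemma tendsto_real_at_bot: "(f \<longlongrightarrow> l) at_bot \<Longrightarrow> (\<lambda>n. f (- real n)) \<longlonglongrightarrow> l"
  using tendsto_real_at_top[of "\<lambda>t. f (- t)"] by (simp add: filterlim_at_bot_mirror)

lemma integration_by_parts:
  assumes v: "primitive v g" "v \<in> L2" "g \<in> L2" and w: "primitive w h" "w \<in> L2" "h \<in> L2"
  shows "(LINT t|lborel. g t \<bullet> w t) = - (LINT t|lborel. v t \<bullet> h t)"
proof -
  have i: "integrable lborel (\<lambda>t. g t \<bullet> w t)" "integrable lborel (\<lambda>t. v t \<bullet> h t)"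
    by (intro L2_inner_integrable v w)+
  have "(\<lambda>n. LINT t:{-real n..real n}|lborel. g t \<bullet> w t + v t \<bullet> h t) \<longlonglongrightarrow> (LINT t|lborel. g t \<bullet> w t + v t \<bullet> h t)"
    by (rule integral_Icc_tendsto) (intro Bochner_Integration.integrable_add i)
  moreover have "(LINT t:{-real n..real n}|lborel. g t \<bullet> w t + v t \<bullet> h t) = v n \<bullet> w n - v (-real n) \<bullet> w (-real n)" for n
    by (rule primitiveD[OF primitive_inner[OF v(1) w(1)], symmetric]) simp
  moreover have "(\<lambda>n. v n \<bullet> w n - v (-real n) \<bullet> w (-real n)) \<longlonglongrightarrow> 0"
    using tendsto_diff[OF 
         tendsto_inner[OF tendsto_real_at_top[OF primitive_L2_vanishes(1)[OF v]] tendsto_real_at_top[OF primitive_L2_vanishes(1)[OF w]]]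
         tendsto_inner[OF tendsto_real_at_bot[OF primitive_L2_vanishes(2)[OF v]] tendsto_real_at_bot[OF primitive_L2_vanishes(2)[OF w]]]] by simp
  ultimately have "(LINT t|lborel. g t \<bullet> w t + v t \<bullet> h t) = 0" 
    using LIMSEQ_unique by fastforce
  then show ?thesis using i by simp
qed

text \<open>One integrates the derivative of \<open>|v|\<^sup>2\<close>, which is at most \<open>|v|\<^sup>2 + |v'|\<^sup>2\<close>, from minus infinity.\<close>

lemma sup_bound:
  assumes v: "primitive v g" "v \<in> L2" "g \<in> L2"
  shows "(norm (v t))\<^sup>2 \<le> (LINT t|lborel. (norm (v t))\<^sup>2) + (LINT t|lborel. (norm (g t))\<^sup>2)"
proof -
  define C where "C = (LINT t|lborel. (norm (v t))\<^sup>2) + (LINT t|lborel. (norm (g t))\<^sup>2)"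
  have i: "integrable lborel (\<lambda>t. (norm (v t))\<^sup>2 + (norm (g t))\<^sup>2)" using v(2,3)[THEN L2_integrable] by simp
  have C: "C = (LINT t|lborel. (norm (v t))\<^sup>2 + (norm (g t))\<^sup>2)" 
    unfolding C_def using v(2,3)[THEN L2_integrable] by simp
  have i2: "integrable lborel (\<lambda>t. 2 * (v t \<bullet> g t))" using L2_inner_integrable[OF v(2,3)] by simp
  have le: "(norm (v t))\<^sup>2 - (norm (v s))\<^sup>2 \<le> C" if "s \<le> t" for s
  proof -
    have "(norm (v t))\<^sup>2 - (norm (v s))\<^sup>2 = (LINT r:{s..t}|lborel. 2 * (v r \<bullet> g r))"
      by (rule primitiveD[OF primitive_norm_sq[OF v(1)] that])
    also have "\<dots> \<le> (LINT r:{s..t}|lborel. (norm (v r))\<^sup>2 + (norm (g r))\<^sup>2)"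
    proof (rule set_integral_mono)
      show "2 * (v r \<bullet> g r) \<le> (norm (v r))\<^sup>2 + (norm (g r))\<^sup>2" for r
        using inner_le_sq[of "v r" "g r"] by (auto simp: abs_le_iff)
    qed (use integrable_set_integrable[OF i] integrable_set_integrable[OF i2] in auto)
    also have "\<dots> \<le> C" unfolding C by (rule set_integral_le_integral[OF i]) auto
    finally show ?thesis .
  qed
  have "((\<lambda>s. (norm (v t))\<^sup>2 - (norm (v s))\<^sup>2) \<longlongrightarrow> (norm (v t))\<^sup>2 - (norm (0::'a))\<^sup>2) at_bot"
    by (intro tendsto_intros primitive_L2_vanishes[OF v])
  then have "(norm (v t))\<^sup>2 - (norm (0::'a))\<^sup>2 \<le> C"
    by (rule tendsto_upperbound) (use le in \<open>auto intro: eventually_mono[OF eventually_le_at_bot[of t]]\<close>)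
  then show ?thesis by (simp add: C_def)
qed

section \<open>The resolvent of the derivative\<close>

text \<open>The solution of \<open>y' + y = f\<close> that stays bounded at minus infinity.\<close>

definition resolvent :: "(real \<Rightarrow> 'a::euclidean_space) \<Rightarrow> real \<Rightarrow> 'a" where
  "resolvent f t = exp (- t) *\<^sub>R (LINT r:{..t}|lborel. exp r *\<^sub>R f r)"

lemma exp_set_integrable: 
  "set_integrable lborel {..t} (\<lambda>r::real. exp r)" "(LINT r:{..t}|lborel. exp r) \<le> exp t"
proof -
  have FTC: "(LINT r:{a..b}|lborel. exp r) = exp b - exp a" if "a \<le> b" for a b :: real
    unfolding set_lebesgue_integral_def
    by (rule integral_FTC_atLeastAtMost[OF that]) (auto intro!: derivative_eq_intros continuous_intros
      simp: has_real_derivative_iff_has_vector_derivative[symmetric])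
  have si: "set_integrable lborel {a..b} (\<lambda>r::real. exp r)" for a b
    by (rule borel_integrable_atLeastAtMost') (intro continuous_intros)
  have e: "indicat_real {-real n..real n} r *\<^sub>R (indicat_real {..t} r * exp r) = indicat_real {-real n..min (real n) t} r *\<^sub>R exp r" for n r
    by (auto simp: indicator_def)
  have s1: "set_integrable lborel {-real n..real n} (\<lambda>r. indicat_real {..t} r * exp r)" for n
    using si[of "-real n" "min (real n) t"] unfolding set_integrable_def e .
  have s2: "(LINT r:{-real n..real n}|lborel. indicat_real {..t} r * exp r) \<le> exp t" for n
  proof -
    have "(LINT r:{-real n..real n}|lborel. indicat_real {..t} r * exp r) = (LINT r:{-real n..min (real n) t}|lborel. exp r)"
      unfolding set_lebesgue_integral_def e ..
    also have "\<dots> \<le> exp t"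
    proof (cases "-real n \<le> min (real n) t")
      case True
      have "exp (min (real n) t) \<le> exp t" by simp
      then show ?thesis unfolding FTC[OF True] using exp_ge_zero[of "-real n"] by linarith
    qed (simp add: set_lebesgue_integral_def)
    finally show ?thesis .
  qed
  have "integrable lborel (\<lambda>r. indicat_real {..t} r * exp r)" "(LINT r|lborel. indicat_real {..t} r * exp r) \<le> exp t"
    by (rule integrable_of_bounded_Icc[OF _ _ s1 s2]; simp)+
  then show "set_integrable lborel {..t} (\<lambda>r::real. exp r)" "(LINT r:{..t}|lborel. exp r) \<le> exp t"
    by (auto simp: set_integrable_def set_lebesgue_integral_def)
qed

context
  fixes f :: "real \<Rightarrow> 'a::euclidean_space"
  assumes f: "f \<in> L2"
begin

lemma resolvent_integrand:
  "set_integrable lborel {..t} (\<lambda>r. exp r *\<^sub>R f r)"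
  "(LINT r:{..t}|lborel. norm (exp r *\<^sub>R f r)) \<le> exp t * (1 + (LINT r|lborel. (norm (f r))\<^sup>2)) / 2"
proof -
  note [measurable] = L2_measurable[OF f]
  have s1: "set_integrable lborel {..t} (\<lambda>r. exp r + exp t * (norm (f r))\<^sup>2)"
    using integrable_set_integrable[OF L2_integrable[OF f]] by (intro set_integral_add exp_set_integrable set_integrable_mult_right) auto
  have s2: "set_integrable lborel {..t} (\<lambda>r. (exp r + exp t * (norm (f r))\<^sup>2) / 2)"
    using s1 by simp
  have le: "norm (exp r *\<^sub>R f r) \<le> (exp r + exp t * (norm (f r))\<^sup>2) / 2" if "r \<in> {..t}" for r
  proof -
    have "exp r * norm (f r) \<le> exp r * ((1 + (norm (f r))\<^sup>2) / 2)"
      by (intro mult_left_mono le_sq_half) simp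
    also have "\<dots> = (exp r + exp r * (norm (f r))\<^sup>2) / 2" by (simp add: field_simps)
    also have "\<dots> \<le> (exp r + exp t * (norm (f r))\<^sup>2) / 2"
      using that by (intro divide_right_mono add_left_mono mult_right_mono) auto
    finally show ?thesis by simp
  qed
  show 1: "set_integrable lborel {..t} (\<lambda>r. exp r *\<^sub>R f r)"
  proof (rule set_integrable_bound[OF s2])
    show "set_borel_measurable lborel {..t} (\<lambda>r. exp r *\<^sub>R f r)"
      unfolding set_borel_measurable_def by measurable
    show "AE x in lborel. x \<in> {..t} \<longrightarrow> norm (exp x *\<^sub>R f x) \<le> norm ((exp x + exp t * (norm (f x))\<^sup>2) / 2)"
      using le by (intro AE_I2 impI order_trans[OF le]) auto
  qed
  have "(LINT r:{..t}|lborel. norm (exp r *\<^sub>R f r)) \<le> (LINT r:{..t}|lborel. (exp r + exp t * (norm (f r))\<^sup>2) / 2)"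
    by (rule set_integral_mono[OF _ s2 le]) (use integrable_norm[OF 1[unfolded set_integrable_def]] in \<open>auto simp: set_integrable_def mult.assoc\<close>)
  also have "\<dots> = (LINT r:{..t}|lborel. exp r + exp t * (norm (f r))\<^sup>2) / 2" by (rule set_integral_divide_zero)
  also have "(LINT r:{..t}|lborel. exp r + exp t * (norm (f r))\<^sup>2) = 
      (LINT r:{..t}|lborel. exp r) + (LINT r:{..t}|lborel. exp t * (norm (f r))\<^sup>2)"
    using integrable_set_integrable[OF L2_integrable[OF f]] 
    by (intro set_integral_add exp_set_integrable set_integrable_mult_right) auto
  also have "\<dots> \<le> exp t + exp t * (LINT r|lborel. (norm (f r))\<^sup>2)"
    using exp_set_integrable(2)[of t] set_integral_le_integral[OF L2_integrable[OF f], of "{..t}"] 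
    by (simp add: add_mono mult_left_mono)
  finally show "(LINT r:{..t}|lborel. norm (exp r *\<^sub>R f r)) \<le> exp t * (1 + (LINT r|lborel. (norm (f r))\<^sup>2)) / 2"
    by (simp add: algebra_simps)
qed

lemma primitive_resolvent: "primitive (resolvent f) (\<lambda>t. f t - resolvent f t)"
proof -
  define Y where "Y t = (LINT r:{..t}|lborel. exp r *\<^sub>R f r)" for t
  note [measurable] = L2_measurable[OF f]
  have cexp: "continuous_on UNIV (\<lambda>r::real. exp r)" by (intro continuous_intros)
  have l: "(\<lambda>r. exp r *\<^sub>R f r) \<in> L2_loc"
    by (rule L2_loc_prod[OF _ L2_imp_L2_loc[OF f] cexp, of _ 1]) auto
  have "Y b - Y a = (LINT r:{a..b}|lborel. exp r *\<^sub>R f r)" if "a \<le> b" for a b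
  proof -
    have "Y b = (LINT r:{..a} \<union> {a..b}|lborel. exp r *\<^sub>R f r)"
      unfolding Y_def using that by (intro arg_cong[of _ _ "\<lambda>A. set_lebesgue_integral lborel A (\<lambda>r. exp r *\<^sub>R f r)"]) auto
    also have "\<dots> = Y a + (LINT r:{a..b}|lborel. exp r *\<^sub>R f r)"
      unfolding Y_def
    proof (rule set_integral_Un_AE)
      show "AE x in lborel. \<not> (x \<in> {..a} \<and> x \<in> {a..b})"
        using AE_lborel_singleton[of a] by eventually_elim auto
    qed (use resolvent_integrand L2_loc_set_integrable[OF l] in auto)
    finally show ?thesis by simp
  qed
  then have pY: "primitive Y (\<lambda>r. exp r *\<^sub>R f r)" using l by (simp add: primitive_def)
  have pe: "primitive (\<lambda>t::real. exp (- t)) (\<lambda>t. - exp (- t))"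
    by (rule primitive_C1) (auto intro!: derivative_eq_intros continuous_intros simp: has_real_derivative_iff_has_vector_derivative[symmetric])
  have "primitive (\<lambda>t. exp (- t) *\<^sub>R Y t) (\<lambda>t. (- exp (- t)) *\<^sub>R Y t + exp (- t) *\<^sub>R exp t *\<^sub>R f t)"
    by (rule primitive_product[OF bounded_bilinear_scaleR pe pY])
  moreover have "(\<lambda>t. (- exp (- t)) *\<^sub>R Y t + exp (- t) *\<^sub>R exp t *\<^sub>R f t) = (\<lambda>t. f t - resolvent f t)"
    by (auto simp: fun_eq_iff resolvent_def Y_def exp_minus)
  ultimately show ?thesis by (simp add: resolvent_def[abs_def] Y_def)
qed

lemma resolvent_bounded: "norm (resolvent f t) \<le> (1 + (LINT r|lborel. (norm (f r))\<^sup>2)) / 2"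
proof -
  have "norm (resolvent f t) \<le> exp (- t) * (LINT r:{..t}|lborel. norm (exp r *\<^sub>R f r))"
    unfolding resolvent_def using set_integral_norm_le[OF resolvent_integrand(1)[of t]] by simp
  also have "\<dots> \<le> exp (- t) * (exp t * (1 + (LINT r|lborel. (norm (f r))\<^sup>2)) / 2)"
    by (intro mult_left_mono resolvent_integrand) simp
  also have "\<dots> = (1 + (LINT r|lborel. (norm (f r))\<^sup>2)) / 2" by (simp add: exp_minus)
  finally show ?thesis .
qed

end

text \<open>Testing \<open>y' + y = f\<close> with \<open>f\<close> itself: the cross term is the derivative of \<open>|y|\<^sup>2\<close>.\<close>

lemma first_order_identity:
  fixes y f :: "'a::euclidean_space"
  shows "(norm (y + (f - y)))\<^sup>2 = ((norm y)\<^sup>2 + (norm (f - y))\<^sup>2) + 2 * (y \<bullet> (f - y))"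
  by (simp add: power2_norm_eq_inner algebra_simps inner_commute)

text \<open>Integrating \<open>first_order_identity\<close> over a bounded interval, the cross term contributes the boundary values of
  \<open>|y|\<^sup>2\<close>, which are bounded by \<open>resolvent_bounded\<close>.\<close>

lemma resolvent_L2:
  fixes f :: "real \<Rightarrow> 'a::euclidean_space"
  assumes f: "f \<in> L2"
  shows "resolvent f \<in> L2"
proof (rule L2I)
  let ?y = "resolvent f"
  note p = primitive_resolvent[OF f]
  note [measurable] = primitive_measurable[OF p] L2_measurable[OF f]
  show "?y \<in> borel_measurable borel" by measurable
  define B where "B = (1 + (LINT r|lborel. (norm (f r))\<^sup>2)) / 2"
  have B: "(norm (?y t))\<^sup>2 \<le> B\<^sup>2" for t
    using resolvent_bounded[OF f, of t] by (intro power_mono) (auto simp: B_def)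
  note si = L2_loc_sq_set_integrable[OF L2_loc_continuous[OF primitive_continuous[OF p]]]
    L2_loc_sq_set_integrable[OF primitive_L2_loc[OF p]]
    integrable_set_integrable[OF L2_integrable[OF f], OF borel_closed[OF closed_atLeastAtMost]]
  note sp = primitive_set_integrable[OF primitive_norm_sq[OF p]]
  show "integrable lborel (\<lambda>t. (norm (?y t))\<^sup>2)"
  proof (rule integrable_of_bounded_Icc(1))
    fix n
    let ?I = "{-real n..real n}"
    have "(LINT t:?I|lborel. (norm (f t))\<^sup>2) = (LINT t:?I|lborel. ((norm (?y t))\<^sup>2 + (norm (f t - ?y t))\<^sup>2) + 2 * (?y t \<bullet> (f t - ?y t)))"
      by (rule set_lebesgue_integral_cong) (use first_order_identity[of "?y _" "f _"] in auto)
    also have "\<dots> = (LINT t:?I|lborel. (norm (?y t))\<^sup>2) + (LINT t:?I|lborel. (norm (f t - ?y t))\<^sup>2) + (LINT t:?I|lborel. 2 * (?y t \<bullet> (f t - ?y t)))"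
      using si sp by (simp only: set_integral_add)
    also have "(LINT t:?I|lborel. 2 * (?y t \<bullet> (f t - ?y t))) = (norm (?y n))\<^sup>2 - (norm (?y (- real n)))\<^sup>2"
      using primitiveD[OF primitive_norm_sq[OF p], of "-real n" "real n"] by simp
    finally have "(LINT t:?I|lborel. (norm (?y t))\<^sup>2) = (LINT t:?I|lborel. (norm (f t))\<^sup>2) 
       - (LINT t:?I|lborel. (norm (f t - ?y t))\<^sup>2) - ((norm (?y n))\<^sup>2 - (norm (?y (- real n)))\<^sup>2)" by simp
    moreover have "0 \<le> (LINT t:?I|lborel. (norm (f t - ?y t))\<^sup>2)" by (rule set_integral_nonneg') simp
    moreover have "(LINT t:?I|lborel. (norm (f t))\<^sup>2) \<le> (LINT t|lborel. (norm (f t))\<^sup>2)"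
      by (rule set_integral_le_integral[OF L2_integrable[OF f]]) auto
    moreover have "0 \<le> (norm (?y n))\<^sup>2" by simp
    ultimately show "(LINT t:?I|lborel. (norm (?y t))\<^sup>2) \<le> (LINT t|lborel. (norm (f t))\<^sup>2) + B\<^sup>2"
      using B[of "-real n"] by linarith
  qed (use si in auto)
qed

text \<open>The boundary terms vanish at infinity, so \<open>f \<mapsto> y\<close> is an isometry from \<open>L2\<close> into the Sobolev space.\<close>

lemma first_order_energy:
  fixes f y :: "real \<Rightarrow> 'a::euclidean_space"
  assumes f: "f \<in> L2" and y: "y \<in> L2" and p: "primitive y (\<lambda>t. f t - y t)"
  shows "(LINT t|lborel. (norm (y t))\<^sup>2) + (LINT t|lborel. (norm (f t - y t))\<^sup>2) = (LINT t|lborel. (norm (f t))\<^sup>2)"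
proof -
  have d: "(\<lambda>t. f t - y t) \<in> L2" by (rule L2_diff[OF f y])
  have 0: "(LINT t|lborel. y t \<bullet> (f t - y t)) = 0"
    using integration_by_parts[OF p y d p y d] by (simp add: inner_commute)
  have "(LINT t|lborel. (norm (f t))\<^sup>2) = (LINT t|lborel. ((norm (y t))\<^sup>2 + (norm (f t - y t))\<^sup>2) + 2 * (y t \<bullet> (f t - y t)))"
    by (rule Bochner_Integration.integral_cong) (use first_order_identity[of "y _" "f _"] in auto)
  also have "\<dots> = (LINT t|lborel. (norm (y t))\<^sup>2) + (LINT t|lborel. (norm (f t - y t))\<^sup>2)"
    using L2_integrable[OF y] L2_integrable[OF d] L2_inner_integrable[OF y d] 0 by simp
  finally show ?thesis by simp
qed

text \<open>The solution of \<open>w - w' = f\<close>, obtained from \<open>resolvent\<close> by reversing time.\<close>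

definition coresolvent :: "(real \<Rightarrow> 'a::euclidean_space) \<Rightarrow> real \<Rightarrow> 'a" where
  "coresolvent f t = resolvent (\<lambda>r. f (- r)) (- t)"

lemma coresolvent_L2: "f \<in> L2 \<Longrightarrow> coresolvent f \<in> L2"
  unfolding coresolvent_def[abs_def] by (intro L2_reflect resolvent_L2)

lemma primitive_coresolvent:
  assumes "f \<in> L2" shows "primitive (coresolvent f) (\<lambda>t. coresolvent f t - f t)"
  using primitive_reflect[OF primitive_resolvent[OF L2_reflect[OF assms]]]
  by (simp add: coresolvent_def[abs_def])

lemma backward_energy:
  fixes f w :: "real \<Rightarrow> 'a::euclidean_space"
  assumes f: "f \<in> L2" and w: "w \<in> L2" and p: "primitive w (\<lambda>t. w t - f t)"
  shows "(LINT t|lborel. (norm (w t))\<^sup>2) + (LINT t|lborel. (norm (w t - f t))\<^sup>2) = (LINT t|lborel. (norm (f t))\<^sup>2)"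
proof -
  have "primitive (\<lambda>t. w (- t)) (\<lambda>t. f (- t) - w (- t))"
    using primitive_reflect[OF p] by simp
  from first_order_energy[OF L2_reflect[OF f] L2_reflect[OF w] this]
  show ?thesis 
    using integral_reflect[of "\<lambda>t. (norm (w t))\<^sup>2"] integral_reflect[of "\<lambda>t. (norm (f t))\<^sup>2"] 
      integral_reflect[of "\<lambda>t. (norm (w t - f t))\<^sup>2"] by (simp add: norm_minus_commute)
qed

section \<open>Absolute values of primitives\<close>

text \<open>The chain rule for pointwise limits of smooth functions with uniformly bounded derivatives: dominated
  convergence passes to the limit in the integral. The limit of the derivatives may be discontinuous.\<close>

lemma primitive_chain_limit:
  fixes f :: "real \<Rightarrow> real" and \<phi> \<phi>' :: "nat \<Rightarrow> real \<Rightarrow> real"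
  assumes p: "primitive f F" and d: "\<And>n x. (\<phi> n has_real_derivative \<phi>' n x) (at x)"
    and c: "\<And>n. continuous_on UNIV (\<phi>' n)" and bd: "\<And>n x. \<bar>\<phi>' n x\<bar> \<le> 1"
    and lim: "\<And>x. (\<lambda>n. \<phi> n x) \<longlonglongrightarrow> \<Phi> x" and lim': "\<And>x. (\<lambda>n. \<phi>' n x) \<longlonglongrightarrow> \<Psi> x"
  shows "primitive (\<lambda>t. \<Phi> (f t)) (\<lambda>t. \<Psi> (f t) * F t)"
proof -
  have [measurable]: "\<phi>' n \<in> borel_measurable borel" for n by (rule borel_measurable_continuous_onI[OF c])
  have [measurable]: "\<Psi> \<in> borel_measurable borel" by (rule borel_measurable_LIMSEQ_metric[OF _ lim']) measurable
  note [measurable] = primitive_measurable[OF p]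
  have le1: "\<bar>\<Psi> x\<bar> \<le> 1" for x by (rule LIMSEQ_le_const2[OF tendsto_rabs[OF lim']]) (use bd in auto)
  have dom: "norm (s * F t) \<le> norm (F t)" if "\<bar>s\<bar> \<le> 1" for s t
    using that by (simp add: abs_mult mult_left_le_one_le)
  have l: "(\<lambda>t. \<Psi> (f t) * F t) \<in> L2_loc"
  proof (rule L2_loc_prod[OF _ primitive_L2_loc[OF p]])
    show "norm (\<Psi> (f t) * F t) \<le> 1 * norm (F t) * norm (1::real)" for t using dom[OF le1] by simp
    show "(\<lambda>t. \<Psi> (f t) * F t) \<in> borel_measurable borel" by measurable
    show "continuous_on UNIV (\<lambda>_::real. 1::real)" by (rule continuous_on_const)
  qed
  have "\<Phi> (f b) - \<Phi> (f a) = (LINT t:{a..b}|lborel. \<Psi> (f t) * F t)" if ab: "a \<le> b" for a b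
  proof (rule LIMSEQ_unique)
    show "(\<lambda>n. \<phi> n (f b) - \<phi> n (f a)) \<longlonglongrightarrow> \<Phi> (f b) - \<Phi> (f a)" by (intro tendsto_diff lim)
    have "(\<lambda>n. LINT t:{a..b}|lborel. \<phi>' n (f t) * F t) \<longlonglongrightarrow> (LINT t:{a..b}|lborel. \<Psi> (f t) * F t)"
      unfolding set_lebesgue_integral_def
    proof (rule integral_dominated_convergence[of _ _ _ "\<lambda>t. indicat_real {a..b} t *\<^sub>R norm (F t)"])
      show "integrable lborel (\<lambda>t. indicat_real {a..b} t *\<^sub>R norm (F t))"
        using L2_loc_norm_set_integrable[OF primitive_L2_loc[OF p]] by (simp add: set_integrable_def)
      show "AE t in lborel. norm (indicat_real {a..b} t *\<^sub>R (\<phi>' n (f t) * F t)) \<le> indicat_real {a..b} t *\<^sub>R norm (F t)" for n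
        using dom[OF bd] by (intro AE_I2) (simp add: indicator_def)
      show "AE t in lborel. (\<lambda>n. indicat_real {a..b} t *\<^sub>R (\<phi>' n (f t) * F t)) \<longlonglongrightarrow> indicat_real {a..b} t *\<^sub>R (\<Psi> (f t) * F t)"
        by (intro AE_I2 tendsto_intros lim')
    qed measurable
    then show "(\<lambda>n. \<phi> n (f b) - \<phi> n (f a)) \<longlonglongrightarrow> (LINT t:{a..b}|lborel. \<Psi> (f t) * F t)"
      by (simp add: primitiveD[OF primitive_chain[OF p d c] ab])
  qed
  then show ?thesis using l by (simp add: primitive_def)
qed

lemma inverse_Suc_tendsto: "(\<lambda>n. 1 / real (Suc n)) \<longlonglongrightarrow> 0"
  using LIMSEQ_inverse_real_of_nat by (simp add: inverse_eq_divide)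

text \<open>The absolute value is the limit of the smooth functions \<open>sqrt (x\<^sup>2 + e\<^sup>2)\<close>.\<close>

lemma primitive_abs:
  fixes f :: "real \<Rightarrow> real"
  assumes p: "primitive f F" shows "primitive (\<lambda>t. \<bar>f t\<bar>) (\<lambda>t. sgn (f t) * F t)"
proof -
  define e where "e n = 1 / real (Suc n)" for n
  define \<phi> where "\<phi> n x = sqrt (x\<^sup>2 + (e n)\<^sup>2)" for n x
  have sq: "x\<^sup>2 + (e n)\<^sup>2 > 0" for n x by (simp add: e_def add_nonneg_pos)
  then have pos: "\<phi> n x > 0" for n x unfolding \<phi>_def by (rule real_sqrt_gt_zero)
  have lim: "(\<lambda>n. \<phi> n x) \<longlonglongrightarrow> \<bar>x\<bar>" for x
  proof -
    have "(\<lambda>n. \<phi> n x) \<longlonglongrightarrow> sqrt (x\<^sup>2 + 0\<^sup>2)" unfolding \<phi>_def e_def by (intro tendsto_intros inverse_Suc_tendsto)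
    then show ?thesis by simp
  qed
  show ?thesis
  proof (rule primitive_chain_limit[OF p, of \<phi> "\<lambda>n x. x / \<phi> n x", OF _ _ _ lim])
    show "(\<phi> n has_real_derivative x / \<phi> n x) (at x)" for n x
    proof -
      have "((\<lambda>x. x\<^sup>2 + (e n)\<^sup>2) has_real_derivative 2 * x) (at x)" by (auto intro!: derivative_eq_intros)
      from DERIV_chain2[OF DERIV_real_sqrt[OF sq[of x n]] this] 
      have "(\<phi> n has_real_derivative inverse (sqrt (x\<^sup>2 + (e n)\<^sup>2)) / 2 * (2 * x)) (at x)"
        unfolding \<phi>_def[abs_def] .
      then show ?thesis
        by (rule DERIV_cong) (simp only: \<phi>_def, simp add: field_simps)
    qed
    show "continuous_on UNIV (\<lambda>x. x / \<phi> n x)" for n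
    proof (intro continuous_intros)
      show "continuous_on UNIV (\<phi> n)" unfolding \<phi>_def[abs_def] by (intro continuous_intros)
      show "\<forall>x\<in>UNIV. \<phi> n x \<noteq> 0" using pos by (metis less_irrefl)
    qed
    show "\<bar>x / \<phi> n x\<bar> \<le> 1" for n x
    proof -
      have "\<bar>x\<bar> \<le> \<phi> n x" unfolding \<phi>_def by (rule real_le_rsqrt) simp
      then show ?thesis using pos[of n x] by (simp add: abs_divide)
    qed
    show "(\<lambda>n. x / \<phi> n x) \<longlonglongrightarrow> sgn x" for x
    proof (cases "x = 0")
      case False
      then have "(\<lambda>n. x / \<phi> n x) \<longlonglongrightarrow> x / \<bar>x\<bar>" by (intro tendsto_intros lim) auto
      then show ?thesis using False by (cases "x > 0") (auto simp: sgn_if)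
    qed simp
  qed
qed

text \<open>The functions \<open>arctan (N x) / N\<close> tend to zero, while their derivatives tend to the indicator function of
  the origin. So the derivative of \<open>f\<close>, cut off to the zero set of \<open>f\<close>, has the primitive zero.\<close>

lemma derivative_zero_on_zero_set:
  fixes f :: "real \<Rightarrow> real"
  assumes p: "primitive f F" shows "AE t in lborel. f t = 0 \<longrightarrow> F t = 0"
proof -
  define N where "N n = real (Suc n)" for n
  have N: "N n > 0" for n by (simp add: N_def)
  have N0: "(\<lambda>n. 1 / N n) \<longlonglongrightarrow> 0" unfolding N_def by (rule inverse_Suc_tendsto)
  have pos: "1 + (N n * x)\<^sup>2 > 0" for n x by (simp add: add_pos_nonneg)
  have "primitive (\<lambda>t. (\<lambda>_. 0) (f t)) (\<lambda>t. indicat_real {0} (f t) * F t)"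
  proof (rule primitive_chain_limit[OF p, of "\<lambda>n x. arctan (N n * x) / N n" "\<lambda>n x. 1 / (1 + (N n * x)\<^sup>2)"])
    show "((\<lambda>x. arctan (N n * x) / N n) has_real_derivative 1 / (1 + (N n * x)\<^sup>2)) (at x)" for n x
    proof -
      have "((\<lambda>x. N n * x) has_real_derivative N n) (at x)" by (auto intro!: derivative_eq_intros)
      from DERIV_cdivide[OF DERIV_chain2[OF DERIV_arctan this], of "N n"]
      show ?thesis using N[of n] by (simp add: inverse_eq_divide)
    qed
    show "continuous_on UNIV (\<lambda>x. 1 / (1 + (N n * x)\<^sup>2))" for n
      using pos by (intro continuous_intros) (metis less_irrefl)
    show "\<bar>1 / (1 + (N n * x)\<^sup>2)\<bar> \<le> 1" for n x using pos[of n x] by simp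
    show "(\<lambda>n. arctan (N n * x) / N n) \<longlonglongrightarrow> 0" for x
    proof (rule Lim_null_comparison)
      show "\<forall>\<^sub>F n in sequentially. norm (arctan (N n * x) / N n) \<le> 2 * (1 / N n)"
      proof (intro always_eventually allI)
        fix n
        have "\<bar>arctan (N n * x)\<bar> \<le> 2" using arctan_bounded[of "N n * x"] pi_less_4 by (auto simp: abs_le_iff)
        then show "norm (arctan (N n * x) / N n) \<le> 2 * (1 / N n)" using N[of n] by (simp add: divide_right_mono)
      qed
      show "(\<lambda>n. 2 * (1 / N n)) \<longlonglongrightarrow> 0" using tendsto_mult[OF tendsto_const[of 2] N0] by simp
    qed
    show "(\<lambda>n. 1 / (1 + (N n * x)\<^sup>2)) \<longlonglongrightarrow> indicat_real {0} x" for x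
    proof (cases "x = 0")
      case False
      have "(\<lambda>n. 1 / (1 + (N n * x)\<^sup>2)) \<longlonglongrightarrow> 0"
      proof (rule Lim_null_comparison)
        show "\<forall>\<^sub>F n in sequentially. norm (1 / (1 + (N n * x)\<^sup>2)) \<le> (1 / N n) * (1 / N n) * (1 / x\<^sup>2)"
        proof (intro always_eventually allI)
          fix n
          have "(N n * x)\<^sup>2 > 0" using N[of n] False by simp
          then have "1 / (1 + (N n * x)\<^sup>2) \<le> 1 / (N n * x)\<^sup>2" using pos[of n x] by (intro divide_left_mono mult_pos_pos) auto
          then show "norm (1 / (1 + (N n * x)\<^sup>2)) \<le> (1 / N n) * (1 / N n) * (1 / x\<^sup>2)"
            using pos[of n x] by (simp add: power2_eq_square mult_ac)
        qed
        show "(\<lambda>n. (1 / N n) * (1 / N n) * (1 / x\<^sup>2)) \<longlonglongrightarrow> 0"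
          using tendsto_mult[OF tendsto_mult[OF N0 N0] tendsto_const[of "1 / x\<^sup>2"]] by simp
      qed
      then show ?thesis using False by simp
    qed simp
  qed
  from primitive_unique_AE[OF this primitive_const[of 0]]
  show ?thesis by eventually_elim (auto simp: indicator_def)
qed

text \<open>The odd function that is nonnegative to the right of the origin and has the absolute value of \<open>f\<close>.\<close>

definition odd_abs :: "(real \<Rightarrow> real) \<Rightarrow> real \<Rightarrow> real" where
  "odd_abs f t = (if t \<ge> 0 then \<bar>f t\<bar> else - \<bar>f t\<bar>)"

definition odd_sgn :: "(real \<Rightarrow> real) \<Rightarrow> real \<Rightarrow> real" where
  "odd_sgn f t = (if t \<ge> 0 then sgn (f t) else - sgn (f t))"

lemma primitive_odd_abs:
  assumes p: "primitive f F" and f0: "f 0 = 0"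
  shows "primitive (odd_abs f) (\<lambda>t. odd_sgn f t * F t)"
proof -
  have "primitive (\<lambda>t. if t \<le> 0 then - \<bar>f t\<bar> else \<bar>f t\<bar>) (\<lambda>t. if t \<le> 0 then - (sgn (f t) * F t) else sgn (f t) * F t)"
    by (rule primitive_glue[OF primitive_minus[OF primitive_abs[OF p]] primitive_abs[OF p]]) (simp add: f0)
  moreover have "(\<lambda>t. if t \<le> 0 then - \<bar>f t\<bar> else \<bar>f t\<bar>) = odd_abs f"
  proof
    show "(if t \<le> 0 then - \<bar>f t\<bar> else \<bar>f t\<bar>) = odd_abs f t" for t
      by (cases "t = 0") (auto simp: odd_abs_def f0)
  qed
  moreover have "(\<lambda>t. if t \<le> 0 then - (sgn (f t) * F t) else sgn (f t) * F t) = (\<lambda>t. odd_sgn f t * F t)"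
  proof
    show "(if t \<le> 0 then - (sgn (f t) * F t) else sgn (f t) * F t) = odd_sgn f t * F t" for t
      by (cases "t = 0") (auto simp: odd_sgn_def f0)
  qed
  ultimately show ?thesis by simp
qed

section \<open>The potential\<close>

lemma bounded_linear_refl1: "bounded_linear (refl1 i)"
proof (rule bounded_linear_intro[where K=1])
  show "refl1 i (x + y) = refl1 i x + refl1 i y" for x y by (simp add: refl1_def vec_eq_iff)
  show "refl1 i (r *\<^sub>R x) = r *\<^sub>R refl1 i x" for r x by (simp add: refl1_def vec_eq_iff)
  show "norm (refl1 i x) \<le> norm x * 1" for x
  proof -
    have "(refl1 i x $ j)\<^sup>2 = (x $ j)\<^sup>2" for j by (simp add: refl1_def)
    then show ?thesis by (simp add: norm_vec_def L2_set_def)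
  qed
qed

lemma refl1_simps [simp]:
  "refl1 i (refl1 i u) = u" "refl1 i (x + y) = refl1 i x + refl1 i y" "refl1 i (x - y) = refl1 i x - refl1 i y"
  "refl1 i (- x) = - refl1 i x" "refl1 i 0 = 0" "refl1 i (r *\<^sub>R x) = r *\<^sub>R refl1 i x"
  by (simp_all add: refl1_def vec_eq_iff)

lemma refl1_inner: "refl1 i a \<bullet> refl1 i b = a \<bullet> b"
  unfolding inner_vec_def by (rule sum.cong) (auto simp: refl1_def)

lemma refl1_norm [simp]: "norm (refl1 i u) = norm u"
  by (simp add: norm_eq_sqrt_inner refl1_inner)

lemma refl1_inner_left: "refl1 i a \<bullet> b = a \<bullet> refl1 i b"
  using refl1_inner[of i a "refl1 i b"] by simp

lemma refl1_component: "refl1 i u = u - (2 * (u $ i)) *\<^sub>R axis i 1"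
  by (auto simp: refl1_def vec_eq_iff axis_def)

lemma C2_potential_has_derivative:
  assumes "C2_potential V"
  shows "(V has_derivative (\<lambda>h. grad V u \<bullet> h)) (at u)"
proof -
  have d: "(V has_derivative frechet_derivative V (at u)) (at u)"
    using assms frechet_derivative_works unfolding C2_potential_def by blast
  interpret bounded_linear "frechet_derivative V (at u)" by (rule has_derivative_bounded_linear[OF d])
  have "frechet_derivative V (at u) h = grad V u \<bullet> h" for h
  proof -
    have "frechet_derivative V (at u) h = frechet_derivative V (at u) (\<Sum>j\<in>UNIV. (h $ j) *\<^sub>R axis j 1)"
      using basis_expansion[of h] by (simp add: scalar_mult_eq_scaleR)
    also have "\<dots> = (\<Sum>j\<in>UNIV. (h $ j) * frechet_derivative V (at u) (axis j 1))"
      by (simp add: sum scaleR)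
    finally show ?thesis by (simp add: grad_def inner_vec_def mult.commute)
  qed
  then have "frechet_derivative V (at u) = (\<lambda>h. grad V u \<bullet> h)" by auto
  then show ?thesis using d by simp
qed

lemma C2_potential_grad_has_derivative:
  assumes "C2_potential V"
  shows "(grad V has_derivative (*v) (hess V u)) (at u)"
proof -
  have d: "(grad V has_derivative frechet_derivative (grad V) (at u)) (at u)"
    using assms frechet_derivative_works unfolding C2_potential_def by blast
  have "linear (frechet_derivative (grad V) (at u))" by (rule has_derivative_linear[OF d])
  then have "Vector_Spaces.linear (*s) (*s) (frechet_derivative (grad V) (at u))"
    by (simp add: linear_matrix_vector_mul_eq)
  from matrix_works[OF this] have "(*v) (hess V u) = frechet_derivative (grad V) (at u)"
    unfolding hess_def by auto
  then show ?thesis using d by simp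
qed

lemma C2_potential_continuous: "C2_potential V \<Longrightarrow> continuous_on UNIV V" "C2_potential V \<Longrightarrow> continuous_on UNIV (grad V)"
  by (auto intro!: differentiable_imp_continuous_on simp: differentiable_on_def C2_potential_def)

lemma compact_image_norm_bound:
  assumes "compact (f ` K)" shows "\<exists>B>0. \<forall>u\<in>K. norm (f u) \<le> B"
proof -
  have "bounded (f ` K)" by (rule compact_imp_bounded[OF assms])
  then obtain B where "B > 0" "\<forall>x\<in>f ` K. norm x \<le> B" unfolding bounded_pos by blast
  then show ?thesis by (intro exI[of _ B]) simp
qed

lemma C2_potential_grad_Lipschitz:
  assumes "C2_potential V"
  shows "\<exists>K>0. \<forall>x\<in>cball 0 M. \<forall>y\<in>cball 0 M. norm (grad V x - grad V y) \<le> K * norm (x - y)"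
proof -
  have "compact (hess V ` cball 0 M)"
    using assms unfolding C2_potential_def by (intro compact_continuous_image) (auto intro: continuous_on_subset)
  then obtain B where B: "B > 0" "\<And>u. u \<in> cball 0 M \<Longrightarrow> norm (hess V u) \<le> B"
    using compact_image_norm_bound by blast
  define K where "K = real CARD('a) * real CARD('a) * B"
  have "norm (grad V x - grad V y) \<le> K * norm (x - y)" if "x \<in> cball 0 M" "y \<in> cball 0 M" for x y
  proof (rule differentiable_bound[of "cball 0 M" _ "\<lambda>u. (*v) (hess V u)"])
    show "(grad V has_derivative (*v) (hess V u)) (at u within cball 0 M)" for u
      by (rule has_derivative_at_withinI[OF C2_potential_grad_has_derivative[OF assms]])
    fix u :: "real^'a" assume u: "u \<in> cball 0 M"
    show "onorm ((*v) (hess V u)) \<le> K"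
      unfolding K_def
    proof (rule onorm_le_matrix_component)
      fix j k
      have "\<bar>hess V u $ j $ k\<bar> \<le> norm (hess V u $ j)" by (rule component_le_norm_cart)
      also have "\<dots> \<le> norm (hess V u)" by (rule Finite_Cartesian_Product.norm_nth_le)
      finally show "\<bar>hess V u $ j $ k\<bar> \<le> B" using B(2)[OF u] by simp
    qed
  qed (use that in auto)
  moreover have "K > 0" using B by (simp add: K_def)
  ultimately show ?thesis by blast
qed

lemma C2_potential_line_derivative:
  assumes "C2_potential V"
  shows "((\<lambda>r. V (x + r *\<^sub>R h)) has_real_derivative grad V (x + r *\<^sub>R h) \<bullet> h) (at r)"
proof -
  have "((\<lambda>r. x + r *\<^sub>R h) has_derivative (\<lambda>d. d *\<^sub>R h)) (at r)" 
    by (auto intro!: derivative_eq_intros)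
  from diff_chain_at[OF this C2_potential_has_derivative[OF assms]]
  have "((\<lambda>r. V (x + r *\<^sub>R h)) has_derivative (\<lambda>d. grad V (x + r *\<^sub>R h) \<bullet> (d *\<^sub>R h))) (at r)"
    by (simp add: o_def)
  then show ?thesis by (simp add: has_field_derivative_def mult.commute[of _ "_ \<bullet> _"])
qed

lemma C2_potential_mvt:
  assumes "C2_potential V"
  shows "\<exists>r. 0 < r \<and> r < 1 \<and> V (x + h) - V x = grad V (x + r *\<^sub>R h) \<bullet> h"
  using MVT2[of 0 1 "\<lambda>r. V (x + r *\<^sub>R h)", OF _ C2_potential_line_derivative[OF assms]] by auto

lemma convex_cball_segment:
  fixes x h :: "'a::real_normed_vector"
  assumes "x \<in> cball c M" "x + h \<in> cball c M" "0 \<le> r" "r \<le> 1"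
  shows "x + r *\<^sub>R h \<in> cball c M"
proof -
  have "(1 - r) *\<^sub>R x + r *\<^sub>R (x + h) \<in> cball c M"
    by (rule convexD_alt[OF convex_cball]) (use assms in auto)
  then show ?thesis by (simp add: algebra_simps)
qed

lemma C2_potential_Taylor:
  assumes "C2_potential V"
    and K: "\<forall>x\<in>cball 0 M. \<forall>y\<in>cball 0 M. norm (grad V x - grad V y) \<le> K * norm (x - y)" "K > 0"
    and xh: "x \<in> cball 0 M" "x + h \<in> cball 0 M"
  shows "\<bar>V (x + h) - V x - grad V x \<bullet> h\<bar> \<le> K * (norm h)\<^sup>2"
proof -
  obtain r where r: "0 < r" "r < 1" "V (x + h) - V x = grad V (x + r *\<^sub>R h) \<bullet> h"
    using C2_potential_mvt[OF assms(1)] by blast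
  have in_ball: "x + r *\<^sub>R h \<in> cball 0 M" by (rule convex_cball_segment[OF xh]) (use r in auto)
  have "V (x + h) - V x - grad V x \<bullet> h = (grad V (x + r *\<^sub>R h) - grad V x) \<bullet> h"
    by (simp add: r(3) inner_diff_left)
  also have "\<bar>\<dots>\<bar> \<le> norm (grad V (x + r *\<^sub>R h) - grad V x) * norm h" by (rule Cauchy_Schwarz_ineq2)
  also have "\<dots> \<le> (K * norm (x + r *\<^sub>R h - x)) * norm h"
    by (intro mult_right_mono K(1)[rule_format] in_ball xh(1)) simp
  also have "\<dots> \<le> (K * norm h) * norm h"
    using r K(2) by (intro mult_right_mono mult_left_mono) (auto simp: mult_left_le_one_le)
  finally show ?thesis by (simp add: power2_eq_square)
qed

text \<open>A nonnegative function with Lipschitz gradient controls the square of its gradient: a short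
  step in the direction of steepest descent cannot make it negative.\<close>

lemma grad_sq_le_potential:
  assumes C2: "C2_potential V" and nn: "\<And>u. V u \<ge> 0"
  shows "\<exists>C>0. \<forall>u\<in>cball 0 M. (norm (grad V u))\<^sup>2 \<le> C * V u"
proof -
  have "compact (grad V ` cball 0 M)"
    by (intro compact_continuous_image continuous_on_subset[OF C2_potential_continuous(2)[OF C2]]) auto
  then obtain B where B: "B > 0" "\<And>u. u \<in> cball 0 M \<Longrightarrow> norm (grad V u) \<le> B"
    using compact_image_norm_bound by blast
  obtain K where K: "K > 0" "\<forall>x\<in>cball 0 (M+B). \<forall>y\<in>cball 0 (M+B). norm (grad V x - grad V y) \<le> K * norm (x - y)"
    using C2_potential_grad_Lipschitz[OF C2] by blast
  define \<tau> where "\<tau> = min 1 (1 / (2 * K))"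
  have \<tau>: "\<tau> > 0" "\<tau> \<le> 1" "\<tau> * K \<le> 1/2" using K(1) by (auto simp: \<tau>_def min_def field_simps)
  have "(norm (grad V u))\<^sup>2 \<le> (2 / \<tau>) * V u" if u: "u \<in> cball 0 M" for u
  proof -
    define G where "G = grad V u"
    have nG: "norm G \<le> B" using B(2)[OF u] by (simp add: G_def)
    have "norm (u + (- \<tau>) *\<^sub>R G) \<le> norm u + norm ((- \<tau>) *\<^sub>R G)" by (rule norm_triangle_ineq)
    also have "\<dots> \<le> M + 1 * B" using u \<tau> nG unfolding norm_scaleR by (intro add_mono mult_mono) auto
    finally have 1: "u + (- \<tau>) *\<^sub>R G \<in> cball 0 (M+B)" by simp
    have 2: "u \<in> cball 0 (M+B)" using u B(1) by simp
    have "V (u + (- \<tau>) *\<^sub>R G) - V u - grad V u \<bullet> ((- \<tau>) *\<^sub>R G) \<le> K * (norm ((- \<tau>) *\<^sub>R G))\<^sup>2"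
      using C2_potential_Taylor[OF C2 K(2,1) 2 1] by (simp add: abs_le_iff)
    then have "0 \<le> V u - \<tau> * (norm G)\<^sup>2 + K * (\<tau>\<^sup>2 * (norm G)\<^sup>2)"
      using nn[of "u + (- \<tau>) *\<^sub>R G"] by (simp add: G_def power2_norm_eq_inner[symmetric] power_mult_distrib)
    also have "K * (\<tau>\<^sup>2 * (norm G)\<^sup>2) = (\<tau> * K) * (\<tau> * (norm G)\<^sup>2)" by (simp add: power2_eq_square)
    also have "\<dots> \<le> (1/2) * (\<tau> * (norm G)\<^sup>2)" using \<tau> by (intro mult_right_mono) auto
    finally have "\<tau> * (norm G)\<^sup>2 \<le> 2 * V u" by simp
    then show ?thesis using \<tau>(1) by (simp add: G_def field_simps)
  qed
  then show ?thesis using \<tau>(1) by (intro exI[of _ "2 / \<tau>"]) auto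
qed

lemma pos_definite_lower_bound:
  fixes A :: "real^'n^'n"
  assumes "pos_definite A"
  shows "\<exists>m>0. \<forall>h. h \<bullet> (A *v h) \<ge> m * (norm h)\<^sup>2"
proof -
  have cont: "continuous_on (sphere 0 1) (\<lambda>h. h \<bullet> (A *v h))"
    by (intro continuous_intros linear_continuous_on) (simp add: matrix_vector_mul_bounded_linear)
  have ne: "sphere (0::real^'n) 1 \<noteq> {}" by (metis sphere_eq_empty not_one_less_zero)
  obtain x where x: "x \<in> sphere 0 1" "\<And>h. h \<in> sphere 0 1 \<Longrightarrow> x \<bullet> (A *v x) \<le> h \<bullet> (A *v h)"
    using continuous_attains_inf[OF compact_sphere ne cont] by blast
  have "x \<noteq> 0" using x(1) by auto
  then have pos: "x \<bullet> (A *v x) > 0" using assms by (simp add: pos_definite_def)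
  have "h \<bullet> (A *v h) \<ge> (x \<bullet> (A *v x)) * (norm h)\<^sup>2" for h
  proof (cases "h = 0")
    case False
    define k where "k = (1 / norm h) *\<^sub>R h"
    have hk: "h = norm h *\<^sub>R k" "k \<in> sphere 0 1" using False by (auto simp: k_def)
    have "h \<bullet> (A *v h) = (norm h)\<^sup>2 * (k \<bullet> (A *v k))"
      by (subst (1 2) hk(1)) (simp add: scaleR_matrix_vector_assoc[symmetric] matrix_vector_mult_scaleR power2_eq_square)
    then show ?thesis using mult_left_mono[OF x(2)[OF hk(2)] zero_le_power2[of "norm h"]] by (simp only: mult.commute)
  qed simp
  then show ?thesis using pos by blast
qed

locale double_well =
  fixes V :: "real ^ 'n \<Rightarrow> real" and S :: "(real ^ 'n) set" and i :: 'n and sm sp :: "real ^ 'n"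
  assumes finite_S: "finite S" and sm: "sm \<in> S" and sp: "sp \<in> S" 
    and C2: "C2_potential V" and V_nonneg: "\<And>u. V u \<ge> 0" and V_zero: "\<And>u. V u = 0 \<longleftrightarrow> u \<in> S"
    and coercive: "\<exists>\<beta>0>0. \<exists>R0>0. \<forall>u. norm u \<ge> R0 \<longrightarrow> V u \<ge> \<beta>0"
    and hess_pos: "\<And>s. s \<in> S \<Longrightarrow> pos_definite (hess V s)"
    and sm_def: "sm = axis i (-1)" and sp_def: "sp = axis i 1" and V_refl: "\<And>u. V (refl1 i u) = V u"
begin

lemma refl_sp: "refl1 i sp = sm" and refl_sm: "refl1 i sm = sp"
  by (auto simp: sp_def sm_def refl1_def vec_eq_iff axis_def)

lemma V_cont: "continuous_on UNIV V" and grad_cont: "continuous_on UNIV (grad V)"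
  using C2_potential_continuous[OF C2] by auto

lemma V_measurable [measurable]: "V \<in> borel_measurable borel"
  by (rule borel_measurable_continuous_onI[OF V_cont])

lemma grad_measurable [measurable]: "grad V \<in> borel_measurable borel"
  by (rule borel_measurable_continuous_onI[OF grad_cont])

lemma grad_Lipschitz: "\<exists>K>0. \<forall>x\<in>cball 0 M. \<forall>y\<in>cball 0 M. norm (grad V x - grad V y) \<le> K * norm (x - y)"
  by (rule C2_potential_grad_Lipschitz[OF C2])

lemma grad_sq_le: "\<exists>C>0. \<forall>u\<in>cball 0 M. (norm (grad V u))\<^sup>2 \<le> C * V u"
  by (rule grad_sq_le_potential[OF C2 V_nonneg])

lemma grad_zero: assumes "s \<in> S" shows "grad V s = 0"
proof -
  obtain C where "(norm (grad V s))\<^sup>2 \<le> C * V s" using grad_sq_le[of "norm s"] by force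
  then show ?thesis using V_zero[of s] assms by simp
qed

lemma V_quadratic_upper:
  assumes "s \<in> S"
  shows "\<exists>K>0. \<forall>u. norm (u - s) \<le> 1 \<longrightarrow> V u \<le> K * (norm (u - s))\<^sup>2"
proof -
  obtain K where K: "K > 0" "\<forall>x\<in>cball 0 (norm s + 1). \<forall>y\<in>cball 0 (norm s + 1). norm (grad V x - grad V y) \<le> K * norm (x - y)"
    using grad_Lipschitz by blast
  have "V u \<le> K * (norm (u - s))\<^sup>2" if "norm (u - s) \<le> 1" for u
  proof -
    have "s \<in> cball 0 (norm s + 1)" "s + (u - s) \<in> cball 0 (norm s + 1)"
      using that norm_triangle_sub[of u s] by auto
    from C2_potential_Taylor[OF C2 K(2,1) this] show ?thesis
      using V_zero[of s] assms grad_zero[OF assms] by (simp add: abs_le_iff)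
  qed
  then show ?thesis using K(1) by blast
qed

text \<open>The first order expansion of the gradient gives the lower bound for \<open>grad V u \<bullet> (u - s)\<close>, and integrating
  it along the segment from \<open>s\<close> to \<open>u\<close> gives the one for \<open>V u\<close>.\<close>

lemma nondegenerate:
  assumes s: "s \<in> S"
  shows "\<exists>\<rho>>0. \<exists>\<mu>>0. \<rho> < 1 \<and> (\<forall>u. norm (u - s) \<le> \<rho> \<longrightarrow> 
    grad V u \<bullet> (u - s) \<ge> \<mu> * (norm (u - s))\<^sup>2 \<and> V u \<ge> \<mu> * (norm (u - s))\<^sup>2)"
proof -
  obtain m where m: "m > 0" "\<And>h. h \<bullet> (hess V s *v h) \<ge> m * (norm h)\<^sup>2"
    using pos_definite_lower_bound[OF hess_pos[OF s]] by blast
  have "\<exists>d>0. \<forall>u. norm (u - s) < d \<longrightarrow> norm (grad V u - grad V s - hess V s *v (u - s)) \<le> (m / 2) * norm (u - s)"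
    using C2_potential_grad_has_derivative[OF C2, of s] m(1) unfolding has_derivative_at_alt
    by (meson half_gt_zero)
  then obtain d where d: "d > 0" "\<And>u. norm (u - s) < d \<Longrightarrow> norm (grad V u - grad V s - hess V s *v (u - s)) \<le> (m / 2) * norm (u - s)"
    by blast
  define \<rho> where "\<rho> = min (d/2) (1/2)"
  have rho: "\<rho> > 0" "\<rho> < 1" "\<rho> < d" using d(1) by (auto simp: \<rho>_def)
  have g: "grad V u \<bullet> (u - s) \<ge> (m / 2) * (norm (u - s))\<^sup>2" if "norm (u - s) \<le> \<rho>" for u
  proof -
    define h where "h = u - s"
    have n: "norm (grad V u - hess V s *v h) \<le> (m / 2) * norm h"
      using d(2)[of u] that rho grad_zero[OF s] by (simp add: h_def)
    have "h \<bullet> (hess V s *v h) - grad V u \<bullet> h = - ((grad V u - hess V s *v h) \<bullet> h)"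
      by (simp add: inner_diff_left inner_diff_right inner_commute)
    also have "\<dots> \<le> \<bar>(grad V u - hess V s *v h) \<bullet> h\<bar>" by (rule abs_ge_minus_self)
    also have "\<dots> \<le> norm (grad V u - hess V s *v h) * norm h" by (rule Cauchy_Schwarz_ineq2)
    also have "\<dots> \<le> (m / 2) * norm h * norm h" by (intro mult_right_mono n) simp
    finally show ?thesis using m(2)[of h] by (simp add: h_def power2_eq_square)
  qed
  have v: "V u \<ge> (m / 4) * (norm (u - s))\<^sup>2" if u: "norm (u - s) \<le> \<rho>" for u
  proof -
    define h where "h = u - s"
    \<comment> \<open>V minus its claimed lower bound increases along the segment\<close>
    define \<phi> where "\<phi> r = V (s + r *\<^sub>R h) - (m / 4) * (r\<^sup>2 * (norm h)\<^sup>2)" for r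
    note dV = C2_potential_line_derivative[OF C2, of s h]
    have d\<phi>: "(\<phi> has_real_derivative grad V (s + r *\<^sub>R h) \<bullet> h - (m / 2) * (r * (norm h)\<^sup>2)) (at r)" for r
      proof -
      have "((\<lambda>r. (m / 4) * (r\<^sup>2 * (norm h)\<^sup>2)) has_real_derivative (m / 2) * (r * (norm h)\<^sup>2)) (at r)"
        by (auto intro!: derivative_eq_intros)
      from DERIV_diff[OF dV this] show ?thesis unfolding \<phi>_def[abs_def] .
    qed
    have "\<phi> 0 \<le> \<phi> 1"
    proof (rule DERIV_nonneg_imp_nondecreasing[where f=\<phi> and a=0 and b=1])
      fix r :: real assume r: "0 \<le> r" "r \<le> 1"
      have "grad V (s + r *\<^sub>R h) \<bullet> h - (m / 2) * (r * (norm h)\<^sup>2) \<ge> 0"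
      proof (cases "r = 0")
        case True then show ?thesis using grad_zero[OF s] by simp
      next
        case False
        have "norm (s + r *\<^sub>R h - s) \<le> \<rho>" 
        proof -
          have "norm (s + r *\<^sub>R h - s) = r * norm h" using r by simp
          also have "\<dots> \<le> norm h" using r by (intro mult_left_le_one_le) auto
          finally show ?thesis using u by (simp add: h_def)
        qed
        from g[OF this] have "(m / 2) * (norm (r *\<^sub>R h))\<^sup>2 \<le> grad V (s + r *\<^sub>R h) \<bullet> (r *\<^sub>R h)"
          by simp
        also have "\<dots> = r * (grad V (s + r *\<^sub>R h) \<bullet> h)" by simp
        also have "(m / 2) * (norm (r *\<^sub>R h))\<^sup>2 = r * ((m / 2) * (r * (norm h)\<^sup>2))"
          by (simp add: power_mult_distrib power2_eq_square)
        finally have "r * ((m / 2) * (r * (norm h)\<^sup>2)) \<le> r * (grad V (s + r *\<^sub>R h) \<bullet> h)" .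
        then have "(m / 2) * (r * (norm h)\<^sup>2) \<le> grad V (s + r *\<^sub>R h) \<bullet> h"
          using r False by (simp only: mult_le_cancel_left_pos)
        then show ?thesis by simp
      qed
      then show "\<exists>y. (\<phi> has_real_derivative y) (at r) \<and> y \<ge> 0" using d\<phi> by blast
    qed simp
    then show ?thesis using V_zero[of s] s by (simp add: \<phi>_def h_def)
  qed
  show ?thesis
  proof (rule exI[of _ \<rho>], rule conjI[OF rho(1)], rule exI[of _ "m / 4"], intro conjI allI impI)
    fix u assume u: "norm (u - s) \<le> \<rho>"
    have "(m / 4) * (norm (u - s))\<^sup>2 \<le> (m / 2) * (norm (u - s))\<^sup>2" using m(1) by (intro mult_right_mono) auto
    then show "m / 4 * (norm (u - s))\<^sup>2 \<le> grad V u \<bullet> (u - s)" using g[OF u] by linarith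
    show "m / 4 * (norm (u - s))\<^sup>2 \<le> V u" by (rule v[OF u])
  qed (use rho m(1) in auto)
qed

lemma grad_refl: "grad V (refl1 i u) = refl1 i (grad V u)"
proof -
  have "(refl1 i has_derivative refl1 i) (at u)" by (rule bounded_linear_imp_has_derivative[OF bounded_linear_refl1])
  from diff_chain_at[OF this C2_potential_has_derivative[OF C2]]
  have "(V has_derivative (\<lambda>h. grad V (refl1 i u) \<bullet> refl1 i h)) (at u)"
    by (simp add: o_def V_refl)
  from has_derivative_unique[OF this C2_potential_has_derivative[OF C2]]
  have "grad V (refl1 i u) \<bullet> refl1 i h = grad V u \<bullet> h" for h by meson
  then have "refl1 i (grad V (refl1 i u)) \<bullet> h = grad V u \<bullet> h" for h by (simp add: refl1_inner_left)
  then have "refl1 i (grad V (refl1 i u)) = grad V u" by (metis vector_eq_rdot)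
  then show ?thesis by (metis refl1_simps(1))
qed

lemma V_bounded_below_compact:
  assumes "compact K" "K \<inter> S = {}"
  shows "\<exists>\<eta>>0. \<forall>u\<in>K. V u \<ge> \<eta>"
proof (cases "K = {}")
  case False
  obtain x where x: "x \<in> K" "\<And>u. u \<in> K \<Longrightarrow> V x \<le> V u"
    using continuous_attains_inf[OF assms(1) False continuous_on_subset[OF V_cont]] by blast
  have "V x > 0" using x(1) assms(2) V_zero[of x] V_nonneg[of x] by fastforce
  then show ?thesis using x by blast
qed (auto intro: exI[of _ 1])

section \<open>Connecting curves\<close>

lemma energy_L2:
  assumes p: "primitive q g" and fin: "energy V q < \<infinity>"
  shows "g \<in> L2" "integrable lborel (\<lambda>t. V (q t))" 
    "energy V q = ennreal ((LINT t|lborel. (norm (g t))\<^sup>2) / 2 + (LINT t|lborel. V (q t)))"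
proof -
  note [measurable] = primitive_measurable[OF p]
  have "integrable lborel (\<lambda>t. (norm (g t))\<^sup>2 / 2 + V (q t))"
  proof (rule integrableI_nonneg)
    show "(\<integral>\<^sup>+ t. ennreal ((norm (g t))\<^sup>2 / 2 + V (q t)) \<partial>lborel) < \<infinity>"
      using fin energy_primitive[OF p] by metis
  qed (auto simp: V_nonneg)
  then have i: "integrable lborel (\<lambda>t. (norm (g t))\<^sup>2 / 2 + V (q t))" .
  have i1: "integrable lborel (\<lambda>t. (norm (g t))\<^sup>2 / 2)" 
    by (rule Bochner_Integration.integrable_bound[OF i]) (auto simp: V_nonneg)
  show i2: "integrable lborel (\<lambda>t. V (q t))" 
    by (rule Bochner_Integration.integrable_bound[OF i]) (auto simp: V_nonneg)
  have "integrable lborel (\<lambda>t. 2 * ((norm (g t))\<^sup>2 / 2))" using i1 by (rule integrable_mult_right)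
  then show "g \<in> L2" by (intro L2I) auto
  have "(\<integral>\<^sup>+ t. ennreal ((norm (g t))\<^sup>2 / 2 + V (q t)) \<partial>lborel) = ennreal (LINT t|lborel. (norm (g t))\<^sup>2 / 2 + V (q t))"
    by (rule nn_integral_eq_integral[OF i]) (auto simp: V_nonneg)
  also have "(LINT t|lborel. (norm (g t))\<^sup>2 / 2 + V (q t)) = (LINT t|lborel. (norm (g t))\<^sup>2) / 2 + (LINT t|lborel. V (q t))"
    using i1 i2 by simp
  finally show "energy V q = ennreal ((LINT t|lborel. (norm (g t))\<^sup>2) / 2 + (LINT t|lborel. V (q t)))"
    using energy_primitive[OF p] by metis
qed

lemma energy_eq:
  assumes p: "primitive q g" and g: "g \<in> L2" and Vq: "integrable lborel (\<lambda>t. V (q t))"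
  shows "energy V q = ennreal ((LINT t|lborel. (norm (g t))\<^sup>2) / 2 + (LINT t|lborel. V (q t)))"
proof -
  have "energy V q = (\<integral>\<^sup>+ t. ennreal ((norm (g t))\<^sup>2 / 2 + V (q t)) \<partial>lborel)" by (rule energy_primitive[OF p])
  also have "\<dots> = ennreal (LINT t|lborel. (norm (g t))\<^sup>2 / 2 + V (q t))"
    by (rule nn_integral_eq_integral) (use L2_integrable[OF g] Vq V_nonneg in auto)
  finally show ?thesis using L2_integrable[OF g] Vq by simp
qed

text \<open>Where \<open>V \<ge> m\<close> with \<open>m \<le> 1\<close>, the energy density is at least \<open>m\<close> times the speed. So the energy bounds the length
  of the pieces outside the ball beyond which \<open>V\<close> is bounded below, and the curve starts inside this ball.\<close>

lemma conn_bounded: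
  "\<exists>M>0. \<forall>q\<in>conn V sm sp. energy V q \<le> ennreal C \<longrightarrow> (\<forall>t. norm (q t) \<le> M)"
proof -
  obtain \<beta> R where bR: "\<beta> > 0" "R > 0" "\<And>u. norm u \<ge> R \<Longrightarrow> V u \<ge> \<beta>" using coercive by blast
  define m where "m = min 1 \<beta>"
  have m: "m > 0" "m \<le> 1" "m \<le> \<beta>" using bR(1) by (auto simp: m_def)
  define M where "M = R + \<bar>C\<bar> / m + 1"
  have "norm (q t) \<le> M" if q: "q \<in> conn V sm sp" "energy V q \<le> ennreal C" for q t
  proof (rule ccontr)
    assume "\<not> norm (q t) \<le> M"
    then have big: "norm (q t) > M" by simp
    obtain g where p: "primitive q g" using q(1) H1_loc_iff unfolding conn_def by blast
    have fin: "energy V q < \<infinity>" using q(1) by (simp add: conn_def)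
    note e = energy_L2[OF p fin]
    have "\<bar>C\<bar> / m \<ge> 0" using m(1) by simp
    then have RM: "R < norm (q t)" using big unfolding M_def by linarith
    have "norm sm < R" 
    proof (rule ccontr)
      assume "\<not> norm sm < R" then have "V sm \<ge> \<beta>" by (intro bR(3)) simp
      then show False using V_zero[of sm] sm bR(1) by simp
    qed
    have "(q \<longlongrightarrow> sm) at_bot" using q(1) by (simp add: conn_def)
    then have "((\<lambda>t. norm (q t)) \<longlongrightarrow> norm sm) at_bot" by (rule tendsto_norm)
    from order_tendstoD(2)[OF this \<open>norm sm < R\<close>] obtain t0 where t0: "\<And>s. s \<le> t0 \<Longrightarrow> norm (q s) < R"
      unfolding eventually_at_bot_linorder by blast
    have cq: "continuous_on UNIV (\<lambda>t. norm (q t))" by (intro continuous_on_norm primitive_continuous[OF p])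
    define Z where "Z = {s\<in>{t0..t}. norm (q s) \<le> R}"
    have t0t: "t0 \<le> t" using t0[of t] RM by (meson less_asym linear)
    have "closed ({t0..t} \<inter> {s. norm (q s) \<le> R})"
      by (intro closed_Int closed_Collect_le cq continuous_on_const) auto
    moreover have "{t0..t} \<inter> {s. norm (q s) \<le> R} = Z" by (auto simp: Z_def)
    ultimately have "closed Z" by simp
    have "t0 \<in> Z" using t0[of t0] t0t by (simp add: Z_def)
    \<comment> \<open>the last time before t at which the curve is in the ball of radius R\<close>
    define s where "s = Sup Z"
    have bdd: "bdd_above Z" unfolding Z_def by (intro bdd_aboveI[of _ t]) auto
    have sZ: "s \<in> Z" unfolding s_def using closed_contains_Sup \<open>closed Z\<close> bdd \<open>t0 \<in> Z\<close> by blast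
    have out: "norm (q r) \<ge> R" if "r \<in> {s<..t}" for r
    proof (rule ccontr)
      assume "\<not> R \<le> norm (q r)"
      then have "r \<in> Z" using that sZ by (auto simp: Z_def)
      then have "r \<le> s" unfolding s_def by (rule cSup_upper[OF _ bdd])
      then show False using that by simp
    qed
    have st: "s \<le> t" using sZ by (simp add: Z_def)
    have i: "integrable lborel (\<lambda>r. (norm (g r))\<^sup>2 / 2 + V (q r))" using e(2) L2_integrable[OF e(1)] by simp
    have "norm (q t) - R \<le> norm (q t - q s)" using sZ norm_triangle_ineq2[of "q t" "q s"] by (simp add: Z_def)
    also have "\<dots> \<le> (LINT r:{s..t}|lborel. norm (g r))" by (rule primitive_dist_le[OF p st])
    also have "\<dots> \<le> (LINT r:{s..t}|lborel. ((norm (g r))\<^sup>2 / 2 + V (q r)) / m)"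
    proof (rule set_integral_mono_AE)
      show "set_integrable lborel {s..t} (\<lambda>r. norm (g r))" by (rule L2_loc_norm_set_integrable[OF primitive_L2_loc[OF p]])
      show "set_integrable lborel {s..t} (\<lambda>r. ((norm (g r))\<^sup>2 / 2 + V (q r)) / m)"
        by (intro set_integrable_divide integrable_set_integrable[OF i]) auto
      show "AE r \<in> {s..t} in lborel. norm (g r) \<le> ((norm (g r))\<^sup>2 / 2 + V (q r)) / m"
        using AE_lborel_singleton[of s]
      proof eventually_elim
        fix r assume "r \<noteq> s"
        show "r \<in> {s..t} \<longrightarrow> norm (g r) \<le> ((norm (g r))\<^sup>2 / 2 + V (q r)) / m"
        proof
          assume "r \<in> {s..t}"
          then have V: "V (q r) \<ge> m" using bR(3)[OF out[of r]] \<open>r \<noteq> s\<close> m by simp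
          have "m * norm (g r) \<le> (m\<^sup>2 + (norm (g r))\<^sup>2) / 2"
            using zero_le_power2[of "m - norm (g r)"] by (simp add: power2_eq_square algebra_simps)
          also have "m\<^sup>2 \<le> m" using m by (simp add: power2_eq_square mult_left_le_one_le)
          finally have "m * norm (g r) \<le> (norm (g r))\<^sup>2 / 2 + V (q r)" using V m(1) by (simp add: field_simps)
          then show "norm (g r) \<le> ((norm (g r))\<^sup>2 / 2 + V (q r)) / m" using m(1) by (simp add: field_simps)
        qed
      qed
    qed
    also have "\<dots> = (LINT r:{s..t}|lborel. (norm (g r))\<^sup>2 / 2 + V (q r)) / m" by (rule set_integral_divide_zero)
    also have "\<dots> \<le> (LINT r|lborel. (norm (g r))\<^sup>2 / 2 + V (q r)) / m"
      by (intro divide_right_mono set_integral_le_integral[OF i]) (use m V_nonneg in auto)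
    also have "(LINT r|lborel. (norm (g r))\<^sup>2 / 2 + V (q r)) = (LINT t|lborel. (norm (g t))\<^sup>2) / 2 + (LINT t|lborel. V (q t))"
      using e(2) L2_integrable[OF e(1)] by simp
    also have "\<dots> \<le> \<bar>C\<bar>"
    proof -
      have "ennreal ((LINT t|lborel. (norm (g t))\<^sup>2) / 2 + (LINT t|lborel. V (q t))) \<le> ennreal \<bar>C\<bar>"
        using q(2) e(3) by (metis abs_ge_self ennreal_leI order_trans)
      then show ?thesis by (simp add: ennreal_le_iff)
    qed
    finally have "norm (q t) - R \<le> \<bar>C\<bar> / m" using m(1) by (simp add: divide_right_mono)
    then show False using big by (simp add: M_def)
  qed
  moreover have "M > 0" using bR(2) m(1) by (simp add: M_def add_pos_nonneg)
  ultimately show ?thesis by blast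
qed

lemma grad_L2:
  assumes "q \<in> borel_measurable borel" "\<And>t. norm (q t) \<le> M" "integrable lborel (\<lambda>t. V (q t))"
  shows "(\<lambda>t. grad V (q t)) \<in> L2"
proof -
  note [measurable] = assms(1)
  obtain C where C: "\<And>u. u \<in> cball 0 M \<Longrightarrow> (norm (grad V u))\<^sup>2 \<le> C * V u" using grad_sq_le by blast
  have m: "(\<lambda>t. grad V (q t)) \<in> borel_measurable borel" by measurable
  show ?thesis
  proof (rule L2I[OF m])
    show "integrable lborel (\<lambda>t. (norm (grad V (q t)))\<^sup>2)"
    proof (rule Bochner_Integration.integrable_bound[of _ "\<lambda>t. C * V (q t)"])
      show "AE t in lborel. norm ((norm (grad V (q t)))\<^sup>2) \<le> norm (C * V (q t))"
      proof (intro AE_I2)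
        fix t
        have "(norm (grad V (q t)))\<^sup>2 \<le> C * V (q t)" using C[of "q t"] assms(2)[of t] by simp
        also have "\<dots> \<le> norm (C * V (q t))" by simp
        finally show "norm ((norm (grad V (q t)))\<^sup>2) \<le> norm (C * V (q t))" by simp
      qed
    qed (use assms(3) in auto)
  qed
qed

end

lemma primitive_clamp:
  fixes a b :: real assumes ab: "a \<le> b"
  shows "primitive (\<lambda>t. max a (min b t)) (indicat_real {a..b})"
  unfolding primitive_def
proof (intro conjI allI impI)
  show "indicat_real {a..b} \<in> L2_loc"
  proof (rule L2_locI)
    show "set_integrable lborel {x..y} (\<lambda>t. (norm (indicat_real {a..b} t))\<^sup>2)" for x y
      by (rule set_integrable_boundedI[OF _ set_integrable_const[of x y 1]]) (auto simp: indicator_def)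
  qed simp
  fix x y :: real assume xy: "x \<le> y"
  have "(LINT t:{x..y}|lborel. indicat_real {a..b} t) = measure lborel ({max x a..min y b})"
  proof -
    have "(LINT t:{x..y}|lborel. indicat_real {a..b} t) = (LINT t|lborel. indicat_real {max x a..min y b} t)"
      unfolding set_lebesgue_integral_def by (rule Bochner_Integration.integral_cong) (auto simp: indicator_def)
    then show ?thesis by simp
  qed
  also have "\<dots> = max a (min b y) - max a (min b x)"
  proof (cases "max x a \<le> min y b")
    case True
    then have "measure lborel {max x a..min y b} = min y b - max x a" by (rule measure_lborel_Icc)
    then show ?thesis using ab xy True by (auto simp: max_def min_def split: if_splits)
  next
    case False
    then have "measure lborel {max x a..min y b} = 0" by simp
    then show ?thesis using ab xy False by (auto simp: max_def min_def split: if_splits)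
  qed
  finally show "max a (min b y) - max a (min b x) = (LINT t:{x..y}|lborel. indicat_real {a..b} t)" by simp
qed

lemma L2_indicator: "(\<lambda>t. indicat_real {a..b::real} t *\<^sub>R (c::'a::euclidean_space)) \<in> L2"
proof (rule L2I)
  have "(\<lambda>t. (norm (indicat_real {a..b} t *\<^sub>R c))\<^sup>2) = (\<lambda>t. indicat_real {a..b} t *\<^sub>R (norm c)\<^sup>2)"
    by (auto simp: fun_eq_iff indicator_def)
  then show "integrable lborel (\<lambda>t. (norm (indicat_real {a..b} t *\<^sub>R c))\<^sup>2)"
    using set_integrable_const[of a b "(norm c)\<^sup>2"] unfolding set_integrable_def by metis
qed measurable

lemma primitive_psi: "primitive (psi a b) (\<lambda>t. indicat_real {-1..1} t *\<^sub>R ((1/2) *\<^sub>R (b - a)))"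
proof -
  have p: "primitive (\<lambda>t. max (-1) (min 1 t)) (indicat_real {-1..1})" by (rule primitive_clamp) simp
  have "primitive (\<lambda>t. max (-1) (min 1 t) *\<^sub>R ((1/2) *\<^sub>R (b - a)) + (1/2) *\<^sub>R (a + b)) (\<lambda>t. indicat_real {-1..1} t *\<^sub>R ((1/2) *\<^sub>R (b - a)))"
    by (rule primitive_add_const[OF primitive_bounded_linear[OF bounded_linear_scaleR_left p]])
  moreover have "(\<lambda>t. max (-1) (min 1 t) *\<^sub>R ((1/2) *\<^sub>R (b - a)) + (1/2) *\<^sub>R (a + b)) = psi a b"
  proof
    fix t :: real
    consider "t \<le> -1" | "t \<ge> 1" | "-1 < t" "t < 1" by linarith
    then show "max (-1) (min 1 t) *\<^sub>R ((1/2) *\<^sub>R (b - a)) + (1/2) *\<^sub>R (a + b) = psi a b t"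
    proof cases
      case 1 then show ?thesis by (simp add: psi_def vec_eq_iff field_simps)
    next
      case 2 then show ?thesis by (simp add: psi_def vec_eq_iff field_simps)
    next
      case 3 then show ?thesis by (simp add: psi_def vec_eq_iff field_simps)
    qed
  qed
  ultimately show ?thesis by simp
qed

lemma psi_tendsto: "(psi a b \<longlongrightarrow> b) at_top" "(psi a b \<longlongrightarrow> a) at_bot"
proof -
  have "\<forall>\<^sub>F t in at_top. psi a b t = b" using eventually_ge_at_top[of 1] by eventually_elim (simp add: psi_def)
  then show "(psi a b \<longlongrightarrow> b) at_top" by (rule tendsto_eventually)
  have "\<forall>\<^sub>F t in at_bot. psi a b t = a" using eventually_le_at_bot[of "-1"] by eventually_elim (simp add: psi_def)
  then show "(psi a b \<longlongrightarrow> a) at_bot" by (rule tendsto_eventually)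
qed

context double_well
begin

lemma conn_weak_deriv:
  assumes "q \<in> conn V a b"
  shows "primitive q (weak_deriv q)" "weak_deriv q \<in> L2" "integrable lborel (\<lambda>t. V (q t))"
    "energy V q = ennreal ((LINT t|lborel. (norm (weak_deriv q t))\<^sup>2) / 2 + (LINT t|lborel. V (q t)))"
    "(q \<longlongrightarrow> a) at_bot" "(q \<longlongrightarrow> b) at_top"
proof -
  obtain g where g: "primitive q g" using assms H1_loc_iff unfolding conn_def by blast
  show p: "primitive q (weak_deriv q)" by (rule primitive_weak_deriv[OF g])
  have fin: "energy V q < \<infinity>" using assms by (simp add: conn_def)
  show "weak_deriv q \<in> L2" "integrable lborel (\<lambda>t. V (q t))"
    "energy V q = ennreal ((LINT t|lborel. (norm (weak_deriv q t))\<^sup>2) / 2 + (LINT t|lborel. V (q t)))"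
    by (rule energy_L2[OF p fin])+
  show "(q \<longlongrightarrow> a) at_bot" "(q \<longlongrightarrow> b) at_top" using assms by (auto simp: conn_def)
qed

lemma connI:
  assumes "primitive q g" "g \<in> L2" "integrable lborel (\<lambda>t. V (q t))" "(q \<longlongrightarrow> a) at_bot" "(q \<longlongrightarrow> b) at_top"
  shows "q \<in> conn V a b"
  unfolding conn_def using assms energy_eq[OF assms(1-3)] H1_loc_iff by (auto simp: less_top)

text \<open>Near its two ends, \<open>q\<close> is so close to a nondegenerate well that the square of the distance to the
  well is bounded by a multiple of the integrable function \<open>V \<circ> q\<close>.\<close>

lemma conn_minus_psi_L2:
  assumes q: "q \<in> conn V sm sp"
  shows "(\<lambda>t. q t - psi sm sp t) \<in> L2"
proof -
  note c = conn_weak_deriv[OF q]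
  obtain \<rho>1 \<mu>1 where r1: "\<rho>1 > 0" "\<mu>1 > 0" "\<And>u. norm (u - sm) \<le> \<rho>1 \<Longrightarrow> V u \<ge> \<mu>1 * (norm (u - sm))\<^sup>2"
    using nondegenerate[OF sm] by blast
  obtain \<rho>2 \<mu>2 where r2: "\<rho>2 > 0" "\<mu>2 > 0" "\<And>u. norm (u - sp) \<le> \<rho>2 \<Longrightarrow> V u \<ge> \<mu>2 * (norm (u - sp))\<^sup>2"
    using nondegenerate[OF sp] by blast
  obtain T1 where T1: "\<And>t. t \<le> T1 \<Longrightarrow> norm (q t - sm) < \<rho>1"
    using tendstoD[OF c(5) r1(1)] unfolding eventually_at_bot_linorder dist_norm by blast
  obtain T2 where T2: "\<And>t. t \<ge> T2 \<Longrightarrow> norm (q t - sp) < \<rho>2"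
    using tendstoD[OF c(6) r2(1)] unfolding eventually_at_top_linorder dist_norm by blast
  define A B where "A = min T1 (-1)" and "B = max T2 1"
  define v where "v t = q t - psi sm sp t" for t
  have cv: "continuous_on UNIV v" unfolding v_def[abs_def]
    by (intro continuous_intros primitive_continuous[OF c(1)] primitive_continuous[OF primitive_psi])
  note [measurable] = borel_measurable_continuous_onI[OF cv] primitive_measurable[OF c(1)]
  have "compact (v ` {A..B})" by (intro compact_continuous_image continuous_on_subset[OF cv]) auto
  then obtain N where N: "N > 0" "\<And>t. t \<in> {A..B} \<Longrightarrow> norm (v t) \<le> N" using compact_image_norm_bound by blast
  have "integrable lborel (\<lambda>t. (norm (v t))\<^sup>2)"
  proof (rule Bochner_Integration.integrable_bound[of _ "\<lambda>t. indicat_real {A..B} t *\<^sub>R N\<^sup>2 + (1 / \<mu>1 + 1 / \<mu>2) * V (q t)"])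
    show "integrable lborel (\<lambda>t. indicat_real {A..B} t *\<^sub>R N\<^sup>2 + (1 / \<mu>1 + 1 / \<mu>2) * V (q t))"
      using set_integrable_const[of A B "N\<^sup>2"] c(3) unfolding set_integrable_def by simp
    show "AE t in lborel. norm ((norm (v t))\<^sup>2) \<le> norm (indicat_real {A..B} t *\<^sub>R N\<^sup>2 + (1 / \<mu>1 + 1 / \<mu>2) * V (q t))"
    proof (intro AE_I2)
      fix t
      have nn: "(1 / \<mu>1) * V (q t) \<ge> 0" "(1 / \<mu>2) * V (q t) \<ge> 0" using r1 r2 V_nonneg by auto
      have "(norm (v t))\<^sup>2 \<le> indicat_real {A..B} t *\<^sub>R N\<^sup>2 + ((1 / \<mu>1) * V (q t) + (1 / \<mu>2) * V (q t))"
      proof -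
        consider "t < A" | "t > B" | "t \<in> {A..B}" unfolding atLeastAtMost_iff by linarith
        then show ?thesis
        proof cases
          case 1
          then have vt: "v t = q t - sm" by (simp add: v_def psi_def A_def)
          have "\<mu>1 * (norm (v t))\<^sup>2 \<le> V (q t)" unfolding vt using T1[of t] 1 by (intro r1(3)) (simp add: A_def)
          then have "(norm (v t))\<^sup>2 \<le> (1 / \<mu>1) * V (q t)" using r1(2) by (simp add: field_simps)
          moreover have "indicat_real {A..B} t *\<^sub>R N\<^sup>2 = 0" using 1 by simp
          ultimately show ?thesis using nn by linarith
        next
          case 2
          then have vt: "v t = q t - sp" by (simp add: v_def psi_def B_def)
          have "\<mu>2 * (norm (v t))\<^sup>2 \<le> V (q t)" unfolding vt using T2[of t] 2 by (intro r2(3)) (simp add: B_def)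
          then have "(norm (v t))\<^sup>2 \<le> (1 / \<mu>2) * V (q t)" using r2(2) by (simp add: field_simps)
          moreover have "indicat_real {A..B} t *\<^sub>R N\<^sup>2 = 0" using 2 by simp
          ultimately show ?thesis using nn by linarith
        next
          case 3
          then have "(norm (v t))\<^sup>2 \<le> N\<^sup>2" using N by (intro power_mono) auto
          moreover have "indicat_real {A..B} t *\<^sub>R N\<^sup>2 = N\<^sup>2" using 3 by simp
          ultimately show ?thesis using nn by linarith
        qed
      qed
      also have "\<dots> = indicat_real {A..B} t *\<^sub>R N\<^sup>2 + (1 / \<mu>1 + 1 / \<mu>2) * V (q t)" by (simp add: algebra_simps)
      finally show "norm ((norm (v t))\<^sup>2) \<le> norm (indicat_real {A..B} t *\<^sub>R N\<^sup>2 + (1 / \<mu>1 + 1 / \<mu>2) * V (q t))" by simp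
    qed
  qed measurable
  then have "v \<in> L2" by (intro L2I) auto
  then show ?thesis by (simp add: v_def[abs_def])
qed

lemma conn_minus_psi_H1:
  assumes q: "q \<in> conn V sm sp"
  shows "(\<lambda>t. q t - psi sm sp t) \<in> H1"
  unfolding H1_iff
  using conn_minus_psi_L2[OF q] primitive_diff[OF conn_weak_deriv(1)[OF q] primitive_psi[of sm sp]]
    L2_diff[OF conn_weak_deriv(2)[OF q] L2_indicator[of "-1" 1 "(1/2) *\<^sub>R (sp - sm)"]] by blast

lemma H1_plus_psi:
  assumes v: "v \<in> H1"
  shows "primitive (\<lambda>t. v t + psi sm sp t) (weak_deriv (\<lambda>t. v t + psi sm sp t))"
    "weak_deriv (\<lambda>t. v t + psi sm sp t) \<in> L2" 
    "((\<lambda>t. v t + psi sm sp t) \<longlongrightarrow> sm) at_bot" "((\<lambda>t. v t + psi sm sp t) \<longlongrightarrow> sp) at_top"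
proof -
  obtain g where g: "v \<in> L2" "primitive v g" "g \<in> L2" using v unfolding H1_iff by blast
  let ?p = "\<lambda>t. indicat_real {-1..1} t *\<^sub>R ((1/2) *\<^sub>R (sp - sm))"
  have p: "primitive (\<lambda>t. v t + psi sm sp t) (\<lambda>t. g t + ?p t)" by (rule primitive_add[OF g(2) primitive_psi])
  show w: "primitive (\<lambda>t. v t + psi sm sp t) (weak_deriv (\<lambda>t. v t + psi sm sp t))" by (rule primitive_weak_deriv[OF p])
  show "weak_deriv (\<lambda>t. v t + psi sm sp t) \<in> L2"
    by (rule L2_bound[OF L2_add[OF g(3) L2_indicator[of "-1" 1 "(1/2) *\<^sub>R (sp - sm)"]] primitive_measurable(2)[OF w], of 1])
      (use primitive_unique_AE[OF w p] in eventually_elim, simp)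
  show "((\<lambda>t. v t + psi sm sp t) \<longlongrightarrow> sm) at_bot" "((\<lambda>t. v t + psi sm sp t) \<longlongrightarrow> sp) at_top"
    using tendsto_add[OF primitive_L2_vanishes(2)[OF g(2,1,3)] psi_tendsto(2)]
      tendsto_add[OF primitive_L2_vanishes(1)[OF g(2,1,3)] psi_tendsto(1)] by simp_all
qed

section \<open>Cutting a curve near a well\<close>

lemma energy_reflect:
  assumes p: "primitive q g" shows "energy V (\<lambda>t. q (- t)) = energy V q"
proof -
  note [measurable] = primitive_measurable[OF p]
  have "energy V (\<lambda>t. q (- t)) = (\<integral>\<^sup>+ t. ennreal ((norm (- g (- t)))\<^sup>2 / 2 + V (q (- t))) \<partial>lborel)"
    by (rule energy_primitive[OF primitive_reflect[OF p]])
  also have "\<dots> = (\<integral>\<^sup>+ t. ennreal ((norm (g t))\<^sup>2 / 2 + V (q t)) \<partial>lborel)"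
    using nn_integral_real_affine[of "\<lambda>t. ennreal ((norm (g t))\<^sup>2 / 2 + V (q t))" "-1" 0] by simp
  finally show ?thesis using energy_primitive[OF p] by simp
qed

lemma conn_reflect:
  assumes q: "q \<in> conn V a b" shows "(\<lambda>t. q (- t)) \<in> conn V b a"
proof -
  note c = conn_weak_deriv[OF q]
  show ?thesis
  proof (rule connI[OF primitive_reflect[OF c(1)]])
    show "(\<lambda>t. - weak_deriv q (- t)) \<in> L2" by (intro L2_minus L2_reflect c)
    show "integrable lborel (\<lambda>t. V (q (- t)))" using integrable_lborel_affine[OF c(3), of "-1" 0] by simp
    show "((\<lambda>t. q (- t)) \<longlongrightarrow> b) at_bot" "((\<lambda>t. q (- t)) \<longlongrightarrow> a) at_top"
      using c(5,6) by (auto simp: filterlim_at_bot_mirror)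
  qed
qed

lemma min_energy_reflect: "min_energy V a b \<le> min_energy V b a"
  unfolding min_energy_def
proof (rule INF_greatest)
  fix q assume q: "q \<in> conn V b a"
  have "(INF q\<in>conn V a b. energy V q) \<le> energy V (\<lambda>t. q (- t))" by (rule INF_lower[OF conn_reflect[OF q]])
  then show "(INF q\<in>conn V a b. energy V q) \<le> energy V q" by (simp add: energy_reflect[OF conn_weak_deriv(1)[OF q]])
qed

text \<open>Follow \<open>q\<close> up to the time \<open>c\<close>, at which it is close to the well \<open>s\<close>, and then go to \<open>s\<close> on a straight line
  in unit time. As \<open>V\<close> vanishes quadratically at \<open>s\<close>, the detour costs at most a multiple of \<open>\<delta>\<^sup>2\<close>.\<close>

lemma cut_left:
  assumes s: "s \<in> S" and K: "K > 0" "\<And>u. norm (u - s) \<le> 1 \<Longrightarrow> V u \<le> K * (norm (u - s))\<^sup>2"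
    and q: "q \<in> conn V a b" and d: "norm (q c - s) \<le> \<delta>" "\<delta> \<le> 1"
  shows "min_energy V a s \<le> 
    (\<integral>\<^sup>+ t. ennreal ((norm (weak_deriv q t))\<^sup>2 / 2 + V (q t)) * indicator {..c} t \<partial>lborel) + ennreal ((1/2 + K) * \<delta>\<^sup>2)"
proof -
  note cq = conn_weak_deriv[OF q]
  define g where "g = weak_deriv q"
  have g: "primitive q g" "g \<in> L2" using cq by (auto simp: g_def)
  have d0: "\<delta> \<ge> 0" using d(1) norm_ge_zero order_trans by blast
  \<comment> \<open>the straight line from q c to s, constant before time c and after time c + 1\<close>
  define p where "p t = (max c (min (c+1) t)) *\<^sub>R (s - q c) + (q c - c *\<^sub>R (s - q c))" for t
  define h where "h t = indicat_real {c..c+1} t *\<^sub>R (s - q c)" for t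
  have p: "primitive p h" unfolding p_def[abs_def] h_def[abs_def]
    by (rule primitive_add_const[OF primitive_bounded_linear[OF bounded_linear_scaleR_left primitive_clamp]]) simp
  have pc: "q c = p c" by (simp add: p_def)
  have p_end: "p t = s" if "t \<ge> c + 1" for t using that by (simp add: p_def algebra_simps)
  have p_mid: "norm (p t - s) \<le> \<delta>" if "t \<in> {c..c+1}" for t
  proof -
    have "p t - s = (1 - (t - c)) *\<^sub>R (q c - s)" using that by (simp add: p_def algebra_simps)
    then have "norm (p t - s) = (1 - (t - c)) * norm (q c - s)" using that by simp
    also have "\<dots> \<le> norm (q c - s)" using that by (intro mult_left_le_one_le) auto
    finally show ?thesis using d(1) by simp
  qed
  define Q where "Q t = (if t \<le> c then q t else p t)" for t
  define G where "G t = (if t \<le> c then g t else h t)" for t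
  have Q: "primitive Q G" unfolding Q_def[abs_def] G_def[abs_def] by (rule primitive_glue[OF g(1) p pc])
  note [measurable] = primitive_measurable[OF Q] primitive_measurable[OF g(1)]
  have dens: "ennreal ((norm (G t))\<^sup>2 / 2 + V (Q t)) \<le> 
      ennreal ((norm (g t))\<^sup>2 / 2 + V (q t)) * indicator {..c} t + ennreal ((1/2 + K) * \<delta>\<^sup>2) * indicator {c..c+1} t" for t
  proof -
    consider "t \<le> c" | "t > c + 1" | "c < t" "t \<le> c + 1" by linarith
    then show ?thesis
    proof cases
      case 1 then show ?thesis by (simp add: Q_def G_def)
    next
      case 2 then show ?thesis using V_zero[of s] s by (simp add: Q_def G_def h_def p_end)
    next
      case 3
      have "V (p t) \<le> K * (norm (p t - s))\<^sup>2" using p_mid[of t] 3 d(2) by (intro K(2)) auto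
      also have "\<dots> \<le> K * \<delta>\<^sup>2" using p_mid[of t] 3 K(1) by (intro mult_left_mono power_mono) auto
      finally have 4: "V (p t) \<le> K * \<delta>\<^sup>2" .
      have "(norm (s - q c))\<^sup>2 \<le> \<delta>\<^sup>2" using d by (intro power_mono) (auto simp: norm_minus_commute)
      then have "(norm (G t))\<^sup>2 / 2 + V (Q t) \<le> (1/2 + K) * \<delta>\<^sup>2" using 3 4
        by (simp add: G_def Q_def h_def algebra_simps)
      then show ?thesis using 3 by (simp add: ennreal_leI)
    qed
  qed
  have "energy V Q = (\<integral>\<^sup>+ t. ennreal ((norm (G t))\<^sup>2 / 2 + V (Q t)) \<partial>lborel)" by (rule energy_primitive[OF Q])
  also have "\<dots> \<le> (\<integral>\<^sup>+ t. ennreal ((norm (g t))\<^sup>2 / 2 + V (q t)) * indicator {..c} t + ennreal ((1/2 + K) * \<delta>\<^sup>2) * indicator {c..c+1} t \<partial>lborel)"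
    by (rule nn_integral_mono[OF dens])
  also have "\<dots> = (\<integral>\<^sup>+ t. ennreal ((norm (g t))\<^sup>2 / 2 + V (q t)) * indicator {..c} t \<partial>lborel) + ennreal ((1/2 + K) * \<delta>\<^sup>2)"
    by (subst nn_integral_add) (auto simp: nn_integral_cmult_indicator)
  finally have le: "energy V Q \<le> (\<integral>\<^sup>+ t. ennreal ((norm (g t))\<^sup>2 / 2 + V (q t)) * indicator {..c} t \<partial>lborel) + ennreal ((1/2 + K) * \<delta>\<^sup>2)" .
  have "(\<integral>\<^sup>+ t. ennreal ((norm (g t))\<^sup>2 / 2 + V (q t)) * indicator {..c} t \<partial>lborel) \<le> energy V q"
    unfolding energy_primitive[OF g(1)] by (rule nn_integral_mono) (auto simp: indicator_def)
  also have "\<dots> < \<infinity>" using q by (simp add: conn_def)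
  finally have fin: "energy V Q < \<infinity>" by (intro le_less_trans[OF le]) (simp add: ennreal_add_less_top)
  have "Q \<in> conn V a s"
  proof (rule connI[OF Q])
    show "G \<in> L2" "integrable lborel (\<lambda>t. V (Q t))" by (rule energy_L2[OF Q fin])+
    have "\<forall>\<^sub>F t in at_bot. q t = Q t" using eventually_le_at_bot[of c] by eventually_elim (simp add: Q_def)
    then show "(Q \<longlongrightarrow> a) at_bot" by (rule Lim_transform_eventually[OF cq(5)])
    have "\<forall>\<^sub>F t in at_top. Q t = s" using eventually_ge_at_top[of "c+1"] by eventually_elim (simp add: Q_def p_end)
    then show "(Q \<longlongrightarrow> s) at_top" by (rule tendsto_eventually)
  qed
  then have "min_energy V a s \<le> energy V Q" unfolding min_energy_def by (rule INF_lower)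
  then show ?thesis using le by (simp add: g_def)
qed

text \<open>Time reversal turns the estimate for the part before \<open>c\<close> into one for the part after \<open>c\<close>.\<close>

lemma cut:
  assumes s: "s \<in> S" and "\<epsilon> > 0"
  shows "\<exists>\<delta>>0. \<forall>q\<in>conn V a b. \<forall>c. norm (q c - s) \<le> \<delta> \<longrightarrow> min_energy V a s + min_energy V s b \<le> energy V q + ennreal \<epsilon>"
proof -
  obtain K where K: "K > 0" "\<And>u. norm (u - s) \<le> 1 \<Longrightarrow> V u \<le> K * (norm (u - s))\<^sup>2"
    using V_quadratic_upper[OF s] by blast
  define \<delta> where "\<delta> = min 1 (\<epsilon> / (1 + 2 * K))"
  have K': "1 + 2 * K > 0" using K(1) by simp
  have "\<delta> \<le> \<epsilon> / (1 + 2 * K)" by (simp add: \<delta>_def)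
  then have "(1 + 2 * K) * \<delta> \<le> \<epsilon>" using pos_le_divide_eq[OF K'] by (simp add: mult.commute)
  then have \<delta>: "\<delta> > 0" "\<delta> \<le> 1" "(1 + 2 * K) * \<delta> \<le> \<epsilon>" using assms(2) K' by (auto simp: \<delta>_def)
  have small: "2 * ((1/2 + K) * \<delta>\<^sup>2) \<le> \<epsilon>"
  proof -
    have "2 * ((1/2 + K) * \<delta>\<^sup>2) = ((1 + 2 * K) * \<delta>) * \<delta>" by (simp add: power2_eq_square algebra_simps)
    also have "\<dots> \<le> ((1 + 2 * K) * \<delta>) * 1" using \<delta> K(1) by (intro mult_left_mono) auto
    finally show ?thesis using \<delta>(3) by simp
  qed
  have "min_energy V a s + min_energy V s b \<le> energy V q + ennreal \<epsilon>" 
    if q: "q \<in> conn V a b" and c: "norm (q c - s) \<le> \<delta>" for q c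
  proof -
    define g where "g = weak_deriv q"
    have g: "primitive q g" using conn_weak_deriv[OF q] by (simp add: g_def)
    note [measurable] = primitive_measurable[OF g]
    let ?e = "\<lambda>t. ennreal ((norm (g t))\<^sup>2 / 2 + V (q t))"
    let ?\<eta> = "ennreal ((1/2 + K) * \<delta>\<^sup>2)"
    have 1: "min_energy V a s \<le> (\<integral>\<^sup>+ t. ?e t * indicator {..c} t \<partial>lborel) + ?\<eta>"
      using cut_left[OF s K q c \<delta>(2)] by (simp add: g_def)
    have qr: "(\<lambda>t. q (- t)) \<in> conn V b a" by (rule conn_reflect[OF q])
    have "min_energy V b s \<le> (\<integral>\<^sup>+ t. ennreal ((norm (weak_deriv (\<lambda>t. q (- t)) t))\<^sup>2 / 2 + V (q (- t))) * indicator {..-c} t \<partial>lborel) + ?\<eta>"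
      using cut_left[OF s K qr, of "-c" \<delta>] c \<delta>(2) by simp
    also have "(\<integral>\<^sup>+ t. ennreal ((norm (weak_deriv (\<lambda>t. q (- t)) t))\<^sup>2 / 2 + V (q (- t))) * indicator {..-c} t \<partial>lborel) =
      (\<integral>\<^sup>+ t. ?e (- t) * indicator {..-c} t \<partial>lborel)"
    proof (rule nn_integral_cong_AE)
      show "AE t in lborel. ennreal ((norm (weak_deriv (\<lambda>t. q (- t)) t))\<^sup>2 / 2 + V (q (- t))) * indicator {..-c} t = ?e (- t) * indicator {..-c} t"
        using primitive_unique_AE[OF conn_weak_deriv(1)[OF qr] primitive_reflect[OF g]] by eventually_elim simp
    qed
    also have "\<dots> = (\<integral>\<^sup>+ t. ?e t * indicator {c..} t \<partial>lborel)"
    proof -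
      have "(\<integral>\<^sup>+ t. ?e t * indicator {c..} t \<partial>lborel) = (\<integral>\<^sup>+ t. ?e (- t) * indicator {c..} (- t) \<partial>lborel)"
        using nn_integral_real_affine[of "\<lambda>t. ?e t * indicator {c..} t" "-1" 0] by simp
      also have "\<dots> = (\<integral>\<^sup>+ t. ?e (- t) * indicator {..-c} t \<partial>lborel)"
        by (rule nn_integral_cong) (auto simp: indicator_def)
      finally show ?thesis by simp
    qed
    finally have 2: "min_energy V s b \<le> (\<integral>\<^sup>+ t. ?e t * indicator {c..} t \<partial>lborel) + ?\<eta>"
      using min_energy_reflect order_trans by blast
    have "min_energy V a s + min_energy V s b \<le> 
      ((\<integral>\<^sup>+ t. ?e t * indicator {..c} t \<partial>lborel) + ?\<eta>) + ((\<integral>\<^sup>+ t. ?e t * indicator {c..} t \<partial>lborel) + ?\<eta>)"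
      by (rule add_mono[OF 1 2])
    also have "\<dots> = ((\<integral>\<^sup>+ t. ?e t * indicator {..c} t \<partial>lborel) + (\<integral>\<^sup>+ t. ?e t * indicator {c..} t \<partial>lborel)) + (?\<eta> + ?\<eta>)"
      by (simp add: add_ac)
    also have "(\<integral>\<^sup>+ t. ?e t * indicator {..c} t \<partial>lborel) + (\<integral>\<^sup>+ t. ?e t * indicator {c..} t \<partial>lborel) = 
      (\<integral>\<^sup>+ t. ?e t * indicator {..c} t + ?e t * indicator {c..} t \<partial>lborel)"
      by (rule nn_integral_add[symmetric]) auto
    also have "\<dots> = (\<integral>\<^sup>+ t. ?e t \<partial>lborel)"
    proof (rule nn_integral_cong_AE)
      show "AE t in lborel. ?e t * indicator {..c} t + ?e t * indicator {c..} t = ?e t"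
        using AE_lborel_singleton[of c] by eventually_elim (auto simp: indicator_def)
    qed
    also have "\<dots> = energy V q" by (rule energy_primitive[OF g, symmetric])
    also have "?\<eta> + ?\<eta> = ennreal (2 * ((1/2 + K) * \<delta>\<^sup>2))" using K(1) by (simp add: ennreal_plus[symmetric] del: ennreal_plus)
    also have "energy V q + \<dots> \<le> energy V q + ennreal \<epsilon>" by (intro add_left_mono ennreal_leI small)
    finally show ?thesis .
  qed
  then show ?thesis using \<delta>(1) by blast
qed

end

section \<open>The gradient of the energy\<close>

abbreviation L2sq :: "(real \<Rightarrow> 'a::euclidean_space) \<Rightarrow> real" where
  "L2sq f \<equiv> (LINT t|lborel. (norm (f t))\<^sup>2)"

lemma L2sq_nonneg: "0 \<le> L2sq f"
  by simp

lemma L2sq_add_le: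
  assumes "f \<in> L2" "g \<in> L2" shows "L2sq (\<lambda>t. f t + g t) \<le> 2 * L2sq f + 2 * L2sq g"
proof -
  have "L2sq (\<lambda>t. f t + g t) \<le> (LINT t|lborel. 2 * (norm (f t))\<^sup>2 + 2 * (norm (g t))\<^sup>2)"
    by (rule integral_mono) (use assms[THEN L2_integrable] L2_integrable[OF L2_add[OF assms]] norm_add_sq_le in auto)
  also have "\<dots> = 2 * L2sq f + 2 * L2sq g" using assms[THEN L2_integrable] by simp
  finally show ?thesis .
qed

lemma L2sq_scaleR: "L2sq (\<lambda>t. r *\<^sub>R f t) = r\<^sup>2 * L2sq f"
  by (simp add: power_mult_distrib)

lemma L2sq_diff_le:
  assumes "f \<in> L2" "g \<in> L2" shows "L2sq (\<lambda>t. f t - g t) \<le> 2 * L2sq f + 2 * L2sq g"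
  using L2sq_add_le[OF assms(1) L2_minus[OF assms(2)]] by simp

lemma L2sq_mono:
  assumes "f \<in> L2" "g \<in> L2" "AE t in lborel. (norm (f t))\<^sup>2 \<le> C * (norm (g t))\<^sup>2" 
  shows "L2sq f \<le> C * L2sq g"
proof -
  have "L2sq f \<le> (LINT t|lborel. C * (norm (g t))\<^sup>2)"
    by (rule integral_mono_AE) (use assms(1,2)[THEN L2_integrable] assms(3) in auto)
  then show ?thesis by simp
qed

lemma L2sq_cong_AE:
  assumes "f \<in> borel_measurable borel" "g \<in> borel_measurable borel" "AE t in lborel. f t = g t"
  shows "L2sq f = L2sq g"
proof (rule integral_cong_AE)
  note [measurable] = assms(1,2)
  show "(\<lambda>t. (norm (f t))\<^sup>2) \<in> borel_measurable lborel" "(\<lambda>t. (norm (g t))\<^sup>2) \<in> borel_measurable lborel" by measurable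
  show "AE t in lborel. (norm (f t))\<^sup>2 = (norm (g t))\<^sup>2" using assms(3) by eventually_elim simp
qed

lemma L2sq_reflect: "L2sq (\<lambda>t. f (- t)) = L2sq f"
  using integral_reflect[of "\<lambda>t. (norm (f t))\<^sup>2"] by simp

lemma L2_cong_AE:
  assumes "f \<in> L2" "g \<in> borel_measurable borel" "AE t in lborel. g t = f t"
  shows "g \<in> L2"
  by (rule L2_bound[OF assms(1,2), of 1]) (use assms(3) in eventually_elim, simp)

lemma L2_refl1: "f \<in> L2 \<Longrightarrow> (\<lambda>t. refl1 i (f t)) \<in> L2"
  by (rule L2_bounded_linear[OF bounded_linear_refl1])

lemma primitive_refl1: "primitive q g \<Longrightarrow> primitive (\<lambda>t. refl1 i (q t)) (\<lambda>t. refl1 i (g t))"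
  by (rule primitive_bounded_linear[OF bounded_linear_refl1])

text \<open>The part of a curve that is invariant under the simultaneous reflection of time and space. Differentiation
  exchanges it with the anti-invariant part.\<close>

definition symmetrize :: "'n \<Rightarrow> (real \<Rightarrow> real ^ 'n) \<Rightarrow> real \<Rightarrow> real ^ 'n" where
  "symmetrize i w t = (1/2) *\<^sub>R (w t + refl1 i (w (- t)))"

definition antisymmetrize :: "'n \<Rightarrow> (real \<Rightarrow> real ^ 'n) \<Rightarrow> real \<Rightarrow> real ^ 'n" where
  "antisymmetrize i w t = (1/2) *\<^sub>R (w t - refl1 i (w (- t)))"

lemma symmetrize_L2: "w \<in> L2 \<Longrightarrow> symmetrize i w \<in> L2"
  unfolding symmetrize_def[abs_def] by (intro L2_scaleR L2_add L2_refl1 L2_reflect)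

lemma antisymmetrize_L2: "w \<in> L2 \<Longrightarrow> antisymmetrize i w \<in> L2"
  unfolding antisymmetrize_def[abs_def] by (intro L2_scaleR L2_diff L2_refl1 L2_reflect)

lemma primitive_symmetrize:
  assumes "primitive w h" shows "primitive (symmetrize i w) (antisymmetrize i h)"
proof -
  have "primitive (\<lambda>t. (1/2) *\<^sub>R (w t + refl1 i (w (- t)))) (\<lambda>t. (1/2) *\<^sub>R (h t + refl1 i (- h (- t))))"
    by (intro primitive_scaleR primitive_add primitive_refl1 primitive_reflect assms)
  then show ?thesis by (simp add: symmetrize_def[abs_def] antisymmetrize_def[abs_def])
qed

lemma symmetrize_symmetric: "symmetrize i w (- t) = refl1 i (symmetrize i w t)"
  by (simp add: symmetrize_def add.commute)

lemma symmetrize_diff: "symmetrize i v t - symmetrize i w t = symmetrize i (\<lambda>t. v t - w t) t"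
  "antisymmetrize i v t - antisymmetrize i w t = antisymmetrize i (\<lambda>t. v t - w t) t"
  by (simp_all add: symmetrize_def antisymmetrize_def algebra_simps)

lemma L2sq_refl1_reflect: "L2sq (\<lambda>t. refl1 i (f (- t))) = L2sq f"
  using L2sq_reflect[of f] by simp

lemma symmetrize_le: assumes "w \<in> L2" shows "L2sq (symmetrize i w) \<le> L2sq w"
proof -
  have "L2sq (symmetrize i w) = (1/4) * L2sq (\<lambda>t. w t + refl1 i (w (- t)))"
    unfolding symmetrize_def L2sq_scaleR by (simp add: power2_eq_square)
  also have "\<dots> \<le> (1/4) * (2 * L2sq w + 2 * L2sq (\<lambda>t. refl1 i (w (- t))))"
    by (intro mult_left_mono L2sq_add_le L2_refl1 L2_reflect assms) simp
  finally show ?thesis by (simp only: L2sq_refl1_reflect) simp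
qed

lemma antisymmetrize_le: assumes "w \<in> L2" shows "L2sq (antisymmetrize i w) \<le> L2sq w"
proof -
  have "L2sq (antisymmetrize i w) = (1/4) * L2sq (\<lambda>t. w t - refl1 i (w (- t)))"
    unfolding antisymmetrize_def L2sq_scaleR by (simp add: power2_eq_square)
  also have "\<dots> \<le> (1/4) * (2 * L2sq w + 2 * L2sq (\<lambda>t. refl1 i (w (- t))))"
    by (intro mult_left_mono L2sq_diff_le L2_refl1 L2_reflect assms) simp
  finally show ?thesis by (simp only: L2sq_refl1_reflect) simp
qed

context double_well
begin

text \<open>The bound \<open>M\<close> is a parameter because the constants below depend on the curve only through \<open>M\<close> and
  the energy.\<close>

definition finite_curve :: "real \<Rightarrow> (real \<Rightarrow> real ^ 'n) \<Rightarrow> bool" where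
  "finite_curve M q \<longleftrightarrow> primitive q (weak_deriv q) \<and> weak_deriv q \<in> L2 \<and> integrable lborel (\<lambda>t. V (q t)) \<and> (\<forall>t. norm (q t) \<le> M)"

definition real_energy :: "(real \<Rightarrow> real ^ 'n) \<Rightarrow> real" where
  "real_energy q = L2sq (weak_deriv q) / 2 + (LINT t|lborel. V (q t))"

text \<open>With \<open>y\<close> the resolvent of \<open>q' + grad V q\<close>, the residual \<open>R = y - q'\<close> satisfies \<open>q' = y - R\<close> and
  \<open>y' = grad V q - R\<close>. It vanishes if and only if \<open>q'' = grad V q\<close>, which is thereby expressed without a second derivative of \<open>q\<close>.\<close>

definition residual :: "(real \<Rightarrow> real ^ 'n) \<Rightarrow> real \<Rightarrow> real ^ 'n" where
  "residual q t = resolvent (\<lambda>t. weak_deriv q t + grad V (q t)) t - weak_deriv q t"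

text \<open>The gradient \<open>w\<close> of the energy with respect to the inner product of the Sobolev space: \<open>w - w' = R\<close> implies
  \<open>w - w'' = R + R' = (y + y') - (q' + q'') = grad V q - q''\<close>.\<close>

definition correction :: "(real \<Rightarrow> real ^ 'n) \<Rightarrow> real \<Rightarrow> real ^ 'n" where
  "correction q = coresolvent (residual q)"

text \<open>Averaging over the reflection makes the symmetry of the gradient at a symmetric curve evident.\<close>

definition descent :: "(real \<Rightarrow> real ^ 'n) \<Rightarrow> real \<Rightarrow> real ^ 'n" where
  "descent q = symmetrize i (correction q)"

definition descent' :: "(real \<Rightarrow> real ^ 'n) \<Rightarrow> real \<Rightarrow> real ^ 'n" where
  "descent' q = antisymmetrize i (\<lambda>t. correction q t - residual q t)"

lemma real_energy_nonneg: "0 \<le> real_energy q"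
  unfolding real_energy_def by (intro add_nonneg_nonneg Bochner_Integration.integral_nonneg divide_nonneg_nonneg V_nonneg) auto

lemma finite_curveI:
  assumes p: "primitive q g" and g: "g \<in> L2" and Vq: "integrable lborel (\<lambda>t. V (q t))" and M: "\<And>t. norm (q t) \<le> M"
  shows "finite_curve M q" "real_energy q = L2sq g / 2 + (LINT t|lborel. V (q t))"
proof -
  note w = primitive_weak_deriv[OF p]
  note AE = primitive_unique_AE[OF w p]
  have "weak_deriv q \<in> L2" by (rule L2_cong_AE[OF g primitive_measurable(2)[OF w] AE])
  then show "finite_curve M q" using w Vq M by (simp add: finite_curve_def)
  have "L2sq (weak_deriv q) = L2sq g" by (rule L2sq_cong_AE[OF primitive_measurable(2)[OF w] primitive_measurable(2)[OF p] AE])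
  then show "real_energy q = L2sq g / 2 + (LINT t|lborel. V (q t))" by (simp add: real_energy_def)
qed

lemma finite_curve_energy: "finite_curve M q \<Longrightarrow> energy V q = ennreal (real_energy q)"
  unfolding finite_curve_def real_energy_def using energy_eq by blast

lemma conn_finite_curve:
  assumes "q \<in> conn V a b" "\<And>t. norm (q t) \<le> M" shows "finite_curve M q"
  using conn_weak_deriv[OF assms(1)] assms(2) by (simp add: finite_curve_def)

context
  fixes M and q :: "real \<Rightarrow> real ^ 'n"
  assumes q: "finite_curve M q"
begin

lemma finite_curve_prim: "primitive q (weak_deriv q)" and finite_curve_deriv_L2: "weak_deriv q \<in> L2" 
  and finite_curve_V: "integrable lborel (\<lambda>t. V (q t))" and finite_curve_bound: "norm (q t) \<le> M"
  using q by (auto simp: finite_curve_def)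

lemma finite_curve_grad_L2: "(\<lambda>t. grad V (q t)) \<in> L2"
  by (rule grad_L2[OF primitive_measurable(1)[OF finite_curve_prim] finite_curve_bound finite_curve_V])

lemma force_L2: "(\<lambda>t. weak_deriv q t + grad V (q t)) \<in> L2"
  by (rule L2_add[OF finite_curve_deriv_L2 finite_curve_grad_L2])

lemma resolvent_force:
  "resolvent (\<lambda>t. weak_deriv q t + grad V (q t)) \<in> L2"
  "primitive (resolvent (\<lambda>t. weak_deriv q t + grad V (q t))) (\<lambda>t. grad V (q t) - residual q t)"
  using resolvent_L2[OF force_L2] primitive_resolvent[OF force_L2] by (auto simp: residual_def algebra_simps)

lemma residual_L2: "residual q \<in> L2"
  unfolding residual_def[abs_def] by (rule L2_diff[OF resolvent_force(1) finite_curve_deriv_L2])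

lemma correction_L2: "correction q \<in> L2" 
  and primitive_correction: "primitive (correction q) (\<lambda>t. correction q t - residual q t)"
  unfolding correction_def using coresolvent_L2[OF residual_L2] primitive_coresolvent[OF residual_L2] by auto

lemma correction_norm: "L2sq (correction q) + L2sq (\<lambda>t. correction q t - residual q t) = L2sq (residual q)"
  by (rule backward_energy[OF residual_L2 correction_L2 primitive_correction])

lemma correction'_L2: "(\<lambda>t. correction q t - residual q t) \<in> L2"
  by (rule L2_diff[OF correction_L2 residual_L2])

lemma descent_L2: "descent q \<in> L2" and descent'_L2: "descent' q \<in> L2" 
  and primitive_descent: "primitive (descent q) (descent' q)"
  unfolding descent_def descent'_def 
  by (auto intro: symmetrize_L2 antisymmetrize_L2 correction_L2 correction'_L2 primitive_symmetrize primitive_correction)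

lemma descent_norm: "L2sq (descent q) + L2sq (descent' q) \<le> L2sq (residual q)"
  unfolding descent_def descent'_def 
  by (rule order_trans[OF add_mono[OF symmetrize_le[OF correction_L2] antisymmetrize_le[OF correction'_L2]] eq_refl[OF correction_norm]])

text \<open>Insert \<open>q' = y - R\<close> and integrate \<open>y \<bullet> w'\<close> by parts, using \<open>y' = grad V q - R\<close>; what remains is the product of
  \<open>R\<close> with \<open>w - w' = R\<close>.\<close>

lemma correction_first_variation:
  "(LINT t|lborel. weak_deriv q t \<bullet> (correction q t - residual q t) + grad V (q t) \<bullet> correction q t) = L2sq (residual q)"
proof -
  let ?y = "resolvent (\<lambda>t. weak_deriv q t + grad V (q t))"
  let ?w = "correction q" and ?R = "residual q"
  have yL: "(\<lambda>t. grad V (q t) - ?R t) \<in> L2" by (rule L2_diff[OF finite_curve_grad_L2 residual_L2])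
  have i: "integrable lborel (\<lambda>t. (grad V (q t) - ?R t) \<bullet> ?w t)" "integrable lborel (\<lambda>t. ?y t \<bullet> (?w t - ?R t))"
    by (intro L2_inner_integrable yL correction_L2 resolvent_force correction'_L2)+
  have "(LINT t|lborel. weak_deriv q t \<bullet> (?w t - ?R t) + grad V (q t) \<bullet> ?w t) = 
     (LINT t|lborel. ((grad V (q t) - ?R t) \<bullet> ?w t + ?y t \<bullet> (?w t - ?R t)) + (norm (?R t))\<^sup>2)"
    by (rule Bochner_Integration.integral_cong)
      (auto simp: residual_def power2_norm_eq_inner algebra_simps inner_commute)
  also have "\<dots> = ((LINT t|lborel. (grad V (q t) - ?R t) \<bullet> ?w t) + (LINT t|lborel. ?y t \<bullet> (?w t - ?R t))) + L2sq ?R"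
    using i L2_integrable[OF residual_L2] by simp
  also have "\<dots> = L2sq ?R"
    using integration_by_parts[OF resolvent_force(2,1) yL primitive_correction correction_L2 correction'_L2] by simp
  finally show ?thesis .
qed

lemma weak_deriv_symmetric:
  assumes sym: "\<And>t. q (- t) = refl1 i (q t)"
  shows "AE t in lborel. weak_deriv q (- t) = - refl1 i (weak_deriv q t)"
proof -
  have "primitive (\<lambda>t. refl1 i (q t)) (\<lambda>t. - weak_deriv q (- t))"
    using primitive_reflect[OF finite_curve_prim] sym by simp
  from primitive_unique_AE[OF this primitive_refl1[OF finite_curve_prim]]
  show ?thesis by eventually_elim (metis minus_minus)
qed

text \<open>At a symmetric curve the first variation takes the same value on \<open>w\<close> and on its reflection.\<close>

lemma first_variation:
  assumes sym: "\<And>t. q (- t) = refl1 i (q t)"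
  shows "(LINT t|lborel. weak_deriv q t \<bullet> descent' q t + grad V (q t) \<bullet> descent q t) = L2sq (residual q)"
proof -
  let ?w = "correction q" and ?h = "\<lambda>t. correction q t - residual q t" and ?g = "weak_deriv q" and ?F = "\<lambda>t. grad V (q t)"
  note [measurable] = L2_measurable[OF finite_curve_deriv_L2] L2_measurable[OF correction'_L2]
  have rh: "(\<lambda>t. refl1 i (?h (- t))) \<in> L2" and rw: "(\<lambda>t. refl1 i (?w (- t))) \<in> L2"
    by (intro L2_refl1 L2_reflect correction'_L2) (intro L2_refl1 L2_reflect correction_L2)
  have i: "integrable lborel (\<lambda>t. ?g t \<bullet> ?h t)" "integrable lborel (\<lambda>t. ?F t \<bullet> ?w t)"
    "integrable lborel (\<lambda>t. ?g t \<bullet> refl1 i (?h (- t)))" "integrable lborel (\<lambda>t. ?F t \<bullet> refl1 i (?w (- t)))"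
    by (intro L2_inner_integrable finite_curve_deriv_L2 finite_curve_grad_L2 correction_L2 correction'_L2 rh rw)+
  have "(LINT t|lborel. ?g t \<bullet> refl1 i (?h (- t))) = (LINT t|lborel. ?g (- t) \<bullet> refl1 i (?h t))"
    using integral_reflect[of "\<lambda>t. ?g t \<bullet> refl1 i (?h (- t))"] by simp
  also have "\<dots> = (LINT t|lborel. - (?g t \<bullet> ?h t))"
  proof (rule integral_cong_AE)
    have [measurable]: "refl1 i \<in> borel_measurable borel"
      by (intro borel_measurable_continuous_onI linear_continuous_on bounded_linear_refl1)
    show "(\<lambda>t. ?g (- t) \<bullet> refl1 i (?h t)) \<in> borel_measurable lborel" "(\<lambda>t. - (?g t \<bullet> ?h t)) \<in> borel_measurable lborel" by measurable
    show "AE t in lborel. ?g (- t) \<bullet> refl1 i (?h t) = - (?g t \<bullet> ?h t)"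
      using weak_deriv_symmetric[OF sym] by eventually_elim (simp add: refl1_inner del: refl1_simps(3))
  qed
  finally have 1: "(LINT t|lborel. ?g t \<bullet> refl1 i (?h (- t))) = - (LINT t|lborel. ?g t \<bullet> ?h t)" by simp
  have "(LINT t|lborel. ?F t \<bullet> refl1 i (?w (- t))) = (LINT t|lborel. ?F (- t) \<bullet> refl1 i (?w t))"
    using integral_reflect[of "\<lambda>t. ?F t \<bullet> refl1 i (?w (- t))"] by simp
  also have "\<dots> = (LINT t|lborel. ?F t \<bullet> ?w t)"
    by (rule Bochner_Integration.integral_cong) (auto simp: sym grad_refl refl1_inner)
  finally have 2: "(LINT t|lborel. ?F t \<bullet> refl1 i (?w (- t))) = (LINT t|lborel. ?F t \<bullet> ?w t)" .
  have "(LINT t|lborel. ?g t \<bullet> descent' q t + ?F t \<bullet> descent q t) = 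
    (LINT t|lborel. (1/2) * (?g t \<bullet> ?h t - ?g t \<bullet> refl1 i (?h (- t))) + (1/2) * (?F t \<bullet> ?w t + ?F t \<bullet> refl1 i (?w (- t))))"
    by (rule Bochner_Integration.integral_cong)
      (simp_all add: descent_def descent'_def symmetrize_def antisymmetrize_def inner_add_right inner_diff_right del: refl1_simps(3))
  also have "\<dots> = (LINT t|lborel. ?g t \<bullet> ?h t) + (LINT t|lborel. ?F t \<bullet> ?w t)"
    using i 1 2 by simp
  also have "\<dots> = (LINT t|lborel. ?g t \<bullet> ?h t + ?F t \<bullet> ?w t)" using i by simp
  also have "\<dots> = L2sq (residual q)" by (rule correction_first_variation)
  finally show ?thesis .
qed

lemma force_bound:
  assumes C: "\<And>u. u \<in> cball 0 M \<Longrightarrow> (norm (grad V u))\<^sup>2 \<le> C * V u" "C > 0"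
  shows "L2sq (\<lambda>t. weak_deriv q t + grad V (q t)) \<le> (4 + 2 * C) * real_energy q"
proof -
  have "L2sq (\<lambda>t. grad V (q t)) \<le> (LINT t|lborel. C * V (q t))"
    by (rule integral_mono) (use L2_integrable[OF finite_curve_grad_L2] finite_curve_V C finite_curve_bound in auto)
  then have F: "L2sq (\<lambda>t. grad V (q t)) \<le> C * (LINT t|lborel. V (q t))" by simp
  have "L2sq (\<lambda>t. weak_deriv q t + grad V (q t)) \<le> 2 * L2sq (weak_deriv q) + 2 * L2sq (\<lambda>t. grad V (q t))"
    by (rule L2sq_add_le[OF finite_curve_deriv_L2 finite_curve_grad_L2])
  moreover have "0 \<le> L2sq (weak_deriv q)" "0 \<le> (LINT t|lborel. V (q t))" 
    by (simp, intro Bochner_Integration.integral_nonneg V_nonneg)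
  then have "0 \<le> C * L2sq (weak_deriv q)" "0 \<le> (LINT t|lborel. V (q t))" using C(2) by auto
  moreover have "(4 + 2 * C) * (x / 2 + v) = 2 * x + 4 * v + (C * x) + 2 * (C * v)" for x v
    by (simp add: algebra_simps)
  ultimately show ?thesis unfolding real_energy_def using F by simp
qed

lemma residual_bound:
  assumes C: "\<And>u. u \<in> cball 0 M \<Longrightarrow> (norm (grad V u))\<^sup>2 \<le> C * V u" "C > 0"
  shows "L2sq (residual q) \<le> (12 + 4 * C) * real_energy q"
proof -
  let ?y = "resolvent (\<lambda>t. weak_deriv q t + grad V (q t))" and ?f = "\<lambda>t. weak_deriv q t + grad V (q t)"
  have "L2sq ?y \<le> L2sq ?f"
    using first_order_energy[OF force_L2 resolvent_force(1) primitive_resolvent[OF force_L2]] L2sq_nonneg[of "\<lambda>t. ?f t - ?y t"] by linarith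
  moreover have "L2sq ?f \<le> (4 + 2 * C) * real_energy q" by (rule force_bound[OF C])
  moreover have "L2sq (residual q) \<le> 2 * L2sq ?y + 2 * L2sq (weak_deriv q)"
    unfolding residual_def by (rule L2sq_diff_le[OF resolvent_force(1) finite_curve_deriv_L2])
  moreover have "L2sq (weak_deriv q) \<le> 2 * real_energy q"
    using Bochner_Integration.integral_nonneg[of lborel "\<lambda>t. V (q t)"] V_nonneg by (simp add: real_energy_def)
  ultimately show ?thesis by (simp add: algebra_simps)
qed

end

lemma norm_diff_scaleR_sq:
  "(norm (a - r *\<^sub>R b))\<^sup>2 = (norm a)\<^sup>2 - 2 * r * (a \<bullet> b) + r\<^sup>2 * (norm b)\<^sup>2"
  unfolding power2_norm_eq_inner by (simp add: inner_diff_left inner_diff_right inner_commute power2_eq_square)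

text \<open>Along the gradient direction the energy decreases to first order by the square of the residual,
  and the second order error is at most \<open>\<tau>\<^sup>2 (1/2 + K)\<close> times the same quantity. The step size is uniform on an energy
  sublevel, because there the residual and with it the supremum of the step are bounded.\<close>

lemma energy_descent:
  assumes "E \<ge> 0"
  shows "\<exists>\<tau>>0. \<exists>M'. \<forall>q. finite_curve M q \<and> real_energy q \<le> E \<and> (\<forall>t. q (- t) = refl1 i (q t)) \<longrightarrow>
    finite_curve M' (\<lambda>t. q t - \<tau> *\<^sub>R descent q t) \<and>
    real_energy (\<lambda>t. q t - \<tau> *\<^sub>R descent q t) + \<tau> / 2 * L2sq (residual q) \<le> real_energy q"
proof -
  obtain C where C: "C > 0" "\<And>u. u \<in> cball 0 M \<Longrightarrow> (norm (grad V u))\<^sup>2 \<le> C * V u" using grad_sq_le by blast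
  define A where "A = (12 + 4 * C) * E"
  define W where "W = sqrt A"
  have A0: "A \<ge> 0" using C(1) assms by (simp add: A_def)
  obtain K where K: "K > 0" "\<forall>x\<in>cball 0 (M+W). \<forall>y\<in>cball 0 (M+W). norm (grad V x - grad V y) \<le> K * norm (x - y)"
    using grad_Lipschitz by blast
  \<comment> \<open>half of the gain of first order is spent on the error of second order\<close>
  define \<tau> where "\<tau> = min 1 (1 / (1 + 2 * K))"
  have K': "1 + 2 * K > 0" using K(1) by simp
  have "\<tau> \<le> 1 / (1 + 2 * K)" by (simp add: \<tau>_def)
  then have "\<tau> * (1 + 2 * K) \<le> 1" using pos_le_divide_eq[OF K'] by simp
  then have \<tau>: "\<tau> > 0" "\<tau> \<le> 1" "\<tau> * (1/2 + K) \<le> 1/2" using K' by (auto simp: \<tau>_def algebra_simps)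
  have "finite_curve (M+W) (\<lambda>t. q t - \<tau> *\<^sub>R descent q t) \<and>
    real_energy (\<lambda>t. q t - \<tau> *\<^sub>R descent q t) + \<tau> / 2 * L2sq (residual q) \<le> real_energy q"
    if q: "finite_curve M q" and E: "real_energy q \<le> E" and sym: "\<And>t. q (- t) = refl1 i (q t)" for q
  proof -
    let ?D = "descent q" and ?D' = "descent' q" and ?g = "weak_deriv q" and ?R = "residual q"
    let ?p = "\<lambda>t. q t - \<tau> *\<^sub>R descent q t"
    note DL = descent_L2[OF q] descent'_L2[OF q] and prim = finite_curve_prim[OF q] primitive_descent[OF q]
    note gL = finite_curve_deriv_L2[OF q] and FL = finite_curve_grad_L2[OF q]
    have "L2sq ?R \<le> (12 + 4 * C) * real_energy q" by (rule residual_bound[OF q C(2,1)])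
    also have "\<dots> \<le> A" unfolding A_def using E C(1) by (intro mult_left_mono) auto
    finally have RA: "L2sq ?R \<le> A" .
    have D: "norm (?D t) \<le> W" for t
    proof -
      have "(norm (?D t))\<^sup>2 \<le> A" 
        by (rule order_trans[OF order_trans[OF sup_bound[OF prim(2) DL] descent_norm[OF q]] RA])
      then show ?thesis unfolding W_def by (simp add: real_le_rsqrt)
    qed
    have tD: "norm (\<tau> *\<^sub>R ?D t) \<le> W" for t
    proof -
      have "norm (\<tau> *\<^sub>R ?D t) \<le> norm (?D t)" using \<tau> by (simp add: mult_left_le_one_le)
      then show ?thesis using D[of t] by simp
    qed
    have W0: "W \<ge> 0" using A0 by (simp add: W_def)
    have pb: "norm (?p t) \<le> M + W" for t
      using norm_triangle_ineq4[of "q t" "\<tau> *\<^sub>R ?D t"] finite_curve_bound[OF q, of t] tD[of t] by linarith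
    have pp: "primitive ?p (\<lambda>t. ?g t - \<tau> *\<^sub>R ?D' t)" by (intro primitive_diff primitive_scaleR prim)
    have ppL: "(\<lambda>t. ?g t - \<tau> *\<^sub>R ?D' t) \<in> L2" by (intro L2_diff L2_scaleR gL DL)
    note [measurable] = primitive_measurable[OF pp]
    \<comment> \<open>the Taylor bound for the potential along the new curve\<close>
    define U where "U t = V (q t) - \<tau> * (grad V (q t) \<bullet> ?D t) + K * \<tau>\<^sup>2 * (norm (?D t))\<^sup>2" for t
    have VU: "V (?p t) \<le> U t" for t
    proof -
      have "q t \<in> cball 0 (M+W)" using finite_curve_bound[OF q, of t] W0 by simp
      moreover have "q t + (- \<tau> *\<^sub>R ?D t) \<in> cball 0 (M+W)" using pb[of t] by simp
      ultimately have "V (q t + (- \<tau> *\<^sub>R ?D t)) - V (q t) - grad V (q t) \<bullet> (- \<tau> *\<^sub>R ?D t) \<le> K * (norm (- \<tau> *\<^sub>R ?D t))\<^sup>2"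
        using C2_potential_Taylor[OF C2 K(2,1)] abs_le_iff by blast
      then show ?thesis by (simp add: U_def power_mult_distrib algebra_simps)
    qed
    have iF: "integrable lborel (\<lambda>t. grad V (q t) \<bullet> ?D t)" by (rule L2_inner_integrable[OF FL DL(1)])
    have iU: "integrable lborel U" unfolding U_def[abs_def]
      using iF L2_integrable[OF DL(1)] finite_curve_V[OF q] by auto
    have iV: "integrable lborel (\<lambda>t. V (?p t))"
    proof (rule Bochner_Integration.integrable_bound[OF iU])
      show "AE t in lborel. norm (V (?p t)) \<le> norm (U t)"
        using VU V_nonneg by (intro AE_I2) (metis abs_of_nonneg order_trans real_norm_def)
    qed measurable
    have ig: "integrable lborel (\<lambda>t. ?g t \<bullet> ?D' t)" by (rule L2_inner_integrable[OF gL DL(2)])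
    have 1: "(LINT t|lborel. V (?p t)) \<le> (LINT t|lborel. V (q t)) - \<tau> * (LINT t|lborel. grad V (q t) \<bullet> ?D t) + K * \<tau>\<^sup>2 * L2sq ?D"
    proof -
      have "(LINT t|lborel. V (?p t)) \<le> (LINT t|lborel. U t)" by (rule integral_mono[OF iV iU VU])
      then show ?thesis unfolding U_def using iF L2_integrable[OF DL(1)] finite_curve_V[OF q] by simp
    qed
    have 2: "L2sq (\<lambda>t. ?g t - \<tau> *\<^sub>R ?D' t) / 2 = L2sq ?g / 2 - \<tau> * (LINT t|lborel. ?g t \<bullet> ?D' t) + (1/2) * \<tau>\<^sup>2 * L2sq ?D'"
    proof -
      have "L2sq (\<lambda>t. ?g t - \<tau> *\<^sub>R ?D' t) = (LINT t|lborel. ((norm (?g t))\<^sup>2 - 2 * \<tau> * (?g t \<bullet> ?D' t)) + \<tau>\<^sup>2 * (norm (?D' t))\<^sup>2)"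
        by (rule Bochner_Integration.integral_cong) 
          (auto simp: norm_diff_scaleR_sq)
      also have "\<dots> = L2sq ?g - 2 * \<tau> * (LINT t|lborel. ?g t \<bullet> ?D' t) + \<tau>\<^sup>2 * L2sq ?D'"
        using ig L2_integrable[OF gL] L2_integrable[OF DL(2)] by simp
      finally show ?thesis by simp
    qed
    have 3: "(LINT t|lborel. ?g t \<bullet> ?D' t) + (LINT t|lborel. grad V (q t) \<bullet> ?D t) = L2sq ?R"
      using first_variation[OF q sym] iF ig by simp
    have 4: "K * \<tau>\<^sup>2 * L2sq ?D + (1/2) * \<tau>\<^sup>2 * L2sq ?D' \<le> \<tau> / 2 * L2sq ?R"
    proof -
      have "K * \<tau>\<^sup>2 * L2sq ?D \<le> (1/2 + K) * \<tau>\<^sup>2 * L2sq ?D" "(1/2) * \<tau>\<^sup>2 * L2sq ?D' \<le> (1/2 + K) * \<tau>\<^sup>2 * L2sq ?D'"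
        using K(1) by (intro mult_right_mono; simp)+
      then have "K * \<tau>\<^sup>2 * L2sq ?D + (1/2) * \<tau>\<^sup>2 * L2sq ?D' \<le> (1/2 + K) * \<tau>\<^sup>2 * (L2sq ?D + L2sq ?D')"
        unfolding distrib_left by linarith
      also have "\<dots> \<le> (1/2 + K) * \<tau>\<^sup>2 * L2sq ?R" using K(1) by (intro mult_left_mono descent_norm[OF q]) simp
      also have "(1/2 + K) * \<tau>\<^sup>2 * L2sq ?R = \<tau> * (1/2 + K) * (\<tau> * L2sq ?R)" by (simp add: power2_eq_square)
      also have "\<dots> \<le> 1/2 * (\<tau> * L2sq ?R)" using \<tau> by (intro mult_right_mono) auto
      finally show ?thesis by simp
    qed
    note fc = finite_curveI[OF pp ppL iV pb]
    have "\<tau> * (LINT t|lborel. ?g t \<bullet> ?D' t) + \<tau> * (LINT t|lborel. grad V (q t) \<bullet> ?D t) = \<tau> * L2sq ?R"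
      unfolding 3[symmetric] by (simp add: distrib_left)
    then have "real_energy ?p + \<tau> / 2 * L2sq ?R \<le> real_energy q"
      using 1 2 4 unfolding fc(2) real_energy_def[of q] by linarith
    then show ?thesis using fc(1) by simp
  qed
  then show ?thesis using \<tau>(1) by blast
qed

text \<open>The gradient depends Lipschitz continuously on the curve: all operations involved are linear with
  the exception of the composition with \<open>grad V\<close>, which is Lipschitz on balls.\<close>

lemma descent_Lipschitz:
  "\<exists>C>0. \<forall>p q. finite_curve M p \<and> finite_curve M q \<and> (\<lambda>t. p t - q t) \<in> L2 \<longrightarrow>
     L2sq (\<lambda>t. descent p t - descent q t) + L2sq (\<lambda>t. descent' p t - descent' q t)
      \<le> C * (L2sq (\<lambda>t. p t - q t) + L2sq (\<lambda>t. weak_deriv p t - weak_deriv q t))"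
proof -
  obtain K where K: "K > 0" "\<forall>x\<in>cball 0 M. \<forall>y\<in>cball 0 M. norm (grad V x - grad V y) \<le> K * norm (x - y)"
    using grad_Lipschitz by blast
  have "L2sq (\<lambda>t. descent p t - descent q t) + L2sq (\<lambda>t. descent' p t - descent' q t)
      \<le> (6 + 4 * K\<^sup>2) * (L2sq (\<lambda>t. p t - q t) + L2sq (\<lambda>t. weak_deriv p t - weak_deriv q t))"
    if p: "finite_curve M p" and q: "finite_curve M q" and d: "(\<lambda>t. p t - q t) \<in> L2" for p q
  proof -
    let ?g = "\<lambda>t. weak_deriv p t - weak_deriv q t"
    let ?F = "\<lambda>t. grad V (p t) - grad V (q t)"
    let ?f = "\<lambda>t. (weak_deriv p t + grad V (p t)) - (weak_deriv q t + grad V (q t))"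
    let ?yp = "resolvent (\<lambda>t. weak_deriv p t + grad V (p t))" and ?yq = "resolvent (\<lambda>t. weak_deriv q t + grad V (q t))"
    let ?y = "\<lambda>t. ?yp t - ?yq t"
    let ?R = "\<lambda>t. residual p t - residual q t"
    let ?w = "\<lambda>t. correction p t - correction q t"
    have gL: "?g \<in> L2" by (rule L2_diff[OF finite_curve_deriv_L2[OF p] finite_curve_deriv_L2[OF q]])
    have FL: "?F \<in> L2" by (rule L2_diff[OF finite_curve_grad_L2[OF p] finite_curve_grad_L2[OF q]])
    have fL: "?f \<in> L2" by (rule L2_diff[OF force_L2[OF p] force_L2[OF q]])
    have yL: "?y \<in> L2" by (rule L2_diff[OF resolvent_force(1)[OF p] resolvent_force(1)[OF q]])
    have RL: "?R \<in> L2" by (rule L2_diff[OF residual_L2[OF p] residual_L2[OF q]])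
    have wL: "?w \<in> L2" by (rule L2_diff[OF correction_L2[OF p] correction_L2[OF q]])
    have F: "L2sq ?F \<le> K\<^sup>2 * L2sq (\<lambda>t. p t - q t)"
    proof (rule L2sq_mono[OF FL d], intro AE_I2)
      fix t
      have "norm (?F t) \<le> K * norm (p t - q t)" 
        using K(2) finite_curve_bound[OF p, of t] finite_curve_bound[OF q, of t] by simp
      from power_mono[OF this, of 2] show "(norm (?F t))\<^sup>2 \<le> K\<^sup>2 * (norm (p t - q t))\<^sup>2" by (simp add: power_mult_distrib)
    qed
    have f: "L2sq ?f \<le> 2 * L2sq ?g + 2 * L2sq ?F"
      using L2sq_add_le[OF gL FL] by (simp add: algebra_simps)
    have "primitive ?y (\<lambda>t. ?f t - ?y t)"
      using primitive_diff[OF primitive_resolvent[OF force_L2[OF p]] primitive_resolvent[OF force_L2[OF q]]]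
      by (simp add: algebra_simps)
    from first_order_energy[OF fL yL this] have y: "L2sq ?y \<le> L2sq ?f"
      using L2sq_nonneg[of "\<lambda>t. ?f t - ?y t"] by linarith
    have R: "L2sq ?R \<le> 2 * L2sq ?y + 2 * L2sq ?g"
      using L2sq_diff_le[OF yL gL] by (simp add: residual_def algebra_simps)
    have pw: "primitive ?w (\<lambda>t. ?w t - ?R t)"
      using primitive_diff[OF primitive_correction[OF p] primitive_correction[OF q]] by (simp add: algebra_simps)
    have hL: "(\<lambda>t. ?w t - ?R t) \<in> L2" by (rule L2_diff[OF wL RL])
    have "L2sq (\<lambda>t. descent p t - descent q t) \<le> L2sq ?w"
      unfolding descent_def symmetrize_diff by (rule symmetrize_le[OF wL])
    moreover have "L2sq (\<lambda>t. descent' p t - descent' q t) \<le> L2sq (\<lambda>t. ?w t - ?R t)"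
    proof -
      have "(\<lambda>t. (correction p t - residual p t) - (correction q t - residual q t)) = (\<lambda>t. ?w t - ?R t)" by auto
      then show ?thesis unfolding descent'_def symmetrize_diff using antisymmetrize_le[OF hL] by simp
    qed
    moreover have "L2sq ?w + L2sq (\<lambda>t. ?w t - ?R t) = L2sq ?R" by (rule backward_energy[OF RL wL pw])
    moreover have "0 \<le> L2sq (\<lambda>t. p t - q t)" "0 \<le> K\<^sup>2 * L2sq ?g" by auto
    ultimately show ?thesis using f y R F unfolding distrib_left distrib_right by linarith
  qed
  then show ?thesis by (intro exI[of _ "6 + 4 * K\<^sup>2"]) (auto intro: add_pos_nonneg)
qed

lemma descent_zero:
  assumes q: "finite_curve M q" and R: "L2sq (residual q) \<le> 0"
  shows "descent q t = 0"
proof -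
  have "(norm (descent q t))\<^sup>2 \<le> 0"
    using sup_bound[OF primitive_descent[OF q] descent_L2[OF q] descent'_L2[OF q], of t] descent_norm[OF q] R by linarith
  then show ?thesis by simp
qed

end

section \<open>Folding a symmetric curve into the positive half space\<close>

text \<open>The distinguished coordinate is replaced by the odd function that has the same modulus and is nonnegative for
  \<open>t \<ge> 0\<close>. At each time the curve is either kept or reflected (\<open>fold_curve_cases\<close>).\<close>

definition fold_curve :: "'n \<Rightarrow> (real \<Rightarrow> real ^ 'n) \<Rightarrow> real \<Rightarrow> real ^ 'n" where
  "fold_curve i q t = q t + (odd_abs (\<lambda>t. q t $ i) t - q t $ i) *\<^sub>R axis i 1"

definition fold_deriv :: "'n \<Rightarrow> (real \<Rightarrow> real ^ 'n) \<Rightarrow> (real \<Rightarrow> real ^ 'n) \<Rightarrow> real \<Rightarrow> real ^ 'n" where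
  "fold_deriv i q g t = g t + (odd_sgn (\<lambda>t. q t $ i) t * g t $ i - g t $ i) *\<^sub>R axis i 1"

lemma fold_curve_component [simp]: "fold_curve i q t $ i = odd_abs (\<lambda>t. q t $ i) t"
  by (simp add: fold_curve_def)

lemma fold_curve_cases: "fold_curve i q t = q t \<or> fold_curve i q t = refl1 i (q t)"
proof -
  have "odd_abs (\<lambda>t. q t $ i) t = q t $ i \<or> odd_abs (\<lambda>t. q t $ i) t = - (q t $ i)"
    by (auto simp: odd_abs_def)
  moreover have "(- (q t $ i) - q t $ i) *\<^sub>R axis i 1 = - ((2 * (q t $ i)) *\<^sub>R axis i (1::real))"
    by (simp only: scaleR_minus_left[symmetric]) simp
  ultimately show ?thesis by (auto simp: fold_curve_def refl1_component)
qed

lemma odd_abs_Lipschitz: "\<bar>odd_abs f t - odd_abs h t\<bar> \<le> \<bar>f t - h t\<bar>"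
  unfolding odd_abs_def by auto

lemma odd_sgn_le: "\<bar>odd_sgn f t\<bar> \<le> 1"
  unfolding odd_sgn_def by (auto simp: sgn_if)

lemma norm_replace_component:
  fixes a :: "real ^ 'n"
  assumes "\<bar>k\<bar> \<le> \<bar>a $ i\<bar>"
  shows "norm (a + (k - a $ i) *\<^sub>R axis i 1) \<le> norm a"
proof -
  have "(norm (a + (k - a $ i) *\<^sub>R axis i 1))\<^sup>2 = (norm a)\<^sup>2 + 2 * (k - a $ i) * (a $ i) + (k - a $ i)\<^sup>2"
    unfolding power2_norm_eq_inner
    by (simp add: inner_add_left inner_add_right inner_axis inner_axis' power2_eq_square algebra_simps)
  also have "\<dots> = (norm a)\<^sup>2 + k\<^sup>2 - (a $ i)\<^sup>2" by (simp add: power2_eq_square algebra_simps)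
  also have "\<dots> \<le> (norm a)\<^sup>2" using assms by (simp add: abs_le_square_iff)
  finally show ?thesis by (rule power2_le_imp_le) simp
qed

lemma fold_curve_Lipschitz: "norm (fold_curve i p t - fold_curve i q t) \<le> norm (p t - q t)"
proof -
  have "fold_curve i p t - fold_curve i q t = (p t - q t) + ((odd_abs (\<lambda>t. p t $ i) t - odd_abs (\<lambda>t. q t $ i) t) - (p t - q t) $ i) *\<^sub>R axis i 1"
    by (simp add: fold_curve_def algebra_simps)
  also have "norm \<dots> \<le> norm (p t - q t)"
    by (rule norm_replace_component) (use odd_abs_Lipschitz[of "\<lambda>t. p t $ i" t "\<lambda>t. q t $ i"] in simp)
  finally show ?thesis .
qed

lemma fold_deriv_norm: "norm (fold_deriv i q g t) \<le> norm (g t)"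
  unfolding fold_deriv_def
  by (rule norm_replace_component) (use odd_sgn_le[of "\<lambda>t. q t $ i" t] in \<open>simp add: abs_mult mult_left_le_one_le\<close>)

lemma primitive_fold_curve:
  assumes p: "primitive q g" and q0: "q 0 $ i = 0"
  shows "primitive (fold_curve i q) (fold_deriv i q g)"
proof -
  have pi: "primitive (\<lambda>t. q t $ i) (\<lambda>t. g t $ i)" by (rule primitive_bounded_linear[OF bounded_linear_vec_nth p])
  have po: "primitive (odd_abs (\<lambda>t. q t $ i)) (\<lambda>t. odd_sgn (\<lambda>t. q t $ i) t * g t $ i)"
    by (rule primitive_odd_abs[OF pi q0])
  show ?thesis unfolding fold_curve_def[abs_def] fold_deriv_def[abs_def]
    by (rule primitive_add[OF p primitive_bounded_linear[OF bounded_linear_scaleR_left primitive_diff[OF po pi]]])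
qed

lemma symmetric_component:
  fixes q :: "real \<Rightarrow> real ^ 'n"
  assumes "\<And>t. q (- t) = refl1 i (q t)"
  shows "q (- t) $ i = - (q t $ i)" "q 0 $ i = 0"
proof -
  show 1: "q (- t) $ i = - (q t $ i)" for t using assms[of t] by (simp add: refl1_def)
  show "q 0 $ i = 0" using 1[of 0] by simp
qed

lemma fold_curve_symmetric:
  assumes sym: "\<And>t. q (- t) = refl1 i (q t)"
  shows "fold_curve i q (- t) = refl1 i (fold_curve i q t)"
proof -
  have "odd_abs (\<lambda>t. q t $ i) (- t) = - odd_abs (\<lambda>t. q t $ i) t"
    using symmetric_component[of q i, OF sym] by (cases "t = 0") (auto simp: odd_abs_def)
  moreover have "refl1 i (axis i 1) = - axis i 1" by (simp add: refl1_def vec_eq_iff axis_def)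
  ultimately show ?thesis
    using symmetric_component(1)[of q i, OF sym, of t] by (simp add: fold_curve_def sym algebra_simps)
qed

lemma fold_curve_id:
  assumes sym: "\<And>t. q (- t) = refl1 i (q t)" and pos: "\<And>t. t \<ge> 0 \<Longrightarrow> q t $ i \<ge> 0"
  shows "fold_curve i q = q"
proof
  fix t
  have "odd_abs (\<lambda>t. q t $ i) t = q t $ i"
    using pos[of t] pos[of "- t"] symmetric_component(1)[of q i, OF sym, of t] by (auto simp: odd_abs_def)
  then show "fold_curve i q t = q t" by (simp add: fold_curve_def)
qed

text \<open>Convergence in the Sobolev norm of curves that need not themselves be square integrable.\<close>

definition curve_conv :: "(nat \<Rightarrow> real \<Rightarrow> 'a::euclidean_space) \<Rightarrow> (real \<Rightarrow> 'a) \<Rightarrow> bool" where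
  "curve_conv Q q \<longleftrightarrow> (\<lambda>n. L2sq (\<lambda>t. Q n t - q t)) \<longlonglongrightarrow> 0 \<and> (\<lambda>n. L2sq (\<lambda>t. weak_deriv (Q n) t - weak_deriv q t)) \<longlonglongrightarrow> 0"

lemma curve_convI:
  assumes Q: "\<And>n. primitive (Q n) (G n)" and q: "primitive q g"
    and lim: "(\<lambda>n. L2sq (\<lambda>t. Q n t - q t)) \<longlonglongrightarrow> 0" "(\<lambda>n. L2sq (\<lambda>t. G n t - g t)) \<longlonglongrightarrow> 0"
  shows "curve_conv Q q"
proof -
  have "L2sq (\<lambda>t. weak_deriv (Q n) t - weak_deriv q t) = L2sq (\<lambda>t. G n t - g t)" for n
  proof (rule L2sq_cong_AE)
    note w = primitive_weak_deriv[OF Q[of n]] primitive_weak_deriv[OF q]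
    note [measurable] = w[THEN primitive_measurable(2)] primitive_measurable(2)[OF Q[of n]] primitive_measurable(2)[OF q]
    show "(\<lambda>t. weak_deriv (Q n) t - weak_deriv q t) \<in> borel_measurable borel" "(\<lambda>t. G n t - g t) \<in> borel_measurable borel"
      by measurable
    show "AE t in lborel. weak_deriv (Q n) t - weak_deriv q t = G n t - g t"
      using primitive_unique_AE[OF w(1) Q[of n]] primitive_unique_AE[OF w(2) q] by eventually_elim simp
  qed
  then show ?thesis using lim by (simp add: curve_conv_def)
qed

lemma H1_norm_diff:
  assumes "primitive p g" "primitive q h"
  shows "H1_norm (\<lambda>t. p t - q t) = sqrt (L2sq (\<lambda>t. p t - q t) + L2sq (\<lambda>t. g t - h t))"
  by (rule H1_norm_primitive[OF primitive_diff[OF assms]])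

lemma curve_conv_H1_norm:
  assumes Q: "\<And>n. primitive (Q n) (weak_deriv (Q n))" and q: "primitive q (weak_deriv q)"
  shows "curve_conv Q q \<longleftrightarrow> (\<lambda>n. H1_norm (\<lambda>t. Q n t - q t)) \<longlonglongrightarrow> 0"
proof
  let ?A = "\<lambda>n. L2sq (\<lambda>t. Q n t - q t)" and ?B = "\<lambda>n. L2sq (\<lambda>t. weak_deriv (Q n) t - weak_deriv q t)"
  have eq: "H1_norm (\<lambda>t. Q n t - q t) = sqrt (?A n + ?B n)" for n by (rule H1_norm_diff[OF Q q])
  assume "curve_conv Q q"
  then have "(\<lambda>n. sqrt (?A n + ?B n)) \<longlonglongrightarrow> sqrt (0 + 0)"
    unfolding curve_conv_def by (intro tendsto_intros) auto
  then show "(\<lambda>n. H1_norm (\<lambda>t. Q n t - q t)) \<longlonglongrightarrow> 0" unfolding eq by simp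
next
  let ?A = "\<lambda>n. L2sq (\<lambda>t. Q n t - q t)" and ?B = "\<lambda>n. L2sq (\<lambda>t. weak_deriv (Q n) t - weak_deriv q t)"
  have eq: "H1_norm (\<lambda>t. Q n t - q t) = sqrt (?A n + ?B n)" for n by (rule H1_norm_diff[OF Q q])
  assume "(\<lambda>n. H1_norm (\<lambda>t. Q n t - q t)) \<longlonglongrightarrow> 0"
  then have "(\<lambda>n. (sqrt (?A n + ?B n))\<^sup>2) \<longlonglongrightarrow> 0\<^sup>2" unfolding eq by (intro tendsto_intros)
  moreover have "(sqrt (?A n + ?B n))\<^sup>2 = ?A n + ?B n" for n by (intro real_sqrt_pow2 add_nonneg_nonneg L2sq_nonneg)
  ultimately have lim: "(\<lambda>n. ?A n + ?B n) \<longlonglongrightarrow> 0" by simp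
  have "?A \<longlonglongrightarrow> 0" "?B \<longlonglongrightarrow> 0"
    by (rule tendsto_sandwich[OF _ _ tendsto_const lim]; intro always_eventually allI; use L2sq_nonneg in \<open>auto simp del: L2sq_nonneg\<close>)+
  then show "curve_conv Q q" by (simp add: curve_conv_def)
qed

lemma tendsto_zero_squeeze:
  fixes a b :: "nat \<Rightarrow> real"
  assumes "\<And>n. 0 \<le> a n" "\<And>n. a n \<le> b n" "b \<longlonglongrightarrow> 0"
  shows "a \<longlonglongrightarrow> 0"
  by (rule tendsto_sandwich[OF _ _ tendsto_const assms(3)]) (use assms(1,2) in auto)

lemma L2_dominated:
  assumes "f \<in> L2" "g \<in> borel_measurable borel" "\<And>t. norm (g t) \<le> norm (f t)"
  shows "g \<in> L2" "L2sq g \<le> L2sq f"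
proof -
  have le: "(norm (g t))\<^sup>2 \<le> 1 * (norm (f t))\<^sup>2" for t using power_mono[OF assms(3)[of t], of 2] by simp
  show g: "g \<in> L2" by (rule L2_bound[OF assms(1,2) AE_I2[OF le]])
  show "L2sq g \<le> L2sq f" using L2sq_mono[OF g assms(1) AE_I2[OF le]] by simp
qed

lemma vec_nth_measurable [measurable (raw)]:
  fixes f :: "'b \<Rightarrow> real ^ 'n"
  assumes "f \<in> borel_measurable M" shows "(\<lambda>x. f x $ i) \<in> borel_measurable M"
proof -
  have "(\<lambda>x::real^'n. x $ i) \<in> borel_measurable borel" by (intro borel_measurable_continuous_onI continuous_intros)
  from measurable_compose[OF assms this] show ?thesis .
qed

text \<open>The derivative of the folded curve is the derivative times a sign. The signs converge where the coordinate of the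
  limit is not zero; where it is zero, the derivative of this coordinate vanishes almost everywhere by
  \<open>derivative_zero_on_zero_set\<close>. So dominated convergence applies to the term \<open>X n\<close> containing the
  difference of the signs.\<close>

lemma fold_curve_conv:
  fixes Q :: "nat \<Rightarrow> real \<Rightarrow> real ^ 'n" 
  assumes Q: "\<And>n. primitive (Q n) (weak_deriv (Q n))" "\<And>n. (\<lambda>t. Q n t - q t) \<in> L2" "\<And>n. weak_deriv (Q n) \<in> L2" "\<And>n. Q n 0 $ i = 0"
    and q: "primitive q (weak_deriv q)" "weak_deriv q \<in> L2" "q 0 $ i = 0"
    and conv: "curve_conv Q q"
  shows "curve_conv (\<lambda>n. fold_curve i (Q n)) (fold_curve i q)"
proof (rule curve_convI)
  let ?g = "weak_deriv q" and ?G = "\<lambda>n. weak_deriv (Q n)"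
  show pQ: "primitive (fold_curve i (Q n)) (fold_deriv i (Q n) (?G n))" for n by (rule primitive_fold_curve[OF Q(1) Q(4)])
  show pq: "primitive (fold_curve i q) (fold_deriv i q ?g)" by (rule primitive_fold_curve[OF q(1,3)])
  note mQ = primitive_measurable[OF pQ] and mq = primitive_measurable[OF pq]
  have lim1: "(\<lambda>n. L2sq (\<lambda>t. Q n t - q t)) \<longlonglongrightarrow> 0" and lim2: "(\<lambda>n. L2sq (\<lambda>t. ?G n t - ?g t)) \<longlonglongrightarrow> 0"
    using conv by (auto simp: curve_conv_def)
  have le1: "L2sq (\<lambda>t. fold_curve i (Q n) t - fold_curve i q t) \<le> L2sq (\<lambda>t. Q n t - q t)" for n
    by (rule L2_dominated(2)[OF Q(2)]) (intro borel_measurable_diff mQ mq fold_curve_Lipschitz)+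
  show "(\<lambda>n. L2sq (\<lambda>t. fold_curve i (Q n) t - fold_curve i q t)) \<longlonglongrightarrow> 0"
    by (rule tendsto_zero_squeeze[OF L2sq_nonneg le1 lim1])
  define sg where "sg n t = odd_sgn (\<lambda>t. Q n t $ i) t" for n t
  define s where "s t = odd_sgn (\<lambda>t. q t $ i) t" for t
  define X where "X n t = ((sg n t - s t) * ?g t $ i) *\<^sub>R (axis i 1 :: real ^ 'n)" for n t
  define Y where "Y n t = (?G n t - ?g t) + (sg n t * (?G n t - ?g t) $ i - (?G n t - ?g t) $ i) *\<^sub>R axis i 1" for n t
  have split: "fold_deriv i (Q n) (?G n) t - fold_deriv i q ?g t = Y n t + X n t" for n t
  proof -
    define u v c d where "u = sg n t * ?G n t $ i - ?G n t $ i" and "v = s t * ?g t $ i - ?g t $ i"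
      and "c = sg n t * (?G n t - ?g t) $ i - (?G n t - ?g t) $ i" and "d = (sg n t - s t) * ?g t $ i"
    have uv: "u - v = c + d" by (simp add: u_def v_def c_def d_def algebra_simps)
    have "fold_deriv i (Q n) (?G n) t - fold_deriv i q ?g t = (?G n t - ?g t) + (u - v) *\<^sub>R axis i 1"
      unfolding scaleR_left_diff_distrib by (simp add: fold_deriv_def u_def v_def sg_def s_def)
    also have "\<dots> = ((?G n t - ?g t) + c *\<^sub>R axis i 1) + d *\<^sub>R axis i 1" unfolding uv scaleR_left_distrib by simp
    finally show ?thesis by (simp add: Y_def X_def c_def d_def)
  qed
  note [measurable] = primitive_measurable[OF Q(1)] primitive_measurable[OF q(1)]
  have [measurable]: "sg n \<in> borel_measurable borel" "s \<in> borel_measurable borel" for n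
    unfolding sg_def[abs_def] s_def[abs_def] odd_sgn_def by measurable
  have XM: "X n \<in> borel_measurable borel" "Y n \<in> borel_measurable borel" for n unfolding X_def[abs_def] Y_def[abs_def] by measurable
  have GgL: "(\<lambda>t. ?G n t - ?g t) \<in> L2" for n by (rule L2_diff[OF Q(3) q(2)])
  have Yle: "norm (Y n t) \<le> norm (?G n t - ?g t)" for n t
    unfolding Y_def by (rule norm_replace_component) 
      (use odd_sgn_le[of "\<lambda>t. Q n t $ i" t] in \<open>simp add: abs_mult mult_left_le_one_le sg_def\<close>)
  have YL: "Y n \<in> L2" and Y2: "L2sq (Y n) \<le> L2sq (\<lambda>t. ?G n t - ?g t)" for n
    by (rule L2_dominated[OF GgL XM(2) Yle])+
  have Xn: "norm (X n t) = \<bar>sg n t - s t\<bar> * \<bar>?g t $ i\<bar>" for n t by (simp add: X_def abs_mult norm_axis_1)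
  have Xle: "norm (X n t) \<le> 2 * norm (?g t)" for n t
  proof -
    have "\<bar>sg n t - s t\<bar> \<le> 2" using odd_sgn_le[of "\<lambda>t. Q n t $ i" t] odd_sgn_le[of "\<lambda>t. q t $ i" t] unfolding sg_def s_def by linarith
    then show ?thesis unfolding Xn by (intro mult_mono component_le_norm_cart) auto
  qed
  have Xle2: "(norm (X n t))\<^sup>2 \<le> 4 * (norm (?g t))\<^sup>2" for n t
    using power_mono[OF Xle[of n t], of 2] by (simp add: power_mult_distrib)
  have XL: "X n \<in> L2" for n by (rule L2_bound[OF q(2) XM(1) AE_I2[OF Xle2]])
  have pw: "(\<lambda>n. Q n t) \<longlonglongrightarrow> q t" for t
  proof -
    have "(norm (Q n t - q t))\<^sup>2 \<le> L2sq (\<lambda>t. Q n t - q t) + L2sq (\<lambda>t. ?G n t - ?g t)" for n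
      by (rule sup_bound[OF primitive_diff[OF Q(1) q(1)] Q(2) GgL])
    moreover have "(\<lambda>n. L2sq (\<lambda>t. Q n t - q t) + L2sq (\<lambda>t. ?G n t - ?g t)) \<longlonglongrightarrow> 0"
      using tendsto_add[OF lim1 lim2] by simp
    ultimately have "(\<lambda>n. (norm (Q n t - q t))\<^sup>2) \<longlonglongrightarrow> 0"
      by (intro tendsto_zero_squeeze[OF zero_le_power2])
    from tendsto_real_sqrt[OF this] have "(\<lambda>n. norm (Q n t - q t)) \<longlonglongrightarrow> 0" by simp
    then have "(\<lambda>n. Q n t - q t) \<longlonglongrightarrow> 0" by (rule tendsto_norm_zero_cancel)
    then show ?thesis by (rule LIM_zero_cancel)
  qed
  have "(\<lambda>n. L2sq (X n)) \<longlonglongrightarrow> (LINT t|(lborel :: real measure). 0)"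
  proof (rule integral_dominated_convergence[of _ _ _ "\<lambda>t. 4 * (norm (?g t))\<^sup>2"])
    show "integrable lborel (\<lambda>t. 4 * (norm (?g t))\<^sup>2)" using L2_integrable[OF q(2)] by simp
    show "AE t in lborel. norm ((norm (X n t))\<^sup>2) \<le> 4 * (norm (?g t))\<^sup>2" for n using Xle2 by (intro AE_I2) simp
    have "AE t in lborel. q t $ i = 0 \<longrightarrow> ?g t $ i = 0"
      by (rule derivative_zero_on_zero_set[OF primitive_bounded_linear[OF bounded_linear_vec_nth q(1)]])
    then show "AE t in lborel. (\<lambda>n. (norm (X n t))\<^sup>2) \<longlonglongrightarrow> 0"
    proof eventually_elim
      fix t assume z: "q t $ i = 0 \<longrightarrow> ?g t $ i = 0"
      show "(\<lambda>n. (norm (X n t))\<^sup>2) \<longlonglongrightarrow> 0"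
      proof (cases "q t $ i = 0")
        case True then show ?thesis using z by (simp add: Xn)
      next
        case False
        have l: "(\<lambda>n. Q n t $ i) \<longlonglongrightarrow> q t $ i" by (rule tendsto_vec_nth[OF pw])
        have "\<forall>\<^sub>F n in sequentially. sgn (Q n t $ i) = sgn (q t $ i)"
        proof (cases "q t $ i > 0")
          case True
          from order_tendstoD(1)[OF l True] show ?thesis by eventually_elim (use True in simp)
        next
          case False
          then have "q t $ i < 0" using \<open>q t $ i \<noteq> 0\<close> by simp
          from order_tendstoD(2)[OF l this] show ?thesis by eventually_elim (use \<open>q t $ i < 0\<close> in simp)
        qed
        then have "\<forall>\<^sub>F n in sequentially. (norm (X n t))\<^sup>2 = 0"
          by eventually_elim (simp add: Xn sg_def s_def odd_sgn_def)
        then show ?thesis by (rule tendsto_eventually)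
      qed
    qed
  qed (use XM in measurable)
  then have X0: "(\<lambda>n. L2sq (X n)) \<longlonglongrightarrow> 0" by simp
  have "L2sq (\<lambda>t. fold_deriv i (Q n) (?G n) t - fold_deriv i q ?g t) \<le> 2 * L2sq (\<lambda>t. ?G n t - ?g t) + 2 * L2sq (X n)" for n
    unfolding split using L2sq_add_le[OF YL XL, of n n] Y2[of n] by linarith
  moreover have "(\<lambda>n. 2 * L2sq (\<lambda>t. ?G n t - ?g t) + 2 * L2sq (X n)) \<longlonglongrightarrow> 2 * 0 + 2 * 0"
    by (intro tendsto_intros lim2 X0)
  ultimately show "(\<lambda>n. L2sq (\<lambda>t. fold_deriv i (Q n) (?G n) t - fold_deriv i q ?g t)) \<longlonglongrightarrow> 0"
    by (intro tendsto_zero_squeeze[OF L2sq_nonneg]) simp_all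
qed

section \<open>The Sobolev distance\<close>

text \<open>A bilinear term that is bounded by weighted sums for all weights is bounded by the geometric mean: one
  optimizes over the weight.\<close>

lemma cross_term_bound:
  fixes A B X :: real
  assumes "A \<ge> 0" "B \<ge> 0" and le: "\<And>r. r > 0 \<Longrightarrow> 2 * X \<le> r * A + B / r"
  shows "X \<le> sqrt A * sqrt B"
proof -
  consider "A = 0" | "B = 0" | "A > 0" "B > 0" using assms by linarith
  then show ?thesis
  proof cases
    case 1
    show ?thesis
    proof (rule ccontr)
      assume "\<not> X \<le> sqrt A * sqrt B"
      then have X: "X > 0" using 1 by simp
      have "(B + 1) / X > 0" using X assms(2) by simp
      from le[OF this] have "2 * X \<le> B * X / (B + 1)" using 1 X by simp
      also have "\<dots> \<le> X" using X assms(2) by (simp add: field_simps)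
      finally show False using X by simp
    qed
  next
    case 2
    show ?thesis
    proof (rule ccontr)
      assume "\<not> X \<le> sqrt A * sqrt B"
      then have X: "X > 0" using 2 by simp
      have "X / (A + 1) > 0" using X assms(1) by simp
      from le[OF this] have "2 * X \<le> X * A / (A + 1)" using 2 X by simp
      also have "\<dots> \<le> X" using X assms(1) by (simp add: field_simps)
      finally show False using X by simp
    qed
  next
    case 3
    define a b where "a = sqrt A" and "b = sqrt B"
    have ab: "a > 0" "b > 0" "A = a * a" "B = b * b" using 3 by (auto simp: a_def b_def)
    have "b / a > 0" using ab by simp
    from le[OF this] have "2 * X \<le> b / a * (a * a) + b * b / (b / a)" unfolding ab(3,4) .
    also have "\<dots> = 2 * (a * b)" using ab(1,2) by (simp add: field_simps)
    finally show ?thesis by (simp add: a_def b_def)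
  qed
qed

lemma L2_inner_weighted:
  fixes u v :: "real \<Rightarrow> 'a::euclidean_space"
  assumes "u \<in> L2" "v \<in> L2" "r > 0"
  shows "2 * (LINT t|lborel. u t \<bullet> v t) \<le> r * L2sq u + L2sq v / r"
proof -
  define k where "k = sqrt r"
  have k: "k > 0" "k * k = r" using assms(3) by (auto simp: k_def)
  have "(LINT t|lborel. 2 * (u t \<bullet> v t)) \<le> (LINT t|lborel. r * (norm (u t))\<^sup>2 + (norm (v t))\<^sup>2 / r)"
  proof (rule integral_mono)
    fix t
    have "2 * (u t \<bullet> v t) = 2 * ((k *\<^sub>R u t) \<bullet> ((1/k) *\<^sub>R v t))" using k by simp
    also have "\<dots> \<le> (norm (k *\<^sub>R u t))\<^sup>2 + (norm ((1/k) *\<^sub>R v t))\<^sup>2"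
      using inner_le_sq[of "k *\<^sub>R u t" "(1/k) *\<^sub>R v t"] by (auto simp: abs_le_iff)
    also have "\<dots> = r * (norm (u t))\<^sup>2 + (norm (v t))\<^sup>2 / r"
      using k by (simp add: power_mult_distrib power2_eq_square[of k] power_divide)
    finally show "2 * (u t \<bullet> v t) \<le> r * (norm (u t))\<^sup>2 + (norm (v t))\<^sup>2 / r" .
  qed (use assms(1,2)[THEN L2_integrable] L2_inner_integrable[OF assms(1,2)] in auto)
  then show ?thesis using assms(1,2)[THEN L2_integrable] by simp
qed

lemma L2_Cauchy_Schwarz:
  fixes u v :: "real \<Rightarrow> 'a::euclidean_space"
  assumes "u \<in> L2" "v \<in> L2"
  shows "(LINT t|lborel. u t \<bullet> v t) \<le> sqrt (L2sq u) * sqrt (L2sq v)"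
  by (rule cross_term_bound[OF L2sq_nonneg L2sq_nonneg L2_inner_weighted[OF assms]])

lemma L2sq_add:
  fixes u v :: "real \<Rightarrow> 'a::euclidean_space"
  assumes "u \<in> L2" "v \<in> L2"
  shows "L2sq (\<lambda>t. u t + v t) = L2sq u + 2 * (LINT t|lborel. u t \<bullet> v t) + L2sq v"
proof -
  have "L2sq (\<lambda>t. u t + v t) = (LINT t|lborel. ((norm (u t))\<^sup>2 + 2 * (u t \<bullet> v t)) + (norm (v t))\<^sup>2)"
    by (rule Bochner_Integration.integral_cong) (auto simp: power2_norm_eq_inner inner_add_left inner_add_right inner_commute)
  then show ?thesis using assms[THEN L2_integrable] L2_inner_integrable[OF assms] by simp
qed

lemma H1_norm_triangle:
  fixes f g :: "real \<Rightarrow> 'a::euclidean_space"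
  assumes "f \<in> H1" "g \<in> H1"
  shows "H1_norm (\<lambda>t. f t + g t) \<le> H1_norm f + H1_norm g"
proof -
  obtain f' where f: "f \<in> L2" "primitive f f'" "f' \<in> L2" using assms(1) unfolding H1_iff by blast
  obtain g' where g: "g \<in> L2" "primitive g g'" "g' \<in> L2" using assms(2) unfolding H1_iff by blast
  define A where "A = L2sq f + L2sq f'"
  define B where "B = L2sq g + L2sq g'"
  define X where "X = (LINT t|lborel. f t \<bullet> g t) + (LINT t|lborel. f' t \<bullet> g' t)"
  have A0: "A \<ge> 0" and B0: "B \<ge> 0" by (simp_all add: A_def B_def)
  have X: "X \<le> sqrt A * sqrt B"
  proof (rule cross_term_bound[OF A0 B0])
    fix r :: real assume r: "r > 0"
    show "2 * X \<le> r * A + B / r"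
      using L2_inner_weighted[OF f(1) g(1) r] L2_inner_weighted[OF f(3) g(3) r]
      by (simp add: X_def A_def B_def distrib_left add_divide_distrib)
  qed
  have "H1_norm (\<lambda>t. f t + g t) = sqrt (L2sq (\<lambda>t. f t + g t) + L2sq (\<lambda>t. f' t + g' t))"
    by (rule H1_norm_primitive[OF primitive_add[OF f(2) g(2)]])
  also have "L2sq (\<lambda>t. f t + g t) + L2sq (\<lambda>t. f' t + g' t) = A + 2 * X + B"
    unfolding L2sq_add[OF f(1) g(1)] L2sq_add[OF f(3) g(3)] by (simp add: A_def B_def X_def)
  also have "\<dots> \<le> A + 2 * (sqrt A * sqrt B) + B" using X by simp
  also have "\<dots> = (sqrt A + sqrt B)\<^sup>2" using A0 B0 by (simp add: power2_sum)
  also have "sqrt ((sqrt A + sqrt B)\<^sup>2) = sqrt A + sqrt B" using A0 B0 by simp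
  finally show ?thesis using H1_norm_primitive[OF f(2)] H1_norm_primitive[OF g(2)] by (simp add: A_def B_def)
qed

lemma H1_norm_minus_commute: 
  assumes "primitive p g" "primitive q h"
  shows "H1_norm (\<lambda>t. p t - q t) = H1_norm (\<lambda>t. q t - p t)"
  unfolding H1_norm_diff[OF assms] H1_norm_diff[OF assms(2,1)] by (simp add: norm_minus_commute)

lemma H1_norm_nonneg: "0 \<le> H1_norm v"
  unfolding H1_norm_def by simp

lemma H1_diff: assumes "f \<in> H1" "g \<in> H1" shows "(\<lambda>t. f t - g t) \<in> H1"
  using assms unfolding H1_iff by (metis L2_diff primitive_diff)

section \<open>Almost optimal paths\<close>

context double_well
begin

lemma psi_symmetric: "psi sm sp (- t) = refl1 i (psi sm sp t)"
  by (auto simp: psi_def refl_sp refl_sm)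

lemma psi_nonneg: assumes "t \<ge> 0" shows "psi sm sp t $ i \<ge> 0"
proof -
  have "sp $ i = 1" "sm $ i = -1" by (simp_all add: sp_def sm_def axis_def)
  then show ?thesis using assms by (auto simp: psi_def)
qed

lemma fold_psi: "fold_curve i (psi sm sp) = psi sm sp"
  by (rule fold_curve_id[of "psi sm sp" i, OF psi_symmetric psi_nonneg])

lemma symmetric_all:
  fixes q :: "real \<Rightarrow> real ^ 'n"
  assumes "\<And>t. t \<ge> 0 \<Longrightarrow> refl1 i (q t) = q (- t)" shows "q (- t) = refl1 i (q t)"
proof (cases "t \<ge> 0")
  case False
  then have "refl1 i (q (- t)) = q t" using assms[of "- t"] by simp
  then show ?thesis by (metis refl1_simps(1))
qed (use assms in simp)

lemma X_sym_iff:
  "q \<in> X_sym V i sm sp \<longleftrightarrow> q \<in> conn V sm sp \<and> (\<forall>t. q (- t) = refl1 i (q t)) \<and> (\<forall>t\<ge>0. q t $ i \<ge> 0)"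
  unfolding X_sym_def using symmetric_all[of q] by auto

text \<open>Folding fixes \<open>psi\<close> and is pointwise nonexpansive, so the folded curve has the same limits.\<close>

lemma fold_X_sym:
  assumes q: "q \<in> conn V sm sp" and sym: "\<And>t. q (- t) = refl1 i (q t)"
  shows "fold_curve i q \<in> X_sym V i sm sp" "energy V (fold_curve i q) \<le> energy V q"
proof -
  note c = conn_weak_deriv[OF q]
  have p: "primitive (fold_curve i q) (fold_deriv i q (weak_deriv q))"
    by (rule primitive_fold_curve[OF c(1) symmetric_component(2)[of q i, OF sym]])
  have d: "fold_deriv i q (weak_deriv q) \<in> L2" "L2sq (fold_deriv i q (weak_deriv q)) \<le> L2sq (weak_deriv q)"
    by (rule L2_dominated[OF c(2) primitive_measurable(2)[OF p] fold_deriv_norm])+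
  have Vf: "V (fold_curve i q t) = V (q t)" for t using fold_curve_cases[of i q t] V_refl by auto
  have iV: "integrable lborel (\<lambda>t. V (fold_curve i q t))" using c(3) by (simp add: Vf)
  have "((\<lambda>t. fold_curve i q t - psi sm sp t) \<longlongrightarrow> 0) F" if "((\<lambda>t. q t - psi sm sp t) \<longlongrightarrow> 0) F" for F
  proof (rule Lim_null_comparison[OF _ tendsto_norm_zero[OF that]], intro always_eventually allI)
    fix t show "norm (fold_curve i q t - psi sm sp t) \<le> norm (q t - psi sm sp t)"
      using fold_curve_Lipschitz[of i q t "psi sm sp"] by (simp add: fold_psi)
  qed
  then have z: "((\<lambda>t. fold_curve i q t - psi sm sp t) \<longlongrightarrow> 0) at_top" "((\<lambda>t. fold_curve i q t - psi sm sp t) \<longlongrightarrow> 0) at_bot"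
    using tendsto_diff[OF c(6) psi_tendsto(1)[where a=sm and b=sp]] tendsto_diff[OF c(5) psi_tendsto(2)[where a=sm and b=sp]] by auto
  have "fold_curve i q \<in> conn V sm sp"
  proof (rule connI[OF p d(1) iV])
    show "(fold_curve i q \<longlongrightarrow> sm) at_bot" using tendsto_add[OF z(2) psi_tendsto(2)[of sm sp]] by simp
    show "(fold_curve i q \<longlongrightarrow> sp) at_top" using tendsto_add[OF z(1) psi_tendsto(1)[where a=sm and b=sp]] by simp
  qed
  then show "fold_curve i q \<in> X_sym V i sm sp"
    unfolding X_sym_iff using fold_curve_symmetric[of q i, OF sym] by (auto simp: odd_abs_def)
  show "energy V (fold_curve i q) \<le> energy V q"
    unfolding energy_eq[OF p d(1) iV] c(4) by (rule ennreal_leI) (use d(2) in \<open>simp add: Vf\<close>)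
qed

text \<open>One step of steepest descent, applied to all curves of an almost optimal folded path, yields again
  an admissible path, because minimizers are critical points and do not move. So the step cannot
  decrease the energy much everywhere along the path.\<close>

lemma almost_optimal_paths:
  assumes min: "minimizers V sm sp = F0 \<union> F1" and c: "c_sym V i sm sp F0 F1 = ennreal c0" "c0 \<ge> 0"
  shows "\<exists>\<tau>>0. \<exists>M. \<forall>\<epsilon>. 0 < \<epsilon> \<and> \<epsilon> \<le> 1 \<longrightarrow> (\<exists>Q.
     (\<forall>s\<in>{0..1}. Q s \<in> X_sym V i sm sp \<and> finite_curve M (Q s) \<and> real_energy (Q s) \<le> c0 + \<epsilon> \<and>
        min_energy V sm sp + ennreal (\<tau> / 2 * L2sq (residual (Q s))) \<le> energy V (Q s)) \<and>
     Q 0 \<in> F0 \<and> Q 1 \<in> F1 \<and>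
     (\<forall>s\<in>{0..1}. ((\<lambda>r. H1_norm (\<lambda>t. Q r t - Q s t)) \<longlongrightarrow> 0) (at s within {0..1::real})) \<and>
     (\<exists>s\<in>{0..1}. c0 - \<epsilon> \<le> real_energy (Q s) - \<tau> / 2 * L2sq (residual (Q s))))"
proof -
  obtain M where M: "\<And>q t. q \<in> conn V sm sp \<Longrightarrow> energy V q \<le> ennreal (c0 + 1) \<Longrightarrow> norm (q t) \<le> M"
    using conn_bounded[of "c0 + 1"] by blast
  have "c0 + 1 \<ge> 0" using c(2) by simp
  from energy_descent[OF this, of M] obtain \<tau> M' where \<tau>: "\<tau> > 0" and 
    desc: "\<And>q. finite_curve M q \<Longrightarrow> real_energy q \<le> c0 + 1 \<Longrightarrow> (\<And>t. q (- t) = refl1 i (q t)) \<Longrightarrow>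
      finite_curve M' (\<lambda>t. q t - \<tau> *\<^sub>R descent q t) \<and>
      real_energy (\<lambda>t. q t - \<tau> *\<^sub>R descent q t) + \<tau> / 2 * L2sq (residual q) \<le> real_energy q" by blast
  obtain L where L: "L > 0" "\<And>p q. finite_curve M p \<Longrightarrow> finite_curve M q \<Longrightarrow> (\<lambda>t. p t - q t) \<in> L2 \<Longrightarrow>
     L2sq (\<lambda>t. descent p t - descent q t) + L2sq (\<lambda>t. descent' p t - descent' q t)
      \<le> L * (L2sq (\<lambda>t. p t - q t) + L2sq (\<lambda>t. weak_deriv p t - weak_deriv q t))"
    using descent_Lipschitz[of M] by blast
  show ?thesis
  proof (rule exI[of _ \<tau>], rule conjI[OF \<tau>], rule exI[of _ M], intro allI impI)
    fix \<epsilon> :: real assume "0 < \<epsilon> \<and> \<epsilon> \<le> 1"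
    then have \<epsilon>: "\<epsilon> > 0" "\<epsilon> \<le> 1" by auto
    have "c_sym V i sm sp F0 F1 < ennreal (c0 + \<epsilon>)" unfolding c(1) using c(2) \<epsilon> by (intro ennreal_lessI) auto
    then obtain \<gamma> where \<gamma>: "\<gamma> \<in> Gamma_sym V i sm sp F0 F1" "(SUP s\<in>{0..1}. J V sm sp (\<gamma> s)) < ennreal (c0 + \<epsilon>)"
      unfolding c_sym_def INF_less_iff by blast
    \<comment> \<open>q is the path of curves, Q its folding, and P the result of one step of steepest descent from Q\<close>
    define q where "q s = (\<lambda>t. \<gamma> s t + psi sm sp t)" for s
    define Q where "Q s = fold_curve i (q s)" for s
    define P where "P s = (\<lambda>t. Q s t - \<tau> *\<^sub>R descent (Q s) t)" for s
    have H1: "\<gamma> s \<in> H1" and sym: "q s (- t) = refl1 i (q s t)" if "s \<in> {0..1}" for s t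
    proof -
      have g: "\<gamma> s \<in> H1_sym i" using \<gamma>(1) that by (simp add: Gamma_sym_def)
      then show "\<gamma> s \<in> H1" by (simp add: H1_sym_def)
      have "\<gamma> s (- t) = refl1 i (\<gamma> s t)" using symmetric_all[of "\<gamma> s"] g by (simp add: H1_sym_def)
      then show "q s (- t) = refl1 i (q s t)" by (simp add: q_def psi_symmetric)
    qed
    have Eq: "energy V (q s) \<le> ennreal (c0 + \<epsilon>)" if "s \<in> {0..1}" for s
    proof -
      have "J V sm sp (\<gamma> s) \<le> (SUP s\<in>{0..1}. J V sm sp (\<gamma> s))" by (rule SUP_upper[OF that])
      then show ?thesis using \<gamma>(2) by (simp add: J_def q_def)
    qed
    have qc: "q s \<in> conn V sm sp" if s: "s \<in> {0..1}" for s
    proof -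
      note h = H1_plus_psi[OF H1[OF s], folded q_def]
      have "energy V (q s) < \<infinity>" using Eq[OF s] by (rule le_less_trans) simp
      from energy_L2[OF h(1) this] show ?thesis using h by (intro connI) auto
    qed
    note QX = fold_X_sym[OF qc sym, folded Q_def]
    have Qc: "Q s \<in> conn V sm sp" and Qsym: "Q s (- t) = refl1 i (Q s t)" if "s \<in> {0..1}" for s t
      using QX(1)[OF that that] unfolding X_sym_iff by auto
    have EQ: "energy V (Q s) \<le> ennreal (c0 + \<epsilon>)" if s: "s \<in> {0..1}" for s
      using QX(2)[OF s s] Eq[OF s] by (rule order_trans)
    have fQ: "finite_curve M (Q s)" if s: "s \<in> {0..1}" for s
    proof (rule conn_finite_curve[OF Qc[OF s]])
      have "energy V (Q s) \<le> ennreal (c0 + 1)" using EQ[OF s] \<epsilon> by (meson add_left_mono ennreal_leI order_trans)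
      then show "norm (Q s t) \<le> M" for t by (rule M[OF Qc[OF s]])
    qed
    have rQ: "real_energy (Q s) \<le> c0 + \<epsilon>" if s: "s \<in> {0..1}" for s
      using EQ[OF s, unfolded finite_curve_energy[OF fQ[OF s]]] by (subst (asm) ennreal_le_iff) (use c(2) \<epsilon> in auto)
    have d: "finite_curve M' (P s)" "real_energy (P s) + \<tau> / 2 * L2sq (residual (Q s)) \<le> real_energy (Q s)" if s: "s \<in> {0..1}" for s
      using desc[OF fQ[OF s] _ Qsym[OF s]] rQ[OF s] \<epsilon> unfolding P_def by auto
    have Psym: "P s (- t) = refl1 i (P s t)" if s: "s \<in> {0..1}" for s t
      using Qsym[OF s, of t] symmetrize_symmetric[of i "correction (Q s)" t] by (simp add: P_def descent_def)
    have Pc: "P s \<in> conn V sm sp" if s: "s \<in> {0..1}" for s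
    proof (rule connI)
      note fP = d(1)[OF s]
      show "primitive (P s) (weak_deriv (P s))" "weak_deriv (P s) \<in> L2" "integrable lborel (\<lambda>t. V (P s t))"
        using fP by (auto simp: finite_curve_def)
      note D0 = primitive_L2_vanishes[OF primitive_descent[OF fQ[OF s]] descent_L2[OF fQ[OF s]] descent'_L2[OF fQ[OF s]]]
      note cq = conn_weak_deriv[OF Qc[OF s]]
      show "(P s \<longlongrightarrow> sm) at_bot"
        using tendsto_diff[OF cq(5) tendsto_scaleR[OF tendsto_const D0(2)], of \<tau>] by (simp add: P_def)
      show "(P s \<longlongrightarrow> sp) at_top"
        using tendsto_diff[OF cq(6) tendsto_scaleR[OF tendsto_const D0(1)], of \<tau>] by (simp add: P_def)
    qed
    have gain: "energy V (P s) + ennreal (\<tau> / 2 * L2sq (residual (Q s))) \<le> energy V (Q s)" if s: "s \<in> {0..1}" for s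
    proof -
      have "energy V (P s) + ennreal (\<tau> / 2 * L2sq (residual (Q s))) = ennreal (real_energy (P s) + \<tau> / 2 * L2sq (residual (Q s)))"
        unfolding finite_curve_energy[OF d(1)[OF s]] using \<tau> by (intro ennreal_plus[symmetric] real_energy_nonneg) auto
      also have "\<dots> \<le> energy V (Q s)" unfolding finite_curve_energy[OF fQ[OF s]] by (rule ennreal_leI[OF d(2)[OF s]])
      finally show ?thesis .
    qed
    have low: "min_energy V sm sp + ennreal (\<tau> / 2 * L2sq (residual (Q s))) \<le> energy V (Q s)" if s: "s \<in> {0..1}" for s
    proof -
      have "min_energy V sm sp \<le> energy V (P s)" unfolding min_energy_def by (rule INF_lower[OF Pc[OF s]])
      then show ?thesis using gain[OF s] by (meson add_right_mono order_trans)
    qed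
    \<comment> \<open>a minimizer has no residual, as otherwise the step would lead below the minimum\<close>
    have ends: "Q s \<in> F \<and> P s = Q s" if g: "\<gamma> s \<in> V_sym V i sm sp F" and F: "F \<subseteq> minimizers V sm sp" and s: "s \<in> {0..1}" for s F
    proof -
      obtain u where u: "u \<in> F" "u \<in> X_sym V i sm sp" "\<gamma> s = (\<lambda>t. u t - psi sm sp t)"
        using g unfolding V_sym_def F_sym_def by blast
      have qu: "q s = u" by (simp add: q_def u(3))
      have "Q s = u" unfolding Q_def qu by (rule fold_curve_id) (use u(2) X_sym_iff in auto)
      have "energy V (Q s) = min_energy V sm sp" using F u(1) \<open>Q s = u\<close> by (auto simp: minimizers_def)
      then have "energy V (Q s) + ennreal (\<tau> / 2 * L2sq (residual (Q s))) \<le> energy V (Q s)" using low[OF s] by simp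
      moreover have x0: "0 \<le> \<tau> / 2 * L2sq (residual (Q s))" using \<tau> by simp
      ultimately have "ennreal (real_energy (Q s) + \<tau> / 2 * L2sq (residual (Q s))) \<le> ennreal (real_energy (Q s))"
        unfolding finite_curve_energy[OF fQ[OF s]] ennreal_plus[OF real_energy_nonneg x0] by blast
      then have "\<tau> / 2 * L2sq (residual (Q s)) \<le> 0"
        by (subst (asm) ennreal_le_iff[OF real_energy_nonneg]) linarith
      moreover have "x \<le> 0" if "\<tau> / 2 * x \<le> 0" for x
        using that \<tau> by (simp add: mult_le_0_iff)
      ultimately have "L2sq (residual (Q s)) \<le> 0" by blast
      then have "P s = Q s" unfolding P_def using descent_zero[OF fQ[OF s]] by simp
      then show ?thesis using \<open>Q s = u\<close> u(1) by simp
    qed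
    have e0: "Q 0 \<in> F0" "P 0 = Q 0" and e1: "Q 1 \<in> F1" "P 1 = Q 1"
      using ends[of 0 F0] ends[of 1 F1] \<gamma>(1) min by (auto simp: Gamma_sym_def)
    \<comment> \<open>both new paths are continuous, which is checked along sequences of parameters\<close>
    have seq: "curve_conv (\<lambda>n. Q (X n)) (Q s) \<and> curve_conv (\<lambda>n. P (X n)) (P s)"
      if s: "s \<in> {0..1}" and X: "\<And>n. X n \<in> {0..1}" "X \<longlonglongrightarrow> s" "\<And>n. X n \<noteq> s" for s X
    proof -
      have "((\<lambda>r. H1_norm (\<lambda>t. \<gamma> r t - \<gamma> s t)) \<longlongrightarrow> 0) (at s within {0..1})" using \<gamma>(1) s by (simp add: Gamma_sym_def)
      then have "((\<lambda>r. H1_norm (\<lambda>t. \<gamma> r t - \<gamma> s t)) \<circ> X) \<longlonglongrightarrow> 0"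
        unfolding tendsto_at_iff_sequentially using X by auto
      moreover have "H1_norm (\<lambda>t. \<gamma> r t - \<gamma> s t) = H1_norm (\<lambda>t. q r t - q s t)" for r by (simp add: q_def)
      ultimately have "(\<lambda>n. H1_norm (\<lambda>t. q (X n) t - q s t)) \<longlonglongrightarrow> 0" by (simp add: o_def)
      then have cq: "curve_conv (\<lambda>n. q (X n)) (q s)"
        by (subst curve_conv_H1_norm) (use conn_weak_deriv(1)[OF qc[OF X(1)]] conn_weak_deriv(1)[OF qc[OF s]] in auto)
      have dq: "(\<lambda>t. q (X n) t - q s t) \<in> L2" for n
      proof -
        have "(\<lambda>t. \<gamma> (X n) t - \<gamma> s t) \<in> L2" using H1[OF X(1)] H1[OF s] unfolding H1_iff by (metis L2_diff)
        then show ?thesis by (simp add: q_def)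
      qed
      have cQ: "curve_conv (\<lambda>n. Q (X n)) (Q s)"
        unfolding Q_def
      proof (rule fold_curve_conv[OF _ dq _ _ _ _ _ cq])
        show "primitive (q (X n)) (weak_deriv (q (X n)))" "weak_deriv (q (X n)) \<in> L2" for n
          using conn_weak_deriv[OF qc[OF X(1)]] by auto
        show "primitive (q s) (weak_deriv (q s))" "weak_deriv (q s) \<in> L2" using conn_weak_deriv[OF qc[OF s]] by auto
        show "q (X n) 0 $ i = 0" for n by (rule symmetric_component(2)) (rule sym[OF X(1)])
        show "q s 0 $ i = 0" by (rule symmetric_component(2)) (rule sym[OF s])
      qed
      have dQ: "(\<lambda>t. Q (X n) t - Q s t) \<in> L2" for n
      proof -
        have "(\<lambda>t. (Q (X n) t - psi sm sp t) - (Q s t - psi sm sp t)) \<in> L2"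
          by (rule L2_diff[OF conn_minus_psi_L2[OF Qc[OF X(1)]] conn_minus_psi_L2[OF Qc[OF s]]])
        then show ?thesis by simp
      qed
      let ?A = "\<lambda>n. L2sq (\<lambda>t. Q (X n) t - Q s t)" and ?B = "\<lambda>n. L2sq (\<lambda>t. weak_deriv (Q (X n)) t - weak_deriv (Q s) t)"
      let ?D = "\<lambda>n t. descent (Q (X n)) t - descent (Q s) t" and ?D' = "\<lambda>n t. descent' (Q (X n)) t - descent' (Q s) t"
      have AB: "?A \<longlonglongrightarrow> 0" "?B \<longlonglongrightarrow> 0" using cQ by (auto simp: curve_conv_def)
      have lim: "(\<lambda>n. L * (?A n + ?B n)) \<longlonglongrightarrow> 0" using tendsto_mult[OF tendsto_const[of L] tendsto_add[OF AB]] by simp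
      note Lip = L(2)[OF fQ[OF X(1)] fQ[OF s] dQ]
      have D: "(\<lambda>n. L2sq (?D n)) \<longlonglongrightarrow> 0"
        by (rule tendsto_zero_squeeze[OF L2sq_nonneg _ lim]) (rule order_trans[OF _ Lip], use L2sq_nonneg in auto)
      have D': "(\<lambda>n. L2sq (?D' n)) \<longlonglongrightarrow> 0"
        by (rule tendsto_zero_squeeze[OF L2sq_nonneg _ lim]) (rule order_trans[OF _ Lip], use L2sq_nonneg in auto)
      have DL: "?D n \<in> L2" "?D' n \<in> L2" for n
        by (intro L2_diff descent_L2[OF fQ[OF X(1)]] descent_L2[OF fQ[OF s]])
          (intro L2_diff descent'_L2[OF fQ[OF X(1)]] descent'_L2[OF fQ[OF s]])
      have "curve_conv (\<lambda>n. P (X n)) (P s)"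
      proof (rule curve_convI)
        have pr: "primitive (P r) (\<lambda>t. weak_deriv (Q r) t - \<tau> *\<^sub>R descent' (Q r) t)" if "r \<in> {0..1}" for r
          unfolding P_def by (intro primitive_diff primitive_scaleR finite_curve_prim[OF fQ[OF that]] primitive_descent[OF fQ[OF that]])
        show "primitive (P (X n)) (\<lambda>t. weak_deriv (Q (X n)) t - \<tau> *\<^sub>R descent' (Q (X n)) t)" for n by (rule pr[OF X(1)])
        show "primitive (P s) (\<lambda>t. weak_deriv (Q s) t - \<tau> *\<^sub>R descent' (Q s) t)" by (rule pr[OF s])
        have gL: "(\<lambda>t. weak_deriv (Q (X n)) t - weak_deriv (Q s) t) \<in> L2" for n
          by (rule L2_diff[OF finite_curve_deriv_L2[OF fQ[OF X(1)]] finite_curve_deriv_L2[OF fQ[OF s]]])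
        have sq: "L2sq (\<lambda>t. u t - \<tau> *\<^sub>R v t) \<le> 2 * L2sq u + 2 * \<tau>\<^sup>2 * L2sq v" if "u \<in> L2" "v \<in> L2" for u v :: "real \<Rightarrow> real ^ 'n"
          using L2sq_diff_le[OF that(1) L2_scaleR[OF that(2)], of \<tau>] unfolding L2sq_scaleR by simp
        have lim1: "(\<lambda>n. 2 * ?A n + 2 * \<tau>\<^sup>2 * L2sq (?D n)) \<longlonglongrightarrow> 0"
          using tendsto_add[OF tendsto_mult[OF tendsto_const[of 2] AB(1)] tendsto_mult[OF tendsto_const[of "2 * \<tau>\<^sup>2"] D]] by simp
        have lim2: "(\<lambda>n. 2 * ?B n + 2 * \<tau>\<^sup>2 * L2sq (?D' n)) \<longlonglongrightarrow> 0"
          using tendsto_add[OF tendsto_mult[OF tendsto_const[of 2] AB(2)] tendsto_mult[OF tendsto_const[of "2 * \<tau>\<^sup>2"] D']] by simp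
        have eq1: "(\<lambda>t. P (X n) t - P s t) = (\<lambda>t. (Q (X n) t - Q s t) - \<tau> *\<^sub>R ?D n t)" for n
          by (auto simp: P_def algebra_simps)
        have eq2: "(\<lambda>t. (weak_deriv (Q (X n)) t - \<tau> *\<^sub>R descent' (Q (X n)) t) - (weak_deriv (Q s) t - \<tau> *\<^sub>R descent' (Q s) t)) = 
          (\<lambda>t. (weak_deriv (Q (X n)) t - weak_deriv (Q s) t) - \<tau> *\<^sub>R ?D' n t)" for n
          by (auto simp: algebra_simps)
        have le1: "L2sq (\<lambda>t. P (X n) t - P s t) \<le> 2 * ?A n + 2 * \<tau>\<^sup>2 * L2sq (?D n)" for n
          using sq[OF dQ DL(1)] unfolding fun_cong[OF eq1] .
        have le2: "L2sq (\<lambda>t. (weak_deriv (Q (X n)) t - \<tau> *\<^sub>R descent' (Q (X n)) t) - (weak_deriv (Q s) t - \<tau> *\<^sub>R descent' (Q s) t)) 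
           \<le> 2 * ?B n + 2 * \<tau>\<^sup>2 * L2sq (?D' n)" for n
          using sq[OF gL DL(2)] unfolding fun_cong[OF eq2] .
        show "(\<lambda>n. L2sq (\<lambda>t. P (X n) t - P s t)) \<longlonglongrightarrow> 0" by (rule tendsto_zero_squeeze[OF L2sq_nonneg le1 lim1])
        show "(\<lambda>n. L2sq (\<lambda>t. (weak_deriv (Q (X n)) t - \<tau> *\<^sub>R descent' (Q (X n)) t) - (weak_deriv (Q s) t - \<tau> *\<^sub>R descent' (Q s) t))) \<longlonglongrightarrow> 0"
          by (rule tendsto_zero_squeeze[OF L2sq_nonneg le2 lim2])
      qed
      then show ?thesis using cQ by simp
    qed
    have contQ: "((\<lambda>r. H1_norm (\<lambda>t. Q r t - Q s t)) \<longlongrightarrow> 0) (at s within {0..1})"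
      and contP: "((\<lambda>r. H1_norm (\<lambda>t. P r t - P s t)) \<longlongrightarrow> 0) (at s within {0..1})" if s: "s \<in> {0..1}" for s
    proof -
      have "((\<lambda>r. H1_norm (\<lambda>t. Q r t - Q s t)) \<circ> X) \<longlonglongrightarrow> 0 \<and> ((\<lambda>r. H1_norm (\<lambda>t. P r t - P s t)) \<circ> X) \<longlonglongrightarrow> 0" 
        if X: "\<forall>n. X n \<in> {0..1} - {s}" "X \<longlonglongrightarrow> s" for X
      proof -
        have Xn: "X n \<in> {0..1}" "X n \<noteq> s" for n using X(1) by auto
        note cc = seq[OF s Xn(1) X(2) Xn(2)]
        have "(\<lambda>n. H1_norm (\<lambda>t. Q (X n) t - Q s t)) \<longlonglongrightarrow> 0"
          using cc by (subst (asm) curve_conv_H1_norm) (use conn_weak_deriv(1)[OF Qc[OF Xn(1)]] conn_weak_deriv(1)[OF Qc[OF s]] in auto)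
        moreover have "(\<lambda>n. H1_norm (\<lambda>t. P (X n) t - P s t)) \<longlonglongrightarrow> 0"
          using conjunct2[OF cc] by (subst (asm) curve_conv_H1_norm) (use conn_weak_deriv(1)[OF Pc[OF Xn(1)]] conn_weak_deriv(1)[OF Pc[OF s]] in auto)
        ultimately show ?thesis by (simp add: o_def)
      qed
      then show "((\<lambda>r. H1_norm (\<lambda>t. Q r t - Q s t)) \<longlongrightarrow> 0) (at s within {0..1})"
        "((\<lambda>r. H1_norm (\<lambda>t. P r t - P s t)) \<longlongrightarrow> 0) (at s within {0..1})"
        unfolding tendsto_at_iff_sequentially by auto
    qed
    have "(\<lambda>s t. P s t - psi sm sp t) \<in> Gamma_sym V i sm sp F0 F1"
      unfolding Gamma_sym_def
    proof (intro CollectI conjI ballI)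
      fix s :: real assume s: "s \<in> {0..1}"
      show "(\<lambda>t. P s t - psi sm sp t) \<in> H1_sym i"
        unfolding H1_sym_def using conn_minus_psi_H1[OF Pc[OF s]] Psym[OF s] by (simp add: psi_symmetric)
      show "((\<lambda>r. H1_norm (\<lambda>t. P r t - psi sm sp t - (P s t - psi sm sp t))) \<longlongrightarrow> 0) (at s within {0..1})"
        using contP[OF s] by simp
    next
      show "(\<lambda>t. P 0 t - psi sm sp t) \<in> V_sym V i sm sp F0" "(\<lambda>t. P 1 t - psi sm sp t) \<in> V_sym V i sm sp F1"
        unfolding V_sym_def F_sym_def e0(2) e1(2) using e0(1) e1(1) QX(1) by auto
    qed
    then have "ennreal c0 \<le> (SUP s\<in>{0..1}. J V sm sp (\<lambda>t. P s t - psi sm sp t))"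
      unfolding c(1)[symmetric] c_sym_def by (rule INF_lower2) simp
    also have "\<dots> = (SUP s\<in>{0..1}. energy V (P s))" by (simp add: J_def)
    finally have sup: "ennreal c0 \<le> (SUP s\<in>{0..1}. energy V (P s))" .
    have "\<exists>s\<in>{0..1}. c0 - \<epsilon> \<le> real_energy (P s)"
    proof (cases "c0 - \<epsilon> \<ge> 0")
      case True
      have "ennreal (c0 - \<epsilon>) < ennreal c0" using True \<epsilon>(1) by (intro ennreal_lessI) auto
      then have "ennreal (c0 - \<epsilon>) < (SUP s\<in>{0..1}. energy V (P s))" using sup by (rule less_le_trans)
      then obtain s where s: "s \<in> {0..1}" "ennreal (c0 - \<epsilon>) < energy V (P s)" unfolding less_SUP_iff by blast
      then have "c0 - \<epsilon> \<le> real_energy (P s)" 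
        unfolding finite_curve_energy[OF d(1)[OF s(1)]] using ennreal_less_iff[OF True] by simp
      then show ?thesis using s(1) by blast
    next
      case False
      then show ?thesis using real_energy_nonneg[of "P 0"] by (intro bexI[of _ 0]) auto
    qed
    then have last: "\<exists>s\<in>{0..1}. c0 - \<epsilon> \<le> real_energy (Q s) - \<tau> / 2 * L2sq (residual (Q s))"
      using d(2) by (meson le_diff_eq order_trans)
    show "\<exists>Q. (\<forall>s\<in>{0..1}. Q s \<in> X_sym V i sm sp \<and> finite_curve M (Q s) \<and> real_energy (Q s) \<le> c0 + \<epsilon> \<and>
        min_energy V sm sp + ennreal (\<tau> / 2 * L2sq (residual (Q s))) \<le> energy V (Q s)) \<and>
     Q 0 \<in> F0 \<and> Q 1 \<in> F1 \<and>
     (\<forall>s\<in>{0..1}. ((\<lambda>r. H1_norm (\<lambda>t. Q r t - Q s t)) \<longlongrightarrow> 0) (at s within {0..1::real})) \<and>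
     (\<exists>s\<in>{0..1}. c0 - \<epsilon> \<le> real_energy (Q s) - \<tau> / 2 * L2sq (residual (Q s)))"
      using QX(1) fQ rQ low e0(1) e1(1) contQ last by (intro exI[of _ Q] conjI ballI) auto
  qed
qed

lemma path_between_separated_sets:
  fixes Q :: "real \<Rightarrow> real \<Rightarrow> real ^ 'n"
  assumes Qc: "\<And>s. s \<in> {0..1} \<Longrightarrow> Q s \<in> conn V sm sp" 
    and F: "F0 \<subseteq> conn V sm sp" "F1 \<subseteq> conn V sm sp" 
    and cont: "\<And>s. s \<in> {0..1} \<Longrightarrow> ((\<lambda>r. H1_norm (\<lambda>t. Q r t - Q s t)) \<longlongrightarrow> 0) (at s within {0..1::real})"
    and ends: "Q 0 \<in> F0" "Q 1 \<in> F1" and sep: "H1_setdist F0 F1 > 0"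
  shows "\<exists>s\<in>{0..1}. \<forall>p\<in>F0 \<union> F1. H1_norm (\<lambda>t. Q s t - p t) \<ge> H1_setdist F0 F1 / 2"
proof (rule ccontr)
  define N where "N p q = H1_norm (\<lambda>t. p t - q t)" for p q :: "real \<Rightarrow> real ^ 'n"
  define d where "d = H1_setdist F0 F1"
  assume "\<not> ?thesis"
  then have cover: "\<exists>p\<in>F0 \<union> F1. N (Q s) p < d / 2" if "s \<in> {0..1}" for s
    using that by (force simp: N_def d_def not_le)
  have tri: "N p r \<le> N p q + N q r" if "p \<in> conn V sm sp" "q \<in> conn V sm sp" "r \<in> conn V sm sp" for p q r
  proof -
    have "(\<lambda>t. a t - b t) \<in> H1" if "a \<in> conn V sm sp" "b \<in> conn V sm sp" for a b
      using H1_diff[OF conn_minus_psi_H1[OF that(1)] conn_minus_psi_H1[OF that(2)]] by simp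
    from H1_norm_triangle[OF this[OF that(1,2)] this[OF that(2,3)]] show ?thesis by (simp add: N_def)
  qed
  have comm: "N p q = N q p" if "p \<in> conn V sm sp" "q \<in> conn V sm sp" for p q
    unfolding N_def by (rule H1_norm_minus_commute[OF conn_weak_deriv(1)[OF that(1)] conn_weak_deriv(1)[OF that(2)]])
  have far: "d \<le> N p q" if "p \<in> F0" "q \<in> F1" for p q
  proof -
    have "bdd_below ((\<lambda>p. H1_norm (\<lambda>t. fst p t - snd p t)) ` (F0 \<times> F1))"
      by (rule bdd_belowI[of _ 0]) (auto simp: H1_norm_nonneg)
    then have "d \<le> (\<lambda>p. H1_norm (\<lambda>t. fst p t - snd p t)) (p, q)"
      unfolding d_def H1_setdist_def by (rule cINF_lower) (use that in simp)
    then show ?thesis by (simp add: N_def)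
  qed
  \<comment> \<open>otherwise the parameters near F0 and those near F1 form a partition of the interval into open sets\<close>
  define U where "U F = {s\<in>{0..1}. \<exists>p\<in>F. N (Q s) p < d / 2}" for F
  have opn: "openin (top_of_set {0..1}) (U F)" if F: "F \<subseteq> conn V sm sp" for F
    unfolding openin_euclidean_subtopology_iff
  proof (intro conjI ballI)
    show "U F \<subseteq> {0..1}" by (auto simp: U_def)
    fix s assume "s \<in> U F"
    then obtain p where p: "s \<in> {0..1}" "p \<in> F" "N (Q s) p < d / 2" by (auto simp: U_def)
    have "d / 2 - N (Q s) p > 0" using p by simp
    from tendstoD[OF cont[OF p(1)] this] obtain e where e: "e > 0" 
      "\<And>r. r \<in> {0..1} \<Longrightarrow> r \<noteq> s \<Longrightarrow> dist r s < e \<Longrightarrow> dist (N (Q r) (Q s)) 0 < d / 2 - N (Q s) p"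
      unfolding eventually_at N_def by blast
    have "r \<in> U F" if r: "r \<in> {0..1}" "dist r s < e" for r
    proof (cases "r = s")
      case False
      have "N (Q r) (Q s) < d / 2 - N (Q s) p" using e(2)[OF r(1) False r(2)] by (simp add: dist_real_def)
      moreover have "N (Q r) p \<le> N (Q r) (Q s) + N (Q s) p" by (rule tri) (use Qc r p F in auto)
      ultimately have "N (Q r) p < d / 2" by linarith
      then show ?thesis using r(1) p(2) unfolding U_def by blast
    qed (use \<open>s \<in> U F\<close> in simp)
    then show "\<exists>e>0. \<forall>x'\<in>{0..1}. dist x' s < e \<longrightarrow> x' \<in> U F" using e(1) by blast
  qed
  have N0: "N p p = 0" if "p \<in> conn V sm sp" for p
    unfolding N_def H1_norm_diff[OF conn_weak_deriv(1)[OF that] conn_weak_deriv(1)[OF that]] by simp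
  have "d > 0" using sep by (simp add: d_def)
  have UI: "s \<in> U F" if "s \<in> {0..1}" "Q s \<in> F" for s F
  proof -
    have "N (Q s) (Q s) < d / 2" using N0[OF Qc[OF that(1)]] \<open>d > 0\<close> by simp
    then show ?thesis using that unfolding U_def by blast
  qed
  have "0 \<in> U F0" "1 \<in> U F1" using UI ends by auto
  moreover have "U F0 \<inter> U F1 = {}"
  proof (rule ccontr)
    assume "U F0 \<inter> U F1 \<noteq> {}"
    then obtain s p0 p1 where s: "s \<in> {0..1}" "p0 \<in> F0" "p1 \<in> F1" "N (Q s) p0 < d / 2" "N (Q s) p1 < d / 2"
      by (auto simp: U_def)
    have "N p0 p1 \<le> N p0 (Q s) + N (Q s) p1" by (rule tri) (use s F Qc in auto)
    moreover have "N p0 (Q s) = N (Q s) p0" by (rule comm) (use s F Qc in auto)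
    ultimately show False using s far[OF s(2,3)] by linarith
  qed
  moreover have "{0..1} \<subseteq> U F0 \<union> U F1" using cover unfolding U_def by blast
  moreover have "connected {0..1::real}" by simp
  ultimately show False using opn[OF F(1)] opn[OF F(2)] unfolding connected_openin by blast
qed

end

section \<open>Compactness of almost solutions\<close>

lemma primitive_has_vector_derivative:
  fixes q :: "real \<Rightarrow> 'a::euclidean_space"
  assumes p: "primitive q g" and g: "continuous_on UNIV g"
  shows "(q has_vector_derivative g t) (at t)"
proof -
  have "((\<lambda>x. integral {t-1..x} g) has_vector_derivative g t) (at t within {t-1..t+1})"
    by (rule integral_has_vector_derivative) (use g in \<open>auto intro: continuous_on_subset\<close>)
  then have "((\<lambda>x. integral {t-1..x} g + q (t-1)) has_vector_derivative g t) (at t within {t-1..t+1})"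
    by (auto intro!: derivative_eq_intros)
  then have "(q has_vector_derivative g t) (at t within {t-1..t+1})"
  proof (rule has_vector_derivative_transform[rotated 2])
    show "q x = integral {t-1..x} g + q (t-1)" if "x \<in> {t-1..t+1}" for x
    proof -
      have "q x - q (t-1) = (LINT r:{t-1..x}|lborel. g r)" by (rule primitiveD[OF p]) (use that in simp)
      also have "\<dots> = integral {t-1..x} g" by (rule set_borel_integral_eq_integral(2)[OF primitive_set_integrable[OF p]])
      finally show ?thesis by (simp add: algebra_simps)
    qed
  qed simp
  moreover have "at t within {t-1..t+1} = at t" by (rule at_within_interior) simp
  ultimately show ?thesis by simp
qed

lemma L2_loc_bounded:
  fixes f :: "real \<Rightarrow> 'a::euclidean_space"
  assumes "f \<in> borel_measurable borel" "\<And>t. norm (f t) \<le> B"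
  shows "f \<in> L2_loc"
proof (rule L2_locI[OF assms(1)])
  note [measurable] = assms(1)
  show "set_integrable lborel {a..b} (\<lambda>t. (norm (f t))\<^sup>2)" for a b
    by (rule set_integrable_boundedI[OF _ set_integrable_const[of a b "B\<^sup>2"]]) 
      (auto intro!: power_mono assms(2))
qed

lemma L2_integral_norm_le:
  fixes f :: "real \<Rightarrow> 'a::euclidean_space"
  assumes f: "f \<in> L2" and ab: "a \<le> b"
  shows "(LINT t:{a..b}|lborel. norm (f t)) \<le> sqrt (b - a) * sqrt (L2sq f)"
proof (rule cross_term_bound)
  fix r :: real assume r: "r > 0"
  have si: "set_integrable lborel {a..b} (\<lambda>t. (norm (f t))\<^sup>2)" by (rule L2_loc_sq_set_integrable[OF L2_imp_L2_loc[OF f]])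
  have "2 * (LINT t:{a..b}|lborel. norm (f t)) = (LINT t:{a..b}|lborel. 2 * norm (f t))" by simp
  also have "\<dots> \<le> (LINT t:{a..b}|lborel. r + (norm (f t))\<^sup>2 / r)"
  proof (rule set_integral_mono)
    show "set_integrable lborel {a..b} (\<lambda>t. 2 * norm (f t))"
      using L2_loc_norm_set_integrable[OF L2_imp_L2_loc[OF f]] by (intro set_integrable_mult_right) auto
    show "set_integrable lborel {a..b} (\<lambda>t. r + (norm (f t))\<^sup>2 / r)"
      by (intro set_integral_add set_integrable_const set_integrable_divide si)
    show "2 * norm (f t) \<le> r + (norm (f t))\<^sup>2 / r" for t
      using zero_le_power2[of "r - norm (f t)"] r by (simp add: field_simps power2_eq_square)
  qed
  also have "\<dots> = (LINT t:{a..b}|lborel. r) + (LINT t:{a..b}|lborel. (norm (f t))\<^sup>2 / r)"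
    by (intro set_integral_add(2) set_integrable_const set_integrable_divide si)
  also have "\<dots> = r * (b - a) + (LINT t:{a..b}|lborel. (norm (f t))\<^sup>2) / r" 
    using ab by (simp add: set_integral_constant mult.commute)
  also have "\<dots> \<le> r * (b - a) + L2sq f / r"
    using r by (intro add_left_mono divide_right_mono set_integral_le_integral[OF L2_integrable[OF f]]) auto
  finally show "2 * (LINT t:{a..b}|lborel. norm (f t)) \<le> r * (b - a) + L2sq f / r" .
qed (use ab in auto)

lemma L2_integral_norm_tendsto_0:
  fixes R :: "nat \<Rightarrow> real \<Rightarrow> 'a::euclidean_space"
  assumes R: "\<And>n. R n \<in> L2" "(\<lambda>n. L2sq (R n)) \<longlonglongrightarrow> 0" and ab: "a \<le> b"
  shows "(\<lambda>n. LINT t:{a..b}|lborel. norm (R n t)) \<longlonglongrightarrow> 0"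
proof (rule tendsto_zero_squeeze)
  show "0 \<le> (LINT t:{a..b}|lborel. norm (R n t))" for n by (rule set_integral_nonneg') simp
  show "(LINT t:{a..b}|lborel. norm (R n t)) \<le> sqrt (b - a) * sqrt (L2sq (R n))" for n
    by (rule L2_integral_norm_le[OF R(1) ab])
  show "(\<lambda>n. sqrt (b - a) * sqrt (L2sq (R n))) \<longlonglongrightarrow> 0"
    using tendsto_mult[OF tendsto_const[of "sqrt (b-a)"] tendsto_real_sqrt[OF R(2)]] by simp
qed

lemma set_integral_bounded_tendsto:
  fixes f :: "nat \<Rightarrow> real \<Rightarrow> 'a::euclidean_space"
  assumes [measurable]: "\<And>n. f n \<in> borel_measurable borel" "g \<in> borel_measurable borel" 
    and B: "\<And>n t. norm (f n t) \<le> B" and lim: "\<And>t. (\<lambda>n. f n t) \<longlonglongrightarrow> g t"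
  shows "(\<lambda>n. LINT t:{a..b}|lborel. f n t) \<longlonglongrightarrow> (LINT t:{a..b}|lborel. g t)"
  unfolding set_lebesgue_integral_def
proof (rule integral_dominated_convergence[of _ _ _ "\<lambda>t. indicat_real {a..b} t *\<^sub>R B"])
  show "integrable lborel (\<lambda>t. indicat_real {a..b} t *\<^sub>R B)"
    using set_integrable_const[of a b B] unfolding set_integrable_def .
  show "AE t in lborel. norm (indicat_real {a..b} t *\<^sub>R f n t) \<le> indicat_real {a..b} t *\<^sub>R B" for n
    using B[of n] by (intro AE_I2) (simp add: indicator_def)
  show "AE t in lborel. (\<lambda>n. indicat_real {a..b} t *\<^sub>R f n t) \<longlonglongrightarrow> indicat_real {a..b} t *\<^sub>R g t"
    by (intro AE_I2 tendsto_intros lim)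
qed measurable

text \<open>Pointwise convergence on a dense set extends to all points for functions whose increments are
  controlled uniformly up to an error that tends to zero; the functions themselves need not be equicontinuous.\<close>

lemma convergent_from_dense:
  fixes f :: "nat \<Rightarrow> real \<Rightarrow> 'a::banach"
  assumes dense: "\<And>r. r \<in> \<rat> \<Longrightarrow> convergent (\<lambda>n. f n r)"
    and incr: "\<And>n a b. a \<le> b \<Longrightarrow> b \<le> a + 1 \<Longrightarrow> norm (f n b - f n a) \<le> L * (b - a) + \<sigma> n"
    and \<sigma>: "\<sigma> \<longlonglongrightarrow> 0" and L: "L \<ge> 0"
  shows "convergent (\<lambda>n. f n t)"
proof -
  have "Cauchy (\<lambda>n. f n t)"
    unfolding Cauchy_def
  proof (intro allI impI)
    fix e :: real assume e: "e > 0"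
    define d where "d = min 1 (e / (8 * (L + 1)))"
    have d: "d > 0" "d \<le> 1" using e L by (auto simp: d_def)
    have "L * d \<le> (L + 1) * (e / (8 * (L + 1)))" using d L unfolding d_def by (intro mult_mono) auto
    also have "\<dots> = e / 8"
    proof -
      have "8 * L + 8 \<noteq> 0" using L by linarith
      then show ?thesis by (simp add: field_simps)
    qed
    finally have Ld: "L * d \<le> e / 8" .
    obtain r where r: "r \<in> \<rat>" "t < r" "r < t + d" using Rats_dense_in_real[of t "t + d"] d(1) by auto
    have step: "norm (f n r - f n t) \<le> e / 8 + \<sigma> n" for n
    proof -
      have "norm (f n r - f n t) \<le> L * (r - t) + \<sigma> n" by (rule incr) (use r d in auto)
      also have "L * (r - t) \<le> L * d" using r L by (intro mult_left_mono) auto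
      finally show ?thesis using Ld by simp
    qed
    have "\<forall>\<^sub>F n in sequentially. \<sigma> n < e / 8" using order_tendstoD(2)[OF \<sigma>, of "e/8"] e by simp
    then obtain N1 where N1: "\<And>n. n \<ge> N1 \<Longrightarrow> \<sigma> n < e / 8" unfolding eventually_sequentially by blast
    have "Cauchy (\<lambda>n. f n r)" using dense[OF r(1)] by (rule convergent_Cauchy)
    then obtain N2 where N2: "\<And>m n. m \<ge> N2 \<Longrightarrow> n \<ge> N2 \<Longrightarrow> dist (f m r) (f n r) < e / 4"
      using e unfolding Cauchy_def by (meson divide_pos_pos zero_less_numeral)
    have "dist (f m t) (f n t) < e" if "m \<ge> max N1 N2" "n \<ge> max N1 N2" for m n
    proof -
      have a: "dist (f m r) (f n r) < e / 4" using N2 that by simp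
      have b: "dist (f m t) (f m r) \<le> e / 8 + \<sigma> m" using step[of m] by (simp add: dist_norm norm_minus_commute)
      have c: "dist (f n r) (f n t) \<le> e / 8 + \<sigma> n" using step[of n] by (simp add: dist_norm)
      have "dist (f m t) (f n t) \<le> dist (f m t) (f m r) + dist (f m r) (f n t)" by (rule dist_triangle)
      also have "dist (f m r) (f n t) \<le> dist (f m r) (f n r) + dist (f n r) (f n t)" by (rule dist_triangle)
      finally have "dist (f m t) (f n t) \<le> dist (f m t) (f m r) + (dist (f m r) (f n r) + dist (f n r) (f n t))" by simp
      moreover have "\<sigma> m < e / 8" "\<sigma> n < e / 8" using N1 that by auto
      ultimately show ?thesis using a b c e by linarith
    qed
    then show "\<exists>N. \<forall>m\<ge>N. \<forall>n\<ge>N. dist (f m t) (f n t) < e" by blast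
  qed
  then show ?thesis by (rule Cauchy_convergent)
qed

context double_well
begin

text \<open>Both sequences have increments controlled by bounded functions up to the norm of \<open>R n\<close>, so a diagonal
  sequence that converges at all rational times converges everywhere. In the limit the error terms vanish, and
  the integral equations become differential equations.\<close>

lemma almost_solutions_converge:
  assumes Q: "\<And>n. primitive (Q n) (\<lambda>t. Y n t - R n t)" and Y: "\<And>n. primitive (Y n) (\<lambda>t. grad V (Q n t) - R n t)"
    and M: "\<And>n t. norm (Q n t) \<le> M" and B: "\<And>n t. norm (Y n t) \<le> B"
    and R: "\<And>n. R n \<in> L2" "(\<lambda>n. L2sq (R n)) \<longlonglongrightarrow> 0"
  obtains k u p where "strict_mono (k :: nat \<Rightarrow> nat)" 
    "\<And>t. (\<lambda>n. Q (k n) t) \<longlonglongrightarrow> u t" "\<And>t. (\<lambda>n. Y (k n) t) \<longlonglongrightarrow> p t"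
    "\<And>t. (u has_vector_derivative p t) (at t)" "\<And>t. (p has_vector_derivative grad V (u t)) (at t)"
    "continuous_on UNIV u" "continuous_on UNIV p" "primitive u p"
proof -
  have B0: "B \<ge> 0" using B[of 0 0] norm_ge_zero order_trans by blast
  have "compact (grad V ` cball 0 M)"
    by (intro compact_continuous_image continuous_on_subset[OF grad_cont]) auto
  then obtain G where G: "G > 0" "\<And>u. u \<in> cball 0 M \<Longrightarrow> norm (grad V u) \<le> G" using compact_image_norm_bound by blast
  have FG: "norm (grad V (Q n t)) \<le> G" for n t using G(2)[of "Q n t"] M by simp
  define \<sigma> where "\<sigma> n = sqrt (L2sq (R n))" for n
  have \<sigma>: "\<sigma> \<longlonglongrightarrow> 0" unfolding \<sigma>_def using tendsto_real_sqrt[OF R(2)] by simp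
  have incr: "norm (f b - f a) \<le> C * (b - a) + \<sigma> n" 
    if f: "primitive f (\<lambda>t. h t - R n t)" and h: "\<And>t. norm (h t) \<le> C" and ab: "a \<le> b" "b \<le> a + 1" for f h a b C n
  proof -
    have "norm (f b - f a) \<le> (LINT t:{a..b}|lborel. norm (h t - R n t))" by (rule primitive_dist_le[OF f ab(1)])
    also have "\<dots> \<le> (LINT t:{a..b}|lborel. C + norm (R n t))"
    proof (rule set_integral_mono)
      show "set_integrable lborel {a..b} (\<lambda>t. norm (h t - R n t))" by (rule L2_loc_norm_set_integrable[OF primitive_L2_loc[OF f]])
      show "set_integrable lborel {a..b} (\<lambda>t. C + norm (R n t))"
        by (intro set_integral_add set_integrable_const L2_loc_norm_set_integrable L2_imp_L2_loc R)
      show "norm (h t - R n t) \<le> C + norm (R n t)" for t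
        using norm_triangle_ineq4[of "h t" "R n t"] h[of t] by linarith
    qed
    also have "\<dots> = (LINT t:{a..b}|lborel. C) + (LINT t:{a..b}|lborel. norm (R n t))"
      by (intro set_integral_add(2) set_integrable_const L2_loc_norm_set_integrable L2_imp_L2_loc R)
    also have "(LINT t:{a..b}|lborel. C) = C * (b - a)" using set_integral_constant[OF ab(1)] by (simp add: mult.commute)
    also have "(LINT t:{a..b}|lborel. norm (R n t)) \<le> sqrt (b - a) * \<sigma> n"
      unfolding \<sigma>_def by (rule L2_integral_norm_le[OF R(1) ab(1)])
    also have "\<dots> \<le> 1 * \<sigma> n" unfolding \<sigma>_def using ab by (intro mult_right_mono) auto
    finally show ?thesis by simp
  qed
  have bd: "norm (Q n x, Y n x) \<le> M + B" for n x
    using norm_Pair_le[of "Q n x" "Y n x"] M[of n x] B[of n x] by linarith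
  obtain k where k: "strict_mono (k :: nat \<Rightarrow> nat)" "\<And>x. x \<in> \<rat> \<Longrightarrow> \<exists>l. (\<lambda>n. (Q (k n) x, Y (k n) x)) \<longlonglongrightarrow> l"
    by (rule function_convergent_subsequence[OF countable_rat, of "\<lambda>n x. (Q n x, Y n x)" "M + B", OF bd]) blast
  have \<sigma>k: "(\<lambda>n. \<sigma> (k n)) \<longlonglongrightarrow> 0" using LIMSEQ_subseq_LIMSEQ[OF \<sigma> k(1)] by (simp add: o_def)
  have Rk: "(\<lambda>n. L2sq (R (k n))) \<longlonglongrightarrow> 0" using LIMSEQ_subseq_LIMSEQ[OF R(2) k(1)] by (simp add: o_def)
  have "convergent (\<lambda>n. Q (k n) t)" for t
  proof (rule convergent_from_dense[OF _ _ \<sigma>k B0])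
    show "convergent (\<lambda>n. Q (k n) r)" if "r \<in> \<rat>" for r
      using k(2)[OF that] tendsto_fst unfolding convergent_def by fastforce
  qed (rule incr[OF Q B])
  then have "\<exists>l. (\<lambda>n. Q (k n) t) \<longlonglongrightarrow> l" for t unfolding convergent_def .
  then obtain u where u: "\<And>t. (\<lambda>n. Q (k n) t) \<longlonglongrightarrow> u t" by metis
  have "convergent (\<lambda>n. Y (k n) t)" for t
  proof (rule convergent_from_dense[OF _ _ \<sigma>k])
    show "convergent (\<lambda>n. Y (k n) r)" if "r \<in> \<rat>" for r
      using k(2)[OF that] tendsto_snd unfolding convergent_def by fastforce
    show "0 \<le> G" using G(1) by simp
  qed (rule incr[OF Y FG])
  then have "\<exists>l. (\<lambda>n. Y (k n) t) \<longlonglongrightarrow> l" for t unfolding convergent_def .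
  then obtain p where p: "\<And>t. (\<lambda>n. Y (k n) t) \<longlonglongrightarrow> p t" by metis
  note [measurable] = primitive_measurable(1)[OF Q] primitive_measurable(1)[OF Y]
  have um[measurable]: "u \<in> borel_measurable borel" by (rule borel_measurable_LIMSEQ_metric[OF _ u]) measurable
  have pm[measurable]: "p \<in> borel_measurable borel" by (rule borel_measurable_LIMSEQ_metric[OF _ p]) measurable
  \<comment> \<open>the passage to the limit is the same for the two equations\<close>
  have limit: "primitive x y" 
    if X: "\<And>n. primitive (X n) (\<lambda>t. h n t - R (k n) t)" and h: "\<And>n. h n \<in> borel_measurable borel" "\<And>n t. norm (h n t) \<le> C"
      and xl: "\<And>t. (\<lambda>n. X n t) \<longlonglongrightarrow> x t" and yl: "\<And>t. (\<lambda>n. h n t) \<longlonglongrightarrow> y t" for X h x y C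
    unfolding primitive_def
  proof (intro conjI allI impI)
    have ym: "y \<in> borel_measurable borel" by (rule borel_measurable_LIMSEQ_metric[OF h(1) yl])
    have yb: "norm (y t) \<le> C" for t by (rule LIMSEQ_le_const2[OF tendsto_norm[OF yl]]) (use h(2) in auto)
    show "y \<in> L2_loc" by (rule L2_loc_bounded[OF ym yb])
    fix a b :: real assume ab: "a \<le> b"
    have hi: "set_integrable lborel {a..b} (h n)" for n by (rule L2_loc_set_integrable[OF L2_loc_bounded[OF h(1) h(2)]])
    have Ri: "set_integrable lborel {a..b} (R (k n))" for n by (rule L2_loc_set_integrable[OF L2_imp_L2_loc[OF R(1)]])
    have "X n b - X n a = (LINT t:{a..b}|lborel. h n t) - (LINT t:{a..b}|lborel. R (k n) t)" for n
      using primitiveD[OF X ab, of n] set_integral_diff(2)[OF hi Ri] by simp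
    moreover have "(\<lambda>n. LINT t:{a..b}|lborel. h n t) \<longlonglongrightarrow> (LINT t:{a..b}|lborel. y t)"
      by (rule set_integral_bounded_tendsto[OF h(1) ym h(2) yl])
    moreover have "(\<lambda>n. LINT t:{a..b}|lborel. R (k n) t) \<longlonglongrightarrow> 0"
      by (rule Lim_null_comparison[OF _ L2_integral_norm_tendsto_0[OF R(1) Rk ab]]) 
        (intro always_eventually allI set_integral_norm_le Ri)
    ultimately have "(\<lambda>n. X n b - X n a) \<longlonglongrightarrow> (LINT t:{a..b}|lborel. y t) - 0" 
      by (simp only: tendsto_diff)
    moreover have "(\<lambda>n. X n b - X n a) \<longlonglongrightarrow> x b - x a" by (intro tendsto_diff xl)
    ultimately show "x b - x a = (LINT t:{a..b}|lborel. y t)" using LIMSEQ_unique by fastforce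
  qed
  have up: "primitive u p"
    by (rule limit[OF Q _ B u p]) measurable
  have cu: "continuous_on UNIV u" by (rule primitive_continuous[OF up])
  have pp: "primitive p (\<lambda>t. grad V (u t))"
  proof (rule limit[OF Y _ FG p])
    show "(\<lambda>t. grad V (Q (k n) t)) \<in> borel_measurable borel" for n by measurable
    show "(\<lambda>n. grad V (Q (k n) t)) \<longlonglongrightarrow> grad V (u t)" for t
      by (rule continuous_on_tendsto_compose[OF grad_cont u]) auto
  qed
  have cp: "continuous_on UNIV p" by (rule primitive_continuous[OF pp])
  have cg: "continuous_on UNIV (\<lambda>t. grad V (u t))" by (rule continuous_on_compose2[OF grad_cont cu]) auto
  show thesis
    by (rule that[OF k(1) u p primitive_has_vector_derivative[OF up cp] primitive_has_vector_derivative[OF pp cg] cu cp up])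
qed

text \<open>Lower semicontinuity: on bounded intervals \<open>Y n\<close> is bounded and differs from the derivative of
  \<open>Q n\<close> by the vanishing \<open>R n\<close>.\<close>

lemma energy_lower_semicontinuous:
  assumes Q: "\<And>n. primitive (Q n) (\<lambda>t. Y n t - R n t)" and Ym: "\<And>n. Y n \<in> borel_measurable borel"
    and M: "\<And>n t. norm (Q n t) \<le> M" and B: "\<And>n t. norm (Y n t) \<le> B"
    and R: "\<And>n. R n \<in> L2" "(\<lambda>n. L2sq (R n)) \<longlonglongrightarrow> 0"
    and u: "\<And>t. (\<lambda>n. Q n t) \<longlonglongrightarrow> u t" and p: "\<And>t. (\<lambda>n. Y n t) \<longlonglongrightarrow> p t" and up: "primitive u p"
    and gL: "\<And>n. (\<lambda>t. Y n t - R n t) \<in> L2" and Vi: "\<And>n. integrable lborel (\<lambda>t. V (Q n t))"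
    and E: "(\<lambda>n. L2sq (\<lambda>t. Y n t - R n t) / 2 + (LINT t|lborel. V (Q n t))) \<longlonglongrightarrow> E"
  shows "p \<in> L2" "integrable lborel (\<lambda>t. V (u t))" "L2sq p / 2 + (LINT t|lborel. V (u t)) \<le> E"
proof -
  note [measurable] = primitive_measurable[OF up] primitive_measurable(1)[OF Q] Ym
  have "compact (V ` cball 0 M)"
    by (intro compact_continuous_image continuous_on_subset[OF V_cont]) auto
  then obtain G where G: "\<And>u. u \<in> cball 0 M \<Longrightarrow> norm (V u) \<le> G" using compact_image_norm_bound by blast
  have B0: "B \<ge> 0" using B[of 0 0] norm_ge_zero order_trans by blast
  let ?f = "\<lambda>t. (norm (p t))\<^sup>2 / 2 + V (u t)"
  let ?F = "\<lambda>n t. (norm (Y n t))\<^sup>2 / 2 + V (Q n t)"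
  have bd: "norm (?F n t) \<le> B\<^sup>2 / 2 + G" for n t
  proof -
    have "(norm (Y n t))\<^sup>2 \<le> B\<^sup>2" by (intro power_mono B) simp
    moreover have "V (Q n t) \<le> G" using G[of "Q n t"] M[of n t] by simp
    ultimately show ?thesis using V_nonneg[of "Q n t"] by simp
  qed
  have ptl: "(\<lambda>n. ?F n t) \<longlonglongrightarrow> ?f t" for t
    by (intro tendsto_intros p continuous_on_tendsto_compose[OF V_cont u]) auto
  have le: "(LINT t:{-real m..real m}|lborel. ?f t) \<le> E" for m :: nat
  proof -
    let ?I = "{-real m..real m}"
    have lim: "(\<lambda>n. LINT t:?I|lborel. ?F n t) \<longlonglongrightarrow> (LINT t:?I|lborel. ?f t)"
      by (rule set_integral_bounded_tendsto[OF _ _ bd ptl]) measurable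
    have r0: "(\<lambda>n. LINT t:?I|lborel. norm (R n t)) \<longlonglongrightarrow> 0" by (rule L2_integral_norm_tendsto_0[OF R]) simp
    have up: "(LINT t:?I|lborel. ?F n t) \<le> (L2sq (\<lambda>t. Y n t - R n t) / 2 + (LINT t|lborel. V (Q n t))) + B * (LINT t:?I|lborel. norm (R n t))" for n
    proof -
      have i: "integrable lborel (\<lambda>t. (norm (Y n t - R n t))\<^sup>2 / 2 + V (Q n t))" using L2_integrable[OF gL] Vi by simp
      have si: "set_integrable lborel ?I (\<lambda>t. (norm (Y n t - R n t))\<^sup>2 / 2 + V (Q n t))" by (rule integrable_set_integrable[OF i]) simp
      have ri: "set_integrable lborel ?I (\<lambda>t. B * norm (R n t))"
        using L2_loc_norm_set_integrable[OF L2_imp_L2_loc[OF R(1)]] by (intro set_integrable_mult_right) auto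
      have "(LINT t:?I|lborel. ?F n t) \<le> (LINT t:?I|lborel. ((norm (Y n t - R n t))\<^sup>2 / 2 + V (Q n t)) + B * norm (R n t))"
      proof (rule set_integral_mono)
        show "set_integrable lborel ?I (?F n)"
          by (rule set_integrable_boundedI[OF _ set_integrable_const[of _ _ "B\<^sup>2 / 2 + G"]]) (use bd in \<open>auto simp del: real_norm_def\<close>)
        show "set_integrable lborel ?I (\<lambda>t. ((norm (Y n t - R n t))\<^sup>2 / 2 + V (Q n t)) + B * norm (R n t))"
          by (rule set_integral_add(1)[OF si ri])
        fix t
        have "(norm (Y n t))\<^sup>2 = (norm (Y n t - R n t))\<^sup>2 + 2 * (Y n t \<bullet> R n t) - (norm (R n t))\<^sup>2"
          unfolding power2_norm_eq_inner by (simp add: inner_diff_left inner_diff_right inner_commute)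
        also have "\<dots> \<le> (norm (Y n t - R n t))\<^sup>2 + 2 * (B * norm (R n t))"
        proof -
          have "Y n t \<bullet> R n t \<le> norm (Y n t) * norm (R n t)" by (rule norm_cauchy_schwarz)
          also have "\<dots> \<le> B * norm (R n t)" by (intro mult_right_mono B) simp
          finally show ?thesis using zero_le_power2[of "norm (R n t)"] by linarith
        qed
        finally show "?F n t \<le> ((norm (Y n t - R n t))\<^sup>2 / 2 + V (Q n t)) + B * norm (R n t)" by simp
      qed
      also have "\<dots> = (LINT t:?I|lborel. (norm (Y n t - R n t))\<^sup>2 / 2 + V (Q n t)) + B * (LINT t:?I|lborel. norm (R n t))"
        by (simp add: set_integral_add(2)[OF si ri])
      also have "(LINT t:?I|lborel. (norm (Y n t - R n t))\<^sup>2 / 2 + V (Q n t)) \<le> (LINT t|lborel. (norm (Y n t - R n t))\<^sup>2 / 2 + V (Q n t))"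
        by (rule set_integral_le_integral[OF i]) (auto simp: V_nonneg)
      also have "\<dots> = L2sq (\<lambda>t. Y n t - R n t) / 2 + (LINT t|lborel. V (Q n t))" using L2_integrable[OF gL] Vi by simp
      finally show ?thesis by simp
    qed
    have "(\<lambda>n. (L2sq (\<lambda>t. Y n t - R n t) / 2 + (LINT t|lborel. V (Q n t))) + B * (LINT t:?I|lborel. norm (R n t))) \<longlonglongrightarrow> E + B * 0"
      by (intro tendsto_intros E r0)
    from LIMSEQ_le[OF lim this] up show ?thesis by auto
  qed
  have pL: "p \<in> L2_loc" by (rule primitive_L2_loc[OF up])
  have cu: "continuous_on UNIV (\<lambda>t. V (u t))" by (rule continuous_on_compose2[OF V_cont primitive_continuous[OF up]]) auto
  have si: "set_integrable lborel {-real n..real n} ?f" for n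
    by (intro set_integral_add set_integrable_divide L2_loc_sq_set_integrable[OF pL] L2_loc_set_integrable[OF L2_loc_continuous[OF cu]])
  have fm: "?f \<in> borel_measurable borel" by measurable
  have nn: "0 \<le> ?f t" for t using V_nonneg by simp
  note int = integrable_of_bounded_Icc[OF fm nn si le]
  show Vu: "integrable lborel (\<lambda>t. V (u t))" by (rule Bochner_Integration.integrable_bound[OF int(1)]) (auto simp: V_nonneg)
  have "integrable lborel (\<lambda>t. 2 * ((norm (p t))\<^sup>2 / 2))" 
    by (intro integrable_mult_right Bochner_Integration.integrable_bound[OF int(1)]) (auto simp: V_nonneg)
  then show p2: "p \<in> L2" by (intro L2I) auto
  show "L2sq p / 2 + (LINT t|lborel. V (u t)) \<le> E" using int(2) L2_integrable[OF p2] Vu by simp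
qed

text \<open>The function \<open>V \<circ> u\<close> and its derivative \<open>grad V u \<bullet> p\<close> are both integrable.\<close>

lemma potential_vanishes:
  assumes u': "\<And>t. (u has_vector_derivative p t) (at t)" and cont: "continuous_on UNIV u" "continuous_on UNIV p"
    and p: "p \<in> L2" and Vu: "integrable lborel (\<lambda>t. V (u t))" and M: "\<And>t. norm (u t) \<le> M"
  shows "((\<lambda>t. V (u t)) \<longlongrightarrow> 0) at_top" "((\<lambda>t. V (u t)) \<longlongrightarrow> 0) at_bot"
proof -
  have "((\<lambda>t. V (u t)) has_vector_derivative grad V (u t) \<bullet> p t) (at t)" for t
  proof -
    have "(u has_derivative (\<lambda>h. h *\<^sub>R p t)) (at t)" using u'[of t] by (simp add: has_vector_derivative_def)
    from diff_chain_at[OF this C2_potential_has_derivative[OF C2]]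
    show ?thesis by (simp add: o_def has_vector_derivative_def)
  qed
  then have pr: "primitive (\<lambda>t. V (u t)) (\<lambda>t. grad V (u t) \<bullet> p t)"
    by (rule primitive_C1) (intro continuous_intros cont continuous_on_compose2[OF grad_cont cont(1)] subset_UNIV)
  have i: "integrable lborel (\<lambda>t. grad V (u t) \<bullet> p t)"
    by (rule L2_inner_integrable[OF grad_L2[OF borel_measurable_continuous_onI[OF cont(1)] M Vu] p])
  show "((\<lambda>t. V (u t)) \<longlongrightarrow> 0) at_top" "((\<lambda>t. V (u t)) \<longlongrightarrow> 0) at_bot"
    using primitive_vanishes_at_top[OF pr Vu i] primitive_vanishes_at_bot[OF pr Vu i] by auto
qed

text \<open>Outside a neighbourhood of \<open>sp\<close>, the potential is bounded away from zero on the compact set of points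
  of the closed half space that keep the distance \<open>\<delta>\<close> from the other wells; the well \<open>sm\<close> is not in the half
  space.\<close>

lemma tends_to_sp:
  assumes Vu: "((\<lambda>t. V (u t)) \<longlongrightarrow> 0) F" and M: "\<And>t. norm (u t) \<le> M" and pos: "\<forall>\<^sub>F t in F. u t $ i \<ge> 0"
    and away: "\<delta> > 0" "\<And>s t. s \<in> S - {sm, sp} \<Longrightarrow> norm (u t - s) \<ge> \<delta>"
  shows "(u \<longlongrightarrow> sp) F"
proof (rule tendstoI)
  fix e :: real assume e: "e > 0"
  define K where "K = cball 0 M \<inter> {x. x $ i \<ge> 0} \<inter> {x. norm (x - sp) \<ge> e} \<inter> (\<Inter>s\<in>S - {sm, sp}. {x. norm (x - s) \<ge> \<delta>})"
  have cK: "compact K" unfolding K_def Int_assoc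
    by (intro compact_Int_closed compact_cball closed_Int closed_INT ballI closed_Collect_le continuous_intros)
  have KS: "K \<inter> S = {}"
  proof -
    have "s \<notin> K" if sS: "s \<in> S" for s
    proof -
      consider "s = sm" | "s = sp" | "s \<in> S - {sm, sp}" using sS by blast
      then show ?thesis
      proof cases
        case 1 then show ?thesis by (simp add: K_def sm_def)
      next
        case 2 then show ?thesis using e by (simp add: K_def)
      next
        case 3
        then have "s \<notin> (\<Inter>s\<in>S - {sm, sp}. {x. norm (x - s) \<ge> \<delta>})" using away(1) by (auto intro!: bexI[of _ s])
        then show ?thesis by (simp only: K_def Int_iff) simp
      qed
    qed
    then show ?thesis by blast
  qed
  obtain \<eta> where \<eta>: "\<eta> > 0" "\<And>x. x \<in> K \<Longrightarrow> V x \<ge> \<eta>" using V_bounded_below_compact[OF cK KS] by blast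
  have "\<forall>\<^sub>F t in F. V (u t) < \<eta>" using order_tendstoD(2)[OF Vu \<eta>(1)] .
  then show "\<forall>\<^sub>F t in F. dist (u t) sp < e"
    using pos
  proof eventually_elim
    fix t assume t: "V (u t) < \<eta>" "0 \<le> u t $ i"
    show "dist (u t) sp < e"
    proof (rule ccontr)
      assume "\<not> dist (u t) sp < e"
      then have "u t \<in> K" using t M away(2) by (auto simp: K_def dist_norm)
      then show False using \<eta>(2) t(1) by fastforce
    qed
  qed
qed

text \<open>Below \<open>m_star\<close> no curve of the sequence may come close to a third well, since cutting it
  there would be too cheap.\<close>

lemma away_from_other_wells:
  assumes c: "c0 \<ge> 0" "ennreal c0 < m_star V S sm sp"
  shows "\<exists>\<epsilon>>0. \<exists>\<delta>>0. \<forall>q\<in>conn V sm sp. energy V q \<le> ennreal (c0 + \<epsilon>) \<longrightarrow> (\<forall>s\<in>S - {sm, sp}. \<forall>t. norm (q t - s) \<ge> \<delta>)"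
proof -
  obtain y where y: "ennreal c0 < y" "y < m_star V S sm sp" using dense[OF c(2)] by blast
  have "y < \<infinity>" by (rule less_le_trans[OF y(2)]) simp
  then obtain r where r: "y = ennreal r" "r \<ge> 0" by (metis ennreal_cases infinity_ennreal_def less_irrefl)
  have "c0 < r" using y(1) r c(1) by (simp add: ennreal_less_iff)
  define \<epsilon> where "\<epsilon> = (r - c0) / 2"
  have \<epsilon>: "\<epsilon> > 0" using \<open>c0 < r\<close> by (simp add: \<epsilon>_def)
  have one: "\<exists>\<delta>>0. \<forall>q\<in>conn V sm sp. energy V q \<le> ennreal (c0 + \<epsilon>) \<longrightarrow> (\<forall>t. norm (q t - s) \<ge> \<delta>)" if s: "s \<in> S - {sm, sp}" for s
  proof -
    have "s \<in> S" using s by simp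
    from cut[OF this \<epsilon>] obtain \<delta> where \<delta>: "\<delta> > 0" 
      "\<And>q c. q \<in> conn V sm sp \<Longrightarrow> norm (q c - s) \<le> \<delta> \<Longrightarrow> min_energy V sm s + min_energy V s sp \<le> energy V q + ennreal \<epsilon>" by blast
    have "norm (q t - s) \<ge> \<delta>" if q: "q \<in> conn V sm sp" "energy V q \<le> ennreal (c0 + \<epsilon>)" for q t
    proof (rule ccontr)
      assume "\<not> norm (q t - s) \<ge> \<delta>"
      then have "min_energy V sm s + min_energy V s sp \<le> energy V q + ennreal \<epsilon>" by (intro \<delta>(2)[OF q(1), of t]) simp
      also have "\<dots> \<le> ennreal (c0 + \<epsilon>) + ennreal \<epsilon>" by (intro add_right_mono q(2))
      also have "\<dots> = ennreal r" using c(1) \<epsilon> by (subst ennreal_plus[symmetric]) (auto simp: \<epsilon>_def)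
      finally have "min_energy V sm s + min_energy V s sp \<le> y" by (simp add: r)
      moreover have "m_star V S sm sp \<le> min_energy V sm s + min_energy V s sp"
        unfolding m_star_def by (rule INF_lower[OF s])
      ultimately show False using y(2) by (meson leD order_trans)
    qed
    then show ?thesis using \<delta>(1) by blast
  qed
  have "\<exists>\<delta>>0. \<forall>q\<in>conn V sm sp. energy V q \<le> ennreal (c0 + \<epsilon>) \<longrightarrow> (\<forall>s\<in>A. \<forall>t. norm (q t - s) \<ge> \<delta>)" 
    if "finite A" "A \<subseteq> S - {sm, sp}" for A
    using that
  proof (induction A rule: finite_induct)
    case empty then show ?case by (intro exI[of _ 1]) simp
  next
    case (insert s A)
    have sub: "A \<subseteq> S - {sm, sp}" "s \<in> S - {sm, sp}" using insert.prems by auto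
    from insert.IH[OF sub(1)] obtain d1 where "d1 > 0" 
      "\<forall>q\<in>conn V sm sp. energy V q \<le> ennreal (c0 + \<epsilon>) \<longrightarrow> (\<forall>s\<in>A. \<forall>t. norm (q t - s) \<ge> d1)" by blast
    then have d1: "d1 > 0" "\<And>q s t. q \<in> conn V sm sp \<Longrightarrow> energy V q \<le> ennreal (c0 + \<epsilon>) \<Longrightarrow> s \<in> A \<Longrightarrow> norm (q t - s) \<ge> d1" by auto
    from one[OF sub(2)] obtain d2 where "d2 > 0" 
      "\<forall>q\<in>conn V sm sp. energy V q \<le> ennreal (c0 + \<epsilon>) \<longrightarrow> (\<forall>t. norm (q t - s) \<ge> d2)" by blast
    then have d2: "d2 > 0" "\<And>q t. q \<in> conn V sm sp \<Longrightarrow> energy V q \<le> ennreal (c0 + \<epsilon>) \<Longrightarrow> norm (q t - s) \<ge> d2" by auto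
    have "norm (q t - s') \<ge> min d1 d2" if "q \<in> conn V sm sp" "energy V q \<le> ennreal (c0 + \<epsilon>)" "s' \<in> insert s A" for q t s'
      using d1(2)[OF that(1,2), of s' t] d2(2)[OF that(1,2), of t] that(3) by fastforce
    then show ?case using d1(1) d2(1) by (intro exI[of _ "min d1 d2"]) auto
  qed
  from this[OF finite_Diff[OF finite_S] subset_refl] obtain \<delta> where "\<delta> > 0" 
    "\<forall>q\<in>conn V sm sp. energy V q \<le> ennreal (c0 + \<epsilon>) \<longrightarrow> (\<forall>s\<in>S - {sm, sp}. \<forall>t. norm (q t - s) \<ge> \<delta>)" by blast
  then show ?thesis using \<epsilon> by (intro exI[of _ \<epsilon>] conjI exI[of _ \<delta>])
qed

section \<open>Strong convergence of almost solutions\<close>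

text \<open>The energy is continuous in the Sobolev norm: by Taylor expansion of \<open>V\<close>, the difference is a linear term,
  bounded with the Cauchy-Schwarz inequality, plus a quadratic one.\<close>

lemma real_energy_tendsto:
  assumes conv: "curve_conv Q u" and Q: "\<And>n. finite_curve M (Q n)" and u: "finite_curve M u" and d: "\<And>n. (\<lambda>t. Q n t - u t) \<in> L2"
  shows "(\<lambda>n. real_energy (Q n)) \<longlonglongrightarrow> real_energy u"
proof -
  obtain K where K: "K > 0" "\<forall>x\<in>cball 0 M. \<forall>y\<in>cball 0 M. norm (grad V x - grad V y) \<le> K * norm (x - y)"
    using grad_Lipschitz by blast
  let ?p = "weak_deriv u" and ?G = "\<lambda>t. grad V (u t)"
  let ?D = "\<lambda>n t. Q n t - u t" and ?D' = "\<lambda>n t. weak_deriv (Q n) t - weak_deriv u t"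
  note pL = finite_curve_deriv_L2[OF u] and GL = finite_curve_grad_L2[OF u]
  have DL': "?D' n \<in> L2" for n by (rule L2_diff[OF finite_curve_deriv_L2[OF Q] pL])
  have lim: "(\<lambda>n. L2sq (?D n)) \<longlonglongrightarrow> 0" "(\<lambda>n. L2sq (?D' n)) \<longlonglongrightarrow> 0" using conv by (auto simp: curve_conv_def)
  have CS: "\<bar>LINT t|lborel. a t \<bullet> b t\<bar> \<le> sqrt (L2sq a) * sqrt (L2sq b)" if "a \<in> L2" "b \<in> L2" for a b :: "real \<Rightarrow> real ^ 'n"
    using L2_Cauchy_Schwarz[OF that] L2_Cauchy_Schwarz[OF that(1) L2_minus[OF that(2)]] by (simp add: abs_le_iff)
  let ?b = "\<lambda>n. (sqrt (L2sq ?p) * sqrt (L2sq (?D' n)) + L2sq (?D' n) / 2) + (sqrt (L2sq ?G) * sqrt (L2sq (?D n)) + K * L2sq (?D n))"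
  have bd: "\<bar>real_energy (Q n) - real_energy u\<bar> \<le> ?b n" for n
  proof -
    have "L2sq (weak_deriv (Q n)) = L2sq ?p + 2 * (LINT t|lborel. ?p t \<bullet> ?D' n t) + L2sq (?D' n)"
      using L2sq_add[OF pL DL', of n] by simp
    then have 1: "\<bar>L2sq (weak_deriv (Q n)) / 2 - L2sq ?p / 2\<bar> \<le> sqrt (L2sq ?p) * sqrt (L2sq (?D' n)) + L2sq (?D' n) / 2"
      using CS[OF pL DL', of n] L2sq_nonneg[of "?D' n"] by linarith
    have iD: "integrable lborel (\<lambda>t. K * (norm (?D n t))\<^sup>2)" using L2_integrable[OF d] by simp
    have iG: "integrable lborel (\<lambda>t. ?G t \<bullet> ?D n t)" by (rule L2_inner_integrable[OF GL d])
    note iV = finite_curve_V[OF Q] finite_curve_V[OF u]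
    have pt: "\<bar>V (Q n t) - V (u t) - ?G t \<bullet> ?D n t\<bar> \<le> K * (norm (?D n t))\<^sup>2" for t
      using C2_potential_Taylor[OF C2 K(2,1), of "u t" "?D n t"] finite_curve_bound[OF u, of t] finite_curve_bound[OF Q, of n t] by simp
    have "(LINT t|lborel. V (Q n t) - V (u t) - ?G t \<bullet> ?D n t) \<le> (LINT t|lborel. K * (norm (?D n t))\<^sup>2)"
      by (rule integral_mono[OF _ iD]) (use iV iG pt in \<open>auto simp: abs_le_iff\<close>)
    moreover have "(LINT t|lborel. - (K * (norm (?D n t))\<^sup>2)) \<le> (LINT t|lborel. V (Q n t) - V (u t) - ?G t \<bullet> ?D n t)"
    proof (rule integral_mono)
      show "- (K * (norm (?D n t))\<^sup>2) \<le> V (Q n t) - V (u t) - ?G t \<bullet> ?D n t" for t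
        using pt[of t] by linarith
    qed (use iV iG iD in auto)
    ultimately have "\<bar>(LINT t|lborel. V (Q n t)) - (LINT t|lborel. V (u t)) - (LINT t|lborel. ?G t \<bullet> ?D n t)\<bar> \<le> K * L2sq (?D n)"
      using iV iG by (simp add: abs_le_iff)
    then have 2: "\<bar>(LINT t|lborel. V (Q n t)) - (LINT t|lborel. V (u t))\<bar> \<le> sqrt (L2sq ?G) * sqrt (L2sq (?D n)) + K * L2sq (?D n)"
      using CS[OF GL d, of n] by linarith
    show ?thesis unfolding real_energy_def using 1 2 by linarith
  qed
  have "?b \<longlonglongrightarrow> (sqrt (L2sq ?p) * sqrt 0 + 0 / 2) + (sqrt (L2sq ?G) * sqrt 0 + K * 0)"
    by (intro tendsto_add tendsto_mult tendsto_const tendsto_real_sqrt tendsto_divide lim) simp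
  then have "?b \<longlonglongrightarrow> 0" by simp
  then have "(\<lambda>n. \<bar>real_energy (Q n) - real_energy u\<bar>) \<longlonglongrightarrow> 0" by (rule tendsto_zero_squeeze[OF abs_ge_zero bd])
  then show ?thesis by (simp add: tendsto_rabs_zero_iff LIM_zero_iff)
qed

text \<open>Near the nondegenerate well the equation tested with \<open>q - sp\<close> bounds the Sobolev norm on a half
  line by the boundary term \<open>Y T \<bullet> (q T - sp)\<close> and the error \<open>R\<close>. The boundary term at the far end vanishes as it
  tends to infinity.\<close>

lemma tail_estimate:
  assumes q: "primitive q (\<lambda>t. Y t - R t)" and Y: "primitive Y (\<lambda>t. grad V (q t) - R t)"
    and B: "\<And>t. norm (Y t) \<le> B" and R: "R \<in> L2" and lim: "(q \<longlongrightarrow> sp) at_top"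
    and \<mu>: "\<mu> > 0" "\<And>u. norm (u - sp) \<le> \<rho> \<Longrightarrow> grad V u \<bullet> (u - sp) \<ge> \<mu> * (norm (u - sp))\<^sup>2"
    and near: "\<And>t. t \<ge> T \<Longrightarrow> norm (q t - sp) \<le> \<rho>" and TT: "T \<le> T'"
  shows "(LINT t:{T..T'}|lborel. (norm (q t - sp))\<^sup>2 + (norm (Y t - R t))\<^sup>2) 
    \<le> (2 + 2 / \<mu>) * (B * norm (q T - sp) + (1/2 + 1 / (2 * \<mu>)) * L2sq R)"
proof -
  define C1 where "C1 = 2 + 2 / \<mu>"
  define CR where "CR = 1/2 + 1 / (2 * \<mu>)"
  have C: "C1 > 0" "CR > 0" using \<mu>(1) by (auto simp: C1_def CR_def add_pos_pos)
  let ?W = "\<lambda>t. q t - sp" and ?g = "\<lambda>t. Y t - R t"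
  let ?f = "\<lambda>t. (norm (?W t))\<^sup>2 + (norm (?g t))\<^sup>2"
  have W: "primitive ?W ?g" using primitive_add_const[OF q, of "- sp"] by simp
  let ?h = "\<lambda>t. (grad V (q t) - R t) \<bullet> ?W t + Y t \<bullet> ?g t"
  have pYW: "primitive (\<lambda>t. Y t \<bullet> ?W t) ?h" by (rule primitive_inner[OF Y W])
  have pt: "?f t \<le> C1 * (?h t + CR * (norm (R t))\<^sup>2)" if "t \<ge> T" for t
  proof -
    have a: "grad V (q t) \<bullet> ?W t \<ge> \<mu> * (norm (?W t))\<^sup>2" by (rule \<mu>(2)[OF near[OF that]])
    have b: "R t \<bullet> ?W t \<le> \<mu> / 2 * (norm (?W t))\<^sup>2 + 1 / (2 * \<mu>) * (norm (R t))\<^sup>2"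
    proof -
      have "R t \<bullet> ?W t \<le> norm (R t) * norm (?W t)" by (rule norm_cauchy_schwarz)
      also have "\<dots> \<le> \<mu> / 2 * (norm (?W t))\<^sup>2 + 1 / (2 * \<mu>) * (norm (R t))\<^sup>2"
        using zero_le_power2[of "\<mu> * norm (?W t) - norm (R t)"] \<mu>(1) by (simp add: field_simps power2_eq_square)
      finally show ?thesis .
    qed
    have c: "- (R t \<bullet> ?g t) \<le> (norm (R t))\<^sup>2 / 2 + (norm (?g t))\<^sup>2 / 2"
      using inner_le_sq[of "R t" "?g t"] by (auto simp: abs_le_iff)
    have d: "Y t \<bullet> ?g t = (norm (?g t))\<^sup>2 + R t \<bullet> ?g t" by (simp add: power2_norm_eq_inner inner_diff_left)
    have e: "(grad V (q t) - R t) \<bullet> ?W t = grad V (q t) \<bullet> ?W t - R t \<bullet> ?W t" by (rule inner_diff_left)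
    have f: "CR * (norm (R t))\<^sup>2 = (norm (R t))\<^sup>2 / 2 + 1 / (2 * \<mu>) * (norm (R t))\<^sup>2" by (simp add: CR_def algebra_simps)
    have key: "\<mu> / 2 * (norm (?W t))\<^sup>2 + (norm (?g t))\<^sup>2 / 2 \<le> ?h t + CR * (norm (R t))\<^sup>2"
      using a b c d e f by (simp add: field_simps)
    have "?f t \<le> C1 * (\<mu> / 2 * (norm (?W t))\<^sup>2 + (norm (?g t))\<^sup>2 / 2)"
    proof -
      have "C1 * (\<mu> / 2 * x + y / 2) = x + y + (\<mu> * x + y / \<mu>)" for x y
        using \<mu>(1) by (simp add: C1_def field_simps)
      moreover have "0 \<le> \<mu> * (norm (?W t))\<^sup>2 + (norm (?g t))\<^sup>2 / \<mu>" using \<mu>(1) by simp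
      ultimately show ?thesis by simp
    qed
    also have "\<dots> \<le> C1 * (?h t + CR * (norm (R t))\<^sup>2)" using C(1) by (intro mult_left_mono key) simp
    finally show ?thesis .
  qed
  have fi: "set_integrable lborel {a..b} ?f" for a b
    by (intro set_integral_add L2_loc_sq_set_integrable L2_loc_continuous primitive_continuous[OF W] primitive_L2_loc[OF W])
  have hi: "set_integrable lborel {a..b} ?h" for a b by (rule primitive_set_integrable[OF pYW])
  have Ri: "set_integrable lborel {a..b} (\<lambda>t. CR * (norm (R t))\<^sup>2)" for a b
    using L2_loc_sq_set_integrable[OF L2_imp_L2_loc[OF R]] by (intro set_integrable_mult_right) auto
  have bound: "(LINT t:{T..T'}|lborel. ?f t) \<le> C1 * (B * norm (?W s) + B * norm (?W T) + CR * L2sq R)" if s: "s \<ge> T'" for s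
  proof -
    have "(LINT t:{T..s}|lborel. ?f t) = (LINT t:{T..T'}|lborel. ?f t) + (LINT t:{T'..s}|lborel. ?f t)"
      by (rule set_integral_combine[OF TT s fi])
    moreover have "0 \<le> (LINT t:{T'..s}|lborel. ?f t)" by (rule set_integral_nonneg') simp
    ultimately have "(LINT t:{T..T'}|lborel. ?f t) \<le> (LINT t:{T..s}|lborel. ?f t)" by linarith
    also have "\<dots> \<le> (LINT t:{T..s}|lborel. C1 * (?h t + CR * (norm (R t))\<^sup>2))"
      by (rule set_integral_mono[OF fi]) (use pt hi Ri in \<open>auto intro!: set_integral_add\<close>)
    also have "\<dots> = C1 * ((LINT t:{T..s}|lborel. ?h t) + CR * (LINT t:{T..s}|lborel. (norm (R t))\<^sup>2))"
      using set_integral_add(2)[OF hi Ri] by simp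
    also have "\<dots> \<le> C1 * (B * norm (?W s) + B * norm (?W T) + CR * L2sq R)"
    proof (intro mult_left_mono add_mono)
      have "(LINT t:{T..s}|lborel. ?h t) = Y s \<bullet> ?W s - Y T \<bullet> ?W T" using primitiveD[OF pYW, of T s] TT s by simp
      moreover have "Y s \<bullet> ?W s \<le> B * norm (?W s)" 
        by (rule order_trans[OF norm_cauchy_schwarz]) (intro mult_right_mono B norm_ge_zero)
      moreover have "- (Y T \<bullet> ?W T) \<le> B * norm (?W T)"
      proof -
        have "- (Y T \<bullet> ?W T) \<le> norm (Y T) * norm (?W T)" using Cauchy_Schwarz_ineq2[of "Y T" "?W T"] by linarith
        also have "\<dots> \<le> B * norm (?W T)" by (intro mult_right_mono B norm_ge_zero)
        finally show ?thesis .
      qed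
      ultimately show "(LINT t:{T..s}|lborel. ?h t) \<le> B * norm (?W s) + B * norm (?W T)" by linarith
      show "(LINT t:{T..s}|lborel. (norm (R t))\<^sup>2) \<le> L2sq R" by (rule set_integral_le_integral[OF L2_integrable[OF R]]) auto
    qed (use C in auto)
    finally show ?thesis .
  qed
  have "((\<lambda>s. norm (?W s)) \<longlongrightarrow> norm (sp - sp)) at_top" by (intro tendsto_intros lim)
  then have "((\<lambda>s. C1 * (B * norm (?W s) + B * norm (?W T) + CR * L2sq R)) \<longlongrightarrow> C1 * (B * 0 + B * norm (?W T) + CR * L2sq R)) at_top"
    by (intro tendsto_intros) simp
  then have "(LINT t:{T..T'}|lborel. ?f t) \<le> C1 * (B * 0 + B * norm (?W T) + CR * L2sq R)"
    by (rule tendsto_lowerbound) (use bound in \<open>auto intro: eventually_mono[OF eventually_ge_at_top[of T']]\<close>)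
  then show ?thesis by (simp add: C1_def CR_def)
qed

lemma tail_small:
  fixes f :: "real \<Rightarrow> real"
  assumes f: "integrable lborel f" and nn: "\<And>t. 0 \<le> f t" and e: "e > 0"
  shows "\<exists>T0. \<forall>T\<ge>T0. \<forall>T'\<ge>T. (LINT t:{T..T'}|lborel. f t) \<le> e"
proof -
  have "\<forall>\<^sub>F n in sequentially. (LINT t:{-real n..real n}|lborel. f t) > (LINT t|lborel. f t) - e"
    using order_tendstoD(1)[OF integral_Icc_tendsto[OF f]] e by simp
  then obtain n where n: "(LINT t:{-real n..real n}|lborel. f t) > (LINT t|lborel. f t) - e"
    unfolding eventually_sequentially by blast
  note si = integrable_set_integrable[OF f]
  have "(LINT t:{T..T'}|lborel. f t) \<le> e" if T: "T \<ge> real n" "T' \<ge> T" for T T'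
  proof -
    have "(LINT t:{-real n..T'}|lborel. f t) = (LINT t:{-real n..real n}|lborel. f t) + (LINT t:{real n..T'}|lborel. f t)"
      by (rule set_integral_combine) (use T si in auto)
    moreover have "(LINT t:{real n..T'}|lborel. f t) = (LINT t:{real n..T}|lborel. f t) + (LINT t:{T..T'}|lborel. f t)"
      by (rule set_integral_combine) (use T si in auto)
    moreover have "0 \<le> (LINT t:{real n..T}|lborel. f t)" by (rule set_integral_nonneg'[OF nn])
    moreover have "(LINT t:{-real n..T'}|lborel. f t) \<le> (LINT t|lborel. f t)" by (rule set_integral_le_integral[OF f]) (auto simp: nn)
    ultimately show ?thesis using n by linarith
  qed
  then show ?thesis by blast
qed

text \<open>The symmetry transfers estimates for the right tail to the left one. The bounds are stated for bounded
  intervals, on which \<open>tail_estimate\<close> will supply them.\<close>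

lemma even_integral_le:
  fixes f :: "real \<Rightarrow> real"
  assumes f: "integrable lborel f" and nn: "\<And>t. 0 \<le> f t" and even: "AE t in lborel. f (- t) = f t"
    and T: "T \<ge> 0" and mid: "(LINT t:{-T..T}|lborel. f t) \<le> a" and tail: "\<And>T'. T' \<ge> T \<Longrightarrow> (LINT t:{T..T'}|lborel. f t) \<le> b"
  shows "(LINT t|lborel. f t) \<le> a + 2 * b"
proof (rule LIMSEQ_le_const2[OF integral_Icc_tendsto[OF f]])
  note si = integrable_set_integrable[OF f]
  obtain m where m: "T \<le> real m" using real_arch_simple by blast
  have "(LINT t:{-real n..real n}|lborel. f t) \<le> a + 2 * b" if "n \<ge> m" for n
  proof -
    have Tn: "T \<le> real n" using m that by simp
    have 1: "(LINT t:{-real n..real n}|lborel. f t) = (LINT t:{-real n..-T}|lborel. f t) + (LINT t:{-T..real n}|lborel. f t)"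
      by (rule set_integral_combine) (use T Tn si in auto)
    have 2: "(LINT t:{-T..real n}|lborel. f t) = (LINT t:{-T..T}|lborel. f t) + (LINT t:{T..real n}|lborel. f t)"
      by (rule set_integral_combine) (use T Tn si in auto)
    have "(LINT t:{-real n..-T}|lborel. f t) = (LINT t:{T..real n}|lborel. f (- t))"
      using set_integral_reflect_Icc[of T "real n" f] by simp
    also have "\<dots> = (LINT t:{T..real n}|lborel. f t)"
    proof (rule set_lebesgue_integral_cong_AE)
      have [measurable]: "f \<in> borel_measurable borel" using borel_measurable_integrable[OF f] by simp
      show "(\<lambda>t. f (- t)) \<in> borel_measurable lborel" "f \<in> borel_measurable lborel" by measurable
    qed (use even in \<open>auto elim!: eventually_mono\<close>)
    finally show ?thesis using 1 2 mid tail[OF Tn] by linarith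
  qed
  then show "\<exists>N. \<forall>n\<ge>N. (LINT t:{-real n..real n}|lborel. f t) \<le> a + 2 * b" by blast
qed

text \<open>The first scenario, reduced to the curve at \<open>sp\<close>: a nonconstant solution \<open>u\<close> with derivative \<open>p\<close>.\<close>

definition homoclinic :: "real \<Rightarrow> bool" where
  "homoclinic c \<longleftrightarrow> (\<exists>u p. (\<forall>t. (u has_vector_derivative p t) (at t)) \<and> (\<forall>t. (p has_vector_derivative grad V (u t)) (at t)) \<and>
     primitive u p \<and> \<not> u constant_on UNIV \<and> (u \<longlongrightarrow> sp) at_bot \<and> (u \<longlongrightarrow> sp) at_top \<and> energy V u \<le> ennreal c)"

context
  fixes Q :: "nat \<Rightarrow> real \<Rightarrow> real ^ 'n" and M C c0 \<delta> :: real
  assumes QX: "\<And>n. Q n \<in> X_sym V i sm sp" and fQ: "\<And>n. finite_curve M (Q n)" 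
    and EC: "\<And>n. real_energy (Q n) \<le> C" and E: "(\<lambda>n. real_energy (Q n)) \<longlonglongrightarrow> c0" 
    and R0: "(\<lambda>n. L2sq (residual (Q n))) \<longlonglongrightarrow> 0"
    and away: "\<delta> > 0" "\<And>n t s. s \<in> S - {sm, sp} \<Longrightarrow> norm (Q n t - s) \<ge> \<delta>"
begin

text \<open>The function \<open>y\<close> belonging to the residual, which approximates the derivative of \<open>Q n\<close> but is bounded and has
  a weak derivative itself.\<close>

definition velocity :: "nat \<Rightarrow> real \<Rightarrow> real ^ 'n" where
  "velocity n = resolvent (\<lambda>t. weak_deriv (Q n) t + grad V (Q n t))"

lemma weak_deriv_velocity: "weak_deriv (Q n) t = velocity n t - residual (Q n) t"
  by (simp add: velocity_def residual_def)

lemma Q_facts: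
  "primitive (Q n) (\<lambda>t. velocity n t - residual (Q n) t)" "primitive (velocity n) (\<lambda>t. grad V (Q n t) - residual (Q n) t)"
  "norm (Q n t) \<le> M" "residual (Q n) \<in> L2" "(\<lambda>t. velocity n t - residual (Q n) t) \<in> L2" "integrable lborel (\<lambda>t. V (Q n t))"
  "velocity n \<in> borel_measurable borel"
proof -
  show "primitive (Q n) (\<lambda>t. velocity n t - residual (Q n) t)" using finite_curve_prim[OF fQ[of n]] by (simp add: weak_deriv_velocity[symmetric])
  show p: "primitive (velocity n) (\<lambda>t. grad V (Q n t) - residual (Q n) t)" unfolding velocity_def by (rule resolvent_force(2)[OF fQ])
  show "norm (Q n t) \<le> M" by (rule finite_curve_bound[OF fQ])
  show "residual (Q n) \<in> L2" by (rule residual_L2[OF fQ])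
  show "(\<lambda>t. velocity n t - residual (Q n) t) \<in> L2" using finite_curve_deriv_L2[OF fQ[of n]] by (simp add: weak_deriv_velocity[symmetric])
  show "integrable lborel (\<lambda>t. V (Q n t))" by (rule finite_curve_V[OF fQ])
  show "velocity n \<in> borel_measurable borel" by (rule primitive_measurable(1)[OF p])
qed

lemma velocity_bounded: "\<exists>B. \<forall>n t. norm (velocity n t) \<le> B"
proof -
  obtain K where K: "K > 0" "\<And>u. u \<in> cball 0 M \<Longrightarrow> (norm (grad V u))\<^sup>2 \<le> K * V u" using grad_sq_le by blast
  have "norm (velocity n t) \<le> (1 + (4 + 2 * K) * C) / 2" for n t
  proof -
    have "norm (velocity n t) \<le> (1 + L2sq (\<lambda>t. weak_deriv (Q n) t + grad V (Q n t))) / 2"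
      unfolding velocity_def by (rule resolvent_bounded[OF force_L2[OF fQ]])
    also have "\<dots> \<le> (1 + (4 + 2 * K) * real_energy (Q n)) / 2"
      using force_bound[OF fQ K(2,1), of n] by (intro divide_right_mono add_left_mono) auto
    also have "\<dots> \<le> (1 + (4 + 2 * K) * C) / 2"
      using EC[of n] K(1) by (intro divide_right_mono add_left_mono mult_left_mono) auto
    finally show ?thesis .
  qed
  then show ?thesis by blast
qed

lemma E_alt: "(\<lambda>n. L2sq (\<lambda>t. velocity n t - residual (Q n) t) / 2 + (LINT t|lborel. V (Q n t))) \<longlonglongrightarrow> c0"
  using E by (simp add: real_energy_def weak_deriv_velocity)

lemma Q_conn: "Q n \<in> conn V sm sp" and Q_sym: "Q n (- t) = refl1 i (Q n t)" and Q_pos: "t \<ge> 0 \<Longrightarrow> Q n t $ i \<ge> 0"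
  using QX[of n] unfolding X_sym_iff by auto

text \<open>If the last time \<open>T n\<close> at which \<open>Q n\<close> is at distance \<open>\<rho>\<close> from \<open>sp\<close> tends to infinity, the curves
  recentred at \<open>T n\<close> converge to a solution in the positive half space, both of whose limits have to be \<open>sp\<close>.\<close>

lemma escaping_gives_homoclinic:
  assumes T: "filterlim T at_top sequentially" and far: "\<And>n. norm (Q n (T n) - sp) \<ge> \<rho>" and \<rho>: "\<rho> > 0"
  shows "homoclinic c0"
proof -
  obtain B where B: "\<And>n t. norm (velocity n t) \<le> B" using velocity_bounded by blast
  define Q' where "Q' n t = Q n (t + T n)" for n t
  define Y' where "Y' n t = velocity n (t + T n)" for n t
  define R' where "R' n t = residual (Q n) (t + T n)" for n t
  have pQ: "primitive (Q' n) (\<lambda>t. Y' n t - R' n t)" for n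
    using primitive_shift[OF Q_facts(1), of n "T n"] by (simp add: Q'_def[abs_def] Y'_def R'_def)
  have pY: "primitive (Y' n) (\<lambda>t. grad V (Q' n t) - R' n t)" for n
    using primitive_shift[OF Q_facts(2), of n "T n"] by (simp add: Q'_def Y'_def[abs_def] R'_def)
  have QM: "norm (Q' n t) \<le> M" and YB: "norm (Y' n t) \<le> B" for n t unfolding Q'_def Y'_def using Q_facts(3) B by auto
  have RL: "R' n \<in> L2" for n unfolding R'_def[abs_def] by (rule L2_shift[OF Q_facts(4)])
  have sh: "L2sq (\<lambda>t. f (t + c)) = L2sq f" for f :: "real \<Rightarrow> real ^ 'n" and c using integral_shift[of "\<lambda>t. (norm (f t))\<^sup>2" c] by simp
  have Rl: "(\<lambda>n. L2sq (R' n)) \<longlonglongrightarrow> 0" using R0 by (simp only: R'_def sh)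
  obtain k u p where k: "strict_mono (k :: nat \<Rightarrow> nat)" and u: "\<And>t. (\<lambda>n. Q' (k n) t) \<longlonglongrightarrow> u t" and p: "\<And>t. (\<lambda>n. Y' (k n) t) \<longlonglongrightarrow> p t"
    and u': "\<And>t. (u has_vector_derivative p t) (at t)" and p': "\<And>t. (p has_vector_derivative grad V (u t)) (at t)"
    and cont: "continuous_on UNIV u" "continuous_on UNIV p" and up: "primitive u p"
    by (rule almost_solutions_converge[OF pQ pY QM YB RL Rl]) blast
  have gL: "(\<lambda>t. Y' n t - R' n t) \<in> L2" for n
    using L2_shift[OF Q_facts(5), of n "T n"] by (simp add: Y'_def R'_def)
  have iV: "integrable lborel (\<lambda>t. V (Q' n t))" for n
    using integrable_lborel_affine[OF Q_facts(6), of 1 n "T n"] by (simp add: Q'_def add.commute)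
  have En: "L2sq (\<lambda>t. Y' n t - R' n t) / 2 + (LINT t|lborel. V (Q' n t)) = L2sq (\<lambda>t. velocity n t - residual (Q n) t) / 2 + (LINT t|lborel. V (Q n t))" for n
    using sh[of "\<lambda>t. velocity n t - residual (Q n) t" "T n"] integral_shift[of "\<lambda>t. V (Q n t)" "T n"] by (simp add: Y'_def R'_def Q'_def)
  have El: "(\<lambda>n. L2sq (\<lambda>t. Y' (k n) t - R' (k n) t) / 2 + (LINT t|lborel. V (Q' (k n) t))) \<longlonglongrightarrow> c0"
    unfolding En using LIMSEQ_subseq_LIMSEQ[OF E_alt k] by (simp add: o_def)
  have Rk: "(\<lambda>n. L2sq (R' (k n))) \<longlonglongrightarrow> 0" using LIMSEQ_subseq_LIMSEQ[OF Rl k] by (simp add: o_def)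
  note lsc = energy_lower_semicontinuous[OF pQ primitive_measurable(1)[OF pY] QM YB RL Rk u p up gL iV El]
  have uM: "norm (u t) \<le> M" for t by (rule LIMSEQ_le_const2[OF tendsto_norm[OF u]]) (use QM in auto)
  note V0 = potential_vanishes[OF u' cont lsc(1,2) uM]
  have pos: "u t $ i \<ge> 0" for t
  proof (rule LIMSEQ_le_const[OF tendsto_vec_nth[OF u]])
    have "filterlim (\<lambda>n. T (k n)) at_top sequentially" by (rule filterlim_compose[OF T filterlim_subseq[OF k]])
    then have "\<forall>\<^sub>F n in sequentially. T (k n) \<ge> - t" by (simp add: filterlim_at_top)
    then show "\<exists>N. \<forall>n\<ge>N. 0 \<le> Q' (k n) t $ i" unfolding eventually_sequentially Q'_def
      by (metis Q_pos add.commute neg_le_iff_le add_increasing2 diff_ge_0_iff_ge diff_minus_eq_add minus_minus)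
  qed
  have aw: "norm (u t - s) \<ge> \<delta>" if "s \<in> S - {sm, sp}" for s t
  proof (rule LIMSEQ_le_const)
    show "(\<lambda>n. norm (Q' (k n) t - s)) \<longlonglongrightarrow> norm (u t - s)" by (intro tendsto_intros u)
  qed (use away(2)[OF that] in \<open>auto simp: Q'_def\<close>)
  have lims: "(u \<longlongrightarrow> sp) at_top" "(u \<longlongrightarrow> sp) at_bot"
    using tends_to_sp[OF V0(1) uM _ away(1) aw] tends_to_sp[OF V0(2) uM _ away(1) aw] pos by auto
  have "norm (u 0 - sp) \<ge> \<rho>"
  proof (rule LIMSEQ_le_const)
    show "(\<lambda>n. norm (Q' (k n) 0 - sp)) \<longlonglongrightarrow> norm (u 0 - sp)" by (intro tendsto_intros u)
  qed (use far in \<open>auto simp: Q'_def\<close>)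
  have "\<not> u constant_on UNIV"
  proof
    assume "u constant_on UNIV"
    then obtain y where "\<And>t. u t = y" unfolding constant_on_def by auto
    then have "u = (\<lambda>_. u 0)" by auto
    with lims(1) have "((\<lambda>_. u 0) \<longlongrightarrow> sp) (at_top :: real filter)" by metis
    then have "u 0 = sp" by (simp add: tendsto_const_iff)
    then show False using \<open>norm (u 0 - sp) \<ge> \<rho>\<close> \<rho> by simp
  qed
  moreover have "energy V u \<le> ennreal c0" unfolding energy_eq[OF up lsc(1,2)] by (rule ennreal_leI[OF lsc(3)])
  ultimately show ?thesis unfolding homoclinic_def using u' p' up lims by blast
qed

text \<open>If the last times stay bounded, the limit of the curves themselves connects \<open>sm\<close> to \<open>sp\<close>, and the
  tail estimate improves pointwise convergence to convergence in the Sobolev norm.\<close>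

lemma bounded_gives_critical_point:
  assumes \<rho>: "\<mu> > 0" "\<And>u. norm (u - sp) \<le> \<rho> \<Longrightarrow> grad V u \<bullet> (u - sp) \<ge> \<mu> * (norm (u - sp))\<^sup>2"
    and near: "\<And>n t. t \<ge> T0 \<Longrightarrow> norm (Q n t - sp) \<le> \<rho>"
  shows "\<exists>k u. strict_mono (k :: nat \<Rightarrow> nat) \<and> u \<in> X_sym V i sm sp \<and> solves_ode V u \<and> energy V u = ennreal c0 \<and> curve_conv (\<lambda>n. Q (k n)) u"
proof -
  obtain B where B: "\<And>n t. norm (velocity n t) \<le> B" using velocity_bounded by blast
  obtain k u p where k: "strict_mono (k :: nat \<Rightarrow> nat)" and u: "\<And>t. (\<lambda>n. Q (k n) t) \<longlonglongrightarrow> u t" and p: "\<And>t. (\<lambda>n. velocity (k n) t) \<longlonglongrightarrow> p t"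
    and u': "\<And>t. (u has_vector_derivative p t) (at t)" and p': "\<And>t. (p has_vector_derivative grad V (u t)) (at t)"
    and cont: "continuous_on UNIV u" "continuous_on UNIV p" and up: "primitive u p"
    by (rule almost_solutions_converge[OF Q_facts(1,2,3) B Q_facts(4) R0]) blast
  have El: "(\<lambda>n. L2sq (\<lambda>t. velocity (k n) t - residual (Q (k n)) t) / 2 + (LINT t|lborel. V (Q (k n) t))) \<longlonglongrightarrow> c0"
    using LIMSEQ_subseq_LIMSEQ[OF E_alt k] by (simp add: o_def)
  have Rk: "(\<lambda>n. L2sq (residual (Q (k n)))) \<longlonglongrightarrow> 0" using LIMSEQ_subseq_LIMSEQ[OF R0 k] by (simp add: o_def)
  note lsc = energy_lower_semicontinuous[OF Q_facts(1) Q_facts(7) Q_facts(3) B Q_facts(4) Rk u p up Q_facts(5,6) El]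
  have uM: "norm (u t) \<le> M" for t by (rule LIMSEQ_le_const2[OF tendsto_norm[OF u]]) (use Q_facts(3) in auto)
  note V0 = potential_vanishes[OF u' cont lsc(1,2) uM]
  have pos: "u t $ i \<ge> 0" if "t \<ge> 0" for t
    by (rule LIMSEQ_le_const[OF tendsto_vec_nth[OF u]]) (use Q_pos[OF that] in auto)
  have sym: "u (- t) = refl1 i (u t)" for t
  proof (rule LIMSEQ_unique[OF u])
    have "(\<lambda>n. refl1 i (Q (k n) t)) \<longlonglongrightarrow> refl1 i (u t)"
      by (rule bounded_linear.tendsto[OF bounded_linear_refl1 u])
    then show "(\<lambda>n. Q (k n) (- t)) \<longlonglongrightarrow> refl1 i (u t)" by (simp add: Q_sym)
  qed
  have aw: "norm (u t - s) \<ge> \<delta>" if "s \<in> S - {sm, sp}" for s t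
  proof (rule LIMSEQ_le_const)
    show "(\<lambda>n. norm (Q (k n) t - s)) \<longlonglongrightarrow> norm (u t - s)" by (intro tendsto_intros u)
  qed (use away(2)[OF that] in auto)
  have "\<forall>\<^sub>F t in at_top. u t $ i \<ge> 0" using eventually_ge_at_top[of 0] by eventually_elim (rule pos)
  then have top: "(u \<longlongrightarrow> sp) at_top" using tends_to_sp[OF V0(1) uM _ away(1) aw] by blast
  have bot: "(u \<longlongrightarrow> sm) at_bot"
    using bounded_linear.tendsto[OF bounded_linear_refl1 top, of i] by (simp add: filterlim_at_bot_mirror sym refl_sp)
  have uc: "u \<in> conn V sm sp" by (rule connI[OF up lsc(1,2) bot top])
  have uX: "u \<in> X_sym V i sm sp" using uc sym pos by (simp add: X_sym_iff)
  note fu = finite_curveI[OF up lsc(1,2) uM]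
  have ode: "solves_ode V u" unfolding solves_ode_def using u' p' by blast
  let ?D = "\<lambda>n t. Q (k n) t - u t" and ?D' = "\<lambda>n t. weak_deriv (Q (k n)) t - p t"
  have dL: "?D n \<in> L2" for n
  proof -
    have "(\<lambda>t. (Q (k n) t - psi sm sp t) - (u t - psi sm sp t)) \<in> L2"
      by (rule L2_diff[OF conn_minus_psi_L2[OF Q_conn] conn_minus_psi_L2[OF uc]])
    then show ?thesis by simp
  qed
  have dL': "?D' n \<in> L2" for n by (rule L2_diff[OF finite_curve_deriv_L2[OF fQ] lsc(1)])
  \<comment> \<open>the density of the squared Sobolev distance to the limit; it is even by symmetry\<close>
  define h where "h n t = (norm (?D n t))\<^sup>2 + (norm (?D' n t))\<^sup>2" for n t
  have hi: "integrable lborel (h n)" for n unfolding h_def[abs_def] using L2_integrable[OF dL] L2_integrable[OF dL'] by simp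
  have h_int: "(LINT t|lborel. h n t) = L2sq (?D n) + L2sq (?D' n)" for n
    unfolding h_def using L2_integrable[OF dL] L2_integrable[OF dL'] by simp
  have hnn: "0 \<le> h n t" for n t by (simp add: h_def)
  have heven: "AE t in lborel. h n (- t) = h n t" for n
  proof -
    have "AE t in lborel. weak_deriv u (- t) = - refl1 i (weak_deriv u t)" by (rule weak_deriv_symmetric[OF fu(1) sym])
    moreover have upAE: "AE t in lborel. weak_deriv u t = p t" by (rule primitive_unique_AE[OF finite_curve_prim[OF fu(1)] up])
    moreover have "AE t in lborel. weak_deriv u (- t) = p (- t)"
    proof -
      have "AE t in lborel. - weak_deriv u (- t) = - p (- t)"
        by (rule primitive_unique_AE[OF primitive_reflect[OF finite_curve_prim[OF fu(1)]] primitive_reflect[OF up]])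
      then show ?thesis by simp
    qed
    ultimately have "AE t in lborel. p (- t) = - refl1 i (p t)" by eventually_elim simp
    moreover have "AE t in lborel. weak_deriv (Q (k n)) (- t) = - refl1 i (weak_deriv (Q (k n)) t)"
      by (rule weak_deriv_symmetric[OF fQ Q_sym])
    ultimately show ?thesis
    proof eventually_elim
      fix t assume a: "p (- t) = - refl1 i (p t)" "weak_deriv (Q (k n)) (- t) = - refl1 i (weak_deriv (Q (k n)) t)"
      have "?D n (- t) = refl1 i (?D n t)" "?D' n (- t) = - refl1 i (?D' n t)" by (simp_all add: a sym Q_sym)
      then show "h n (- t) = h n t" by (simp only: h_def norm_minus_cancel refl1_norm)
    qed
  qed
  \<comment> \<open>on bounded intervals, pointwise convergence of bounded functions suffices\<close>
  have mid: "(\<lambda>n. LINT t:{-T..T}|lborel. h n t) \<longlonglongrightarrow> 0" for T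
  proof -
    let ?a = "\<lambda>n t. (norm (?D n t))\<^sup>2 + 2 * (norm (velocity (k n) t - p t))\<^sup>2"
    have Mn: "norm (?D n t) \<le> 2 * M" for n t using norm_triangle_ineq4[of "Q (k n) t" "u t"] Q_facts(3)[of "k n" t] uM[of t] by linarith
    have pB: "norm (p t) \<le> B" for t by (rule LIMSEQ_le_const2[OF tendsto_norm[OF p]]) (use B in auto)
    have Yn: "norm (velocity (k n) t - p t) \<le> 2 * B" for n t using norm_triangle_ineq4[of "velocity (k n) t" "p t"] B[of "k n" t] pB[of t] by linarith
    note [measurable] = primitive_measurable[OF up] primitive_measurable(1)[OF Q_facts(1)] Q_facts(7)
    have am: "?a n \<in> borel_measurable borel" for n by measurable
    have ab: "norm (?a n t) \<le> (2 * M)\<^sup>2 + 2 * (2 * B)\<^sup>2" for n t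
      using power_mono[OF Mn[of n t] norm_ge_zero, of 2] power_mono[OF Yn[of n t] norm_ge_zero, of 2] by simp
    have al: "(\<lambda>n. ?a n t) \<longlonglongrightarrow> 0" for t
    proof -
      have "(\<lambda>n. ?a n t) \<longlonglongrightarrow> (norm (u t - u t))\<^sup>2 + 2 * (norm (p t - p t))\<^sup>2" by (intro tendsto_intros u p)
      then show ?thesis by simp
    qed
    have lim: "(\<lambda>n. LINT t:{-T..T}|lborel. ?a n t) \<longlonglongrightarrow> (LINT t:{-T..T}|lborel. 0)"
      by (rule set_integral_bounded_tendsto[OF am _ ab al]) simp
    show ?thesis
    proof (rule tendsto_zero_squeeze)
      show "0 \<le> (LINT t:{-T..T}|lborel. h n t)" for n by (rule set_integral_nonneg'[OF hnn])
      show "(LINT t:{-T..T}|lborel. h n t) \<le> (LINT t:{-T..T}|lborel. ?a n t) + 2 * L2sq (residual (Q (k n)))" for n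
      proof -
        have ai: "set_integrable lborel {-T..T} (?a n)"
          by (rule L2_loc_set_integrable[OF L2_loc_bounded[OF am ab]])
        have ri: "set_integrable lborel {-T..T} (\<lambda>t. 2 * (norm (residual (Q (k n)) t))\<^sup>2)"
          using L2_loc_sq_set_integrable[OF L2_imp_L2_loc[OF Q_facts(4)]] by (intro set_integrable_mult_right) auto
        have "(LINT t:{-T..T}|lborel. h n t) \<le> (LINT t:{-T..T}|lborel. ?a n t + 2 * (norm (residual (Q (k n)) t))\<^sup>2)"
        proof (rule set_integral_mono[OF integrable_set_integrable[OF hi] set_integral_add(1)[OF ai ri]])
          fix t
          have D': "?D' n t = (velocity (k n) t - p t) - residual (Q (k n)) t" by (simp add: weak_deriv_velocity)
          have "(norm (?D' n t))\<^sup>2 \<le> 2 * (norm (velocity (k n) t - p t))\<^sup>2 + 2 * (norm (residual (Q (k n)) t))\<^sup>2"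
            unfolding D' using norm_add_sq_le[of "velocity (k n) t - p t" "- residual (Q (k n)) t"] by simp
          then show "h n t \<le> ?a n t + 2 * (norm (residual (Q (k n)) t))\<^sup>2" by (simp add: h_def)
        qed simp
        also have "\<dots> = (LINT t:{-T..T}|lborel. ?a n t) + 2 * (LINT t:{-T..T}|lborel. (norm (residual (Q (k n)) t))\<^sup>2)"
          unfolding set_integral_add(2)[OF ai ri] by simp
        also have "(LINT t:{-T..T}|lborel. (norm (residual (Q (k n)) t))\<^sup>2) \<le> L2sq (residual (Q (k n)))"
          by (rule set_integral_le_integral[OF L2_integrable[OF Q_facts(4)]]) auto
        finally show ?thesis by simp
      qed
      show "(\<lambda>n. (LINT t:{-T..T}|lborel. ?a n t) + 2 * L2sq (residual (Q (k n)))) \<longlonglongrightarrow> 0"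
        using tendsto_add[OF lim tendsto_mult[OF tendsto_const[of 2] Rk]] by simp
    qed
  qed
  define C1 CR where "C1 = 2 + 2 / \<mu>" and "CR = 1/2 + 1 / (2 * \<mu>)"
  have C1: "C1 > 0" using \<rho>(1) by (simp add: C1_def add_pos_pos)
  have h0: "(\<lambda>n. LINT t|lborel. h n t) \<longlonglongrightarrow> 0"
  proof (rule tendstoI)
    fix e :: real assume e: "e > 0"
    \<comment> \<open>the middle part will contribute at most d, and each of the two tails at most 4 d\<close>
    define d where "d = e / 10"
    have d: "d > 0" using e by (simp add: d_def)
    let ?v = "\<lambda>t. (norm (u t - psi sm sp t))\<^sup>2 + (norm (p t))\<^sup>2"
    have iv: "integrable lborel ?v" using L2_integrable[OF conn_minus_psi_L2[OF uc]] L2_integrable[OF lsc(1)] by simp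
    obtain T1 where T1: "\<And>T T'. T \<ge> T1 \<Longrightarrow> T' \<ge> T \<Longrightarrow> (LINT t:{T..T'}|lborel. ?v t) \<le> d"
      using tail_small[OF iv _ d] by auto
    have "((\<lambda>t. C1 * (B * norm (u t - sp))) \<longlongrightarrow> C1 * (B * norm (sp - sp))) at_top" by (intro tendsto_intros top)
    then have "\<forall>\<^sub>F t in at_top. C1 * (B * norm (u t - sp)) < d" using order_tendstoD(2) d by fastforce
    then have "\<forall>\<^sub>F t in at_top. C1 * (B * norm (u t - sp)) < d \<and> t \<ge> max T0 (max T1 1)"
      using eventually_ge_at_top by (rule eventually_conj)
    then obtain T where T: "C1 * (B * norm (u T - sp)) < d" "T \<ge> T0" "T \<ge> T1" "T \<ge> 1"
      unfolding eventually_at_top_linorder by (metis max.bounded_iff order_refl)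
    have "(\<lambda>n. C1 * (B * norm (Q (k n) T - sp) + CR * L2sq (residual (Q (k n))))) \<longlonglongrightarrow> C1 * (B * norm (u T - sp) + CR * 0)"
      by (intro tendsto_intros u Rk)
    then have ev1: "\<forall>\<^sub>F n in sequentially. C1 * (B * norm (Q (k n) T - sp) + CR * L2sq (residual (Q (k n)))) < d"
      using order_tendstoD(2) T(1) by fastforce
    have ev2: "\<forall>\<^sub>F n in sequentially. (LINT t:{-T..T}|lborel. h n t) < d" using order_tendstoD(2)[OF mid d] .
    show "\<forall>\<^sub>F n in sequentially. dist (LINT t|lborel. h n t) 0 < e"
      using ev1 ev2
    proof eventually_elim
      fix n assume n: "C1 * (B * norm (Q (k n) T - sp) + CR * L2sq (residual (Q (k n)))) < d" "(LINT t:{-T..T}|lborel. h n t) < d"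
      have tl: "(LINT t:{T..T'}|lborel. h n t) \<le> 4 * d" if T': "T' \<ge> T" for T'
      proof -
        let ?w = "\<lambda>t. (norm (Q (k n) t - sp))\<^sup>2 + (norm (velocity (k n) t - residual (Q (k n)) t))\<^sup>2"
        have wd: "(LINT t:{T..T'}|lborel. ?w t) \<le> d"
        proof (rule order_trans[OF tail_estimate[where B=B and \<mu>=\<mu> and \<rho>=\<rho>]])
          show "norm (Q (k n) t - sp) \<le> \<rho>" if "t \<ge> T" for t using near T(2) that by simp
          show "(2 + 2 / \<mu>) * (B * norm (Q (k n) T - sp) + (1/2 + 1 / (2 * \<mu>)) * L2sq (residual (Q (k n)))) \<le> d"
            using n(1) by (simp only: C1_def CR_def less_imp_le)
        qed (use Q_facts(1,2,4) B conn_weak_deriv(6)[OF Q_conn] \<rho> T' in blast)+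
        have pW: "primitive (\<lambda>t. Q (k n) t - sp) (\<lambda>t. velocity (k n) t - residual (Q (k n)) t)"
          using primitive_add_const[OF Q_facts(1), of "k n" "- sp"] by simp
        have wi: "set_integrable lborel {T..T'} ?w"
          by (intro set_integral_add L2_loc_sq_set_integrable L2_loc_continuous primitive_continuous[OF pW] primitive_L2_loc[OF pW])
        have vi: "set_integrable lborel {T..T'} ?v" by (rule integrable_set_integrable[OF iv]) simp
        have w2: "set_integrable lborel {T..T'} (\<lambda>t. 2 * ?w t)" and v2: "set_integrable lborel {T..T'} (\<lambda>t. 2 * ?v t)"
          by (rule set_integrable_mult_right[OF wi]) (rule set_integrable_mult_right[OF vi])
        have "(LINT t:{T..T'}|lborel. h n t) \<le> (LINT t:{T..T'}|lborel. 2 * ?w t + 2 * ?v t)"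
        proof (rule set_integral_mono[OF integrable_set_integrable[OF hi]])
          show "set_integrable lborel {T..T'} (\<lambda>t. 2 * ?w t + 2 * ?v t)"
            by (rule set_integral_add(1)[OF w2 v2])
          fix t assume t: "t \<in> {T..T'}"
          then have ps: "psi sm sp t = sp" using T(4) by (simp add: psi_def)
          have "(norm (?D n t))\<^sup>2 \<le> 2 * (norm (Q (k n) t - sp))\<^sup>2 + 2 * (norm (u t - psi sm sp t))\<^sup>2"
            using norm_add_sq_le[of "Q (k n) t - sp" "sp - u t"] by (simp add: ps norm_minus_commute)
          moreover have "(norm (?D' n t))\<^sup>2 \<le> 2 * (norm (velocity (k n) t - residual (Q (k n)) t))\<^sup>2 + 2 * (norm (p t))\<^sup>2"
            using norm_add_sq_le[of "velocity (k n) t - residual (Q (k n)) t" "- p t"] by (simp add: weak_deriv_velocity)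
          ultimately show "h n t \<le> 2 * ?w t + 2 * ?v t" by (simp add: h_def)
        qed simp
        also have "\<dots> = 2 * (LINT t:{T..T'}|lborel. ?w t) + 2 * (LINT t:{T..T'}|lborel. ?v t)"
          unfolding set_integral_add(2)[OF w2 v2] by (simp only: set_integral_mult_right)
        also have "\<dots> \<le> 4 * d" using wd T1[OF T(3) T'] by linarith
        finally show ?thesis .
      qed
      have "T \<ge> 0" using T(4) by simp
      from even_integral_le[OF hi hnn heven this less_imp_le[OF n(2)] tl] have "(LINT t|lborel. h n t) \<le> d + 2 * (4 * d)" .
      moreover have "0 \<le> (LINT t|lborel. h n t)" by (rule Bochner_Integration.integral_nonneg) (rule hnn)
      ultimately show "dist (LINT t|lborel. h n t) 0 < e" using d by (simp add: dist_real_def d_def)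
    qed
  qed
  have conv: "curve_conv (\<lambda>n. Q (k n)) u"
  proof (rule curve_convI[OF finite_curve_prim[OF fQ] up])
    show "(\<lambda>n. L2sq (?D n)) \<longlonglongrightarrow> 0" "(\<lambda>n. L2sq (?D' n)) \<longlonglongrightarrow> 0"
      by (rule tendsto_zero_squeeze[OF L2sq_nonneg _ h0]; simp add: h_int)+
  qed
  have "(\<lambda>n. real_energy (Q (k n))) \<longlonglongrightarrow> real_energy u" by (rule real_energy_tendsto[OF conv fQ fu(1) dL])
  moreover have "(\<lambda>n. real_energy (Q (k n))) \<longlonglongrightarrow> c0" using LIMSEQ_subseq_LIMSEQ[OF E k] by (simp add: o_def)
  ultimately have "real_energy u = c0" by (rule LIMSEQ_unique)
  then have "energy V u = ennreal c0" using finite_curve_energy[OF fu(1)] by simp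
  then show ?thesis using k uX ode conv by blast
qed

end

end

section \<open>The minimax level\<close>

lemma solution_regularity:
  assumes "\<And>t. (u has_vector_derivative p t) (at t)" "\<And>t. (p has_vector_derivative grad V (u t)) (at t)"
    and "continuous_on UNIV (\<lambda>t. grad V (u t))"
  shows "C2_curve u" "solves_ode V u"
proof -
  have "p C1_differentiable_on UNIV"
    unfolding C1_differentiable_on_def by (rule exI[of _ "\<lambda>t. grad V (u t)"]) (use assms(2,3) in simp)
  then show "C2_curve u" unfolding C2_curve_def using assms(1) by (intro exI[of _ p]) simp
  show "solves_ode V u" unfolding solves_ode_def using assms(1,2) by (intro exI[of _ p]) simp
qed

context double_well
begin

text \<open>The times \<open>T n\<close> at which the curves are last at distance \<open>\<rho>\<close> or more from \<open>sp\<close> either tend to infinity or are bounded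
  along a subsequence.\<close>

lemma almost_critical_sequence:
  fixes Q :: "nat \<Rightarrow> real \<Rightarrow> real ^ 'n"
  assumes QX: "\<And>n. Q n \<in> X_sym V i sm sp" and fQ: "\<And>n. finite_curve M (Q n)" 
    and EC: "\<And>n. real_energy (Q n) \<le> C" and E: "(\<lambda>n. real_energy (Q n)) \<longlonglongrightarrow> c0" 
    and R0: "(\<lambda>n. L2sq (residual (Q n))) \<longlonglongrightarrow> 0"
    and away: "\<delta> > 0" "\<And>n t s. s \<in> S - {sm, sp} \<Longrightarrow> norm (Q n t - s) \<ge> \<delta>"
  shows "homoclinic c0 \<or> (\<exists>k u. strict_mono (k :: nat \<Rightarrow> nat) \<and> u \<in> X_sym V i sm sp \<and> solves_ode V u \<and>
     energy V u = ennreal c0 \<and> curve_conv (\<lambda>n. Q (k n)) u)"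
proof -
  obtain \<rho> \<mu> where \<rho>: "\<rho> > 0" "\<rho> < 1" and \<mu>: "\<mu> > 0" "\<And>u. norm (u - sp) \<le> \<rho> \<Longrightarrow> grad V u \<bullet> (u - sp) \<ge> \<mu> * (norm (u - sp))\<^sup>2"
    using nondegenerate[OF sp] by blast
  define Z where "Z n = {0..} \<inter> {t. norm (Q n t - sp) \<ge> \<rho>}" for n
  define T where "T n = Sup (Z n)" for n
  have cQ: "continuous_on UNIV (Q n)" for n by (rule primitive_continuous[OF finite_curve_prim[OF fQ]])
  \<comment> \<open>a symmetric curve crosses the mirror at time 0, at distance at least 1 from sp\<close>
  have zero: "0 \<in> Z n" for n
  proof -
    have "Q n 0 $ i = 0" by (rule symmetric_component(2)) (use QX[of n] X_sym_iff in blast)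
    then have "(Q n 0 - sp) $ i = -1" by (simp add: sp_def)
    then have "1 \<le> norm (Q n 0 - sp)" using component_le_norm_cart[of "Q n 0 - sp" i] by simp
    then show ?thesis using \<rho> by (simp add: Z_def)
  qed
  have clZ: "closed (Z n)" for n unfolding Z_def
    by (intro closed_Int closed_atLeast closed_Collect_le continuous_intros cQ)
  have bd: "bdd_above (Z n)" for n
  proof -
    have "(Q n \<longlongrightarrow> sp) at_top" using QX[of n] X_sym_iff conn_weak_deriv(6) by blast
    from tendstoD[OF this \<rho>(1)] obtain N where "\<And>t. t \<ge> N \<Longrightarrow> dist (Q n t) sp < \<rho>"
      unfolding eventually_at_top_linorder by blast
    note N = this
    have "t \<le> N" if tZ: "t \<in> Z n" for t
    proof (rule ccontr)
      assume "\<not> t \<le> N"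
      then have "dist (Q n t) sp < \<rho>" by (intro N) simp
      then show False using tZ by (simp add: Z_def dist_norm)
    qed
    then show ?thesis by (rule bdd_aboveI)
  qed
  have TZ: "T n \<in> Z n" for n unfolding T_def using closed_contains_Sup[OF _ bd clZ] zero by blast
  have after: "norm (Q n t - sp) < \<rho>" if "t > T n" for n t
  proof (rule ccontr)
    assume "\<not> norm (Q n t - sp) < \<rho>"
    then have "t \<in> Z n" using that TZ[of n] by (auto simp: Z_def)
    then have "t \<le> T n" unfolding T_def by (rule cSup_upper[OF _ bd])
    then show False using that by simp
  qed
  show ?thesis
  proof (cases "filterlim T at_top sequentially")
    case True
    have "norm (Q n (T n) - sp) \<ge> \<rho>" for n using TZ[of n] by (simp add: Z_def)
    from escaping_gives_homoclinic[OF QX fQ EC E R0 away True this \<rho>(1)] show ?thesis by simp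
  next
    case False
    then obtain A where A: "\<not> (\<forall>\<^sub>F n in sequentially. A \<le> T n)" unfolding filterlim_at_top by blast
    have inf: "infinite {n. T n < A}"
    proof
      assume "finite {n. T n < A}"
      then have "\<forall>\<^sub>F n in sequentially. n \<notin> {n. T n < A}"
        unfolding cofinite_eq_sequentially[symmetric] eventually_cofinite by simp
      then show False using A by (simp add: not_less)
    qed
    obtain r :: "nat \<Rightarrow> nat" where r: "strict_mono r" "\<And>n. T (r n) < A" using infinite_enumerate[OF inf] by auto
    have near: "norm (Q (r n) t - sp) \<le> \<rho>" if "t \<ge> A" for n t
      using after[of "r n" t] r(2)[of n] that by simp
    have "(\<lambda>n. real_energy (Q (r n))) \<longlonglongrightarrow> c0" "(\<lambda>n. L2sq (residual (Q (r n)))) \<longlonglongrightarrow> 0"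
      using LIMSEQ_subseq_LIMSEQ[OF E r(1)] LIMSEQ_subseq_LIMSEQ[OF R0 r(1)] by (auto simp: o_def)
    from bounded_gives_critical_point[of "\<lambda>n. Q (r n)", OF QX fQ EC this away(1) away(2) \<mu> near]
    obtain k u where ku: "strict_mono (k :: nat \<Rightarrow> nat)" "u \<in> X_sym V i sm sp" "solves_ode V u" "energy V u = ennreal c0" 
      "curve_conv (\<lambda>n. Q (r (k n))) u" by blast
    have "strict_mono (r \<circ> k)" by (rule strict_mono_o[OF r(1) ku(1)])
    then show ?thesis using ku by (intro disjI2 exI[of _ "r \<circ> k"] exI[of _ u]) simp
  qed
qed

text \<open>If the minimax level equals the minimum, every curve on an almost optimal path is almost critical,
  and one of them stays away from all minimizers. Otherwise the step of steepest descent singles out an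
  almost critical curve near the minimax level.\<close>

lemma homoclinic_or_mountain_pass:
  assumes d: "minimizers V sm sp = F0 \<union> F1" "H1_setdist F0 F1 > 0"
    and c: "c_sym V i sm sp F0 F1 = ennreal c0" "c0 \<ge> 0" and f: "ennreal c0 < m_star V S sm sp"
  shows "homoclinic c0 \<or> (\<exists>u\<in>X_sym V i sm sp. solves_ode V u \<and> energy V u = ennreal c0 \<and> u \<notin> minimizers V sm sp)"
proof -
  obtain \<tau> M where \<tau>: "\<tau> > 0" and paths: "\<And>\<epsilon>. 0 < \<epsilon> \<Longrightarrow> \<epsilon> \<le> 1 \<Longrightarrow> \<exists>Q.
     (\<forall>s\<in>{0..1}. Q s \<in> X_sym V i sm sp \<and> finite_curve M (Q s) \<and> real_energy (Q s) \<le> c0 + \<epsilon> \<and>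
        min_energy V sm sp + ennreal (\<tau> / 2 * L2sq (residual (Q s))) \<le> energy V (Q s)) \<and>
     Q 0 \<in> F0 \<and> Q 1 \<in> F1 \<and>
     (\<forall>s\<in>{0..1}. ((\<lambda>r. H1_norm (\<lambda>t. Q r t - Q s t)) \<longlongrightarrow> 0) (at s within {0..1::real})) \<and>
     (\<exists>s\<in>{0..1}. c0 - \<epsilon> \<le> real_energy (Q s) - \<tau> / 2 * L2sq (residual (Q s)))"
    using almost_optimal_paths[OF d(1) c] by blast
  obtain \<epsilon>0 \<delta> where \<epsilon>0: "\<epsilon>0 > 0" and \<delta>: "\<delta> > 0" 
    "\<And>q s t. q \<in> conn V sm sp \<Longrightarrow> energy V q \<le> ennreal (c0 + \<epsilon>0) \<Longrightarrow> s \<in> S - {sm, sp} \<Longrightarrow> norm (q t - s) \<ge> \<delta>"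
    using away_from_other_wells[OF c(2) f] by blast
  define \<epsilon> where "\<epsilon> n = min \<epsilon>0 (1 / real (Suc n))" for n
  have \<epsilon>: "\<epsilon> n > 0" "\<epsilon> n \<le> 1" "\<epsilon> n \<le> \<epsilon>0" for n using \<epsilon>0 by (auto simp: \<epsilon>_def min_le_iff_disj)
  have \<epsilon>lim: "\<epsilon> \<longlonglongrightarrow> 0"
  proof (rule tendsto_zero_squeeze)
    show "(\<lambda>n. 1 / real (Suc n)) \<longlonglongrightarrow> 0" by (rule inverse_Suc_tendsto)
    show "0 \<le> \<epsilon> n" "\<epsilon> n \<le> 1 / real (Suc n)" for n using \<epsilon>(1)[of n] by (auto simp: \<epsilon>_def)
  qed
  have F: "F0 \<subseteq> conn V sm sp" "F1 \<subseteq> conn V sm sp" using d(1) by (auto simp: minimizers_def)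
  \<comment> \<open>the last clause is of use when the minimax level equals the minimal energy\<close>
  define good where "good n q \<longleftrightarrow> q \<in> X_sym V i sm sp \<and> finite_curve M q \<and> real_energy q \<le> c0 + \<epsilon> n \<and> c0 - \<epsilon> n \<le> real_energy q \<and>
     L2sq (residual q) \<le> 4 / \<tau> * \<epsilon> n \<and> (ennreal c0 \<le> min_energy V sm sp \<longrightarrow> (\<forall>p\<in>F0 \<union> F1. H1_norm (\<lambda>t. q t - p t) \<ge> H1_setdist F0 F1 / 2))" for n q
  have "\<exists>q. good n q" for n
  proof -
    obtain Q where Q: "\<And>s. s \<in> {0..1} \<Longrightarrow> Q s \<in> X_sym V i sm sp" "\<And>s. s \<in> {0..1} \<Longrightarrow> finite_curve M (Q s)"
      "\<And>s. s \<in> {0..1} \<Longrightarrow> real_energy (Q s) \<le> c0 + \<epsilon> n"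
      "\<And>s. s \<in> {0..1} \<Longrightarrow> min_energy V sm sp + ennreal (\<tau> / 2 * L2sq (residual (Q s))) \<le> energy V (Q s)"
      "Q 0 \<in> F0" "Q 1 \<in> F1" "\<And>s. s \<in> {0..1} \<Longrightarrow> ((\<lambda>r. H1_norm (\<lambda>t. Q r t - Q s t)) \<longlongrightarrow> 0) (at s within {0..1::real})"
      "\<exists>s\<in>{0..1}. c0 - \<epsilon> n \<le> real_energy (Q s) - \<tau> / 2 * L2sq (residual (Q s))"
      using paths[OF \<epsilon>(1,2), of n] by blast
    have Lle: "x \<le> 4 / \<tau> * \<epsilon> n" if "\<tau> / 2 * x \<le> 2 * \<epsilon> n" for x using that \<tau> by (simp add: field_simps)
    show ?thesis
    proof (cases "ennreal c0 \<le> min_energy V sm sp")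
      case True
      have Qc: "Q s \<in> conn V sm sp" if "s \<in> {0..1}" for s using Q(1)[OF that] X_sym_iff by blast
      obtain s where s: "s \<in> {0..1}" "\<And>p. p \<in> F0 \<union> F1 \<Longrightarrow> H1_norm (\<lambda>t. Q s t - p t) \<ge> H1_setdist F0 F1 / 2"
        using path_between_separated_sets[OF Qc F Q(7) Q(5,6) d(2)] by blast
      have x0: "0 \<le> \<tau> / 2 * L2sq (residual (Q s))" using \<tau> by simp
      have "ennreal (c0 + \<tau> / 2 * L2sq (residual (Q s))) = ennreal c0 + ennreal (\<tau> / 2 * L2sq (residual (Q s)))"
        by (rule ennreal_plus[OF c(2) x0])
      also have "\<dots> \<le> min_energy V sm sp + ennreal (\<tau> / 2 * L2sq (residual (Q s)))" by (rule add_right_mono[OF True])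
      also have "\<dots> \<le> ennreal (real_energy (Q s))" using Q(4)[OF s(1)] unfolding finite_curve_energy[OF Q(2)[OF s(1)]] .
      finally have "c0 + \<tau> / 2 * L2sq (residual (Q s)) \<le> real_energy (Q s)"
        by (subst (asm) ennreal_le_iff[OF real_energy_nonneg])
      then have "\<tau> / 2 * L2sq (residual (Q s)) \<le> 2 * \<epsilon> n" "c0 - \<epsilon> n \<le> real_energy (Q s)"
        using Q(3)[OF s(1)] \<epsilon>(1)[of n] x0 by linarith+
      then have "good n (Q s)" unfolding good_def using Q(1-3)[OF s(1)] Lle s(2) by blast
      then show ?thesis by blast
    next
      case False
      obtain s where s: "s \<in> {0..1}" "c0 - \<epsilon> n \<le> real_energy (Q s) - \<tau> / 2 * L2sq (residual (Q s))" using Q(8) by blast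
      have x0: "0 \<le> \<tau> / 2 * L2sq (residual (Q s))" using \<tau> by simp
      have "\<tau> / 2 * L2sq (residual (Q s)) \<le> 2 * \<epsilon> n" "c0 - \<epsilon> n \<le> real_energy (Q s)" using s(2) Q(3)[OF s(1)] x0 by linarith+
      then have "good n (Q s)" unfolding good_def using Q(1-3)[OF s(1)] Lle False by blast
      then show ?thesis by blast
    qed
  qed
  then obtain q where q: "\<And>n. good n (q n)" by metis
  have qX: "\<And>n. q n \<in> X_sym V i sm sp" and fq: "\<And>n. finite_curve M (q n)" and eu: "\<And>n. real_energy (q n) \<le> c0 + \<epsilon> n"
    and el: "\<And>n. c0 - \<epsilon> n \<le> real_energy (q n)" and Rq: "\<And>n. L2sq (residual (q n)) \<le> 4 / \<tau> * \<epsilon> n"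
    and far: "\<And>n p. ennreal c0 \<le> min_energy V sm sp \<Longrightarrow> p \<in> F0 \<union> F1 \<Longrightarrow> H1_norm (\<lambda>t. q n t - p t) \<ge> H1_setdist F0 F1 / 2"
    using q unfolding good_def by blast+
  have qc: "q n \<in> conn V sm sp" for n using qX[of n] X_sym_iff by blast
  have E: "(\<lambda>n. real_energy (q n)) \<longlonglongrightarrow> c0"
  proof (rule tendsto_sandwich[OF always_eventually always_eventually])
    show "\<forall>n. c0 - \<epsilon> n \<le> real_energy (q n)" "\<forall>n. real_energy (q n) \<le> c0 + \<epsilon> n" using el eu by auto
    show "(\<lambda>n. c0 - \<epsilon> n) \<longlonglongrightarrow> c0" "(\<lambda>n. c0 + \<epsilon> n) \<longlonglongrightarrow> c0"
      using tendsto_diff[OF tendsto_const \<epsilon>lim, of c0] tendsto_add[OF tendsto_const \<epsilon>lim, of c0] by auto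
  qed
  have R0: "(\<lambda>n. L2sq (residual (q n))) \<longlonglongrightarrow> 0"
    by (rule tendsto_zero_squeeze[OF L2sq_nonneg Rq]) (use tendsto_mult[OF tendsto_const \<epsilon>lim, of "4 / \<tau>"] in simp)
  have EC: "real_energy (q n) \<le> c0 + 1" for n using eu[of n] \<epsilon>(2)[of n] by linarith
  have aw: "norm (q n t - s) \<ge> \<delta>" if "s \<in> S - {sm, sp}" for n t s
  proof (rule \<delta>(2)[OF qc _ that])
    show "energy V (q n) \<le> ennreal (c0 + \<epsilon>0)" unfolding finite_curve_energy[OF fq]
      using eu[of n] \<epsilon>(3)[of n] by (intro ennreal_leI) linarith
  qed
  from almost_critical_sequence[OF qX fq EC E R0 \<delta>(1) aw] show ?thesis
  proof
    assume "\<exists>k u. strict_mono (k :: nat \<Rightarrow> nat) \<and> u \<in> X_sym V i sm sp \<and> solves_ode V u \<and>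
     energy V u = ennreal c0 \<and> curve_conv (\<lambda>n. q (k n)) u"
    then obtain k u where ku: "strict_mono (k :: nat \<Rightarrow> nat)" "u \<in> X_sym V i sm sp" "solves_ode V u" "energy V u = ennreal c0" 
      "curve_conv (\<lambda>n. q (k n)) u" by blast
    have uc: "u \<in> conn V sm sp" using ku(2) X_sym_iff by blast
    have "u \<notin> minimizers V sm sp"
    proof
      assume um: "u \<in> minimizers V sm sp"
      then have "ennreal c0 \<le> min_energy V sm sp" using ku(4) by (simp add: minimizers_def)
      then have ge: "H1_norm (\<lambda>t. q (k n) t - u t) \<ge> H1_setdist F0 F1 / 2" for n using far um d(1) by blast
      have "(\<lambda>n. H1_norm (\<lambda>t. q (k n) t - u t)) \<longlonglongrightarrow> 0"
        using ku(5) curve_conv_H1_norm[OF conn_weak_deriv(1)[OF qc] conn_weak_deriv(1)[OF uc]] by blast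
      then have "H1_setdist F0 F1 / 2 \<le> 0" by (rule LIMSEQ_le_const) (use ge in auto)
      then show False using d(2) by simp
    qed
    then show ?thesis using ku by blast
  next
    assume "homoclinic c0"
    then show ?thesis by (rule disjI1)
  qed
qed

end

theorem theorem2:
  fixes V :: "real ^ 'n \<Rightarrow> real"
    and S :: "(real ^ 'n) set"
    and i :: 'n
    and sm sp :: "real ^ 'n"
    and F0 F1 :: "(real \<Rightarrow> real ^ 'n) set"
  assumes dim: "CARD('n) \<ge> 2"
    and wells: "finite S" "card S \<ge> 2" "sm \<in> S" "sp \<in> S" "sm \<noteq> sp"
    and a: "C2_potential V" "\<forall>u. V u \<ge> 0" "\<forall>u. V u = 0 \<longleftrightarrow> u \<in> S"
    and b: "\<exists>\<alpha>0>0. \<exists>\<beta>0>0. \<exists>R0>0. \<forall>u. norm u \<ge> R0 \<longrightarrow>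
              grad V u \<bullet> u \<ge> \<alpha>0 * (norm u)\<^sup>2 \<and> V u \<ge> \<beta>0"
    and c: "\<forall>s\<in>S. pos_definite (hess V s)"
    and d: "minimizers V sm sp = F0 \<union> F1" "F0 \<noteq> {}" "F1 \<noteq> {}" "H1_setdist F0 F1 > 0"
    and e: "sm = axis i (-1)" "sp = axis i 1" "\<forall>u. V (refl1 i u) = V u"
    and f: "c_sym V i sm sp F0 F1 < m_star V S sm sp"
  shows "(\<exists>up um.
            \<not> up constant_on UNIV \<and> \<not> um constant_on UNIV \<and>
            up \<in> H1_loc \<and> um \<in> H1_loc \<and> C2_curve up \<and> C2_curve um \<and>
            solves_ode V up \<and> solves_ode V um \<and>
            energy V up \<le> c_sym V i sm sp F0 F1 \<and>
            (up \<longlongrightarrow> sp) at_bot \<and> (up \<longlongrightarrow> sp) at_top \<and>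
            (\<forall>t. um t = refl1 i (up t)) \<and>
            (um \<longlongrightarrow> sm) at_bot \<and> (um \<longlongrightarrow> sm) at_top)
       \<or> (\<exists>u\<in>X_sym V i sm sp.
            solves_ode V u \<and>
            energy V u = c_sym V i sm sp F0 F1 \<and>
            u \<notin> F_sym V i sm sp (minimizers V sm sp))"
proof -
  interpret double_well V S i sm sp
  proof
    show "\<exists>\<beta>0>0. \<exists>R0>0. \<forall>u. norm u \<ge> R0 \<longrightarrow> V u \<ge> \<beta>0" using b by blast
  qed (use wells a c e in auto)
  have "c_sym V i sm sp F0 F1 < \<infinity>" by (rule less_le_trans[OF f]) simp
  then obtain c0 where c0: "c_sym V i sm sp F0 F1 = ennreal c0" "c0 \<ge> 0"
    by (cases "c_sym V i sm sp F0 F1") auto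
  from homoclinic_or_mountain_pass[OF d(1,4) c0 f[unfolded c0(1)]] show ?thesis
  proof
    assume "homoclinic c0"
    then obtain u p where u': "\<And>t. (u has_vector_derivative p t) (at t)" and p': "\<And>t. (p has_vector_derivative grad V (u t)) (at t)"
      and up: "primitive u p" and nc: "\<not> u constant_on UNIV" and lim: "(u \<longlongrightarrow> sp) at_bot" "(u \<longlongrightarrow> sp) at_top" 
      and E: "energy V u \<le> ennreal c0" unfolding homoclinic_def by blast
    define w where "w t = refl1 i (u t)" for t
    have w': "(w has_vector_derivative refl1 i (p t)) (at t)" for t
      unfolding w_def[abs_def] by (rule bounded_linear.has_vector_derivative[OF bounded_linear_refl1 u'])
    have rp': "((\<lambda>t. refl1 i (p t)) has_vector_derivative grad V (w t)) (at t)" for t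
      unfolding w_def grad_refl by (rule bounded_linear.has_vector_derivative[OF bounded_linear_refl1 p'])
    have cu: "continuous_on UNIV (\<lambda>t. grad V (u t))"
      by (rule continuous_on_compose2[OF grad_cont primitive_continuous[OF up]]) simp
    have pw: "primitive w (\<lambda>t. refl1 i (p t))" unfolding w_def[abs_def] by (rule primitive_refl1[OF up])
    have cw: "continuous_on UNIV (\<lambda>t. grad V (w t))"
      by (rule continuous_on_compose2[OF grad_cont primitive_continuous[OF pw]]) simp
    have "\<not> w constant_on UNIV"
    proof
      assume "w constant_on UNIV"
      then obtain y where "\<And>t. w t = y" unfolding constant_on_def by auto
      then have "u t = refl1 i y" for t by (metis w_def refl1_simps(1))
      then show False using nc unfolding constant_on_def by blast
    qed
    moreover have "C2_curve u" "solves_ode V u" by (rule solution_regularity[OF u' p' cu])+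
    moreover have "C2_curve w" "solves_ode V w" by (rule solution_regularity[OF w' rp' cw])+
    moreover have "(w \<longlongrightarrow> sm) at_bot" "(w \<longlongrightarrow> sm) at_top"
      using bounded_linear.tendsto[OF bounded_linear_refl1 lim(1), of i] bounded_linear.tendsto[OF bounded_linear_refl1 lim(2), of i]
      by (simp_all add: w_def[abs_def] refl_sp)
    moreover have "u \<in> H1_loc" "w \<in> H1_loc" using up pw H1_loc_iff by blast+
    ultimately show ?thesis using nc lim E unfolding c0(1) by (intro disjI1 exI[of _ u] exI[of _ w]) (simp add: w_def)
  next
    assume "\<exists>u\<in>X_sym V i sm sp. solves_ode V u \<and> energy V u = ennreal c0 \<and> u \<notin> minimizers V sm sp"
    then show ?thesis unfolding c0(1) F_sym_def by blast
  qed
qed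

end
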